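(* Assume the following. (1) $|\varphi_X|$ is integrable on $\mathbb{R}$. (2) $\mathrm{E}[|\varepsilon|^p]<\infty$ for some $p>0$. (3) $K:\mathbb{R}\to\mathbb{R}$ is a kernel function whose Fourier transform $\varphi_K$ is even and has support $[-1,1]$, and there exist constants $C_2>0$ and $\lambda\ge0$ such that $\varphi_K(1-t)=C_2t^\lambda+o(t^\lambda)$ as $t\downarrow0$. (4) $\varphi_\varepsilon$ does not vanish on $\mathbb{R}$, and there exist constants $C_3>0$, $\gamma>1$, $\gamma_0\in\mathbb{R}$, $\nu>0$ such that $\varphi_\varepsilon(t)=C_3(1+o(1))|t|^{\gamma_0}e^{-\nu|t|^\gamma}$ as $|t|\to\infty$. (5) As $n\to\infty$: (a) $\frac{(\log h_n^{-1})^2}{nh_n^{4\gamma(1+\lambda)}}\to0$; (b) $\max\left\{\frac{n\log h_n^{-1}}{mh_n^{2\gamma(1+\lambda)-2}},\ \frac{e^{2\nu h_n^{-\gamma}}(\log h_n^{-1})^2}{mh_n^{4\gamma(1+\lambda)-2\gamma_0}}\right\}\to0$. (6) $\mathrm{E}[Y^2]<\infty$, and $I\subset\mathbb{R}$ is any compact interval. (7) $f_X\in\Sigma(\beta,B)$ for some $\beta>0$, $B>0$, and, with $k$ the integer such that $k<\beta\le k+1$, $\int_{\mathbb{R}}|x|^{k+1}|K(x)|\,dx<\infty$ and $\int_{\mathbb{R}}x^\ell K(x)\,dx=0$ for $\ell=1,\dots,k$. Let $\tau\in(0,1)$ and consider the multiplier bootstrap confidence band $\hat{\mathcal{C}}_n$.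 Then, as $n\to\infty$, $$\mathrm{P}\{f_X(x)\in\hat{\mathcal{C}}_n(x)\ \forall x\in I\}\to1-\tau,$$ provided that $$h_n^{\beta+1-\gamma(1+\lambda)-\gamma_0}\,e^{-\nu h_n^{-\gamma}}\sqrt{n\log h_n^{-1}}\to0.$$
   Context: $X$ and $\varepsilon$ are independent real random variables with densities $f_X,f_\varepsilon$; $Y=X+\varepsilon$. $\varphi_X,\varphi_\varepsilon$ are the characteristic functions of $X,\varepsilon$. Observed: i.i.d. copies $Y_1,\dots,Y_n$ of $Y$ and an i.i.d. sample $\eta_1,\dots,\eta_m$ from $f_\varepsilon$, with $m=m_n\to\infty$ as $n\to\infty$ (the two samples are not required to be independent of each other); $\mathcal{D}_n=\{Y_1,\dots,Y_n,\eta_1,\dots,\eta_m\}$. $h_n>0$ is a deterministic bandwidth sequence with $h_n\to0$. A kernel function is a real-valued integrable function with integral one; $\varphi_K(t)=\int_{\mathbb{R}}e^{itx}K(x)\,dx$. $\|f\|_I=\sup_{x\in I}|f(x)|$; $[a\pm b]=[a-b,a+b]$. For $\beta,B>0$ and $k$ the integer with $k<\beta\le k+1$, $\Sigma(\beta,B)$ is the set of $f:\mathbb{R}\to\mathbb{R}$ that are $k$-times differentiable with $|f^{(k)}(x)-f^{(k)}(y)|\le B|x-y|^{\beta-k}$ for all $x,y\in\mathbb{R}$. Define $\hat\varphi_\varepsilon(t)=\frac1m\sum_{j=1}^me^{it\eta_j}$, $\hat K_n(x)=\frac1{2\pi}\int_{\mathbb{R}}e^{-itx}\frac{\varphi_K(t)}{\hat\varphi_\varepsilon(t/h_n)}\,dt$,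 $\hat f_X(x)=\frac1{nh_n}\sum_{j=1}^n\hat K_n((x-Y_j)/h_n)$, and $\hat\sigma_n^2(x)=\frac1n\sum_{j=1}^n\hat K_n^2((x-Y_j)/h_n)-\left(\frac1n\sum_{j=1}^n\hat K_n((x-Y_j)/h_n)\right)^2$, $\hat\sigma_n(x)=\sqrt{\hat\sigma_n^2(x)}$. Let $\xi_1,\dots,\xi_n$ be i.i.d. $N(0,1)$, independent of $\mathcal{D}_n$, and for $x\in I$ $$\hat Z_n^\xi(x)=\frac1{\hat\sigma_n(x)\sqrt n}\sum_{j=1}^n\xi_j\Big\{\hat K_n((x-Y_j)/h_n)-n^{-1}\sum_{j'=1}^n\hat K_n((x-Y_{j'})/h_n)\Big\}.$$ $\hat c_n(1-\tau)$ is the conditional $(1-\tau)$-quantile of $\|\hat Z_n^\xi\|_I$ given $\mathcal{D}_n$, and $\hat{\mathcal{C}}_n(x)=\left[\hat f_X(x)\pm\frac{\hat\sigma_n(x)}{\sqrt n\,h_n}\hat c_n(1-\tau)\right]$, $x\in I$. Estimated quantities are defined on the event $\{\inf_{|t|\le h_n^{-1}}|\hat\varphi_\varepsilon(t)|>0,\ \inf_{x\in I}\hat\sigma_n(x)>0\}$, and arbitrarily (e.g. as $0$) on its complement. *)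

theory Defs
  imports "HOL-Probability.Probability" "HOL-Library.Landau_Symbols"
begin

definition kernel_function :: "(real \<Rightarrow> real) \<Rightarrow> bool" where
  "kernel_function K \<longleftrightarrow> integrable lborel K \<and> (\<integral>x. K x \<partial>lborel) = 1"

definition fourier :: "(real \<Rightarrow> real) \<Rightarrow> real \<Rightarrow> complex" where
  "fourier K t = (\<integral>x. iexp (t * x) * complex_of_real (K x) \<partial>lborel)"

definition sup_norm_on :: "real set \<Rightarrow> (real \<Rightarrow> real) \<Rightarrow> real" where
  "sup_norm_on I f = (SUP x\<in>I. \<bar>f x\<bar>)"

definition holder_class :: "real \<Rightarrow> real \<Rightarrow> (real \<Rightarrow> real) set" where
  "holder_class \<beta> B =
    {f. \<exists>k::nat. real k < \<beta> \<and> \<beta> \<le> real k + 1 \<and>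
          (\<forall>j<k. \<forall>x. (deriv ^^ j) f field_differentiable at x) \<and>
          (\<forall>x y. \<bar>(deriv ^^ k) f x - (deriv ^^ k) f y\<bar> \<le> B * \<bar>x - y\<bar> powr (\<beta> - real k))}"

definition quantile :: "real measure \<Rightarrow> real \<Rightarrow> real" where
  "quantile \<mu> p = Inf {z. p \<le> cdf \<mu> z}"

definition regular_cond_distr ::
  "'a measure \<Rightarrow> 'a measure \<Rightarrow> ('a \<Rightarrow> real) \<Rightarrow> ('a \<Rightarrow> real measure) \<Rightarrow> bool" where
  "regular_cond_distr M F W \<kappa> \<longleftrightarrow>
     \<kappa> \<in> F \<rightarrow>\<^sub>M prob_algebra borel \<and>
     (\<forall>A\<in>sets borel. AE \<omega> in M.
        measure (\<kappa> \<omega>) A = real_cond_exp M F (\<lambda>\<omega>'. indicator A (W \<omega>')) \<omega>)"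

definition cond_quantile ::
  "'a measure \<Rightarrow> 'a measure \<Rightarrow> ('a \<Rightarrow> real) \<Rightarrow> real \<Rightarrow> ('a \<Rightarrow> real) \<Rightarrow> bool" where
  "cond_quantile M F W p c \<longleftrightarrow>
     (\<exists>\<kappa>. regular_cond_distr M F W \<kappa> \<and> (\<forall>\<omega>\<in>space M. c \<omega> = quantile (\<kappa> \<omega>) p))"

text \<open>In the following, \<open>y 0, \<dots>, y (n-1)\<close> are the contaminated observations,
  \<open>e 0, \<dots>, e (m-1)\<close> is the auxiliary sample from the error distribution, \<open>h\<close> is the bandwidth
  and \<open>z 0, \<dots>, z (n-1)\<close> are the multipliers.\<close>

definition emp_cf :: "nat \<Rightarrow> (nat \<Rightarrow> real) \<Rightarrow> real \<Rightarrow> complex" where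
  "emp_cf m e t = (\<Sum>j<m. iexp (t * e j)) / of_nat m"

text \<open>For even \<open>fourier K\<close> the integral below is real, so taking \<open>Re\<close> only changes the type.
  The integrand is \<open>0\<close> off the support of \<open>fourier K\<close>, also where \<open>emp_cf\<close> vanishes, since \<open>0 / 0 = 0\<close>.\<close>

definition dec_kernel ::
  "(real \<Rightarrow> real) \<Rightarrow> real \<Rightarrow> nat \<Rightarrow> (nat \<Rightarrow> real) \<Rightarrow> real \<Rightarrow> real" where
  "dec_kernel K h m e x =
     Re (1 / (2 * complex_of_real pi) *
         (\<integral>t. iexp (- (t * x)) * (fourier K t / emp_cf m e (t / h)) \<partial>lborel))"

definition dec_mean ::
  "(real \<Rightarrow> real) \<Rightarrow> real \<Rightarrow> nat \<Rightarrow> nat \<Rightarrow> (nat \<Rightarrow> real) \<Rightarrow> (nat \<Rightarrow> real) \<Rightarrow> real \<Rightarrow> real" where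
  "dec_mean K h n m y e x = (1 / real n) * (\<Sum>j<n. dec_kernel K h m e ((x - y j) / h))"

definition dec_density ::
  "(real \<Rightarrow> real) \<Rightarrow> real \<Rightarrow> nat \<Rightarrow> nat \<Rightarrow> (nat \<Rightarrow> real) \<Rightarrow> (nat \<Rightarrow> real) \<Rightarrow> real \<Rightarrow> real" where
  "dec_density K h n m y e x =
     (1 / (real n * h)) * (\<Sum>j<n. dec_kernel K h m e ((x - y j) / h))"

definition dec_sd ::
  "(real \<Rightarrow> real) \<Rightarrow> real \<Rightarrow> nat \<Rightarrow> nat \<Rightarrow> (nat \<Rightarrow> real) \<Rightarrow> (nat \<Rightarrow> real) \<Rightarrow> real \<Rightarrow> real" where
  "dec_sd K h n m y e x =
     sqrt ((1 / real n) * (\<Sum>j<n. (dec_kernel K h m e ((x - y j) / h))\<^sup>2)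
           - (dec_mean K h n m y e x)\<^sup>2)"

text \<open>The event on which the estimated quantities are defined; off this event the multiplier
  process is set to \<open>0\<close> and the band to \<open>{0}\<close>.\<close>

definition well_defined ::
  "(real \<Rightarrow> real) \<Rightarrow> real set \<Rightarrow> real \<Rightarrow> nat \<Rightarrow> nat \<Rightarrow> (nat \<Rightarrow> real) \<Rightarrow> (nat \<Rightarrow> real) \<Rightarrow> bool" where
  "well_defined K I h n m y e \<longleftrightarrow>
     (INF t\<in>{t. \<bar>t\<bar> \<le> 1 / h}. cmod (emp_cf m e t)) > 0 \<and>
     (INF x\<in>I. dec_sd K h n m y e x) > 0"

definition multiplier_process ::
  "(real \<Rightarrow> real) \<Rightarrow> real set \<Rightarrow> real \<Rightarrow> nat \<Rightarrow> nat \<Rightarrow> (nat \<Rightarrow> real) \<Rightarrow> (nat \<Rightarrow> real) \<Rightarrow>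
     (nat \<Rightarrow> real) \<Rightarrow> real \<Rightarrow> real" where
  "multiplier_process K I h n m y e z x =
     (if well_defined K I h n m y e
      then 1 / (dec_sd K h n m y e x * sqrt (real n)) *
           (\<Sum>j<n. z j * (dec_kernel K h m e ((x - y j) / h) - dec_mean K h n m y e x))
      else 0)"

definition confidence_band ::
  "(real \<Rightarrow> real) \<Rightarrow> real set \<Rightarrow> real \<Rightarrow> nat \<Rightarrow> nat \<Rightarrow> (nat \<Rightarrow> real) \<Rightarrow> (nat \<Rightarrow> real) \<Rightarrow>
     real \<Rightarrow> real \<Rightarrow> real set" where
  "confidence_band K I h n m y e c x =
     (if well_defined K I h n m y e
      then {dec_density K h n m y e x - dec_sd K h n m y e x / (sqrt (real n) * h) * c ..
            dec_density K h n m y e x + dec_sd K h n m y e x / (sqrt (real n) * h) * c}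
      else {0})"

definition row_space :: "nat \<Rightarrow> (nat \<Rightarrow> real) measure" where
  "row_space n = (\<Pi>\<^sub>M j\<in>{..<n}. borel)"

definition sample_row :: "nat \<Rightarrow> (nat \<Rightarrow> 'a \<Rightarrow> real) \<Rightarrow> 'a \<Rightarrow> nat \<Rightarrow> real" where
  "sample_row n V \<omega> = (\<lambda>j\<in>{..<n}. V j \<omega>)"

text \<open>The data \<open>Y\<^sub>1, \<dots>, Y\<^sub>n, \<eta>\<^sub>1, \<dots>, \<eta>\<^sub>m\<close> as one random vector of length \<open>n + m\<close>, so that \<open>indep_var\<close>
  (whose two arguments must have the same value type) can relate it to the multipliers.\<close>

definition data ::
  "nat \<Rightarrow> nat \<Rightarrow> (nat \<Rightarrow> 'a \<Rightarrow> real) \<Rightarrow> (nat \<Rightarrow> 'a \<Rightarrow> real) \<Rightarrow> 'a \<Rightarrow> nat \<Rightarrow> real" where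
  "data n m Y \<eta> = sample_row (n + m) (\<lambda>j. if j < n then Y j else \<eta> (j - n))"

definition data_algebra ::
  "'a measure \<Rightarrow> nat \<Rightarrow> nat \<Rightarrow> (nat \<Rightarrow> 'a \<Rightarrow> real) \<Rightarrow> (nat \<Rightarrow> 'a \<Rightarrow> real) \<Rightarrow> 'a measure" where
  "data_algebra M n m Y \<eta> = vimage_algebra (space M) (data n m Y \<eta>) (row_space (n + m))"

end

theory Submission
  imports Defs
begin

text \<open>
  The estimator and the bootstrap process are integrals over \<open>t\<close> in \<open>{0..1}\<close> of random characteristic functions
  at frequency \<open>t / h\<close> against the weight \<open>fourier K t / \<phi> (t / h)\<close>, with \<open>\<phi>\<close> the characteristic function of the
  error. Supersmoothness makes this weight one of Laplace type: nearly all of its mass lies within \<open>h powr \<gamma>\<close> of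
  the endpoint \<open>t = 1\<close> (\<open>weight_limit\<close>, \<open>weight_bound\<close>). As \<open>\<gamma> > 1\<close>, the corresponding window of frequencies has width
  of order \<open>h powr (\<gamma> - 1)\<close>, which tends to \<open>0\<close>, so a process with mean-Lipschitz increments is seen only at the
  frequency \<open>1 / h\<close> (\<open>edge_approximation\<close>). After division by the estimated standard deviation, both the deviation of
  the estimator and the bootstrap process become \<open>Re (iexp (- x / h) * Z)\<close> up to errors that vanish uniformly over
  the interval. Here \<open>Z\<close> is \<open>sqrt 2\<close> times the normalized empirical characteristic function of the observations at
  \<open>1 / h\<close> in the first case and its multiplier version in the second (\<open>density_linearization\<close>,
  \<open>multiplier_process_linearization\<close>).

  In a nondegenerate interval the factor \<open>iexp (- x / h)\<close> runs through a full period once \<open>h\<close> is small, so the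
  supremum is the modulus of \<open>Z\<close>; in a single point it is the absolute value of one coordinate of a rotation of
  \<open>Z\<close>. The characteristic function of the observations vanishes asymptotically at \<open>1 / h\<close> and \<open>2 / h\<close>, hence \<open>Z\<close> is
  asymptotically standard Gaussian in the plane, for the observations by the central limit theorem
  (\<open>sampling_char_limit\<close>) and for the multipliers conditionally on the data (\<open>bootstrap_char_error\<close>). The interval
  enters the limit only through a rotation, under which the Gaussian law is invariant (\<open>limit_law_of_modulus\<close>). The
  statistic and the bootstrap thus share one atomless limit law whose distribution function increases strictly on the positive half-line, the
  conditional quantile converges in probability to the quantile of this law, and the coverage probability converges
  to \<open>1 - \<tau>\<close> (\<open>bootstrap_coverage_limit\<close>).

  All random errors are bounded in the mean (\<open>err_L1\<close>), so Markov's inequality confines them to a good event of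
  probability tending to \<open>1\<close>, on which the remaining estimates are deterministic. The condition on \<open>m\<close> makes the
  empirical characteristic function of the error sample uniformly close to \<open>\<phi>\<close>, relative to \<open>\<phi>\<close>, on the window
  \<open>\<bar>t\<bar> \<le> 1 / h\<close>, and makes the error sample contribute less than the observations; undersmoothing removes the bias
  (\<open>smoothing_bias\<close>).
\<close>

section \<open>Second moments of sums of independent variables\<close>

text \<open>The unqualified names of these rules belong to the gauge integral.\<close>

lemmas L1_bound = Bochner_Integration.integrable_bound
lemmas L1_add = Bochner_Integration.integrable_add
lemmas L1_diff = Bochner_Integration.integrable_diff
lemmas L1_sum = Bochner_Integration.integrable_sum
lemmas lebesgue_cong = Bochner_Integration.integral_cong
lemmas lebesgue_add = Bochner_Integration.integral_add
lemmas lebesgue_diff = Bochner_Integration.integral_diff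
lemmas lebesgue_sum = Bochner_Integration.integral_sum
lemmas lebesgue_nonneg = Bochner_Integration.integral_nonneg

lemma (in prob_space) expectation_le_sqrt_second_moment:
  fixes Z :: "'a \<Rightarrow> complex"
  assumes [measurable]: "Z \<in> borel_measurable M"
    and sq: "integrable M (\<lambda>w. (cmod (Z w))^2)"
    and le: "expectation (\<lambda>w. (cmod (Z w))^2) \<le> v"
  shows "integrable M (\<lambda>w. cmod (Z w))" "expectation (\<lambda>w. cmod (Z w)) \<le> sqrt v"
proof -
  show int: "integrable M (\<lambda>w. cmod (Z w))" by (rule square_integrable_imp_integrable) (auto intro: sq)
  have "(expectation (\<lambda>w. cmod (Z w)))^2 \<le> expectation (\<lambda>w. (cmod (Z w))^2)"
    using variance_positive[of "\<lambda>w. cmod (Z w)"] variance_eq[OF int sq] by simp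
  then show "expectation (\<lambda>w. cmod (Z w)) \<le> sqrt v" using le by (simp add: real_le_rsqrt)
qed

lemma borel_measurable_cnj [measurable]:
  "f \<in> borel_measurable M \<Longrightarrow> (\<lambda>x. cnj (f x)) \<in> borel_measurable M"
  by (rule measurable_compose[OF _ borel_measurable_continuous_onI]) (auto intro!: continuous_intros)

lemma second_moment_orthogonal_sum:
  fixes f :: "'i \<Rightarrow> 'a \<Rightarrow> complex"
  assumes fin: "finite I"
    and meas: "\<And>j. j \<in> I \<Longrightarrow> f j \<in> borel_measurable M"
    and sq: "\<And>j. j \<in> I \<Longrightarrow> integrable M (\<lambda>w. (cmod (f j w))^2)"
    and orth: "\<And>j l. j \<in> I \<Longrightarrow> l \<in> I \<Longrightarrow> j \<noteq> l \<Longrightarrow> (\<integral>w. f j w * cnj (f l w) \<partial>M) = 0"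
  shows "integrable M (\<lambda>w. (cmod (\<Sum>j\<in>I. f j w))^2)"
    and "(\<integral>w. (cmod (\<Sum>j\<in>I. f j w))^2 \<partial>M) = (\<Sum>j\<in>I. \<integral>w. (cmod (f j w))^2 \<partial>M)"
proof -
  have int: "integrable M (\<lambda>w. f j w * cnj (f l w))" if "j \<in> I" "l \<in> I" for j l
  proof (rule L1_bound)
    show "integrable M (\<lambda>w. (cmod (f j w))^2 + (cmod (f l w))^2)" using that sq by auto
    show "(\<lambda>w. f j w * cnj (f l w)) \<in> borel_measurable M" using meas[OF that(1)] meas[OF that(2)] by measurable
    have "a * b \<le> a^2 + b^2" if "0 \<le> a" "0 \<le> b" for a b :: real using sum_squares_bound[of a b] mult_nonneg_nonneg[OF that] by linarith
    then show "AE w in M. cmod (f j w * cnj (f l w)) \<le> norm ((cmod (f j w))^2 + (cmod (f l w))^2 :: real)" by (auto simp: norm_mult)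
  qed
  have expand: "complex_of_real ((cmod (\<Sum>j\<in>I. f j w))^2) = (\<Sum>j\<in>I. \<Sum>l\<in>I. f j w * cnj (f l w))" for w
    unfolding complex_norm_square cnj_sum sum_product ..
  have expand': "complex_of_real ((cmod (f j w))^2) = f j w * cnj (f j w)" for j w unfolding complex_norm_square ..
  have intc: "integrable M (\<lambda>w. complex_of_real ((cmod (\<Sum>j\<in>I. f j w))^2))" unfolding expand using int by auto
  then show "integrable M (\<lambda>w. (cmod (\<Sum>j\<in>I. f j w))^2)" by (simp only: complex_of_real_integrable_eq)
  have "complex_of_real (\<integral>w. (cmod (\<Sum>j\<in>I. f j w))^2 \<partial>M)
      = (\<integral>w. (\<Sum>j\<in>I. \<Sum>l\<in>I. f j w * cnj (f l w)) \<partial>M)" by (simp only: integral_complex_of_real[symmetric] expand)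
  also have "\<dots> = (\<Sum>j\<in>I. \<Sum>l\<in>I. \<integral>w. f j w * cnj (f l w) \<partial>M)"
    using int by (subst lebesgue_sum; (intro L1_sum sum.cong refl lebesgue_sum)?) auto
  also have "\<dots> = (\<Sum>j\<in>I. \<integral>w. f j w * cnj (f j w) \<partial>M)"
  proof (rule sum.cong[OF refl])
    fix j assume j: "j \<in> I"
    have "(\<Sum>l\<in>I. \<integral>w. f j w * cnj (f l w) \<partial>M) = (\<Sum>l\<in>{j}. \<integral>w. f j w * cnj (f l w) \<partial>M)"
      using fin j orth by (intro sum.mono_neutral_right) auto
    then show "(\<Sum>l\<in>I. \<integral>w. f j w * cnj (f l w) \<partial>M) = (\<integral>w. f j w * cnj (f j w) \<partial>M)" by simp
  qed
  also have "\<dots> = complex_of_real (\<Sum>j\<in>I. \<integral>w. (cmod (f j w))^2 \<partial>M)"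
    unfolding of_real_sum integral_complex_of_real[symmetric] expand' ..
  finally show "(\<integral>w. (cmod (\<Sum>j\<in>I. f j w))^2 \<partial>M) = (\<Sum>j\<in>I. \<integral>w. (cmod (f j w))^2 \<partial>M)"
    by (simp only: of_real_eq_iff)
qed

lemma (in prob_space) indep_vars_pair:
  assumes "indep_vars (\<lambda>_. N) V J" "i \<in> J" "j \<in> J" "i \<noteq> j"
  shows "indep_var N (V i) N (V j)"
proof -
  have *: "indep_vars (\<lambda>_. N) V {i, j}" using assms by (intro indep_vars_subset[OF assms(1)]) auto
  define f where "f = (\<lambda>b. if b then i else j)"
  have f: "inj f" "f ` UNIV = {i, j}" using assms(4) by (auto simp: f_def inj_def)
  have "indep_vars (\<lambda>b. case_bool N N b) (\<lambda>b. case_bool (V i) (V j) b) UNIV"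
  proof -
    have eq: "(\<lambda>b. case_bool N N b) = (\<lambda>_. N)" "(\<lambda>b. case_bool (V i) (V j) b) = (\<lambda>b. V (f b))"
      by (auto simp: fun_eq_iff f_def split: bool.split)
    have "indep_vars (\<lambda>_. N) (\<lambda>b. V (f b)) UNIV" unfolding indep_vars_def2
    proof
      show "\<forall>i\<in>UNIV. random_variable N (V (f i))" using * by (auto simp: indep_vars_def2 f_def)
      have "indep_sets (\<lambda>i. {V i -` A \<inter> space M |A. A \<in> sets N}) (f ` UNIV)" using * unfolding indep_vars_def2 f(2) by simp
      then show "indep_sets (\<lambda>i. {V (f i) -` A \<inter> space M |A. A \<in> sets N}) UNIV" unfolding indep_sets_def
      proof (intro conjI ballI allI impI, goal_cases)
        case (1 i) then show ?case by blast
      next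
        case (2 J A)
        note h = 2(1)[THEN conjunct2, rule_format, of "f ` J" "\<lambda>x. A (the_inv f x)"]
        have inv: "the_inv f (f b) = b" for b by (rule the_inv_f_f[OF f(1)])
        have "prob (\<Inter>x\<in>f ` J. A (the_inv f x)) = (\<Prod>x\<in>f ` J. prob (A (the_inv f x)))" using 2 by (intro h) (auto simp: Pi_iff inv)
        then show ?case using f(1) by (simp add: image_image inv prod.reindex inj_on_def inj_def)
      qed
    qed
    then show ?thesis unfolding eq .
  qed
  then show ?thesis by (simp add: indep_var_def)
qed

lemma (in prob_space) centred_iid_sum_second_moment:
  fixes g :: "real \<Rightarrow> complex"
  assumes indep: "indep_vars (\<lambda>_. borel) V {..<n}"
    and law: "\<And>j. j < n \<Longrightarrow> distr M borel (V j) = P"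
    and [measurable]: "g \<in> borel_measurable borel"
    and sq: "integrable P (\<lambda>v. (cmod (g v))^2)"
  shows "integrable M (\<lambda>w. (cmod (\<Sum>j<n. g (V j w) - (\<integral>v. g v \<partial>P)))^2)"
    and "expectation (\<lambda>w. (cmod (\<Sum>j<n. g (V j w) - (\<integral>v. g v \<partial>P)))^2)
           \<le> real n * (\<integral>v. (cmod (g v))^2 \<partial>P)"
proof -
  define \<mu> where "\<mu> = (\<integral>v. g v \<partial>P)"
  define f where "f = (\<lambda>j w. g (V j w) - \<mu>)"
  have V[measurable]: "V j \<in> borel_measurable M" if "j < n" for j using indep that by (auto simp: indep_vars_def2)
  have gsq: "integrable M (\<lambda>w. (cmod (g (V j w)))^2)"
    "expectation (\<lambda>w. (cmod (g (V j w)))^2) = (\<integral>v. (cmod (g v))^2 \<partial>P)"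
    "expectation (\<lambda>w. g (V j w)) = \<mu>" if "j < n" for j using that sq unfolding \<mu>_def law[OF that, symmetric]
    by (auto simp: integral_distr integrable_distr_eq)
  have gint: "integrable M (\<lambda>w. g (V j w))" if "j < n" for j
  proof -
    have "integrable M (\<lambda>w. cmod (g (V j w)))" using that gsq(1)[OF that] by (intro expectation_le_sqrt_second_moment) auto
    then show ?thesis using that by (simp add: integrable_norm_iff)
  qed
  have f[measurable]: "f j \<in> borel_measurable M" if "j < n" for j using that by (simp add: f_def)
  have fint: "integrable M (f j)" and f0: "expectation (f j) = 0" if "j < n" for j
    using gint[OF that] gsq(3)[OF that] unfolding f_def by (auto simp: prob_space)
  have expand: "(cmod (f j w))^2 = (cmod (g (V j w)))^2 - 2 * Re (g (V j w) * cnj \<mu>) + (cmod \<mu>)^2" for j w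
    unfolding f_def cmod_power2 by (simp add: power2_eq_square algebra_simps)
  have fsq: "integrable M (\<lambda>w. (cmod (f j w))^2)" if "j < n" for j unfolding expand using gsq(1)[OF that] gint[OF that] by auto
  have fsq_le: "expectation (\<lambda>w. (cmod (f j w))^2) \<le> (\<integral>v. (cmod (g v))^2 \<partial>P)" if "j < n" for j
  proof -
    have "expectation (\<lambda>w. (cmod (f j w))^2)
        = (\<integral>v. (cmod (g v))^2 \<partial>P) - 2 * Re (\<mu> * cnj \<mu>) + (cmod \<mu>)^2" unfolding expand using gsq[OF that] gint[OF that]
      by (simp add: prob_space integral_Re del: Re_complex_of_real times_complex.simps)
    also have "Re (\<mu> * cnj \<mu>) = (cmod \<mu>)^2" by (simp only: cmod_power2) (simp add: power2_eq_square)
    finally show ?thesis using zero_le_power2[of "cmod \<mu>"] by linarith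
  qed
  have orth: "expectation (\<lambda>w. f j w * cnj (f l w)) = 0" if jl: "j < n" "l < n" "j \<noteq> l" for j l
  proof -
    have "indep_var borel (V j) borel (V l)" using jl by (intro indep_vars_pair[OF indep]) auto
    from indep_var_compose[OF this, of "\<lambda>v. g v - \<mu>" borel "\<lambda>v. cnj (g v - \<mu>)" borel]
    have "indep_var borel (f j) borel (\<lambda>w. cnj (f l w))" by (simp add: f_def comp_def)
    then have "expectation (\<lambda>w. f j w * cnj (f l w)) = expectation (f j) * expectation (\<lambda>w. cnj (f l w))"
      using fint[OF jl(1)] fint[OF jl(2)] by (intro indep_var_lebesgue_integral) auto
    then show ?thesis using f0[OF jl(1)] by simp
  qed
  have main: "integrable M (\<lambda>w. (cmod (\<Sum>j<n. f j w))^2)"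
    "expectation (\<lambda>w. (cmod (\<Sum>j<n. f j w))^2) = (\<Sum>j<n. expectation (\<lambda>w. (cmod (f j w))^2))"
    by (rule second_moment_orthogonal_sum; (use f fsq orth in auto))+
  show "integrable M (\<lambda>w. (cmod (\<Sum>j<n. g (V j w) - (\<integral>v. g v \<partial>P)))^2)" using main(1) unfolding f_def \<mu>_def .
  have "(\<Sum>j<n. expectation (\<lambda>w. (cmod (f j w))^2)) \<le> (\<Sum>j<n. \<integral>v. (cmod (g v))^2 \<partial>P)"
    using fsq_le by (intro sum_mono) auto
  then show "expectation (\<lambda>w. (cmod (\<Sum>j<n. g (V j w) - (\<integral>v. g v \<partial>P)))^2)
           \<le> real n * (\<integral>v. (cmod (g v))^2 \<partial>P)" using main(2) unfolding f_def \<mu>_def by simp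
qed

text \<open>Tonelli in the form in which it is used below: a pointwise bound on the mean of a random integrand is
  inherited by its integral, so weighted \<open>L\<^sup>1\<close> distances of random characteristic functions reduce to
  a fixed frequency.\<close>

lemma (in prob_space) expected_integral_le:
  fixes H :: "'a \<Rightarrow> real \<Rightarrow> real"
  assumes [measurable]: "case_prod H \<in> borel_measurable (M \<Otimes>\<^sub>M lborel)"
    and nonneg: "\<And>w t. 0 \<le> H w t"
    and int: "\<And>t. integrable M (\<lambda>w. H w t)"
    and le: "\<And>t. expectation (\<lambda>w. H w t) \<le> b t"
    and b: "integrable lborel b"
  shows "integrable M (\<lambda>w. \<integral>t. H w t \<partial>lborel)"
    and "expectation (\<lambda>w. \<integral>t. H w t \<partial>lborel) \<le> (\<integral>t. b t \<partial>lborel)"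
proof -
  interpret P: pair_sigma_finite M lborel ..
  interpret Q: pair_sigma_finite lborel M ..
  have H[measurable]: "(\<lambda>w. H w t) \<in> borel_measurable M" for t by measurable
  have Hswap: "(\<lambda>(t, w). H w t) \<in> borel_measurable (lborel \<Otimes>\<^sub>M M)" by measurable
  have E: "integrable lborel (\<lambda>t. expectation (\<lambda>w. H w t))"
  proof (rule L1_bound[OF b])
    show "(\<lambda>t. expectation (\<lambda>w. H w t)) \<in> borel_measurable lborel" by measurable
    show "AE t in lborel. norm (expectation (\<lambda>w. H w t)) \<le> norm (b t)"
      using le nonneg by (intro AE_I2) (simp add: abs_of_nonneg order_trans[OF le abs_ge_self])
  qed
  have "integrable (lborel \<Otimes>\<^sub>M M) (\<lambda>(t, w). H w t)" by (rule Q.Fubini_integrable[OF Hswap]) (use E int nonneg in auto)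
  then have HI: "integrable (M \<Otimes>\<^sub>M lborel) (case_prod H)" using P.integrable_product_swap_iff[of "case_prod H"] by simp
  show "integrable M (\<lambda>w. \<integral>t. H w t \<partial>lborel)" using P.integrable_fst[OF HI] .
  have "expectation (\<lambda>w. \<integral>t. H w t \<partial>lborel) = (\<integral>t. expectation (\<lambda>w. H w t) \<partial>lborel)"
    using P.Fubini_integral[OF HI] by simp
  also have "\<dots> \<le> (\<integral>t. b t \<partial>lborel)" by (rule integral_mono[OF E b le])
  finally show "expectation (\<lambda>w. \<integral>t. H w t \<partial>lborel) \<le> (\<integral>t. b t \<partial>lborel)" .
qed

section \<open>Central limit theorem for bounded arrays and convergence of Laplace transforms\<close>
lemma one_minus_exp_approx:
  fixes x :: real
  assumes "0 \<le> x"
  shows "\<bar>1 - x - exp (- x)\<bar> \<le> x^2"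
proof -
  have 1: "1 - x \<le> exp (- x)" using exp_ge_add_one_self[of "- x"] by simp
  have "exp (- x) \<le> 1 / (1 + x)" using assms exp_ge_add_one_self[of x] by (simp add: exp_minus field_simps)
  also have "\<dots> \<le> 1 - x + x^2"
  proof -
    have "1 \<le> (1 - x + x^2) * (1 + x)" using assms by (simp add: algebra_simps power2_eq_square)
    then show ?thesis using assms by (simp add: divide_le_eq)
  qed
  finally show ?thesis using 1 by simp
qed

text \<open>Within a row the characteristic function of the sum is an \<open>n\<close>-th power, and the uniform bound \<open>C\<close> controls
  the third-order remainder of its factors. The limit is stated for characteristic functions because the rows
  of interest are projections onto directions that rotate with \<open>n\<close>.\<close>

lemma (in prob_space) clt_bounded_triangular_array:
  fixes V :: "nat \<Rightarrow> nat \<Rightarrow> 'a \<Rightarrow> real"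
  assumes indep: "\<And>n. indep_vars (\<lambda>_. borel) (V n) {..<n}"
    and law: "\<And>n j. j < n \<Longrightarrow> distr M borel (V n j) = P n"
    and P: "\<And>n. prob_space (P n)" "\<And>n. sets (P n) = sets borel"
    and bounded: "\<And>n. AE x in P n. \<bar>x\<bar> \<le> C" and C0: "0 \<le> C"
    and mean: "\<And>n. (\<integral>x. x \<partial>P n) = 0"
    and var: "(\<lambda>n. \<integral>x. x^2 \<partial>P n) \<longlonglongrightarrow> v"
  shows "(\<lambda>n. expectation (\<lambda>w. iexp ((\<Sum>j<n. V n j w) / sqrt (real n)))) \<longlonglongrightarrow> exp (- v / 2)"
proof -
  define s where "s = (\<lambda>n. \<integral>x. x^2 \<partial>P n)"
  have s0: "0 \<le> s n" for n unfolding s_def by simp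

  have main: "cmod (expectation (\<lambda>w. iexp ((\<Sum>j<n. V n j w) / sqrt (real n))) - exp (- s n / 2))
      \<le> (C ^ 3 / 6) / sqrt (real n) + ((s n)^2 / 4) / real n" if n: "0 < n" for n
  proof -
    interpret Q: prob_space "P n" by (rule P)
    interpret Q: real_distribution "P n" by standard (use P[of n] sets_eq_imp_space_eq[OF P(2)] in auto)
    define t where "t = 1 / sqrt (real n)"
    have t0: "0 < t" "t^2 = 1 / real n" using n by (auto simp: t_def power_divide)
    have [measurable]: "V n j \<in> borel_measurable M" if "j < n" for j using indep[of n] that by (auto simp: indep_vars_def2)
    have bd: "AE x in P n. \<bar>x\<bar> ^ k \<le> C ^ k" for k using bounded[of n] by eventually_elim (auto intro: power_mono)
    have int: "integrable (P n) (\<lambda>x. x ^ k)" for k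
      by (rule Q.integrable_const_bound[where B="C^k"]) (use bd[of k] in \<open>auto simp: power_abs\<close>)
    have var_eq: "Q.variance (\<lambda>x. x) = s n" using mean[of n] by (simp add: s_def)
    have approx: "cmod (char (P n) t - (1 - t^2 * s n / 2)) \<le> t^2 / 6 * Q.expectation (\<lambda>x. min (6 * x^2) (\<bar>t\<bar> * \<bar>x\<bar> ^ 3))"
      using Q.char_approx3[of "s n" t] int[of 1] int[of 2] mean[of n] var_eq by simp
    have "Q.expectation (\<lambda>x. min (6 * x^2) (\<bar>t\<bar> * \<bar>x\<bar> ^ 3)) \<le> Q.expectation (\<lambda>x. t * C ^ 3)"
    proof (rule integral_mono_AE)
      show "integrable (P n) (\<lambda>x. min (6 * x^2) (\<bar>t\<bar> * \<bar>x\<bar> ^ 3))"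
        by (rule L1_bound[of _ "\<lambda>x. 6 * x^2"]) (use int[of 2] in auto)
      show "AE x in P n. min (6 * x^2) (\<bar>t\<bar> * \<bar>x\<bar> ^ 3) \<le> t * C ^ 3" using bd[of 3]
      proof eventually_elim
        case (elim x)
        then have "\<bar>t\<bar> * \<bar>x\<bar> ^ 3 \<le> t * C ^ 3" using t0 by (auto intro: mult_left_mono)
        then show ?case by linarith
      qed
    qed auto
    then have "t^2 / 6 * Q.expectation (\<lambda>x. min (6 * x^2) (\<bar>t\<bar> * \<bar>x\<bar> ^ 3)) \<le> t^2 / 6 * (t * C ^ 3)"
      using Q.prob_space by (intro mult_left_mono) auto
    then have a1: "cmod (char (P n) t - (1 - t^2 * s n / 2)) \<le> t^2 / 6 * (t * C ^ 3)" using approx by linarith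
    have "\<bar>1 - t^2 * s n / 2 - exp (- (t^2 * s n / 2))\<bar> \<le> (t^2 * s n / 2)^2" by (rule one_minus_exp_approx) (use s0 in auto)
    then have a2: "cmod ((1 - t^2 * s n / 2) - exp (- (t^2 * s n / 2))) \<le> (t^2 * s n / 2)^2"
      by (metis norm_of_real of_real_1 of_real_diff real_norm_def)
    have a3: "cmod (char (P n) t - exp (- (t^2 * s n / 2))) \<le> t^2 / 6 * (t * C ^ 3) + (t^2 * s n / 2)^2"
      using norm_triangle_le[OF add_mono[OF a1 a2]] by (simp add: algebra_simps)
    have "expectation (\<lambda>w. iexp ((\<Sum>j<n. V n j w) / sqrt (real n))) = char (distr M borel (\<lambda>w. \<Sum>j<n. V n j w)) t"
      unfolding char_def t_def by (subst integral_distr) (auto simp: mult.commute)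
    also have "\<dots> = (\<Prod>j<n. char (distr M borel (V n j)) t)" by (rule char_distr_sum[OF indep])
    also have "\<dots> = char (P n) t ^ n" using law[of _ n] by simp
    finally have E: "expectation (\<lambda>w. iexp ((\<Sum>j<n. V n j w) / sqrt (real n))) = char (P n) t ^ n" .
    have e: "complex_of_real (exp (- s n / 2)) = (complex_of_real (exp (- (t^2 * s n / 2)))) ^ n"
      using n unfolding of_real_power[symmetric] of_real_eq_iff t0(2) by (simp add: exp_of_nat_mult[symmetric])
    have "cmod (char (P n) t ^ n - (complex_of_real (exp (- (t^2 * s n / 2)))) ^ n)
        \<le> real n * cmod (char (P n) t - complex_of_real (exp (- (t^2 * s n / 2))))"
      using s0[of n] by (intro norm_power_diff Q.cmod_char_le_1) (auto simp: norm_of_real)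
    also have "\<dots> \<le> real n * (t^2 / 6 * (t * C ^ 3) + (t^2 * s n / 2)^2)" using a3 by (intro mult_left_mono) auto
    also have "\<dots> = (C ^ 3 / 6) / sqrt (real n) + ((s n)^2 / 4) / real n"
    proof -
      have "real n * (t^2 / 6 * (t * C ^ 3)) = t * C ^ 3 / 6" using n t0(2) by (simp add: field_simps)
      moreover have "real n * (t^2 * s n / 2)^2 = ((s n)^2 / 4) / real n" using n unfolding t0(2) by (simp add: field_simps power2_eq_square)
      ultimately show ?thesis by (simp add: t_def distrib_left)
    qed
    finally show ?thesis unfolding E e .
  qed
  have s: "s \<longlonglongrightarrow> v" using var unfolding s_def .
  have "(\<lambda>n. (C ^ 3 / 6) / sqrt (real n) + ((s n)^2 / 4) / real n) \<longlonglongrightarrow> 0 + 0"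
  proof (intro tendsto_add)
    show "(\<lambda>n. (C ^ 3 / 6) / sqrt (real n)) \<longlonglongrightarrow> 0" by (intro real_tendsto_divide_at_top[OF tendsto_const]
          filterlim_compose[OF sqrt_at_top filterlim_real_sequentially])
    show "(\<lambda>n. ((s n)^2 / 4) / real n) \<longlonglongrightarrow> 0"
      by (intro real_tendsto_divide_at_top[OF _ filterlim_real_sequentially, of _ "v^2 / 4"]
          tendsto_divide tendsto_power tendsto_const s) auto
  qed
  then have lim0: "(\<lambda>n. (C ^ 3 / 6) / sqrt (real n) + ((s n)^2 / 4) / real n) \<longlonglongrightarrow> 0" by (simp only: add_0_left)
  have ev: "eventually (\<lambda>n. cmod (expectation (\<lambda>w. iexp ((\<Sum>j<n. V n j w) / sqrt (real n))) - exp (- s n / 2))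
      \<le> (C ^ 3 / 6) / sqrt (real n) + ((s n)^2 / 4) / real n) sequentially" using main by (rule eventually_sequentiallyI[of 1, OF _]) simp
  have "(\<lambda>n. expectation (\<lambda>w. iexp ((\<Sum>j<n. V n j w) / sqrt (real n))) - exp (- s n / 2)) \<longlonglongrightarrow> 0"
    by (rule Lim_null_comparison[OF ev lim0])
  moreover have "(\<lambda>n. complex_of_real (exp (- s n / 2))) \<longlonglongrightarrow> exp (- v / 2)" by (intro tendsto_intros s) auto
  ultimately show ?thesis using tendsto_add by fastforce
qed

text \<open>The variables \<open>exp (- S\<^sup>2 / 2)\<close> live in \<open>{0..1}\<close>, and \<open>conv\<close> controls all their moments. Weierstrass
  approximation extends this to continuous functions, and sandwiching the indicator of \<open>{..x}\<close> between two
  piecewise linear functions gives distribution functions, since the limit law has no atom at \<open>x\<close>.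
  The weight \<open>s\<close> will be the indicator of an event, so that the limit holds jointly with that event.\<close>

lemma laplace_transform_limit:
  fixes M :: "'a measure" and N :: "'b measure" and S s :: "nat \<Rightarrow> 'a \<Rightarrow> real" and R :: "'b \<Rightarrow> real"
  assumes "prob_space M" "prob_space N"
    and S[measurable]: "\<And>n. S n \<in> borel_measurable M" and S0: "\<And>n w. 0 \<le> S n w"
    and s[measurable]: "\<And>n. s n \<in> borel_measurable M" and s0: "\<And>n w. 0 \<le> s n w" and s1: "\<And>n w. s n w \<le> 1"
    and R[measurable]: "R \<in> borel_measurable N" and R0: "\<And>z. 0 \<le> R z"
    and conv: "\<And>k::nat. (\<lambda>n. (\<integral>w. s n w * exp (- real k * (S n w)^2 / 2) \<partial>M)
          - (\<integral>w. s n w \<partial>M) * (\<integral>z. exp (- real k * (R z)^2 / 2) \<partial>N)) \<longlonglongrightarrow> 0"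
    and x: "0 < x" and atom: "measure N {z\<in>space N. R z = x} = 0"
  shows "(\<lambda>n. (\<integral>w. s n w * indicator {..x} (S n w) \<partial>M)
          - (\<integral>w. s n w \<partial>M) * measure N {z\<in>space N. R z \<le> x}) \<longlonglongrightarrow> 0"
proof -
  interpret M: prob_space M by fact
  interpret N: prob_space N by fact
  define Q where "Q = (\<lambda>n w. exp (- (S n w)\<^sup>2 / 2))"
  define U where "U = (\<lambda>z. exp (- (R z)\<^sup>2 / 2))"
  define q where "q = exp (- x\<^sup>2 / 2)"
  have [measurable]: "Q n \<in> borel_measurable M" for n by (simp add: Q_def)
  have [measurable]: "U \<in> borel_measurable N" by (simp add: U_def)
  have Q01: "Q n w \<in> {0..1}" for n w by (simp add: Q_def)
  have U01: "U z \<in> {0..1}" for z by (simp add: U_def)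
  define D where "D = (\<lambda>g n. (\<integral>w. s n w * g (Q n w) \<partial>M) - (\<integral>w. s n w \<partial>M) * (\<integral>z. g (U z) \<partial>N))"
  have sint: "integrable M (s n)" "(\<integral>w. s n w \<partial>M) \<le> 1" "0 \<le> (\<integral>w. s n w \<partial>M)" for n
  proof -
    show 1: "integrable M (s n)" by (rule M.integrable_const_bound[where B=1]) (use s0 s1 in auto)
    have "(\<integral>w. s n w \<partial>M) \<le> (\<integral>w. 1 \<partial>M)" by (rule integral_mono[OF 1]) (use s1 in auto)
    then show "(\<integral>w. s n w \<partial>M) \<le> 1" by (simp add: M.prob_space)
    show "0 \<le> (\<integral>w. s n w \<partial>M)" using s0 by simp
  qed
  have gQint: "integrable M (\<lambda>w. s n w * g (Q n w))" "integrable N (\<lambda>z. g (U z))"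
    if g: "continuous_on UNIV g" for g :: "real \<Rightarrow> real" and n
  proof -
    have [measurable]: "g \<in> borel_measurable borel" by (rule borel_measurable_continuous_onI[OF g])
    have "compact (g ` {0..1})" by (rule compact_continuous_image[OF continuous_on_subset[OF g]]) auto
    then obtain B where B: "\<And>y. y \<in> {0..1} \<Longrightarrow> \<bar>g y\<bar> \<le> B"
      using compact_imp_bounded bounded_iff by (metis image_eqI real_norm_def)
    have B': "\<bar>s n w * g (Q n w)\<bar> \<le> B" for w using mult_mono[OF s1[of n w] B[OF Q01[of n w]]] s0[of n w] by (simp add: abs_mult)
    show "integrable M (\<lambda>w. s n w * g (Q n w))" by (rule M.integrable_const_bound[where B=B]) (use B' in auto)
    show "integrable N (\<lambda>z. g (U z))" by (rule N.integrable_const_bound[where B=B]) (use B U01 in auto)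
  qed
  have mono: "D (\<lambda>y. y ^ k) \<longlonglongrightarrow> 0" for k
  proof -
    have 1: "Q n w ^ k = exp (- real k * (S n w)^2 / 2)" for n w unfolding Q_def by (simp add: exp_of_nat_mult[symmetric])
    have 2: "U z ^ k = exp (- real k * (R z)^2 / 2)" for z unfolding U_def by (simp add: exp_of_nat_mult[symmetric])
    show ?thesis using conv[of k] unfolding D_def 1 2 .
  qed
  have poly: "D (\<lambda>y. \<Sum>i\<le>m. a i * y ^ i) \<longlonglongrightarrow> 0" for a :: "nat \<Rightarrow> real" and m
  proof -
    have int: "integrable M (\<lambda>w. s n w * Q n w ^ i)" "integrable N (\<lambda>z. U z ^ i)" for n i
      by (rule gQint[of "\<lambda>y. y ^ i"]; intro continuous_intros)+
    have 1: "(\<integral>w. s n w * (\<Sum>i\<le>m. a i * Q n w ^ i) \<partial>M) = (\<Sum>i\<le>m. a i * (\<integral>w. s n w * Q n w ^ i \<partial>M))" for n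
    proof -
      have "(\<integral>w. s n w * (\<Sum>i\<le>m. a i * Q n w ^ i) \<partial>M) = (\<integral>w. (\<Sum>i\<le>m. a i * (s n w * Q n w ^ i)) \<partial>M)"
        by (simp add: sum_distrib_left mult.left_commute)
      also have "\<dots> = (\<Sum>i\<le>m. a i * (\<integral>w. s n w * Q n w ^ i \<partial>M))" using int by (subst lebesgue_sum) auto
      finally show ?thesis .
    qed
    have 2: "(\<integral>z. (\<Sum>i\<le>m. a i * U z ^ i) \<partial>N) = (\<Sum>i\<le>m. a i * (\<integral>z. U z ^ i \<partial>N))"
      using int by (subst lebesgue_sum) auto
    have "D (\<lambda>y. \<Sum>i\<le>m. a i * y ^ i) = (\<lambda>n. \<Sum>i\<le>m. a i * D (\<lambda>y. y ^ i) n)"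
      unfolding D_def 1 2 by (simp add: sum_distrib_left sum_subtractf right_diff_distrib mult.left_commute)
    moreover have "(\<lambda>n. \<Sum>i\<le>m. a i * D (\<lambda>y. y ^ i) n) \<longlonglongrightarrow> (\<Sum>i\<le>m. a i * 0)"
      by (intro tendsto_sum tendsto_mult tendsto_const mono)
    ultimately show ?thesis by simp
  qed
  have cont: "D g \<longlonglongrightarrow> 0" if g: "continuous_on UNIV g" for g :: "real \<Rightarrow> real"
  proof (rule LIMSEQ_I)
    fix e :: real assume e: "0 < e"
    obtain p where p: "real_polynomial_function p" and pg: "\<And>y. y \<in> {0..1} \<Longrightarrow> \<bar>g y - p y\<bar> < e / 3"
      using Stone_Weierstrass_real_polynomial_function[of "{0..1}" g "e/3"] e continuous_on_subset[OF g] by auto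
    obtain a m where pe: "p = (\<lambda>y. \<Sum>i\<le>m. a i * y ^ i)" using p real_polynomial_function_iff_sum by auto
    have pc: "continuous_on UNIV p" unfolding pe by (intro continuous_intros)
    obtain n0 where n0: "\<And>n. n \<ge> n0 \<Longrightarrow> \<bar>D p n\<bar> < e / 3"
      using LIMSEQ_D[OF poly[of a m], of "e/3"] e unfolding pe by auto
    show "\<exists>n0. \<forall>n\<ge>n0. norm (D g n - 0) < e"
    proof (intro exI allI impI)
      fix n assume n: "n0 \<le> n"
      have i1: "\<bar>(\<integral>w. s n w * g (Q n w) \<partial>M) - (\<integral>w. s n w * p (Q n w) \<partial>M)\<bar> \<le> e / 3"
      proof -
        have "\<bar>\<integral>w. s n w * g (Q n w) - s n w * p (Q n w) \<partial>M\<bar> \<le> (\<integral>w. e / 3 \<partial>M)"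
        proof (rule integral_abs_bound[THEN order_trans], rule integral_mono)
          show "integrable M (\<lambda>w. \<bar>s n w * g (Q n w) - s n w * p (Q n w)\<bar>)" by (intro integrable_abs L1_diff gQint g pc)
          show "\<bar>s n w * g (Q n w) - s n w * p (Q n w)\<bar> \<le> e / 3" for w
            using mult_mono[OF s1[of n w] less_imp_le[OF pg[OF Q01[of n w]]]] s0[of n w] by (simp add: abs_mult right_diff_distrib[symmetric])
        qed auto
        then show ?thesis by (simp add: lebesgue_diff gQint g pc M.prob_space)
      qed
      have i2: "\<bar>(\<integral>z. g (U z) \<partial>N) - (\<integral>z. p (U z) \<partial>N)\<bar> \<le> e / 3"
      proof -
        have "\<bar>\<integral>z. g (U z) - p (U z) \<partial>N\<bar> \<le> (\<integral>z. e / 3 \<partial>N)"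
        proof (rule integral_abs_bound[THEN order_trans], rule integral_mono)
          show "integrable N (\<lambda>z. \<bar>g (U z) - p (U z)\<bar>)" by (intro integrable_abs L1_diff gQint g pc)
        qed (use pg[OF U01] in \<open>auto intro: less_imp_le\<close>)
        then show ?thesis by (simp add: lebesgue_diff gQint g pc N.prob_space)
      qed
      have i3: "\<bar>(\<integral>w. s n w \<partial>M) * (\<integral>z. g (U z) \<partial>N) - (\<integral>w. s n w \<partial>M) * (\<integral>z. p (U z) \<partial>N)\<bar> \<le> e / 3"
        using mult_mono[OF sint(2)[of n] i2] sint(3)[of n] by (simp add: right_diff_distrib[symmetric] abs_mult)
      have "\<bar>D g n\<bar> < e" using i1 i3 n0[OF n] unfolding D_def by linarith
      then show "norm (D g n - 0) < e" by simp
    qed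
  qed
  \<comment> \<open>Continuous majorant and minorant of the indicator of \<open>{q..}\<close>; they differ only within \<open>1 / (j + 1)\<close> of \<open>q\<close>.\<close>
  define up where "up = (\<lambda>j::nat. \<lambda>y. min 1 (max 0 ((y - q) * real (Suc j) + 1)))"
  define lo where "lo = (\<lambda>j::nat. \<lambda>y. min 1 (max 0 ((y - q) * real (Suc j))))"
  have upc: "continuous_on UNIV (up j)" and loc: "continuous_on UNIV (lo j)" for j unfolding up_def lo_def by (intro continuous_intros)+
  have ind: "(S n w \<le> x) = (q \<le> Q n w)" for n w using S0[of n w] x unfolding q_def Q_def by (simp add: power2_le_iff_abs_le abs_of_nonneg)
  have indN: "(R z \<le> x) = (q \<le> U z)" "(R z = x) = (U z = q)" for z using R0[of z] x unfolding q_def U_def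
    by (simp_all add: power2_le_iff_abs_le abs_of_nonneg power2_eq_iff_nonneg)
  have up_ge: "indicator {..x} (S n w) \<le> up j (Q n w)" for j n w by (auto simp: indicator_def ind up_def)
  have lo_le: "lo j (Q n w) \<le> indicator {..x} (S n w)" for j n w by (auto simp: indicator_def ind lo_def mult_nonpos_nonneg)
  have upN: "indicator {z\<in>space N. R z \<le> x} z \<le> up j (U z)" if "z \<in> space N" for j z
    using that by (auto simp: indicator_def indN up_def)
  have loN: "lo j (U z) \<le> indicator {z\<in>space N. R z \<le> x} z" if "z \<in> space N" for j z
    using that by (auto simp: indicator_def indN lo_def mult_nonpos_nonneg)
  have gap: "(\<lambda>j. \<integral>z. up j (U z) - lo j (U z) \<partial>N) \<longlonglongrightarrow> (\<integral>z. indicator {z\<in>space N. R z = x} z \<partial>N)"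
  proof (rule integral_dominated_convergence[where w="\<lambda>_. 1"])
    show "AE z in N. (\<lambda>j. up j (U z) - lo j (U z)) \<longlonglongrightarrow> indicator {z\<in>space N. R z = x} z"
    proof (rule AE_I2)
      fix z assume z: "z \<in> space N"
      have "eventually (\<lambda>j. up j (U z) - lo j (U z) = indicator {z\<in>space N. R z = x} z) sequentially"
      proof (cases "U z = q")
        case True
        then show ?thesis using z by (auto simp: indN up_def lo_def)
      next
        case False
        obtain j0 :: nat where j0: "1 / \<bar>U z - q\<bar> < real j0" using reals_Archimedean2 by blast
        have "up j (U z) - lo j (U z) = 0" if "j \<ge> j0" for j
        proof -
          have "1 / \<bar>U z - q\<bar> < real (Suc j)" using j0 that by linarith
          then have "1 < \<bar>U z - q\<bar> * real (Suc j)" using False by (simp add: field_simps)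
          then show ?thesis by (cases "U z > q") (auto simp: up_def lo_def min_def max_def mult_less_0_iff algebra_simps abs_if split: if_splits)
        qed
        then show ?thesis using z False by (auto simp: indN intro: eventually_sequentiallyI[of j0])
      qed
      then show "(\<lambda>j. up j (U z) - lo j (U z)) \<longlonglongrightarrow> indicator {z\<in>space N. R z = x} z" by (rule tendsto_eventually)
    qed
    have [measurable]: "up j \<in> borel_measurable borel" "lo j \<in> borel_measurable borel" for j
      by (auto intro!: borel_measurable_continuous_onI upc loc)
    show "(\<lambda>z. up j (U z) - lo j (U z)) \<in> borel_measurable N" for j by measurable
    show "AE z in N. norm (up j (U z) - lo j (U z)) \<le> 1" for j by (auto simp: up_def lo_def min_def max_def)
  qed auto
  have gap0: "(\<lambda>j. \<integral>z. up j (U z) - lo j (U z) \<partial>N) \<longlonglongrightarrow> 0" using gap atom by simp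
  show ?thesis
  proof (rule LIMSEQ_I)
    fix e :: real assume e: "0 < e"
    obtain j where j: "\<bar>\<integral>z. up j (U z) - lo j (U z) \<partial>N\<bar> < e / 2" using LIMSEQ_D[OF gap0, of "e/2"] e by auto
    have j': "(\<integral>z. up j (U z) \<partial>N) - (\<integral>z. lo j (U z) \<partial>N) < e / 2"
      using j unfolding lebesgue_diff[OF gQint(2)[OF upc[of j]] gQint(2)[OF loc[of j]]] by linarith
    obtain n0 where n0: "\<And>n. n \<ge> n0 \<Longrightarrow> \<bar>D (up j) n\<bar> < e / 2"
      using LIMSEQ_D[OF cont[OF upc[of j]], of "e/2"] e by auto
    obtain n1 where n1: "\<And>n. n \<ge> n1 \<Longrightarrow> \<bar>D (lo j) n\<bar> < e / 2"
      using LIMSEQ_D[OF cont[OF loc[of j]], of "e/2"] e by auto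
    have Nint: "integrable N (indicator {z\<in>space N. R z \<le> x} :: _ \<Rightarrow> real)"
      by (rule N.integrable_const_bound[where B=1]) (auto simp: indicator_def)
    have N_eq: "measure N {z\<in>space N. R z \<le> x} = (\<integral>z. indicator {z\<in>space N. R z \<le> x} z \<partial>N)" by simp
    have N_up: "measure N {z\<in>space N. R z \<le> x} \<le> (\<integral>z. up j (U z) \<partial>N)"
      unfolding N_eq by (rule integral_mono[OF Nint gQint(2)[OF upc] upN])
    have N_lo: "(\<integral>z. lo j (U z) \<partial>N) \<le> measure N {z\<in>space N. R z \<le> x}"
      unfolding N_eq by (rule integral_mono[OF gQint(2)[OF loc] Nint loN])
    show "\<exists>n0. \<forall>n\<ge>n0. norm ((\<integral>w. s n w * indicator {..x} (S n w) \<partial>M)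
          - (\<integral>w. s n w \<partial>M) * measure N {z\<in>space N. R z \<le> x} - 0) < e"
    proof (intro exI allI impI)
      fix n assume n: "max n0 n1 \<le> n"
      have Mint: "integrable M (\<lambda>w. s n w * indicator {..x} (S n w))" by (rule L1_bound[OF sint(1)[of n]]) (auto simp: indicator_def)
      have M_up: "(\<integral>w. s n w * indicator {..x} (S n w) \<partial>M) \<le> (\<integral>w. s n w * up j (Q n w) \<partial>M)"
        by (rule integral_mono[OF Mint gQint(1)[OF upc]]) (auto intro!: mult_left_mono up_ge s0)
      have M_lo: "(\<integral>w. s n w * lo j (Q n w) \<partial>M) \<le> (\<integral>w. s n w * indicator {..x} (S n w) \<partial>M)"
        by (rule integral_mono[OF gQint(1)[OF loc] Mint]) (auto intro!: mult_left_mono lo_le s0)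
      let ?s = "\<integral>w. s n w \<partial>M" and ?m = "measure N {z\<in>space N. R z \<le> x}"
      have a: "?s * (\<integral>z. up j (U z) \<partial>N) - ?s * ?m \<le> e / 2"
      proof -
        have "?s * ((\<integral>z. up j (U z) \<partial>N) - ?m) \<le> 1 * ((\<integral>z. up j (U z) \<partial>N) - ?m)"
          using sint[of n] N_up by (intro mult_right_mono) auto
        then show ?thesis using j' N_lo by (simp add: right_diff_distrib)
      qed
      have b: "?s * ?m - ?s * (\<integral>z. lo j (U z) \<partial>N) \<le> e / 2"
      proof -
        have "?s * (?m - (\<integral>z. lo j (U z) \<partial>N)) \<le> 1 * (?m - (\<integral>z. lo j (U z) \<partial>N))"
          using sint[of n] N_lo by (intro mult_right_mono) auto
        then show ?thesis using j' N_up by (simp add: right_diff_distrib)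
      qed
      have "\<bar>D (up j) n\<bar> < e / 2" "\<bar>D (lo j) n\<bar> < e / 2" using n n0[of n] n1[of n] by auto
      then have "\<bar>(\<integral>w. s n w * indicator {..x} (S n w) \<partial>M) - ?s * ?m\<bar> < e"
        using a b M_up M_lo unfolding D_def by linarith
      then show "norm ((\<integral>w. s n w * indicator {..x} (S n w) \<partial>M) - ?s * ?m - 0) < e" by simp
    qed
  qed
qed

section \<open>From characteristic functions to the law of a modulus\<close>
text \<open>The direction of \<open>Z n\<close> is only known up to a rotation depending on \<open>n\<close>, so \<open>lim\<close> speaks of all sequences \<open>c\<close>
  of constant modulus. Averaging it over a Gaussian vector \<open>\<zeta>\<close> in place of \<open>c\<close> replaces the characteristic
  function by the Gaussian \<open>exp (- r\<^sup>2 * S\<^sup>2 / 2)\<close> of the modulus \<open>S\<close>, by \<open>gauss\<close>; on the limit side the same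
  average gives the Laplace transform of \<open>R\<^sup>2\<close>. Taking \<open>r\<^sup>2 = k\<close> yields the hypothesis of
  \<open>laplace_transform_limit\<close>.\<close>

lemma limit_law_of_modulus:
  fixes M :: "'a measure" and N :: "'b measure" and Z :: "nat \<Rightarrow> 'a \<Rightarrow> complex"
    and S s :: "nat \<Rightarrow> 'a \<Rightarrow> real" and \<zeta> :: "nat \<Rightarrow> 'b \<Rightarrow> complex" and R :: "'b \<Rightarrow> real"
  assumes "prob_space M" "prob_space N"
    and Z[measurable]: "\<And>n. Z n \<in> borel_measurable M"
    and S[measurable]: "\<And>n. S n \<in> borel_measurable M" and S0: "\<And>n w. 0 \<le> S n w"
    and s[measurable]: "\<And>n. s n \<in> borel_measurable M" and s0: "\<And>n w. 0 \<le> s n w" and s1: "\<And>n w. s n w \<le> 1"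
    and \<zeta>[measurable]: "\<And>n. \<zeta> n \<in> borel_measurable N"
    and R[measurable]: "R \<in> borel_measurable N" and norm\<zeta>: "\<And>n z. cmod (\<zeta> n z) = R z"
    and gauss: "\<And>r n w. 0 \<le> r \<Longrightarrow>
        (\<integral>z. iexp (r * Re (cnj (\<zeta> n z) * Z n w)) \<partial>N) = exp (- r\<^sup>2 * (S n w)^2 / 2)"
    and lim: "\<And>r c. (\<And>n. cmod (c n) = r) \<Longrightarrow>
        (\<lambda>n. (\<integral>w. s n w * iexp (Re (cnj (c n) * Z n w)) \<partial>M) - (\<integral>w. s n w \<partial>M) * exp (- r\<^sup>2 / 2)) \<longlonglongrightarrow> 0"
    and x: "0 < x" and atom: "measure N {z\<in>space N. R z = x} = 0"
  shows "(\<lambda>n. (\<integral>w. s n w * indicator {..x} (S n w) \<partial>M)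
          - (\<integral>w. s n w \<partial>M) * measure N {z\<in>space N. R z \<le> x}) \<longlonglongrightarrow> 0"
proof (rule laplace_transform_limit[OF assms(1,2) S S0 s s0 s1 R _ _ x atom])
  interpret M: prob_space M by fact
  interpret N: prob_space N by fact
  interpret P: pair_sigma_finite N M ..
  show "0 \<le> R z" for z using norm\<zeta>[of undefined z] norm_ge_zero by metis
  fix k :: nat
  define r where "r = sqrt (real k)"
  have r: "0 \<le> r" "r^2 = real k" by (auto simp: r_def)
  have sint: "integrable M (s n)" for n by (rule M.integrable_const_bound[where B=1]) (use s0 s1 in auto)
  have s_le: "\<bar>\<integral>w. s n w \<partial>M\<bar> \<le> 1" for n
  proof -
    have "(\<integral>w. s n w \<partial>M) \<le> (\<integral>w. 1 \<partial>M)" by (rule integral_mono[OF sint]) (use s1 in auto)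
    then show ?thesis using s0 by (simp add: M.prob_space)
  qed
  define f where "f = (\<lambda>n z. (\<integral>w. s n w * iexp (r * Re (cnj (\<zeta> n z) * Z n w)) \<partial>M)
      - (\<integral>w. s n w \<partial>M) * exp (- r\<^sup>2 * (R z)^2 / 2))"
  have [measurable]: "Re \<in> borel_measurable borel" by (intro borel_measurable_continuous_onI continuous_intros)
  have meas2: "(\<lambda>(z, w). s n w * iexp (r * Re (cnj (\<zeta> n z) * Z n w))) \<in> borel_measurable (N \<Otimes>\<^sub>M M)" for n
    by measurable
  have int2: "integrable (N \<Otimes>\<^sub>M M) (\<lambda>(z, w). s n w * iexp (r * Re (cnj (\<zeta> n z) * Z n w)))" for n
  proof (rule P.Fubini_integrable[OF meas2])
    show "integrable N (\<lambda>z. \<integral>w. norm (case (z, w) of (z, w) \<Rightarrow> s n w * iexp (r * Re (cnj (\<zeta> n z) * Z n w))) \<partial>M)"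
      by (simp add: norm_mult)
    show "AE z in N. integrable M (\<lambda>w. case (z, w) of (z, w) \<Rightarrow> s n w * iexp (r * Re (cnj (\<zeta> n z) * Z n w)))"
    proof (rule AE_I2)
      fix z assume z: "z \<in> space N"
      have "(\<lambda>w. s n w * iexp (r * Re (cnj (\<zeta> n z) * Z n w))) \<in> borel_measurable M" using measurable_Pair2[OF meas2 z] by simp
      then show "integrable M (\<lambda>w. case (z, w) of (z, w) \<Rightarrow> s n w * iexp (r * Re (cnj (\<zeta> n z) * Z n w)))"
        by (simp, intro L1_bound[OF sint[of n]]) (auto simp: norm_mult)
    qed
  qed
  have f_lim: "(\<lambda>n. f n z) \<longlonglongrightarrow> 0" if "z \<in> space N" for z
  proof -
    have "cmod (of_real r * \<zeta> n z) = r * R z" for n using r by (simp add: norm_mult norm\<zeta>)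
    from lim[OF this] show ?thesis unfolding f_def by (simp add: power_mult_distrib mult.assoc)
  qed
  have f_bound: "cmod (f n z) \<le> 2" for n z
  proof -
    have "cmod (\<integral>w. s n w * iexp (r * Re (cnj (\<zeta> n z) * Z n w)) \<partial>M) \<le> (\<integral>w. cmod (s n w * iexp (r * Re (cnj (\<zeta> n z) * Z n w))) \<partial>M)"
      by (rule integral_norm_bound)
    also have "\<dots> = (\<integral>w. s n w \<partial>M)" using s0 by (simp add: norm_mult)
    also have "\<dots> \<le> 1" using s_le[of n] by simp
    finally have 1: "cmod (\<integral>w. s n w * iexp (r * Re (cnj (\<zeta> n z) * Z n w)) \<partial>M) \<le> 1" .
    have 2: "cmod (complex_of_real ((\<integral>w. s n w \<partial>M) * exp (- r\<^sup>2 * (R z)^2 / 2))) \<le> 1"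
      using mult_mono[OF s_le[of n], of "exp (- r\<^sup>2 * (R z)^2 / 2)" 1] unfolding norm_of_real by (simp add: abs_mult)
    show ?thesis unfolding f_def using norm_triangle_le_diff[OF add_mono[OF 1 2]] by simp
  qed
  have f_meas[measurable]: "f n \<in> borel_measurable N" for n unfolding f_def by measurable
  have "(\<lambda>n. \<integral>z. f n z \<partial>N) \<longlonglongrightarrow> (\<integral>z. 0 \<partial>N)"
    by (rule integral_dominated_convergence[where w="\<lambda>_. 2"]) (auto simp: f_lim f_bound)
  moreover have "(\<integral>z. f n z \<partial>N) = complex_of_real ((\<integral>w. s n w * exp (- real k * (S n w)^2 / 2) \<partial>M)
          - (\<integral>w. s n w \<partial>M) * (\<integral>z. exp (- real k * (R z)^2 / 2) \<partial>N))" for n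
  proof -
    have i2: "integrable N (\<lambda>z. exp (- r\<^sup>2 * (R z)^2 / 2))" by (rule N.integrable_const_bound[where B=1]) auto
    have "(\<integral>z. f n z \<partial>N) = (\<integral>z. (\<integral>w. s n w * iexp (r * Re (cnj (\<zeta> n z) * Z n w)) \<partial>M) \<partial>N)
      - (\<integral>z. complex_of_real ((\<integral>w. s n w \<partial>M) * exp (- r\<^sup>2 * (R z)^2 / 2)) \<partial>N)"
      unfolding f_def of_real_mult[symmetric] by (rule lebesgue_diff) (use P.integrable_fst[OF int2[of n]] i2 in auto)
    also have "(\<integral>z. (\<integral>w. s n w * iexp (r * Re (cnj (\<zeta> n z) * Z n w)) \<partial>M) \<partial>N)
      = (\<integral>w. (\<integral>z. s n w * iexp (r * Re (cnj (\<zeta> n z) * Z n w)) \<partial>N) \<partial>M)"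
      using P.Fubini_integral[OF int2[of n]] by simp
    also have "\<dots> = (\<integral>w. complex_of_real (s n w * exp (- r\<^sup>2 * (S n w)^2 / 2)) \<partial>M)" using gauss[OF r(1)] by simp
    finally show ?thesis by (simp only: integral_complex_of_real r(2) of_real_diff integral_mult_right_zero)
  qed
  ultimately have "(\<lambda>n. complex_of_real ((\<integral>w. s n w * exp (- real k * (S n w)^2 / 2) \<partial>M)
          - (\<integral>w. s n w \<partial>M) * (\<integral>z. exp (- real k * (R z)^2 / 2) \<partial>N))) \<longlonglongrightarrow> complex_of_real 0"
    by simp
  then show "(\<lambda>n. (\<integral>w. s n w * exp (- real k * (S n w)^2 / 2) \<partial>M)
          - (\<integral>w. s n w \<partial>M) * (\<integral>z. exp (- real k * (R z)^2 / 2) \<partial>N)) \<longlonglongrightarrow> 0"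
    by (simp only: tendsto_of_real_iff)
qed

section \<open>Coverage from a common limit of statistic and bootstrap\<close>
text \<open>Let \<open>q\<close> be the \<open>(1 - \<tau>)\<close>-quantile of \<open>D\<close>. On the event that \<open>c n\<close> exceeds \<open>q + \<delta>\<close>, which belongs to the data,
  the conditional probability of \<open>W n \<le> q + \<delta>\<close> stays below \<open>1 - \<tau>\<close>, whereas \<open>conv_b\<close> makes it at least
  \<open>cdf D (q + \<delta> / 2) > 1 - \<tau>\<close> in the limit; the event must therefore have vanishing probability. The other side
  is symmetric, so \<open>c n\<close> tends to \<open>q\<close> in probability, and \<open>T n \<le> c n\<close> has limiting probability \<open>cdf D q\<close>.
  Convergence against events of \<open>F n\<close>, rather than of conditional laws, is what makes the argument elementary.\<close>

lemma (in prob_space) bootstrap_coverage_limit: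
  fixes T W Sc Sb c :: "nat \<Rightarrow> 'a \<Rightarrow> real" and \<Delta> :: "nat \<Rightarrow> real" and D :: "real measure"
    and F :: "nat \<Rightarrow> 'a measure" and G E :: "nat \<Rightarrow> 'a set"
  assumes D: "real_distribution D"
    and atomless: "\<And>x. measure D {x} = 0"
    and nonneg: "measure D {..0} = 0"
    and pos: "\<And>u v. 0 \<le> u \<Longrightarrow> u < v \<Longrightarrow> 0 < measure D {u<..<v}"
    and tau: "0 < \<tau>" "\<tau> < 1"
    and Sc[measurable]: "\<And>n. Sc n \<in> borel_measurable M"
    and Sb[measurable]: "\<And>n. Sb n \<in> borel_measurable M"
    and W[measurable]: "\<And>n. W n \<in> borel_measurable M"
    and G: "\<And>n. G n \<in> events" "(\<lambda>n. prob (space M - G n)) \<longlonglongrightarrow> 0"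
    and \<Delta>: "\<Delta> \<longlonglongrightarrow> 0"
    and close_T: "\<And>n w. w \<in> G n \<Longrightarrow> \<bar>T n w - Sc n w\<bar> \<le> \<Delta> n"
    and close_W: "\<And>n w. w \<in> G n \<Longrightarrow> \<bar>W n w - Sb n w\<bar> \<le> \<Delta> n"
    and F: "\<And>n. subalgebra M (F n)"
    and c: "\<And>n. c n \<in> borel_measurable (F n)"
    and quant: "\<And>n z. AE w in M. c n w \<le> z \<longleftrightarrow>
        1 - \<tau> \<le> real_cond_exp M (F n) (\<lambda>w. indicator {..z} (W n w)) w"
    and conv_c: "\<And>x. 0 < x \<Longrightarrow> (\<lambda>n. prob {w\<in>space M. Sc n w \<le> x}) \<longlonglongrightarrow> cdf D x"
    and conv_b: "\<And>x A. 0 < x \<Longrightarrow> (\<And>n. A n \<in> sets (F n)) \<Longrightarrow>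
        (\<lambda>n. prob (A n \<inter> {w\<in>space M. Sb n w \<le> x}) - prob (A n) * cdf D x) \<longlonglongrightarrow> 0"
    and E: "\<And>n. E n \<in> events" and E_iff: "\<And>n w. w \<in> G n \<Longrightarrow> w \<in> E n \<longleftrightarrow> T n w \<le> c n w"
  shows "(\<lambda>n. prob (E n)) \<longlonglongrightarrow> 1 - \<tau>"
proof -
  interpret D: real_distribution D by fact
  have cont: "isCont (cdf D) x" for x using atomless D.isCont_cdf by blast
  have strict: "cdf D u < cdf D v" if "0 \<le> u" "u < v" for u v
  proof -
    have "measure D {u<..<v} \<le> measure D {u<..v}" by (intro D.finite_measure_mono) auto
    then show ?thesis using pos[OF that] D.cdf_diff_eq[OF that(2)] by linarith
  qed
  have cdf0: "cdf D 0 = 0" using nonneg by (simp add: cdf_def)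
  obtain v where v: "1 - \<tau> < cdf D v"
  proof -
    have "eventually (\<lambda>v. 1 - \<tau> < cdf D v) at_top" using D.cdf_lim_at_top_prob by (rule order_tendstoD) (use tau in auto)
    then show ?thesis using that by (auto simp: eventually_at_top_linorder)
  qed
  have v0: "0 < v"
  proof (rule ccontr)
    assume "\<not> 0 < v"
    then have "cdf D v \<le> cdf D 0" by (intro D.cdf_nondecreasing) auto
    then show False using v cdf0 tau by simp
  qed
  obtain q where q: "0 \<le> q" "cdf D q = 1 - \<tau>" using IVT[of "cdf D" 0 "1 - \<tau>" v] v v0 tau cdf0 cont by auto
  have q0: "0 < q" using q cdf0 tau by (cases "q = 0") auto
  have cM: "c n \<in> borel_measurable M" for n using measurable_from_subalg[OF F c] .
  note [measurable] = cM G(1) E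
  define g where "g = (\<lambda>n. prob (space M - G n))"
  have g: "g \<longlonglongrightarrow> 0" using G(2) unfolding g_def .
  have inG: "prob A \<le> prob B + g n" if "A \<in> events" "B \<in> events" "A \<inter> G n \<subseteq> B" for A B n
  proof -
    have "prob A \<le> prob (B \<union> (space M - G n))" using that G(1)[of n] sets.sets_into_space by (intro finite_measure_mono) blast+
    also have "\<dots> \<le> prob B + g n" unfolding g_def using that by (intro measure_Un_le) auto
    finally show ?thesis .
  qed
  have rce: "prob (A \<inter> {w\<in>space M. W n w \<le> z})
      = (\<integral>w. indicator A w * real_cond_exp M (F n) (\<lambda>w. indicator {..z} (W n w)) w \<partial>M)"
    and rce_int: "integrable M (\<lambda>w. indicator A w * real_cond_exp M (F n) (\<lambda>w. indicator {..z} (W n w)) w)"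
    if A: "A \<in> sets (F n)" for A n z
  proof -
    interpret fs: finite_measure_subalgebra M "F n" by standard (rule F)
    have AM: "A \<in> events" using A F[of n] by (auto simp: subalgebra_def)
    have i: "integrable M (\<lambda>w. indicator {..z} (W n w) :: real)" by (rule integrable_const_bound[where B=1]) (auto simp: indicator_def)
    have "(\<integral>w\<in>A. indicator {..z} (W n w) \<partial>M) = (\<integral>w. indicator (A \<inter> {w\<in>space M. W n w \<le> z}) w \<partial>M)"
      unfolding set_lebesgue_integral_def by (rule lebesgue_cong) (auto simp: indicator_def)
    also have "\<dots> = prob (A \<inter> {w\<in>space M. W n w \<le> z})"
      using AM by (subst Bochner_Integration.integral_indicator) (auto simp: Int_absorb2 sets.sets_into_space)
    finally show "prob (A \<inter> {w\<in>space M. W n w \<le> z})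
      = (\<integral>w. indicator A w * real_cond_exp M (F n) (\<lambda>w. indicator {..z} (W n w)) w \<partial>M)"
      using fs.real_cond_exp_intA[OF i A] by (simp add: set_lebesgue_integral_def)
    show "integrable M (\<lambda>w. indicator A w * real_cond_exp M (F n) (\<lambda>w. indicator {..z} (W n w)) w)"
      using integrable_mult_indicator[OF AM fs.real_cond_exp_int(1)[OF i]] by simp
  qed
  have prob_int: "(1 - \<tau>) * prob A = (\<integral>w. indicator A w * (1 - \<tau>) \<partial>M)" "integrable M (\<lambda>w. indicator A w * (1 - \<tau>))"
    if "A \<in> events" for A
  proof -
    have "integrable M (indicator A :: _ \<Rightarrow> real)"
      by (rule integrable_const_bound[where B=1]) (use that in \<open>auto simp: indicator_def\<close>)
    then show "integrable M (\<lambda>w. indicator A w * (1 - \<tau>))" by auto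
    show "(1 - \<tau>) * prob A = (\<integral>w. indicator A w * (1 - \<tau>) \<partial>M)" using that by (simp add: sets.Int_space_eq2)
  qed
  have upper: "(\<lambda>n. prob {w\<in>space M. q + \<delta> < c n w}) \<longlonglongrightarrow> 0" if \<delta>: "0 < \<delta>" for \<delta>
  proof -
    define A where "A = (\<lambda>n. {w\<in>space M. q + \<delta> < c n w})"
    have AF: "A n \<in> sets (F n)" for n
    proof -
      have "{w\<in>space (F n). q + \<delta> < c n w} \<in> sets (F n)" using c[of n] by measurable
      then show ?thesis using F[of n] by (simp add: A_def subalgebra_def)
    qed
    have AM: "A n \<in> events" for n unfolding A_def by measurable
    define \<kappa> where "\<kappa> = cdf D (q + \<delta> / 2) - (1 - \<tau>)"
    have \<kappa>: "0 < \<kappa>" using strict[of q "q + \<delta>/2"] q \<delta> by (simp add: \<kappa>_def)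
    have c1: "prob (A n \<inter> {w\<in>space M. W n w \<le> q + \<delta>}) \<le> (1 - \<tau>) * prob (A n)" for n
      unfolding rce[OF AF] prob_int(1)[OF AM]
    proof (rule integral_mono_AE[OF rce_int[OF AF] prob_int(2)[OF AM]])
      show "AE w in M. indicator (A n) w * real_cond_exp M (F n) (\<lambda>w. indicator {..q + \<delta>} (W n w)) w
          \<le> indicator (A n) w * (1 - \<tau>)" using quant[of n "q + \<delta>"] by eventually_elim (auto simp: A_def indicator_def)
    qed
    define r where "r = (\<lambda>n. prob (A n \<inter> {w\<in>space M. Sb n w \<le> q + \<delta> / 2}) - prob (A n) * cdf D (q + \<delta> / 2))"
    have r: "r \<longlonglongrightarrow> 0" unfolding r_def using q0 \<delta> AF by (intro conv_b) auto
    have "eventually (\<lambda>n. \<bar>\<Delta> n\<bar> < \<delta> / 2) sequentially"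
      using LIMSEQ_D[OF \<Delta>, of "\<delta>/2"] \<delta> by (auto simp: eventually_sequentially)
    then have "eventually (\<lambda>n. norm (prob (A n)) \<le> (g n - r n) / \<kappa>) sequentially"
    proof eventually_elim
      case (elim n)
      have "prob (A n \<inter> {w\<in>space M. Sb n w \<le> q + \<delta> / 2}) \<le> prob (A n \<inter> {w\<in>space M. W n w \<le> q + \<delta>}) + g n"
      proof (rule inG)
        show "A n \<inter> {w\<in>space M. Sb n w \<le> q + \<delta> / 2} \<inter> G n \<subseteq> A n \<inter> {w\<in>space M. W n w \<le> q + \<delta>}"
          using close_W[of _ n] elim by force
      qed (use AM in auto)
      then have "\<kappa> * prob (A n) \<le> g n - r n" using c1[of n] by (simp add: r_def \<kappa>_def algebra_simps)
      then show ?case using \<kappa> by (simp add: pos_le_divide_eq mult.commute)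
    qed
    moreover have "(\<lambda>n. (g n - r n) / \<kappa>) \<longlonglongrightarrow> 0"
      using tendsto_divide[OF tendsto_diff[OF g r] tendsto_const[of \<kappa>]] \<kappa> by simp
    ultimately show ?thesis unfolding A_def by (rule Lim_null_comparison)
  qed
  have lower: "(\<lambda>n. prob {w\<in>space M. c n w \<le> q - \<delta>}) \<longlonglongrightarrow> 0" if \<delta>: "0 < \<delta>" "\<delta> < q" for \<delta>
  proof -
    define A where "A = (\<lambda>n. {w\<in>space M. c n w \<le> q - \<delta>})"
    have AF: "A n \<in> sets (F n)" for n
    proof -
      have "{w\<in>space (F n). c n w \<le> q - \<delta>} \<in> sets (F n)" using c[of n] by measurable
      then show ?thesis using F[of n] by (simp add: A_def subalgebra_def)
    qed
    have AM: "A n \<in> events" for n unfolding A_def by measurable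
    define \<kappa> where "\<kappa> = (1 - \<tau>) - cdf D (q - \<delta> / 2)"
    have \<kappa>: "0 < \<kappa>" using strict[of "q - \<delta>/2" q] q \<delta> by (simp add: \<kappa>_def)
    have c1: "(1 - \<tau>) * prob (A n) \<le> prob (A n \<inter> {w\<in>space M. W n w \<le> q - \<delta>})" for n
      unfolding rce[OF AF] prob_int(1)[OF AM]
    proof (rule integral_mono_AE[OF prob_int(2)[OF AM] rce_int[OF AF]])
      show "AE w in M. indicator (A n) w * (1 - \<tau>)
         \<le> indicator (A n) w * real_cond_exp M (F n) (\<lambda>w. indicator {..q - \<delta>} (W n w)) w"
        using quant[of n "q - \<delta>"] by eventually_elim (auto simp: A_def indicator_def)
    qed
    define r where "r = (\<lambda>n. prob (A n \<inter> {w\<in>space M. Sb n w \<le> q - \<delta> / 2}) - prob (A n) * cdf D (q - \<delta> / 2))"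
    have r: "r \<longlonglongrightarrow> 0" unfolding r_def using q0 \<delta> AF by (intro conv_b) auto
    have "eventually (\<lambda>n. \<bar>\<Delta> n\<bar> < \<delta> / 2) sequentially"
      using LIMSEQ_D[OF \<Delta>, of "\<delta>/2"] \<delta> by (auto simp: eventually_sequentially)
    then have "eventually (\<lambda>n. norm (prob (A n)) \<le> (g n + r n) / \<kappa>) sequentially"
    proof eventually_elim
      case (elim n)
      have "prob (A n \<inter> {w\<in>space M. W n w \<le> q - \<delta>}) \<le> prob (A n \<inter> {w\<in>space M. Sb n w \<le> q - \<delta> / 2}) + g n"
      proof (rule inG)
        show "A n \<inter> {w\<in>space M. W n w \<le> q - \<delta>} \<inter> G n \<subseteq> A n \<inter> {w\<in>space M. Sb n w \<le> q - \<delta> / 2}"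
          using close_W[of _ n] elim by force
      qed (use AM in auto)
      then have "\<kappa> * prob (A n) \<le> g n + r n" using c1[of n] by (simp add: r_def \<kappa>_def algebra_simps)
      then show ?case using \<kappa> by (simp add: pos_le_divide_eq mult.commute)
    qed
    moreover have "(\<lambda>n. (g n + r n) / \<kappa>) \<longlonglongrightarrow> 0"
      using tendsto_divide[OF tendsto_add[OF g r] tendsto_const[of \<kappa>]] \<kappa> by simp
    ultimately show ?thesis unfolding A_def by (rule Lim_null_comparison)
  qed
  show ?thesis
  proof (rule LIMSEQ_I)
    fix e :: real assume e: "0 < e"
    obtain d where d: "0 < d" "\<And>x. \<bar>x - q\<bar> < d \<Longrightarrow> \<bar>cdf D x - cdf D q\<bar> < e / 2"
    proof -
      have "\<exists>d>0. \<forall>x. dist x q < d \<longrightarrow> dist (cdf D x) (cdf D q) < e / 2"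
        using cont[of q] e unfolding continuous_at_eps_delta by (metis half_gt_zero)
      then show ?thesis using that by (auto simp: dist_real_def)
    qed
    define \<delta> where "\<delta> = min (d / 4) (q / 4)"
    have \<delta>: "0 < \<delta>" "2 * \<delta> < d" "2 * \<delta> < q" using d q0 by (auto simp: \<delta>_def min_def)
    have "\<bar>cdf D (q + 2 * \<delta>) - cdf D q\<bar> < e / 2" "\<bar>cdf D (q - 2 * \<delta>) - cdf D q\<bar> < e / 2"
      using \<delta> by (intro d(2); simp)+
    then have F1: "cdf D (q + 2 * \<delta>) < 1 - \<tau> + e / 2" and F2: "1 - \<tau> - e / 2 < cdf D (q - 2 * \<delta>)" unfolding q(2) by linarith+
    define a where "a = (\<lambda>n. prob {w\<in>space M. Sc n w \<le> q + 2 * \<delta>} + g n + prob {w\<in>space M. q + \<delta> < c n w})"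
    define b where "b = (\<lambda>n. prob {w\<in>space M. Sc n w \<le> q - 2 * \<delta>} - g n - prob {w\<in>space M. c n w \<le> q - \<delta>})"
    have "a \<longlonglongrightarrow> cdf D (q + 2 * \<delta>) + 0 + 0" unfolding a_def using \<delta> q0 by (intro tendsto_add conv_c g upper) auto
    then have ev_a: "eventually (\<lambda>n. a n < 1 - \<tau> + e) sequentially" using F1 e by (intro order_tendstoD) auto
    have "b \<longlonglongrightarrow> cdf D (q - 2 * \<delta>) - 0 - 0" unfolding b_def using \<delta> q0 by (intro tendsto_diff conv_c g lower) auto
    then have ev_b: "eventually (\<lambda>n. 1 - \<tau> - e < b n) sequentially" using F2 e by (intro order_tendstoD) auto
    have "eventually (\<lambda>n. \<bar>\<Delta> n\<bar> < \<delta>) sequentially"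
      using LIMSEQ_D[OF \<Delta>, of "\<delta>"] \<delta> by (auto simp: eventually_sequentially)
    with ev_a ev_b have "eventually (\<lambda>n. norm (prob (E n) - (1 - \<tau>)) < e) sequentially"
    proof eventually_elim
      case (elim n)
      have "prob (E n) \<le> prob ({w\<in>space M. Sc n w \<le> q + 2 * \<delta>} \<union> {w\<in>space M. q + \<delta> < c n w}) + g n"
      proof (rule inG)
        show "E n \<inter> G n \<subseteq> {w\<in>space M. Sc n w \<le> q + 2 * \<delta>} \<union> {w\<in>space M. q + \<delta> < c n w}"
        proof
          fix w assume w: "w \<in> E n \<inter> G n"
          then have "w \<in> space M" using sets.sets_into_space[OF E] by blast
          then show "w \<in> {w\<in>space M. Sc n w \<le> q + 2 * \<delta>} \<union> {w\<in>space M. q + \<delta> < c n w}"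
            using w close_T[of w n] E_iff[of w n] elim(3) by auto
        qed
      qed measurable
      also have "prob ({w\<in>space M. Sc n w \<le> q + 2 * \<delta>} \<union> {w\<in>space M. q + \<delta> < c n w})
          \<le> prob {w\<in>space M. Sc n w \<le> q + 2 * \<delta>} + prob {w\<in>space M. q + \<delta> < c n w}" by (rule measure_Un_le) measurable
      finally have up: "prob (E n) \<le> a n" by (simp add: a_def)
      have "prob {w\<in>space M. Sc n w \<le> q - 2 * \<delta>} \<le> prob (E n \<union> {w\<in>space M. c n w \<le> q - \<delta>}) + g n"
      proof (rule inG)
        show "{w\<in>space M. Sc n w \<le> q - 2 * \<delta>} \<inter> G n \<subseteq> E n \<union> {w\<in>space M. c n w \<le> q - \<delta>}"
        proof
          fix w assume w: "w \<in> {w\<in>space M. Sc n w \<le> q - 2 * \<delta>} \<inter> G n"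
          then show "w \<in> E n \<union> {w\<in>space M. c n w \<le> q - \<delta>}" using close_T[of w n] E_iff[of w n] elim(3) by auto
        qed
      qed measurable
      also have "prob (E n \<union> {w\<in>space M. c n w \<le> q - \<delta>}) \<le> prob (E n) + prob {w\<in>space M. c n w \<le> q - \<delta>}"
        by (rule measure_Un_le) measurable
      finally have "b n \<le> prob (E n)" by (simp add: b_def)
      then have "\<bar>prob (E n) - (1 - \<tau>)\<bar> < e" using up elim(1,2) by linarith
      then show ?case by simp
    qed
    then show "\<exists>n0. \<forall>n\<ge>n0. norm (prob (E n) - (1 - \<tau>)) < e" by (auto simp: eventually_sequentially)
  qed
qed

section \<open>Laws of the modulus of a Gaussian vector\<close>
abbreviation std_gauss :: "real measure" where
  "std_gauss \<equiv> density lborel std_normal_density"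

lemma std_gauss_prob: "prob_space std_gauss"
  by (rule prob_space_normal_density) simp

lemma std_gauss_interval_pos:
  assumes "u < v"
  shows "0 < measure std_gauss {u<..<v}"
proof -
  interpret prob_space std_gauss by (rule std_gauss_prob)
  have "measure std_gauss {u<..<v} \<noteq> 0"
  proof
    assume "measure std_gauss {u<..<v} = 0"
    then have "{u<..<v} \<in> null_sets std_gauss" by (intro null_setsI) (auto simp: emeasure_eq_measure)
    moreover have "(\<lambda>x. ennreal (std_normal_density x)) \<in> borel_measurable lborel" by measurable
    ultimately have "AE x in lborel. x \<in> {u<..<v} \<longrightarrow> ennreal (std_normal_density x) = 0" using null_sets_density_iff by blast
    moreover have "ennreal (std_normal_density x) \<noteq> 0" for x using normal_density_pos[of 1 0 x] by (simp add: ennreal_eq_0_iff)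
    ultimately have "AE x in lborel. x \<notin> {u<..<v}" by simp
    then have "{u<..<v} \<in> null_sets lborel" by (simp add: AE_iff_null_sets)
    then show False using assms by (simp add: null_sets_def)
  qed
  then show ?thesis using measure_nonneg[of std_gauss "{u<..<v}"] by linarith
qed

lemma std_gauss_finite_null:
  assumes "finite A"
  shows "measure std_gauss A = 0"
proof -
  have "A \<in> null_sets lborel" using assms by (rule finite_imp_null_set_lborel)
  then have "A \<in> null_sets std_gauss" using AE_not_in[of A lborel] by (subst null_sets_density_iff) auto
  then show ?thesis by (auto simp: measure_def dest: null_setsD1)
qed

lemma char_std_gauss: "(\<integral>u. iexp (t * u) \<partial>std_gauss) = exp (- t\<^sup>2 / 2)"
  using char_std_normal_distribution by (simp add: char_def fun_eq_iff)

lemma gaussian_plane_char: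
  "(\<integral>(u, v). iexp (\<alpha> * u + \<beta> * v) \<partial>(std_gauss \<Otimes>\<^sub>M std_gauss)) = exp (- (\<alpha>^2 + \<beta>^2) / 2)"
proof -
  interpret prob_space std_gauss by (rule std_gauss_prob)
  interpret P: pair_prob_space std_gauss std_gauss ..
  have meas: "(\<lambda>(u, v). iexp (\<alpha> * u + \<beta> * v)) \<in> borel_measurable (std_gauss \<Otimes>\<^sub>M std_gauss)" by measurable
  have int: "integrable (std_gauss \<Otimes>\<^sub>M std_gauss) (\<lambda>(u, v). iexp (\<alpha> * u + \<beta> * v))"
    by (rule P.integrable_const_bound[where B=1]) (use meas in auto)
  have "(\<integral>(u, v). iexp (\<alpha> * u + \<beta> * v) \<partial>(std_gauss \<Otimes>\<^sub>M std_gauss))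
      = (\<integral>u. (\<integral>v. iexp (\<alpha> * u + \<beta> * v) \<partial>std_gauss) \<partial>std_gauss)"
    by (rule P.integral_fst[OF int, symmetric])
  also have "\<dots> = (\<integral>u. (\<integral>v. iexp (\<alpha> * u) * iexp (\<beta> * v) \<partial>std_gauss) \<partial>std_gauss)"
    by (simp add: ring_distribs exp_add)
  also have "\<dots> = (\<integral>u. iexp (\<alpha> * u) * exp (- \<beta>\<^sup>2 / 2) \<partial>std_gauss)"
    by (simp only: integral_mult_right_zero char_std_gauss)
  also have "\<dots> = (\<integral>u. iexp (\<alpha> * u) \<partial>std_gauss) * exp (- \<beta>\<^sup>2 / 2)" by (rule integral_mult_left_zero)
  also have "\<dots> = complex_of_real (exp (- \<alpha>\<^sup>2 / 2)) * exp (- \<beta>\<^sup>2 / 2)" by (simp only: char_std_gauss)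
  also have "\<dots> = exp (- (\<alpha>^2 + \<beta>^2) / 2)"
    unfolding of_real_mult[symmetric] mult_exp_exp by (simp add: add_divide_distrib diff_divide_distrib)
  finally show ?thesis .
qed

text \<open>The two possible limit laws: the length of a standard Gaussian vector in the plane for a nondegenerate
  interval, and the absolute value of a standard Gaussian variable if the interval is a single point.\<close>

definition gauss_modulus_law :: "bool \<Rightarrow> real measure" where
  "gauss_modulus_law planar = (if planar
     then distr (std_gauss \<Otimes>\<^sub>M std_gauss) borel (\<lambda>(u, v). sqrt (u^2 + v^2))
     else distr std_gauss borel abs)"

lemma gauss_modulus_law:
  shows "real_distribution (gauss_modulus_law planar)"
    and "measure (gauss_modulus_law planar) {x} = 0"
    and "measure (gauss_modulus_law planar) {..0} = 0"
    and "0 \<le> u \<Longrightarrow> u < v \<Longrightarrow> 0 < measure (gauss_modulus_law planar) {u<..<v}"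
proof -
  interpret g: prob_space std_gauss by (rule std_gauss_prob)
  interpret P: pair_prob_space std_gauss std_gauss ..
  have m2[measurable]: "(\<lambda>(u, v). sqrt (u^2 + v^2)) \<in> borel_measurable (std_gauss \<Otimes>\<^sub>M std_gauss)" by measurable
  have m1[measurable]: "(abs :: real \<Rightarrow> real) \<in> borel_measurable std_gauss" by measurable
  show rd: "real_distribution (gauss_modulus_law planar)"
    unfolding gauss_modulus_law_def by (simp add: P.real_distribution_distr g.real_distribution_distr)
  show atom: "measure (gauss_modulus_law planar) {x} = 0" for x
  proof (cases planar)
    case False
    have "measure std_gauss (abs -` {x} \<inter> space std_gauss) \<le> measure std_gauss {x, - x}"
      by (intro g.finite_measure_mono) (auto simp: abs_if split: if_splits)
    then show ?thesis using False std_gauss_finite_null[of "{x, - x}"] measure_nonneg[of std_gauss "abs -` {x} \<inter> space std_gauss"]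
      by (simp add: gauss_modulus_law_def measure_distr del: measure_nonneg)
  next
    case True
    let ?A = "(\<lambda>(u, v). sqrt (u^2 + v^2)) -` {x} \<inter> space (std_gauss \<Otimes>\<^sub>M std_gauss)"
    have A: "?A \<in> sets (std_gauss \<Otimes>\<^sub>M std_gauss)" by measurable
    have "emeasure (std_gauss \<Otimes>\<^sub>M std_gauss) ?A = (\<integral>\<^sup>+u. emeasure std_gauss (Pair u -` ?A) \<partial>std_gauss)"
      by (rule g.emeasure_pair_measure_alt[OF A])
    also have "\<dots> = (\<integral>\<^sup>+u. 0 \<partial>std_gauss)"
    proof (rule nn_integral_cong)
      fix u
      have "Pair u -` ?A \<subseteq> {sqrt (x^2 - u^2), - sqrt (x^2 - u^2)}"
      proof
        fix v assume "v \<in> Pair u -` ?A"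
        then have "u^2 + v^2 = x^2" by auto
        then have "x^2 - u^2 = v^2" by simp
        then show "v \<in> {sqrt (x^2 - u^2), - sqrt (x^2 - u^2)}" by (simp add: abs_if)
      qed
      then have "finite (Pair u -` ?A)" by (rule finite_subset) auto
      then show "emeasure std_gauss (Pair u -` ?A) = 0" using std_gauss_finite_null by (simp add: g.emeasure_eq_measure)
    qed
    finally show ?thesis using True by (simp add: gauss_modulus_law_def measure_distr measure_def[of "std_gauss \<Otimes>\<^sub>M std_gauss"])
  qed
  interpret D: real_distribution "gauss_modulus_law planar" by (rule rd)
  show "measure (gauss_modulus_law planar) {..0} = 0"
  proof -
    have "AE x in gauss_modulus_law planar. 0 \<le> x" unfolding gauss_modulus_law_def by (auto simp: AE_distr_iff)
    then have "measure (gauss_modulus_law planar) {..0} = measure (gauss_modulus_law planar) {0}" by (intro D.finite_measure_eq_AE) auto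
    then show ?thesis using atom by simp
  qed
  show "0 < measure (gauss_modulus_law planar) {u<..<v}" if uv: "0 \<le> u" "u < v"
  proof (cases planar)
    case False
    have "measure std_gauss {u<..<v} \<le> measure std_gauss (abs -` {u<..<v} \<inter> space std_gauss)"
      using uv measurable_sets[OF m1, of "{u<..<v}"] by (intro g.finite_measure_mono) auto
    then show ?thesis using False std_gauss_interval_pos[OF uv(2)] by (simp add: gauss_modulus_law_def measure_distr)
  next
    case True
    define w where "w = (u + v) / 2"
    have w: "u < w" "w < v" "0 < w" using uv by (auto simp: w_def)
    define d where "d = sqrt (v^2 - w^2)"
    have d2: "w^2 + d^2 = v^2" and d: "0 < d" using w power_strict_mono[of w v 2] by (auto simp: d_def)
    let ?A = "(\<lambda>(u, v). sqrt (u^2 + v^2)) -` {u<..<v} \<inter> space (std_gauss \<Otimes>\<^sub>M std_gauss)"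
    have sub: "{u<..<w} \<times> {0<..<d} \<subseteq> ?A"
    proof (clarsimp simp: space_pair_measure)
      fix a b assume ab: "u < a" "a < w" "0 < b" "b < d"
      have "u^2 < a^2" using ab uv by (intro power_strict_mono) auto
      moreover have "a^2 < w^2" using ab uv by (intro power_strict_mono) auto
      moreover have "b^2 < d^2" using ab by (intro power_strict_mono) auto
      moreover have "0 \<le> b^2" by simp
      ultimately have "u^2 < a^2 + b^2" "a^2 + b^2 < v^2" using d2 by linarith+
      then show "u < sqrt (a^2 + b^2) \<and> sqrt (a^2 + b^2) < v" using uv by (auto intro!: real_less_rsqrt real_less_lsqrt)
    qed
    have "measure std_gauss {u<..<w} * measure std_gauss {0<..<d}
        = measure (std_gauss \<Otimes>\<^sub>M std_gauss) ({u<..<w} \<times> {0<..<d})"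
    proof -
      have "emeasure (std_gauss \<Otimes>\<^sub>M std_gauss) ({u<..<w} \<times> {0<..<d})
          = emeasure std_gauss {u<..<w} * emeasure std_gauss {0<..<d}" by (rule g.emeasure_pair_measure_Times) auto
      then show ?thesis by (simp add: measure_def enn2real_mult)
    qed
    also have "\<dots> \<le> measure (std_gauss \<Otimes>\<^sub>M std_gauss) ?A" by (rule P.finite_measure_mono[OF sub]) measurable
    finally show ?thesis using True mult_pos_pos[OF std_gauss_interval_pos[OF w(1)] std_gauss_interval_pos[OF d]]
      by (simp add: gauss_modulus_law_def measure_distr)
  qed
qed

text \<open>Both cases of \<open>limit_law_of_modulus\<close>: the averaging vector is a planar Gaussian, or a real Gaussian multiple of
  the unit vector with angle \<open>\<theta> n\<close>, for which only the component of \<open>Z n\<close> in that direction survives.\<close>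

lemma gauss_modulus_limit:
  fixes M :: "'a measure" and Z :: "nat \<Rightarrow> 'a \<Rightarrow> complex" and s :: "nat \<Rightarrow> 'a \<Rightarrow> real" and \<theta> :: "nat \<Rightarrow> real"
  assumes "prob_space M"
    and Z[measurable]: "\<And>n. Z n \<in> borel_measurable M"
    and s[measurable]: "\<And>n. s n \<in> borel_measurable M" and s0: "\<And>n w. 0 \<le> s n w" and s1: "\<And>n w. s n w \<le> 1"
    and lim: "\<And>r c. (\<And>n. cmod (c n) = r) \<Longrightarrow>
        (\<lambda>n. (\<integral>w. s n w * iexp (Re (cnj (c n) * Z n w)) \<partial>M) - (\<integral>w. s n w \<partial>M) * exp (- r\<^sup>2 / 2)) \<longlonglongrightarrow> 0"
    and x: "0 < x"
  shows "(\<lambda>n. (\<integral>w. s n w * indicator {..x} (if planar then cmod (Z n w) else \<bar>Re (iexp (- \<theta> n) * Z n w)\<bar>) \<partial>M)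
          - (\<integral>w. s n w \<partial>M) * cdf (gauss_modulus_law planar) x) \<longlonglongrightarrow> 0"
proof -
  interpret g: prob_space std_gauss by (rule std_gauss_prob)
  interpret P: pair_prob_space std_gauss std_gauss ..
  have [measurable]: "Re \<in> borel_measurable borel" by (intro borel_measurable_continuous_onI continuous_intros)
  show ?thesis
  proof (cases planar)
    case True
    let ?N = "std_gauss \<Otimes>\<^sub>M std_gauss"
    have cdf: "cdf (gauss_modulus_law planar) x = measure ?N {z\<in>space ?N. (\<lambda>(u, v). sqrt (u^2 + v^2)) z \<le> x}"
      using True by (auto simp: cdf_def gauss_modulus_law_def measure_distr intro!: arg_cong[where f="measure _"])
    have atom: "measure ?N {z\<in>space ?N. (\<lambda>(u, v). sqrt (u^2 + v^2)) z = x} = 0" using True gauss_modulus_law(2)[of planar x]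
      by (auto simp: gauss_modulus_law_def measure_distr vimage_def Int_def conj_commute)
    have "(\<lambda>n. (\<integral>w. s n w * indicator {..x} (cmod (Z n w)) \<partial>M)
          - (\<integral>w. s n w \<partial>M) * measure ?N {z\<in>space ?N. (\<lambda>(u, v). sqrt (u^2 + v^2)) z \<le> x}) \<longlonglongrightarrow> 0"
    proof (rule limit_law_of_modulus[where Z=Z and \<zeta>="\<lambda>n (u, v). Complex u v",
          OF assms(1) P.prob_space_axioms Z _ _ s s0 s1 _ _ _ _ lim x atom])
      show "(\<lambda>(u, v). Complex u v) \<in> borel_measurable ?N" by (simp add: borel_measurable_complex_iff split_beta')
      show "cmod (case z of (u, v) \<Rightarrow> Complex u v) = (case z of (u, v) \<Rightarrow> sqrt (u^2 + v^2))" for z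
        by (cases z) (simp add: cmod_def)
      show "(\<integral>z. iexp (r * Re (cnj (case z of (u, v) \<Rightarrow> Complex u v) * Z n w)) \<partial>?N) = exp (- r\<^sup>2 * (cmod (Z n w))^2 / 2)"
        for r n w
      proof -
        have "(\<integral>z. iexp (r * Re (cnj (case z of (u, v) \<Rightarrow> Complex u v) * Z n w)) \<partial>?N)
          = (\<integral>(u, v). iexp ((r * Re (Z n w)) * u + (r * Im (Z n w)) * v) \<partial>?N)"
          by (intro lebesgue_cong refl) (auto simp: algebra_simps)
        also have "\<dots> = exp (- ((r * Re (Z n w))^2 + (r * Im (Z n w))^2) / 2)" by (rule gaussian_plane_char)
        also have "(r * Re (Z n w))^2 + (r * Im (Z n w))^2 = r^2 * (cmod (Z n w))^2"
          by (simp only: cmod_power2) (simp add: power_mult_distrib distrib_left)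
        finally show ?thesis by simp
      qed
    qed auto
    then show ?thesis using True cdf by simp
  next
    case False
    let ?N = "std_gauss"
    have cdf: "cdf (gauss_modulus_law planar) x = measure ?N {z\<in>space ?N. \<bar>z\<bar> \<le> x}"
      using False by (auto simp: cdf_def gauss_modulus_law_def measure_distr intro!: arg_cong[where f="measure _"])
    have atom: "measure ?N {z\<in>space ?N. \<bar>z\<bar> = x} = 0" using False gauss_modulus_law(2)[of planar x]
      by (auto simp: gauss_modulus_law_def measure_distr vimage_def Int_def conj_commute)
    have "(\<lambda>n. (\<integral>w. s n w * indicator {..x} \<bar>Re (iexp (- \<theta> n) * Z n w)\<bar> \<partial>M)
          - (\<integral>w. s n w \<partial>M) * measure ?N {z\<in>space ?N. \<bar>z\<bar> \<le> x}) \<longlonglongrightarrow> 0"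
    proof (rule limit_law_of_modulus[where Z=Z and \<zeta>="\<lambda>n u. of_real u * iexp (\<theta> n)",
          OF assms(1) g.prob_space_axioms Z _ _ s s0 s1 _ _ _ _ lim x atom])
      show "cmod (of_real z * iexp (\<theta> n)) = \<bar>z\<bar>" for z n by (simp add: norm_mult)
      show "(\<integral>z. iexp (r * Re (cnj (of_real z * iexp (\<theta> n)) * Z n w)) \<partial>?N) = exp (- r\<^sup>2 * \<bar>Re (iexp (- \<theta> n) * Z n w)\<bar>^2 / 2)"
        for r n w
      proof -
        have eq: "r * Re (cnj (of_real z * iexp (\<theta> n)) * Z n w) = (r * Re (iexp (- \<theta> n) * Z n w)) * z" for z
          by (simp add: exp_cnj mult.assoc)
        show ?thesis unfolding eq char_std_gauss by (simp add: power_mult_distrib)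
      qed
    qed auto
    then show ?thesis using False cdf by simp
  qed
qed

text \<open>Freezing \<open>V\<close> makes conditioning on it explicit: the inner expectation is over \<open>U\<close> alone.\<close>

lemma (in prob_space) indep_var_iterated_expectation:
  fixes g :: "'b \<times> 'b \<Rightarrow> complex"
  assumes indep: "indep_var S U T V"
    and g[measurable]: "g \<in> borel_measurable (S \<Otimes>\<^sub>M T)" and bd: "\<And>z. cmod (g z) \<le> C"
  shows "expectation (\<lambda>w. g (U w, V w)) = expectation (\<lambda>w. expectation (\<lambda>w'. g (U w', V w)))"
proof -
  have [measurable]: "U \<in> measurable M S" "V \<in> measurable M T"
    and eq: "distr M S U \<Otimes>\<^sub>M distr M T V = distr M (S \<Otimes>\<^sub>M T) (\<lambda>x. (U x, V x))"
    using indep by (auto simp: indep_var_distribution_eq)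
  interpret pU: prob_space "distr M S U" by (rule prob_space_distr) measurable
  interpret pV: prob_space "distr M T V" by (rule prob_space_distr) measurable
  interpret P: pair_prob_space "distr M S U" "distr M T V" ..
  have gm: "g \<in> borel_measurable (distr M S U \<Otimes>\<^sub>M distr M T V)" using g by (simp cong: measurable_cong_sets)
  have int: "integrable (distr M S U \<Otimes>\<^sub>M distr M T V) g" by (rule P.integrable_const_bound[where B=C]) (use gm bd in auto)
  have int': "integrable (distr M S U \<Otimes>\<^sub>M distr M T V) (case_prod (\<lambda>u v. g (u, v)))" using int by simp
  have "expectation (\<lambda>w. g (U w, V w)) = (\<integral>z. g z \<partial>(distr M S U \<Otimes>\<^sub>M distr M T V))"
    unfolding eq by (subst integral_distr) auto
  also have "\<dots> = (\<integral>v. (\<integral>u. g (u, v) \<partial>distr M S U) \<partial>distr M T V)" using P.integral_snd[OF int'] by simp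
  also have "\<dots> = expectation (\<lambda>w. \<integral>u. g (u, V w) \<partial>distr M S U)" by (subst integral_distr) measurable
  also have "\<dots> = expectation (\<lambda>w. expectation (\<lambda>w'. g (U w', V w)))"
  proof (rule lebesgue_cong[OF refl])
    fix w assume "w \<in> space M"
    then have "V w \<in> space T" by (rule measurable_space[rotated]) measurable
    then have "(\<lambda>u. g (u, V w)) \<in> borel_measurable S" by measurable
    then show "(\<integral>u. g (u, V w) \<partial>distr M S U) = expectation (\<lambda>w'. g (U w', V w))" by (subst integral_distr) auto
  qed
  finally show ?thesis .
qed

lemma (in prob_space) gaussian_linear_form_char:
  fixes \<xi> :: "nat \<Rightarrow> 'a \<Rightarrow> real" and t :: "nat \<Rightarrow> real"
  assumes indep: "indep_vars (\<lambda>_. borel) \<xi> {..<n}"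
    and law: "\<And>j. j < n \<Longrightarrow> distributed M lborel (\<xi> j) (\<lambda>x. ennreal (std_normal_density x))"
  shows "expectation (\<lambda>w. iexp (\<Sum>j<n. \<xi> j w * t j)) = exp (- (\<Sum>j<n. (t j)^2) / 2)"
proof -
  have m: "\<xi> j \<in> borel_measurable M" if "j < n" for j using indep that by (auto simp: indep_vars_def2)
  have ind: "indep_vars (\<lambda>_. borel) (\<lambda>j w. iexp (\<xi> j w * t j)) {..<n}" by (rule indep_vars_compose2[OF indep]) auto
  have int: "integrable M (\<lambda>w. iexp (\<xi> j w * t j))" if "j < n" for j by (rule integrable_const_bound[where B=1]) (use m[OF that] in auto)
  have one: "expectation (\<lambda>w. iexp (\<xi> j w * t j)) = exp (- (t j)\<^sup>2 / 2)" if "j < n" for j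
  proof -
    have d: "distr M lborel (\<xi> j) = std_gauss" using law[OF that] by (simp add: distributed_def)
    have "(\<integral>u. iexp (t j * u) \<partial>distr M lborel (\<xi> j)) = expectation (\<lambda>w. iexp (t j * \<xi> j w))"
      using m[OF that] by (subst integral_distr) auto
    then show ?thesis unfolding d char_std_gauss by (simp add: mult.commute)
  qed
  have "expectation (\<lambda>w. iexp (\<Sum>j<n. \<xi> j w * t j)) = expectation (\<lambda>w. \<Prod>j<n. iexp (\<xi> j w * t j))"
  proof (rule lebesgue_cong[OF refl])
    fix w
    have "\<i> * complex_of_real (\<Sum>j<n. \<xi> j w * t j) = (\<Sum>j<n. \<i> * complex_of_real (\<xi> j w * t j))" by (simp add: sum_distrib_left)
    then show "iexp (\<Sum>j<n. \<xi> j w * t j) = (\<Prod>j<n. iexp (\<xi> j w * t j))" by (simp only: exp_sum[OF finite_lessThan])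
  qed
  also have "\<dots> = (\<Prod>j<n. expectation (\<lambda>w. iexp (\<xi> j w * t j)))" by (rule indep_vars_lebesgue_integral) (use ind int in auto)
  also have "\<dots> = (\<Prod>j<n. complex_of_real (exp (- (t j)\<^sup>2 / 2)))" by (rule prod.cong[OF refl]) (use one in auto)
  also have "\<dots> = exp (- (\<Sum>j<n. (t j)^2) / 2)"
  proof -
    have "(\<Sum>j<n. - (t j)\<^sup>2 / 2) = - (\<Sum>j<n. (t j)^2) / 2" by (simp add: sum_negf sum_divide_distrib[symmetric])
    then show ?thesis using exp_sum[OF finite_lessThan, of "\<lambda>j. - (t j)\<^sup>2 / 2" n] by (simp only: of_real_prod[symmetric])
  qed
  finally show ?thesis .
qed

section \<open>The deconvolution weight near the edge of the spectrum\<close>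
lemma powr_le_exp:
  fixes p c :: real
  assumes p: "0 \<le> p" and c: "0 < c"
  shows "\<exists>C>0. \<forall>u\<ge>0. (1 + u) powr p \<le> C * exp (c * u)"
proof -
  define L where "L = p / c + 1"
  have L: "0 < L" using p c by (simp add: L_def add_nonneg_pos)
  have pc: "p / L \<le> c" using p c by (simp add: L_def divide_le_eq add_nonneg_pos field_simps)
  have "(1 + u) powr p \<le> exp (c + p * ln L) * exp (c * u)" if u: "0 \<le> u" for u
  proof -
    have "ln (1 + u) = ln ((1 + u) / L) + ln L" using u L by (simp add: ln_div)
    also have "ln ((1 + u) / L) \<le> (1 + u) / L" using u L by (intro order_trans[OF ln_le_minus_one]) auto
    finally have "p * ln (1 + u) \<le> p * ((1 + u) / L + ln L)" using p by (intro mult_left_mono) auto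
    also have "\<dots> = (p / L) * (1 + u) + p * ln L" by (simp add: algebra_simps)
    also have "\<dots> \<le> c * (1 + u) + p * ln L" using pc u by (intro add_right_mono mult_right_mono) auto
    finally have "exp (p * ln (1 + u)) \<le> exp ((c + p * ln L) + c * u)" by (simp add: algebra_simps)
    then show ?thesis using u by (simp add: powr_def exp_add)
  qed
  then show ?thesis by (intro exI[of _ "exp (c + p * ln L)"]) auto
qed

lemma integrable_exp_halfline:
  assumes "0 < c"
  shows "integrable lborel (\<lambda>u::real. indicator {0..} u * exp (- c * u))"
    and "integrable lborel (\<lambda>u::real. indicator {0..} u * (u * exp (- c * u)))"
proof -
  have *: "integrable lborel (\<lambda>u::real. indicator {0..} u * (u ^ k * exp (- c * u)))" for k
  proof -
    have "(\<integral>\<^sup>+u. ennreal (u ^ k * exp (- u)) * indicator {0..} u \<partial>lborel) = real (fact k)"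
      by (rule nn_intergal_power_times_exp_Ici)
    then have "integrable lborel (\<lambda>u::real. indicator {0..} u * (u ^ k * exp (- u)))"
    proof (intro integrableI_nonneg)
      assume fin: "(\<integral>\<^sup>+u. ennreal (u ^ k * exp (- u)) * indicator {0..} u \<partial>lborel) = real (fact k)"
      have "(\<integral>\<^sup>+u. ennreal (indicator {0..} u * (u ^ k * exp (- u))) \<partial>lborel)
          = (\<integral>\<^sup>+u. ennreal (u ^ k * exp (- u)) * indicator {0..} u \<partial>lborel)"
        by (intro nn_integral_cong) (auto simp: indicator_def)
      then show "(\<integral>\<^sup>+u. ennreal (indicator {0..} u * (u ^ k * exp (- u))) \<partial>lborel) < \<infinity>" by (simp add: fin)
    qed (auto simp: indicator_def)
    from lborel_integrable_real_affine[OF this, of c 0] assms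
    have "integrable lborel (\<lambda>u::real. indicator {0..} (c * u) * ((c * u) ^ k * exp (- (c * u))))" by simp
    then have "integrable lborel (\<lambda>u::real. (1 / c ^ k) * (indicator {0..} (c * u) * ((c * u) ^ k * exp (- (c * u)))))"
      by (rule integrable_mult_right)
    moreover have "(1 / c ^ k) * (indicator {0..} (c * u) * ((c * u) ^ k * exp (- (c * u)))) = indicator {0..} u * (u ^ k * exp (- c * u))" for u
      using assms by (auto simp: indicator_def power_mult_distrib zero_le_mult_iff)
    ultimately show ?thesis by simp
  qed
  show "integrable lborel (\<lambda>u::real. indicator {0..} u * exp (- c * u))" using *[of 0] by simp
  show "integrable lborel (\<lambda>u::real. indicator {0..} u * (u * exp (- c * u)))" using *[of 1] by simp
qed

lemma fourier_bound: 
  shows "cmod (fourier K t) \<le> (\<integral>x. \<bar>K x\<bar> \<partial>lborel)"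
proof -
  have "cmod (fourier K t) \<le> (\<integral>x. cmod (iexp (t * x) * complex_of_real (K x)) \<partial>lborel)"
    unfolding fourier_def by (rule integral_norm_bound)
  also have "\<dots> = (\<integral>x. \<bar>K x\<bar> \<partial>lborel)" by (simp add: norm_mult)
  finally show ?thesis .
qed

lemma fourier_measurable [measurable]:
  assumes [measurable]: "K \<in> borel_measurable borel"
  shows "fourier K \<in> borel_measurable borel"
  unfolding fourier_def by measurable

text \<open>The inverse of \<open>\<phi> (t / h)\<close> grows like \<open>exp (\<nu> * (t / h) powr \<gamma>)\<close> up to \<open>t = 1\<close>. In the variable
  \<open>u = (1 - t) / h powr \<gamma>\<close> this is \<open>exp (\<nu> * h powr (- \<gamma>)) * exp (- \<nu> * \<gamma> * u)\<close> to leading order, and the kernel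
  contributes \<open>u powr lam\<close>. Laplace's method then gives the total mass \<open>edge_const * edge_scale h\<close> of the weight
  and shows that this mass sits at distance \<open>h powr \<gamma>\<close> from \<open>1\<close>.\<close>

locale supersmooth_edge =
  fixes K :: "real \<Rightarrow> real" and \<phi> :: "real \<Rightarrow> complex"
    and C2 lam C3 \<gamma> \<gamma>0 \<nu> :: real
  assumes K_int: "integrable lborel K"
    and supp: "closure {t. fourier K t \<noteq> 0} = {-1..1}"
    and C2: "0 < C2" and lam: "0 \<le> lam"
    and edge: "(\<lambda>t. fourier K (1 - t) - complex_of_real (C2 * t powr lam))
           \<in> o[at_right 0](\<lambda>t. complex_of_real (t powr lam))"
    and \<phi>_cont: "continuous_on UNIV \<phi>"
    and \<phi>_cnj: "\<And>t. \<phi> (- t) = cnj (\<phi> t)"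
    and \<phi>_nz: "\<And>t. \<phi> t \<noteq> 0"
    and C3: "0 < C3" and gam: "1 < \<gamma>" and nu: "0 < \<nu>"
    and tail: "\<phi> \<sim>[at_infinity]
           (\<lambda>t. complex_of_real (C3 * \<bar>t\<bar> powr \<gamma>0 * exp (- \<nu> * \<bar>t\<bar> powr \<gamma>)))"
begin

definition weight :: "real \<Rightarrow> real \<Rightarrow> complex" where
  "weight h t = indicator {0..1} t * (fourier K t / \<phi> (t / h))"

definition edge_scale :: "real \<Rightarrow> real" where
  "edge_scale h = h powr (\<gamma> * (1 + lam) + \<gamma>0) * exp (\<nu> * h powr (- \<gamma>))"

definition edge_const :: real where
  "edge_const = C2 / C3 * (\<integral>u. indicator {0..} u * (u powr lam * exp (- (\<nu> * \<gamma>) * u)) \<partial>lborel)"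

text \<open>The order of the inverse of \<open>\<phi>\<close> at the end \<open>1 / h\<close> of the frequency window.\<close>

abbreviation inv_growth :: "real \<Rightarrow> real" where
  "inv_growth h \<equiv> h powr \<gamma>0 * exp (\<nu> * h powr (- \<gamma>))"

lemma K_meas [measurable]: "K \<in> borel_measurable borel"
  using K_int by auto

lemma \<phi>_meas [measurable]: "\<phi> \<in> borel_measurable borel"
  by (rule borel_measurable_continuous_onI[OF \<phi>_cont])

lemma weight_meas [measurable]: "weight h \<in> borel_measurable borel"
  unfolding weight_def by measurable

lemma edge_scale_pos: "0 < h \<Longrightarrow> 0 < edge_scale h"
  by (simp add: edge_scale_def)

lemma \<phi>_ratio: "((\<lambda>t. \<phi> t / complex_of_real (C3 * \<bar>t\<bar> powr \<gamma>0 * exp (- \<nu> * \<bar>t\<bar> powr \<gamma>))) \<longlongrightarrow> 1) at_infinity"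
  using asymp_equivD[OF tail] by (rule Lim_transform_eventually)
    (auto simp: \<phi>_nz intro!: always_eventually)

lemma fourier_ratio: "((\<lambda>s. fourier K (1 - s) / complex_of_real (s powr lam)) \<longlongrightarrow> C2) (at_right 0)"
proof -
  have "((\<lambda>t. (fourier K (1 - t) - complex_of_real (C2 * t powr lam)) / complex_of_real (t powr lam)) \<longlongrightarrow> 0) (at_right 0)"
    using edge by (rule smalloD_tendsto)
  then have "((\<lambda>t. (fourier K (1 - t) - complex_of_real (C2 * t powr lam)) / complex_of_real (t powr lam) + C2) \<longlongrightarrow> 0 + complex_of_real C2) (at_right 0)"
    by (intro tendsto_add tendsto_const)
  moreover have "eventually (\<lambda>t. (fourier K (1 - t) - complex_of_real (C2 * t powr lam)) / complex_of_real (t powr lam) + C2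
      = fourier K (1 - t) / complex_of_real (t powr lam)) (at_right 0)"
    using eventually_at_right_less[of "0::real"] by eventually_elim (auto simp: field_simps)
  ultimately show ?thesis by (simp add: Lim_transform_eventually)
qed

lemma fourier_edge_bound: "\<exists>C>0. \<forall>s. 0 < s \<and> s \<le> 1 \<longrightarrow> cmod (fourier K (1 - s)) \<le> C * s powr lam"
proof -
  have "eventually (\<lambda>s. dist (fourier K (1 - s) / complex_of_real (s powr lam)) C2 < 1) (at_right 0)"
    using fourier_ratio by (rule tendstoD) simp
  then obtain d where d: "0 < d" and near: "\<And>s. 0 < s \<Longrightarrow> s < d \<Longrightarrow> dist (fourier K (1 - s) / complex_of_real (s powr lam)) C2 < 1"
    by (auto simp: eventually_at_right_field)
  define B where "B = (\<integral>x. \<bar>K x\<bar> \<partial>lborel)"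
  have B: "0 \<le> B" by (simp add: B_def)
  define C where "C = C2 + 1 + B / d powr lam"
  have "cmod (fourier K (1 - s)) \<le> C * s powr lam" if s: "0 < s" "s \<le> 1" for s
  proof (cases "s < d")
    case True
    have "cmod (fourier K (1 - s) / complex_of_real (s powr lam)) \<le> C2 + 1"
      using near[OF s(1) True] C2 norm_triangle_sub[of "fourier K (1 - s) / complex_of_real (s powr lam)" C2] by (simp add: dist_norm)
    then have "cmod (fourier K (1 - s)) \<le> (C2 + 1) * s powr lam" using s by (simp add: norm_divide divide_le_eq)
    also have "\<dots> \<le> C * s powr lam" using B by (intro mult_right_mono) (auto simp: C_def)
    finally show ?thesis .
  next
    case False
    have "B = B / d powr lam * d powr lam" using d by simp
    also have "\<dots> \<le> B / d powr lam * s powr lam" using False d lam B by (intro mult_left_mono powr_mono2) auto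
    also have "\<dots> \<le> C * s powr lam" using C2 by (intro mult_right_mono) (auto simp: C_def)
    finally show ?thesis using fourier_bound[of K "1 - s"] unfolding B_def by linarith
  qed
  moreover have "0 < C" using C2 B by (simp add: C_def add_pos_nonneg)
  ultimately show ?thesis by blast
qed

lemma inverse_char_bound:
  "\<exists>C>0. \<forall>t. 1 / cmod (\<phi> t) \<le> C * (1 + \<bar>t\<bar>) powr (- \<gamma>0) * exp (\<nu> * \<bar>t\<bar> powr \<gamma>)"
proof -
  let ?g = "\<lambda>t. (1 + \<bar>t\<bar>) powr (- \<gamma>0) * exp (\<nu> * \<bar>t\<bar> powr \<gamma>)"
  have "eventually (\<lambda>t. dist (\<phi> t / complex_of_real (C3 * \<bar>t\<bar> powr \<gamma>0 * exp (- \<nu> * \<bar>t\<bar> powr \<gamma>))) 1 < 1/2) at_infinity"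
    using \<phi>_ratio by (rule tendstoD) simp
  then obtain T0 where T0: "\<And>t. T0 \<le> \<bar>t\<bar> \<Longrightarrow> dist (\<phi> t / complex_of_real (C3 * \<bar>t\<bar> powr \<gamma>0 * exp (- \<nu> * \<bar>t\<bar> powr \<gamma>))) 1 < 1/2"
    by (auto simp: eventually_at_infinity)
  define T where "T = max T0 1"
  define D where "D = 2 / C3 * 2 powr \<bar>\<gamma>0\<bar>"
  have D: "0 < D" using C3 by (simp add: D_def)
  have far: "1 / cmod (\<phi> t) \<le> D * ?g t" if t: "T \<le> \<bar>t\<bar>" for t
  proof -
    let ?a = "C3 * \<bar>t\<bar> powr \<gamma>0 * exp (- \<nu> * \<bar>t\<bar> powr \<gamma>)"
    have t1: "1 \<le> \<bar>t\<bar>" "T0 \<le> \<bar>t\<bar>" using t by (auto simp: T_def)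
    have a: "0 < ?a" using C3 t1 by auto
    have "1 - 1/2 \<le> cmod (\<phi> t / complex_of_real ?a)" using T0[OF t1(2)] norm_triangle_ineq2[of 1 "\<phi> t / complex_of_real ?a"]
      by (simp add: dist_norm norm_minus_commute)
    also have "cmod (\<phi> t / complex_of_real ?a) = cmod (\<phi> t) / ?a" using a by (simp only: norm_divide norm_of_real abs_of_pos)
    finally have "?a / 2 \<le> cmod (\<phi> t)" using a by (simp add: le_divide_eq)
    then have "1 / cmod (\<phi> t) \<le> 1 / (?a / 2)" using a by (intro divide_left_mono) (auto simp: \<phi>_nz)
    also have "\<dots> = 2 / C3 * \<bar>t\<bar> powr (- \<gamma>0) * exp (\<nu> * \<bar>t\<bar> powr \<gamma>)"
      by (simp add: powr_minus exp_minus field_simps)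
    also have "\<dots> \<le> 2 / C3 * (2 powr \<bar>\<gamma>0\<bar> * (1 + \<bar>t\<bar>) powr (- \<gamma>0)) * exp (\<nu> * \<bar>t\<bar> powr \<gamma>)"
    proof (intro mult_right_mono mult_left_mono)
      show "\<bar>t\<bar> powr (- \<gamma>0) \<le> 2 powr \<bar>\<gamma>0\<bar> * (1 + \<bar>t\<bar>) powr (- \<gamma>0)"
      proof (cases "0 \<le> \<gamma>0")
        case True
        have "\<bar>t\<bar> powr (- \<gamma>0) = (2 powr \<gamma>0) * (2 * \<bar>t\<bar>) powr (- \<gamma>0)"
          using t1 by (simp add: powr_mult powr_minus)
        also have "\<dots> \<le> 2 powr \<gamma>0 * (1 + \<bar>t\<bar>) powr (- \<gamma>0)" using t1 True by (intro mult_left_mono powr_mono2') auto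
        finally show ?thesis using True by simp
      next
        case False
        have "\<bar>t\<bar> powr (- \<gamma>0) \<le> 1 * (1 + \<bar>t\<bar>) powr (- \<gamma>0)" using False by (simp add: powr_mono2)
        also have "\<dots> \<le> 2 powr \<bar>\<gamma>0\<bar> * (1 + \<bar>t\<bar>) powr (- \<gamma>0)"
          by (intro mult_right_mono ge_one_powr_ge_zero) auto
        finally show ?thesis .
      qed
    qed (use C3 in auto)
    finally show ?thesis by (simp add: D_def mult.assoc)
  qed
  have "continuous_on {-T..T} (\<lambda>t. 1 / cmod (\<phi> t) / ?g t)"
  proof -
    have "continuous_on {-T..T} \<phi>" using \<phi>_cont by (rule continuous_on_subset) auto
    moreover have "continuous_on {-T..T} (\<lambda>t. \<bar>t\<bar> powr \<gamma>)"
      by (rule continuous_on_powr') (use gam in \<open>auto intro!: continuous_intros\<close>)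
    moreover have "continuous_on {-T..T} (\<lambda>t. (1 + \<bar>t\<bar>) powr (- \<gamma>0))" by (intro continuous_intros) auto
    ultimately show ?thesis by (intro continuous_on_divide continuous_on_mult continuous_on_exp continuous_on_const continuous_on_norm)
        (auto simp: \<phi>_nz)
  qed
  then have "bounded ((\<lambda>t. 1 / cmod (\<phi> t) / ?g t) ` {-T..T})" by (intro compact_imp_bounded compact_continuous_image) auto
  then obtain E where "\<forall>y\<in>(\<lambda>t. 1 / cmod (\<phi> t) / ?g t) ` {-T..T}. norm y \<le> E" unfolding bounded_iff by blast
  then have E: "\<bar>1 / cmod (\<phi> t) / ?g t\<bar> \<le> E" if "t \<in> {-T..T}" for t using that unfolding real_norm_def by blast
  have g: "0 < ?g t" for t by (simp add: add_pos_nonneg)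
  have near: "1 / cmod (\<phi> t) \<le> \<bar>E\<bar> * ?g t" if "\<bar>t\<bar> \<le> T" for t
  proof -
    have "1 / cmod (\<phi> t) / ?g t \<le> \<bar>E\<bar>" using E[of t] that by (auto simp: abs_le_iff)
    then show ?thesis by (simp only: pos_divide_le_eq[OF g])
  qed
  have "1 / cmod (\<phi> t) \<le> (D + \<bar>E\<bar>) * ?g t" for t
    using far[of t] near[of t] g[of t] D by (cases "\<bar>t\<bar> \<le> T") (auto simp: distrib_right add_increasing add_increasing2)
  then show ?thesis using D by (intro exI[of _ "D + \<bar>E\<bar>"]) (auto simp: mult.assoc)
qed

text \<open>On \<open>{0..1}\<close> one has \<open>t powr \<gamma> \<le> t\<close>, which turns the growth of the inverse into exponential decay away from
  \<open>t = 1\<close>; half of the rate \<open>\<nu>\<close> pays for the polynomial factor.\<close>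

lemma inverse_char_scaled_bound:
  "\<exists>C>0. \<forall>h t. 0 < h \<longrightarrow> h \<le> 1 \<longrightarrow> 0 \<le> t \<longrightarrow> t \<le> 1 \<longrightarrow>
     1 / cmod (\<phi> (t / h)) \<le> C * inv_growth h * exp (- (\<nu> / 2) * ((1 - t) / h powr \<gamma>))"
proof -
  obtain C where C: "0 < C" "\<And>t. 1 / cmod (\<phi> t) \<le> C * (1 + \<bar>t\<bar>) powr (- \<gamma>0) * exp (\<nu> * \<bar>t\<bar> powr \<gamma>)"
    using inverse_char_bound by blast
  obtain E where E: "0 < E" "\<And>u. 0 \<le> u \<Longrightarrow> (1 + u) powr \<bar>\<gamma>0\<bar> \<le> E * exp (\<nu> / 2 * u)"
    using powr_le_exp[of "\<bar>\<gamma>0\<bar>" "\<nu> / 2"] nu by auto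
  have "1 / cmod (\<phi> (t / h)) \<le> (C * (2 powr \<bar>\<gamma>0\<bar> * E)) * inv_growth h * exp (- (\<nu> / 2) * ((1 - t) / h powr \<gamma>))"
    if h: "0 < h" "h \<le> 1" and t: "0 \<le> t" "t \<le> 1" for h t
  proof -
    define u where "u = (1 - t) / h powr \<gamma>"
    have u: "0 \<le> u" using t by (simp add: u_def)
    have hg: "h powr \<gamma> \<le> h" using powr_mono'[of 1 \<gamma> h] h gam by simp
    have su: "(1 - t) / h \<le> u" unfolding u_def using h t hg by (intro divide_left_mono) auto
    have e1: "\<nu> * \<bar>t / h\<bar> powr \<gamma> \<le> \<nu> * h powr (- \<gamma>) - \<nu> * u"
    proof -
      have "t powr \<gamma> \<le> t" using powr_mono'[of 1 \<gamma> t] t gam by (cases "t = 0") auto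
      then have "(t / h) powr \<gamma> \<le> t / h powr \<gamma>" using h t by (simp add: powr_divide divide_right_mono)
      also have "\<dots> = h powr (- \<gamma>) - u" by (simp add: u_def powr_minus divide_inverse algebra_simps)
      finally show ?thesis using nu t h mult_left_mono[of "(t / h) powr \<gamma>" "h powr (- \<gamma>) - u" \<nu>] by (simp add: right_diff_distrib)
    qed
    have e2: "(1 + \<bar>t / h\<bar>) powr (- \<gamma>0) \<le> (2 powr \<bar>\<gamma>0\<bar> * h powr \<gamma>0) * (1 + u) powr \<bar>\<gamma>0\<bar>"
    proof (cases "0 \<le> \<gamma>0")
      case True
      have "(1 + t / h) * (1 + (1 - t) / h) = 1 / h + (1 + (t / h) * ((1 - t) / h))" by (simp add: algebra_simps diff_divide_distrib)
      moreover have "0 \<le> (t / h) * ((1 - t) / h)" using h t by simp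
      ultimately have "1 / h \<le> (1 + t / h) * (1 + (1 - t) / h)" by linarith
      also have "\<dots> \<le> (1 + t / h) * (1 + u)" using su h t by (intro mult_left_mono) auto
      finally have "((1 + t / h) * (1 + u)) powr (- \<gamma>0) \<le> (1 / h) powr (- \<gamma>0)" using True h by (intro powr_mono2') auto
      then have "(1 + t / h) powr (- \<gamma>0) * (1 + u) powr (- \<gamma>0) \<le> h powr \<gamma>0"
        using h t u by (simp add: powr_mult powr_divide powr_minus)
      then have "(1 + t / h) powr (- \<gamma>0) * (1 + u) powr (- \<gamma>0) * (1 + u) powr \<gamma>0 \<le> h powr \<gamma>0 * (1 + u) powr \<gamma>0"
        by (rule mult_right_mono) auto
      then have "(1 + t / h) powr (- \<gamma>0) \<le> 1 * h powr \<gamma>0 * (1 + u) powr \<gamma>0"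
        using u by (simp add: powr_add[symmetric] mult.assoc)
      also have "\<dots> \<le> 2 powr \<bar>\<gamma>0\<bar> * h powr \<gamma>0 * (1 + u) powr \<gamma>0"
        by (intro mult_right_mono ge_one_powr_ge_zero) auto
      finally show ?thesis using True h t by simp
    next
      case False
      have "1 + t / h = (h + t) / h" using h by (simp add: add_divide_distrib)
      also have "\<dots> \<le> 2 / h" using h t by (intro divide_right_mono) auto
      finally have "1 + t / h \<le> 2 / h" .
      then have "(1 + t / h) powr (- \<gamma>0) \<le> (2 / h) powr (- \<gamma>0)" using False h t by (intro powr_mono2) auto
      also have "\<dots> = 2 powr \<bar>\<gamma>0\<bar> * h powr \<gamma>0" using h False by (simp add: powr_divide powr_minus field_simps)
      also have "\<dots> = 2 powr \<bar>\<gamma>0\<bar> * h powr \<gamma>0 * 1" by simp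
      also have "\<dots> \<le> 2 powr \<bar>\<gamma>0\<bar> * h powr \<gamma>0 * (1 + u) powr \<bar>\<gamma>0\<bar>"
        using u by (intro mult_left_mono ge_one_powr_ge_zero) auto
      finally show ?thesis using h t by simp
    qed
    have "1 / cmod (\<phi> (t / h)) \<le> C * (1 + \<bar>t / h\<bar>) powr (- \<gamma>0) * exp (\<nu> * \<bar>t / h\<bar> powr \<gamma>)"
      by (rule C(2))
    also have "\<dots> \<le> C * ((2 powr \<bar>\<gamma>0\<bar> * h powr \<gamma>0) * (1 + u) powr \<bar>\<gamma>0\<bar>) * exp (\<nu> * h powr (- \<gamma>) - \<nu> * u)"
      using e1 e2 C(1) by (intro mult_mono mult_left_mono) auto
    also have "\<dots> \<le> C * ((2 powr \<bar>\<gamma>0\<bar> * h powr \<gamma>0) * (E * exp (\<nu> / 2 * u))) * exp (\<nu> * h powr (- \<gamma>) - \<nu> * u)"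
      using E(2)[OF u] C(1) by (intro mult_right_mono mult_left_mono) auto
    also have "\<dots> = (C * (2 powr \<bar>\<gamma>0\<bar> * E)) * inv_growth h * exp (- (\<nu> / 2) * u)"
    proof -
      have "exp (\<nu> / 2 * u) * exp (\<nu> * h powr (- \<gamma>) - \<nu> * u) = exp (\<nu> * h powr (- \<gamma>)) * exp (- (\<nu> / 2) * u)"
        unfolding mult_exp_exp by (simp add: algebra_simps)
      then show ?thesis by (simp add: mult.assoc mult.left_commute[of _ "exp (\<nu> * h powr (- \<gamma>) - \<nu> * u)"])
    qed
    finally show ?thesis by (simp add: u_def)
  qed
  then show ?thesis using C(1) E(1) by (intro exI[of _ "C * (2 powr \<bar>\<gamma>0\<bar> * E)"]) auto
qed

text \<open>The integrable majorant for dominated convergence, in the variable \<open>u = (1 - t) / h powr \<gamma>\<close>. Another half of the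
  remaining rate absorbs \<open>u powr lam\<close>. At \<open>u = 0\<close> the value depends on \<open>fourier K 1\<close>, which is irrelevant for
  integrals.\<close>

lemma weight_bound:
  "\<exists>C>0. \<forall>h u. 0 < h \<longrightarrow> h \<le> 1 \<longrightarrow> u \<noteq> 0 \<longrightarrow>
     h powr \<gamma> * cmod (weight h (1 - h powr \<gamma> * u)) \<le> C * edge_scale h * (indicator {0..} u * exp (- (\<nu> / 4) * u))"
proof -
  obtain A where A: "0 < A" "\<And>s. 0 < s \<Longrightarrow> s \<le> 1 \<Longrightarrow> cmod (fourier K (1 - s)) \<le> A * s powr lam"
    using fourier_edge_bound by blast
  obtain B where B: "0 < B" "\<And>h t. 0 < h \<Longrightarrow> h \<le> 1 \<Longrightarrow> 0 \<le> t \<Longrightarrow> t \<le> 1 \<Longrightarrow>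
     1 / cmod (\<phi> (t / h)) \<le> B * inv_growth h * exp (- (\<nu> / 2) * ((1 - t) / h powr \<gamma>))" using inverse_char_scaled_bound by blast
  obtain E where E: "0 < E" "\<And>u. 0 \<le> u \<Longrightarrow> (1 + u) powr lam \<le> E * exp (\<nu> / 4 * u)"
    using powr_le_exp[of lam "\<nu> / 4"] nu lam by auto
  have "h powr \<gamma> * cmod (weight h (1 - h powr \<gamma> * u)) \<le> (A * B * E) * edge_scale h * (indicator {0..} u * exp (- (\<nu> / 4) * u))"
    if h: "0 < h" "h \<le> 1" and u: "u \<noteq> 0" for h u
  proof (cases "0 < u \<and> h powr \<gamma> * u \<le> 1")
    case False
    then have "1 - h powr \<gamma> * u \<notin> {0..1}" using h u by (auto simp: mult_le_0_iff zero_le_mult_iff not_less)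
    then show ?thesis using A(1) B(1) E(1) edge_scale_pos[OF h(1)] by (simp add: weight_def)
  next
    case True
    let ?s = "h powr \<gamma> * u"
    have s: "0 < ?s" "?s \<le> 1" using h True by auto
    have "cmod (weight h (1 - ?s)) = cmod (fourier K (1 - ?s)) * (1 / cmod (\<phi> ((1 - ?s) / h)))" using s by (simp add: weight_def norm_divide)
    also have "\<dots> \<le> (A * ?s powr lam) * (B * inv_growth h * exp (- (\<nu> / 2) * ((1 - (1 - ?s)) / h powr \<gamma>)))"
      using A(1) B(1) s h by (intro mult_mono A(2) B(2)) auto
    also have "(1 - (1 - ?s)) / h powr \<gamma> = u" using h by simp
    also have "?s powr lam = h powr (\<gamma> * lam) * u powr lam" using h True by (simp add: powr_mult powr_powr)
    finally have "h powr \<gamma> * cmod (weight h (1 - ?s)) \<le> h powr \<gamma> * ((A * (h powr (\<gamma> * lam) * u powr lam)) * (B * inv_growth h * exp (- (\<nu> / 2) * u)))"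
      by (intro mult_left_mono) auto
    also have "\<dots> = A * B * edge_scale h * (u powr lam * exp (- (\<nu> / 2) * u))" by (simp add: edge_scale_def powr_add distrib_left)
    also have "\<dots> \<le> A * B * edge_scale h * (E * exp (\<nu> / 4 * u) * exp (- (\<nu> / 2) * u))"
    proof (intro mult_left_mono mult_right_mono)
      have "u powr lam \<le> (1 + u) powr lam" using True lam by (intro powr_mono2) auto
      then show "u powr lam \<le> E * exp (\<nu> / 4 * u)" using E(2)[of u] True by linarith
    qed (use A B edge_scale_pos[OF h(1)] in auto)
    also have "\<dots> = A * B * edge_scale h * (E * exp (- (\<nu> / 4) * u))" unfolding mult.assoc mult_exp_exp by (simp add: field_simps)
    finally show ?thesis using True by (simp add: mult_ac)
  qed
  then show ?thesis using A(1) B(1) E(1) by (intro exI[of _ "A * B * E"]) auto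
qed

lemma weight_integrals_bound:
  "\<exists>C>0. \<forall>h. 0 < h \<longrightarrow> h \<le> 1 \<longrightarrow>
     integrable lborel (weight h) \<and> integrable lborel (\<lambda>t. cmod (weight h t) * (1 - t)) \<and>
     (\<integral>t. cmod (weight h t) \<partial>lborel) \<le> C * edge_scale h \<and>
     (\<integral>t. cmod (weight h t) * (1 - t) \<partial>lborel) \<le> C * edge_scale h * h powr \<gamma>"
proof -
  obtain C where C: "0 < C" "\<And>h u. 0 < h \<Longrightarrow> h \<le> 1 \<Longrightarrow> u \<noteq> 0 \<Longrightarrow>
     h powr \<gamma> * cmod (weight h (1 - h powr \<gamma> * u)) \<le> C * edge_scale h * (indicator {0..} u * exp (- (\<nu> / 4) * u))"
    using weight_bound by blast
  define I0 where "I0 = (\<integral>u. indicator {0..} u * exp (- (\<nu> / 4) * u) \<partial>lborel)"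
  define I1 where "I1 = (\<integral>u. indicator {0..} u * (u * exp (- (\<nu> / 4) * u)) \<partial>lborel)"
  have I: "0 \<le> I0" "0 \<le> I1" by (auto simp: I0_def I1_def indicator_def intro!: lebesgue_nonneg)
  note ie = integrable_exp_halfline[of "\<nu> / 4"]
  have main: "integrable lborel (\<lambda>t. cmod (weight h t) * (1 - t) ^ k) \<and>
     (\<integral>t. cmod (weight h t) * (1 - t) ^ k \<partial>lborel)
       \<le> C * edge_scale h * h powr (\<gamma> * k) * (\<integral>u. indicator {0..} u * (u ^ k * exp (- (\<nu> / 4) * u)) \<partial>lborel)"
    if h: "0 < h" "h \<le> 1" and k: "integrable lborel (\<lambda>u. indicator {0..} u * (u ^ k * exp (- (\<nu> / 4) * u)))"
    for h and k :: nat
  proof -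
    let ?H = "h powr \<gamma>"
    have H: "?H \<noteq> 0" "0 < ?H" using h by auto
    let ?f = "\<lambda>t. cmod (weight h t) * (1 - t) ^ k"
    let ?b = "\<lambda>u. C * edge_scale h * ?H ^ k * (indicator {0..} u * (u ^ k * exp (- (\<nu> / 4) * u)))"
    have bd: "?H * norm (?f (1 + (- ?H) * u)) \<le> ?b u" if "u \<noteq> 0" for u
    proof (cases "0 < u")
      case True
      have "?H * norm (?f (1 + (- ?H) * u)) = (?H * cmod (weight h (1 - ?H * u))) * (?H * u) ^ k" using True H by (simp add: abs_mult power_abs)
      also have "\<dots> \<le> (C * edge_scale h * (indicator {0..} u * exp (- (\<nu> / 4) * u))) * (?H * u) ^ k"
        using True H by (intro mult_right_mono C(2) h that) auto
      also have "\<dots> = ?b u" by (simp add: power_mult_distrib mult_ac)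
      finally show ?thesis .
    next
      case False
      then have "1 - ?H * u \<notin> {0..1}" using H that by (auto simp: zero_le_mult_iff mult_le_0_iff)
      then show ?thesis using False that C(1) by (auto simp: weight_def indicator_def)
    qed
    have int_b: "integrable lborel ?b" using k by (intro integrable_mult_right) auto
    have bdAE: "AE u in lborel. norm (?H * norm (?f (1 + (- ?H) * u))) \<le> norm (?b u)" using AE_lborel_singleton[of "0::real"]
    proof eventually_elim
      case (elim u)
      have "norm (?H * norm (?f (1 + (- ?H) * u))) = ?H * norm (?f (1 + (- ?H) * u))" using H(2) by (simp add: abs_mult)
      then show ?case using bd[OF elim] abs_ge_self[of "?b u"] unfolding real_norm_def by linarith
    qed
    have int_s: "integrable lborel (\<lambda>u. ?H * norm (?f (1 + (- ?H) * u)))" by (rule L1_bound[OF int_b _ bdAE]) measurable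
    have "integrable lborel (\<lambda>u. norm (?f (1 + (- ?H) * u)))"
      using integrable_mult_right[OF int_s, of "1 / ?H"] H by (auto simp: mult.assoc[symmetric])
    then have "integrable lborel (\<lambda>u. ?f (1 + (- ?H) * u))" by (rule integrable_norm_cancel) measurable
    then have int_f: "integrable lborel ?f" using lborel_integrable_real_affine_iff[of "- ?H" ?f 1] H by simp
    have "(\<integral>t. ?f t \<partial>lborel) \<le> (\<integral>t. norm (?f t) \<partial>lborel)"
      by (intro integral_mono int_f integrable_norm) auto
    also have "\<dots> = ?H * (\<integral>u. norm (?f (1 + (- ?H) * u)) \<partial>lborel)"
      using lborel_integral_real_affine[of "- ?H" "\<lambda>t. norm (?f t)" 1] H by simp
    also have "\<dots> = (\<integral>u. ?H * norm (?f (1 + (- ?H) * u)) \<partial>lborel)" by simp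
    also have "\<dots> \<le> (\<integral>u. ?b u \<partial>lborel)"
    proof (rule integral_mono_AE[OF int_s int_b])
      show "AE u in lborel. ?H * norm (?f (1 + (- ?H) * u)) \<le> ?b u" using AE_lborel_singleton[of "0::real"] by eventually_elim (rule bd)
    qed
    also have "\<dots> = C * edge_scale h * h powr (\<gamma> * k) * (\<integral>u. indicator {0..} u * (u ^ k * exp (- (\<nu> / 4) * u)) \<partial>lborel)"
      using h by (simp add: powr_powr[symmetric] powr_realpow)
    finally show ?thesis using int_f by simp
  qed
  have "integrable lborel (weight h) \<and> integrable lborel (\<lambda>t. cmod (weight h t) * (1 - t)) \<and>
     (\<integral>t. cmod (weight h t) \<partial>lborel) \<le> (C * (I0 + I1 + 1)) * edge_scale h \<and>
     (\<integral>t. cmod (weight h t) * (1 - t) \<partial>lborel) \<le> (C * (I0 + I1 + 1)) * edge_scale h * h powr \<gamma>"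
    if h: "0 < h" "h \<le> 1" for h
  proof -
    have s: "0 \<le> C * edge_scale h" "0 \<le> C * edge_scale h * h powr \<gamma>" using C(1) edge_scale_pos[OF h(1)] by auto
    have 0: "integrable lborel (\<lambda>t. cmod (weight h t))" "(\<integral>t. cmod (weight h t) \<partial>lborel) \<le> C * edge_scale h * I0"
      using main[OF h, of 0] ie(1) nu h by (auto simp: I0_def)
    have 1: "integrable lborel (\<lambda>t. cmod (weight h t) * (1 - t))"
      "(\<integral>t. cmod (weight h t) * (1 - t) \<partial>lborel) \<le> C * edge_scale h * h powr \<gamma> * I1"
      using main[OF h, of 1] ie(2) nu h by (auto simp: I1_def)
    have "integrable lborel (weight h)" using 0(1) by (rule integrable_norm_cancel) measurable
    moreover have "C * edge_scale h * I0 \<le> C * edge_scale h * (I0 + I1 + 1)" using s I by (intro mult_left_mono) auto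
    moreover have "C * edge_scale h * h powr \<gamma> * I1 \<le> C * edge_scale h * h powr \<gamma> * (I0 + I1 + 1)"
      using s I by (intro mult_left_mono) auto
    ultimately show ?thesis using 0 1 by (simp add: mult_ac)
  qed
  moreover have "0 < C * (I0 + I1 + 1)" using C(1) I by simp
  ultimately show ?thesis by blast
qed

lemma powr_quotient_limit: "((\<lambda>s::real. ((1 - s) powr \<gamma> - 1) / s) \<longlongrightarrow> - \<gamma>) (at_right 0)"
proof -
  have "((\<lambda>s. (1 - s) powr \<gamma>) has_real_derivative - \<gamma>) (at 0)" by (auto intro!: derivative_eq_intros)
  then have "((\<lambda>s. ((1 - s) powr \<gamma> - 1) / s) \<longlongrightarrow> - \<gamma>) (at 0)" by (simp add: has_field_derivative_iff)
  then show ?thesis by (rule filterlim_mono) (auto simp: at_within_le_at)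
qed

text \<open>Laplace's method: after the substitution \<open>t = 1 - h powr \<gamma> * u\<close> the integrand converges pointwise, and
  \<open>weight_bound\<close> dominates it.\<close>

lemma weight_limit:
  fixes h :: "nat \<Rightarrow> real"
  assumes h: "\<And>n. 0 < h n" "h \<longlonglongrightarrow> 0"
  shows "(\<lambda>n. (\<integral>t. weight (h n) t \<partial>lborel) / edge_scale (h n)) \<longlonglongrightarrow> edge_const"
    and "0 < edge_const"
proof -
  obtain C where C: "0 < C" "\<And>h u. 0 < h \<Longrightarrow> h \<le> 1 \<Longrightarrow> u \<noteq> 0 \<Longrightarrow>
     h powr \<gamma> * cmod (weight h (1 - h powr \<gamma> * u)) \<le> C * edge_scale h * (indicator {0..} u * exp (- (\<nu> / 4) * u))"
    using weight_bound by blast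
  define f where "f = (\<lambda>n u. complex_of_real (h n powr \<gamma> / edge_scale (h n)) * weight (h n) (1 - h n powr \<gamma> * u))"
  define g where "g = (\<lambda>u. complex_of_real (C2 / C3 * (indicator {0..} u * (u powr lam * exp (- (\<nu> * \<gamma>) * u)))))"
  have hg: "(\<lambda>n. h n powr \<gamma>) \<longlonglongrightarrow> 0"
    using tendsto_powr'[OF h(2) tendsto_const[of \<gamma>]] gam h(1) by (simp add: less_imp_le)
  have h1: "eventually (\<lambda>n. h n \<le> 1) sequentially" using order_tendstoD(2)[OF h(2), of 1] by (auto elim: eventually_mono)
  have lim: "(\<lambda>n. f n u) \<longlonglongrightarrow> g u" if u: "u \<noteq> 0" for u
  proof (cases "0 < u")
    case False
    have "f n u = 0" for n
    proof -
      have "1 - h n powr \<gamma> * u \<notin> {0..1}" using h(1)[of n] u False by (auto simp: zero_le_mult_iff mult_le_0_iff)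
      then show ?thesis by (simp add: f_def weight_def)
    qed
    then show ?thesis using False u by (simp add: g_def)
  next
    case True
    define s where "s = (\<lambda>n. h n powr \<gamma> * u)"
    have s0: "s \<longlonglongrightarrow> 0" using tendsto_mult_right[OF hg, of u] by (simp add: s_def)
    have spos: "0 < s n" for n using h(1)[of n] True by (simp add: s_def)
    have s_r: "filterlim s (at_right 0) sequentially" using s0 spos by (intro tendsto_imp_filterlim_at_right) auto
    have s1: "eventually (\<lambda>n. s n < 1/2) sequentially" using s0 by (rule order_tendstoD) simp
    define x where "x = (\<lambda>n. (1 - s n) / h n)"
    have x: "filterlim x at_top sequentially"
    proof -
      have "filterlim (\<lambda>n. inverse (h n)) at_top sequentially" using h by (intro filterlim_inverse_at_top) auto
      moreover have "(\<lambda>n. 1 - s n) \<longlonglongrightarrow> 1" using tendsto_diff[OF tendsto_const s0, of 1] by simp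
      ultimately show ?thesis unfolding x_def divide_inverse by (intro filterlim_tendsto_pos_mult_at_top[of _ 1]) auto
    qed
    have xinf: "filterlim x at_infinity sequentially" using x by (rule filterlim_at_top_imp_at_infinity)
    define a where "a = (\<lambda>n. C3 * \<bar>x n\<bar> powr \<gamma>0 * exp (- \<nu> * \<bar>x n\<bar> powr \<gamma>))"
    have r1: "(\<lambda>n. \<phi> (x n) / complex_of_real (a n)) \<longlonglongrightarrow> 1"
      using filterlim_compose[OF \<phi>_ratio xinf] unfolding a_def .
    have r2: "(\<lambda>n. fourier K (1 - s n) / complex_of_real (s n powr lam)) \<longlonglongrightarrow> C2"
      using filterlim_compose[OF fourier_ratio s_r] .
    have r3: "(\<lambda>n. ((1 - s n) powr \<gamma> - 1) / s n) \<longlonglongrightarrow> - \<gamma>"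
      using filterlim_compose[OF powr_quotient_limit s_r] .
    have r4: "(\<lambda>n. (1 - s n) powr (- \<gamma>0)) \<longlonglongrightarrow> 1"
      using tendsto_powr[OF tendsto_diff[OF tendsto_const s0, of 1] tendsto_const[of "- \<gamma>0"]] by simp
    have r5: "(\<lambda>n. 1 / C3 * (u powr lam * (1 - s n) powr (- \<gamma>0) * exp (\<nu> * u * (((1 - s n) powr \<gamma> - 1) / s n))))
        \<longlonglongrightarrow> 1 / C3 * (u powr lam * 1 * exp (\<nu> * u * (- \<gamma>)))" by (intro tendsto_intros r3 r4)
    have "(\<lambda>n. complex_of_real (1 / C3 * (u powr lam * (1 - s n) powr (- \<gamma>0) * exp (\<nu> * u * (((1 - s n) powr \<gamma> - 1) / s n))))
          * (fourier K (1 - s n) / complex_of_real (s n powr lam)) / (\<phi> (x n) / complex_of_real (a n)))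
        \<longlonglongrightarrow> complex_of_real (1 / C3 * (u powr lam * 1 * exp (\<nu> * u * (- \<gamma>)))) * C2 / 1"
      by (intro tendsto_divide tendsto_mult r1 r2 tendsto_of_real[OF r5]) auto
    moreover have "complex_of_real (1 / C3 * (u powr lam * 1 * exp (\<nu> * u * (- \<gamma>)))) * C2 / 1 = g u"
      using True by (simp add: g_def mult_ac)
    moreover have "eventually (\<lambda>n. complex_of_real (1 / C3 * (u powr lam * (1 - s n) powr (- \<gamma>0) * exp (\<nu> * u * (((1 - s n) powr \<gamma> - 1) / s n))))
          * (fourier K (1 - s n) / complex_of_real (s n powr lam)) / (\<phi> (x n) / complex_of_real (a n)) = f n u) sequentially" using s1
    proof eventually_elim
      case (elim n)
      have hn: "0 < h n" by (rule h)
      have xn: "0 < x n" using elim hn by (simp add: x_def)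
      have w: "weight (h n) (1 - s n) = fourier K (1 - s n) / \<phi> (x n)" using elim spos[of n] by (simp add: weight_def x_def)
      have e: "exp (\<nu> * u * (((1 - s n) powr \<gamma> - 1) / s n)) = exp (\<nu> * x n powr \<gamma>) * exp (- (\<nu> * h n powr (- \<gamma>)))"
      proof -
        have "u * (((1 - s n) powr \<gamma> - 1) / s n) = ((1 - s n) powr \<gamma> - 1) / h n powr \<gamma>" using True hn by (simp add: s_def)
        also have "\<dots> = x n powr \<gamma> - h n powr (- \<gamma>)" using hn elim powr_divide[of "1 - s n" "h n" \<gamma>]
          unfolding x_def diff_divide_distrib[of _ _ "h n powr \<gamma>"] by (simp add: powr_minus inverse_eq_divide)
        finally have "\<nu> * u * (((1 - s n) powr \<gamma> - 1) / s n) = \<nu> * (x n powr \<gamma> - h n powr (- \<gamma>))"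
          by (simp only: mult.assoc)
        also have "\<dots> = \<nu> * x n powr \<gamma> + - (\<nu> * h n powr (- \<gamma>))" by (simp add: right_diff_distrib)
        finally show ?thesis unfolding mult_exp_exp by (rule arg_cong)
      qed
      have key: "1 / C3 * (u powr lam * (1 - s n) powr (- \<gamma>0) * exp (\<nu> * u * (((1 - s n) powr \<gamma> - 1) / s n)))
          * a n / s n powr lam = h n powr \<gamma> / edge_scale (h n)"
      proof -
        have "a n = C3 * ((1 - s n) powr \<gamma>0 / h n powr \<gamma>0) * (1 / exp (\<nu> * x n powr \<gamma>))"
          using xn hn elim by (simp add: a_def x_def powr_divide exp_minus inverse_eq_divide)
        moreover have "s n powr lam = h n powr (\<gamma> * lam) * u powr lam" using True hn by (simp add: s_def powr_mult powr_powr)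
        moreover have "edge_scale (h n) = h n powr \<gamma> * h n powr (\<gamma> * lam) * h n powr \<gamma>0 * exp (\<nu> * h n powr (- \<gamma>))"
          by (simp add: edge_scale_def powr_add distrib_left)
        moreover have "0 < (1 - s n) powr \<gamma>0" "0 < h n powr \<gamma>0" "0 < h n powr \<gamma>" "0 < h n powr (\<gamma> * lam)" "0 < u powr lam"
          using elim hn True by auto
        ultimately show ?thesis unfolding e using C3 by (simp add: powr_minus exp_minus field_simps)
      qed
      show ?case unfolding f_def s_def[symmetric, THEN fun_cong] key[symmetric] w by (simp add: divide_inverse mult_ac)
    qed
    ultimately show ?thesis by (simp add: Lim_transform_eventually)
  qed
  have ig: "integrable lborel (\<lambda>u. indicator {0..} u * (u powr lam * exp (- (\<nu> * \<gamma>) * u)))"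
  proof -
    obtain E where E: "0 < E" "\<And>u. 0 \<le> u \<Longrightarrow> (1 + u) powr lam \<le> E * exp (\<nu> * \<gamma> / 2 * u)"
      using powr_le_exp[of lam "\<nu> * \<gamma> / 2"] nu gam lam by auto
    have "integrable lborel (\<lambda>u. E * (indicator {0..} u * exp (- (\<nu> * \<gamma> / 2) * u)))"
      using integrable_exp_halfline(1)[of "\<nu> * \<gamma> / 2"] nu gam by (intro integrable_mult_right) auto
    then show ?thesis
    proof (rule L1_bound)
      show "AE u in lborel. norm (indicator {0..} u * (u powr lam * exp (- (\<nu> * \<gamma>) * u))) \<le> norm (E * (indicator {0..} u * exp (- (\<nu> * \<gamma> / 2) * u)))"
      proof (intro AE_I2)
        fix u :: real
        show "norm (indicator {0..} u * (u powr lam * exp (- (\<nu> * \<gamma>) * u))) \<le> norm (E * (indicator {0..} u * exp (- (\<nu> * \<gamma> / 2) * u)))"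
        proof (cases "0 \<le> u")
          case True
          have "u powr lam \<le> (1 + u) powr lam" using True lam by (intro powr_mono2) auto
          then have "u powr lam * exp (- (\<nu> * \<gamma>) * u) \<le> (E * exp (\<nu> * \<gamma> / 2 * u)) * exp (- (\<nu> * \<gamma>) * u)"
            using E(2)[OF True] by (intro mult_right_mono) auto
          also have "\<dots> = E * exp (- (\<nu> * \<gamma> / 2) * u)" unfolding mult.assoc mult_exp_exp by (simp add: field_simps)
          finally show ?thesis using True E(1) by simp
        qed simp
      qed
    qed measurable
  qed
  have int_g: "(\<integral>u. g u \<partial>lborel) = edge_const"
    unfolding g_def edge_const_def by (simp only: integral_complex_of_real integral_mult_right_zero)
  have f_meas: "f n \<in> borel_measurable lborel" for n unfolding f_def by measurable
  have "(\<lambda>n. \<integral>u. (if h n \<le> 1 then f n u else 0) \<partial>lborel) \<longlonglongrightarrow> (\<integral>u. g u \<partial>lborel)"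
  proof (rule integral_dominated_convergence[where w="\<lambda>u. C * (indicator {0..} u * exp (- (\<nu> / 4) * u))"])
    show "g \<in> borel_measurable lborel" unfolding g_def by measurable
    show "(\<lambda>u. if h n \<le> 1 then f n u else 0) \<in> borel_measurable lborel" for n using f_meas by auto
    show "integrable lborel (\<lambda>u. C * (indicator {0..} u * exp (- (\<nu> / 4) * u)))"
      using integrable_exp_halfline(1)[of "\<nu> / 4"] nu by (intro integrable_mult_right) auto
    show "AE u in lborel. (\<lambda>n. if h n \<le> 1 then f n u else 0) \<longlonglongrightarrow> g u" using AE_lborel_singleton[of 0]
    proof eventually_elim
      case (elim u)
      have "eventually (\<lambda>n. f n u = (if h n \<le> 1 then f n u else 0)) sequentially" using h1 by eventually_elim simp
      then show ?case using lim[OF elim] by (rule Lim_transform_eventually[rotated])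
    qed
    show "AE u in lborel. norm (if h n \<le> 1 then f n u else 0) \<le> C * (indicator {0..} u * exp (- (\<nu> / 4) * u))" for n
      using AE_lborel_singleton[of 0]
    proof eventually_elim
      case (elim u)
      show ?case
      proof (cases "h n \<le> 1")
        case True
        have e: "0 < edge_scale (h n)" by (rule edge_scale_pos[OF h(1)])
        have "norm (f n u) = h n powr \<gamma> * cmod (weight (h n) (1 - h n powr \<gamma> * u)) / edge_scale (h n)"
          using e by (simp add: f_def norm_mult norm_divide)
        also have "\<dots> \<le> C * edge_scale (h n) * (indicator {0..} u * exp (- (\<nu> / 4) * u)) / edge_scale (h n)"
          using e by (intro divide_right_mono C(2) h True elim) auto
        finally show ?thesis using True e by simp
      next
        case False
        then show ?thesis using C(1) by (auto simp: indicator_def)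
      qed
    qed
  qed
  moreover have "eventually (\<lambda>n. (\<integral>u. (if h n \<le> 1 then f n u else 0) \<partial>lborel) = (\<integral>t. weight (h n) t \<partial>lborel) / edge_scale (h n)) sequentially"
    using h1
  proof eventually_elim
    case (elim n)
    have "(\<integral>t. weight (h n) t \<partial>lborel) = \<bar>- (h n powr \<gamma>)\<bar> *\<^sub>R (\<integral>u. weight (h n) (1 + - (h n powr \<gamma>) * u) \<partial>lborel)"
      by (rule lborel_integral_real_affine) (use h(1)[of n] in auto)
    then show ?case using elim by (simp add: f_def scaleR_conv_of_real)
  qed
  ultimately show "(\<lambda>n. (\<integral>t. weight (h n) t \<partial>lborel) / edge_scale (h n)) \<longlonglongrightarrow> edge_const"
    unfolding int_g by (rule Lim_transform_eventually)
  show "0 < edge_const"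
  proof -
    have "(\<integral>u. indicator {0..} u * (u powr lam * exp (- (\<nu> * \<gamma>) * u)) \<partial>lborel) \<noteq> 0"
    proof
      assume "(\<integral>u. indicator {0..} u * (u powr lam * exp (- (\<nu> * \<gamma>) * u)) \<partial>lborel) = 0"
      then have "AE u in lborel. indicator {0..} u * (u powr lam * exp (- (\<nu> * \<gamma>) * u)) = 0"
        by (subst (asm) integral_nonneg_eq_0_iff_AE[OF ig]) (auto simp: indicator_def)
      then have "AE u in lborel. u \<notin> {0<..<1::real}" by eventually_elim (auto simp: indicator_def)
      then have "{0<..<1::real} \<in> null_sets lborel" by (simp add: AE_iff_null_sets)
      then show False by (simp add: null_sets_def)
    qed
    moreover have "0 \<le> (\<integral>u. indicator {0..} u * (u powr lam * exp (- (\<nu> * \<gamma>) * u)) \<partial>lborel)"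
      by (rule lebesgue_nonneg) (auto simp: indicator_def)
    ultimately have "0 < (\<integral>u. indicator {0..} u * (u powr lam * exp (- (\<nu> * \<gamma>) * u)) \<partial>lborel)" by linarith
    then show ?thesis using C2 C3 unfolding edge_const_def by (intro mult_pos_pos) auto
  qed
qed

end

section \<open>Taylor expansion in Hoelder classes and Fourier inversion\<close>
lemma conj_symmetric_integral:
  fixes G :: "real \<Rightarrow> complex"
  assumes int: "integrable lborel G" and sym: "\<And>s. G (- s) = cnj (G s)"
  shows "(\<integral>s. G s \<partial>lborel) = of_real (2 * Re (\<integral>s. indicator {0..} s * G s \<partial>lborel))"
proof -
  have i: "integrable lborel (\<lambda>s. indicator A s * G s)" if "A \<in> sets lborel" for A :: "real set"
  proof -
    have "(\<lambda>s. indicator A s * G s) = (\<lambda>s. indicator A s *\<^sub>R G s)" by (auto simp: indicator_def fun_eq_iff)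
    then show ?thesis using integrable_mult_indicator[OF that int] by simp
  qed
  have "(\<integral>s. G s \<partial>lborel) = (\<integral>s. indicator {0..} s * G s + indicator {..<0} s * G s \<partial>lborel)"
    by (intro lebesgue_cong) (auto simp: indicator_def)
  also have "\<dots> = (\<integral>s. indicator {0..} s * G s \<partial>lborel) + (\<integral>s. indicator {..<0} s * G s \<partial>lborel)"
    by (intro lebesgue_add i) auto
  also have "(\<integral>s. indicator {..<0} s * G s \<partial>lborel) = (\<integral>s. indicator {..<0} (- s) * G (- s) \<partial>lborel)"
    using lborel_integral_real_affine[of "-1" "\<lambda>s. indicator {..<0} s * G s" 0] by simp
  also have "\<dots> = (\<integral>s. cnj (indicator {0..} s * G s) \<partial>lborel)"
  proof (rule integral_cong_AE)
    show "AE s in lborel. indicator {..<0} (- s) * G (- s) = cnj (indicator {0..} s * G s)"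
      using AE_lborel_singleton[of "0::real"] by eventually_elim (auto simp: sym indicator_def)
    have [measurable]: "G \<in> borel_measurable lborel" using int by auto
    have [measurable]: "cnj \<in> borel_measurable borel" by (intro borel_measurable_continuous_onI continuous_intros)
    show "(\<lambda>s. cnj (indicator {0..} s * G s)) \<in> borel_measurable lborel" by measurable
    show "(\<lambda>s. indicator {..<0} (- s) * G (- s)) \<in> borel_measurable lborel" by measurable
  qed
  also have "\<dots> = cnj (\<integral>s. indicator {0..} s * G s \<partial>lborel)" by (rule Bochner_Integration.integral_cnj)
  finally show ?thesis by (simp add: complex_add_cnj)
qed

lemma holder_class_taylor:
  assumes f: "f \<in> holder_class \<beta> B" and k: "real k < \<beta>" "\<beta> \<le> real k + 1"
  shows "\<bar>f (x + u) - (\<Sum>j\<le>k. (deriv ^^ j) f x / fact j * u ^ j)\<bar> \<le> B * \<bar>u\<bar> powr \<beta> / fact k"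
    and "isCont f x"
proof -
  obtain k' where k': "real k' < \<beta>" "\<beta> \<le> real k' + 1"
    and diff: "\<And>j x. j < k' \<Longrightarrow> (deriv ^^ j) f field_differentiable at x"
    and hol: "\<And>x y. \<bar>(deriv ^^ k') f x - (deriv ^^ k') f y\<bar> \<le> B * \<bar>x - y\<bar> powr (\<beta> - real k')"
    using f unfolding holder_class_def by blast
  have [simp]: "k' = k" using k k' by linarith
  show *: "\<bar>f (x + u) - (\<Sum>j\<le>k. (deriv ^^ j) f x / fact j * u ^ j)\<bar> \<le> B * \<bar>u\<bar> powr \<beta> / fact k" for x u
  proof (cases "u = 0")
    case True
    have "(\<Sum>j\<le>k. (deriv ^^ j) f x / fact j * 0 ^ j) = f x" by (subst sum.atMost_shift) simp
    then show ?thesis using True by simp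
  next
    case u: False
    have "\<exists>\<zeta>. \<bar>\<zeta> - x\<bar> \<le> \<bar>u\<bar> \<and> f (x + u) = (\<Sum>j<k. (deriv ^^ j) f x / fact j * u ^ j) + (deriv ^^ k) f \<zeta> / fact k * u ^ k"
    proof (cases "k = 0")
      case True
      then show ?thesis by (intro exI[of _ "x + u"]) auto
    next
      case False
      have "\<exists>t. (if x + u < x then x + u < t \<and> t < x else x < t \<and> t < x + u) \<and>
          f (x + u) = (\<Sum>m<k. (deriv ^^ m) f x / fact m * (x + u - x) ^ m) + (deriv ^^ k) f t / fact k * (x + u - x) ^ k"
      proof (rule Taylor[where a="min x (x + u)" and b="max x (x + u)"])
        show "\<forall>m t. m < k \<and> min x (x + u) \<le> t \<and> t \<le> max x (x + u) \<longrightarrow> ((deriv ^^ m) f has_real_derivative (deriv ^^ Suc m) f t) (at t)"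
          using diff by (auto simp: DERIV_deriv_iff_field_differentiable)
      qed (use u False in auto)
      then obtain t where "if x + u < x then x + u < t \<and> t < x else x < t \<and> t < x + u"
        "f (x + u) = (\<Sum>m<k. (deriv ^^ m) f x / fact m * u ^ m) + (deriv ^^ k) f t / fact k * u ^ k" by auto
      then show ?thesis by (intro exI[of _ t]) (auto split: if_splits)
    qed
    then obtain \<zeta> where z: "\<bar>\<zeta> - x\<bar> \<le> \<bar>u\<bar>"
      and eq: "f (x + u) = (\<Sum>j<k. (deriv ^^ j) f x / fact j * u ^ j) + (deriv ^^ k) f \<zeta> / fact k * u ^ k" by blast
    have "f (x + u) - (\<Sum>j\<le>k. (deriv ^^ j) f x / fact j * u ^ j) = ((deriv ^^ k) f \<zeta> - (deriv ^^ k) f x) / fact k * u ^ k"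
      unfolding eq lessThan_Suc_atMost[symmetric] by (simp add: diff_divide_distrib algebra_simps)
    also have "\<bar>\<dots>\<bar> = \<bar>(deriv ^^ k) f \<zeta> - (deriv ^^ k) f x\<bar> * \<bar>u\<bar> ^ k / fact k"
      by (simp add: abs_mult power_abs)
    also have "\<dots> \<le> (B * \<bar>u\<bar> powr (\<beta> - real k)) * \<bar>u\<bar> ^ k / fact k"
    proof (intro divide_right_mono mult_right_mono)
      have B0: "0 \<le> B" using order_trans[OF abs_ge_zero hol[of 0 1]] by simp
      have "B * \<bar>\<zeta> - x\<bar> powr (\<beta> - real k) \<le> B * \<bar>u\<bar> powr (\<beta> - real k)"
        using z k B0 by (intro mult_left_mono powr_mono2) auto
      then show "\<bar>(deriv ^^ k) f \<zeta> - (deriv ^^ k) f x\<bar> \<le> B * \<bar>u\<bar> powr (\<beta> - real k)"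
        using hol[of \<zeta> x] by simp
    qed auto
    also have "\<dots> = B * \<bar>u\<bar> powr \<beta> / fact k" using u by (simp add: powr_diff powr_realpow)
    finally show ?thesis .
  qed
  show "isCont f x"
  proof (cases "k = 0")
    case True
    have "(\<lambda>u. B * \<bar>u\<bar> powr \<beta>) \<midarrow>0\<rightarrow> B * \<bar>0\<bar> powr \<beta>"
      using k True by (intro tendsto_intros tendsto_powr') (auto intro!: tendsto_intros)
    then have "(\<lambda>u. B * \<bar>u\<bar> powr \<beta>) \<midarrow>0\<rightarrow> 0" by simp
    then have "(\<lambda>u. f (x + u) - f x) \<midarrow>0\<rightarrow> 0" by (rule Lim_null_comparison[rotated]) (use *[of x] True in auto)
    then show ?thesis by (simp add: isCont_iff LIM_zero_iff)
  next
    case False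
    then show ?thesis using diff[of 0 x] by (simp add: field_differentiable_imp_continuous_at)
  qed
qed

text \<open>Both sides are limits of averages against a Gaussian of vanishing width: the spatial average tends to \<open>f x\<close> by
  continuity, with the growth bound as domination, and the spectral one by integrability of \<open>\<psi>\<close>.\<close>

lemma density_fourier_inversion:
  fixes f :: "real \<Rightarrow> real"
  assumes f0: "\<And>x. 0 \<le> f x" and f_int: "integrable lborel f"
    and cont: "isCont f x"
    and growth: "\<And>u. \<bar>f (x + u)\<bar> \<le> A * (1 + \<bar>u\<bar> ^ k)"
    and \<psi>: "\<And>t. \<psi> t = (\<integral>y. iexp (t * y) * f y \<partial>lborel)"
    and \<psi>_int: "integrable lborel (\<lambda>t. cmod (\<psi> t))"
  shows "complex_of_real (f x) = 1 / (2 * pi) * (\<integral>t. iexp (- (t * x)) * \<psi> t \<partial>lborel)"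
proof -
  have [measurable]: "f \<in> borel_measurable borel" using f_int by auto
  have [measurable]: "\<psi> \<in> borel_measurable borel" unfolding \<psi>[abs_def] by measurable
  let ?g = std_normal_density
  have g_le: "?g u \<le> 1 / sqrt (2 * pi)" "0 \<le> ?g u" for u by (auto simp: normal_density_def intro!: divide_right_mono)
  have ch: "(\<integral>u. iexp (t * u) * ?g u \<partial>lborel) = exp (- t\<^sup>2 / 2)" for t
  proof -
    have "(\<integral>u. iexp (t * u) * ?g u \<partial>lborel) = (\<integral>u. ?g u *\<^sub>R iexp (t * u) \<partial>lborel)"
      by (simp add: scaleR_conv_of_real mult.commute)
    also have "\<dots> = (\<integral>u. iexp (t * u) \<partial>std_gauss)" by (subst integral_density) auto
    finally show ?thesis by (simp only: char_std_gauss)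
  qed
  have fgauss: "(\<integral>z. f (x + \<sigma> * z) * ?g z \<partial>lborel) = 1 / sqrt (2 * pi) * (\<integral>t. iexp (- (t * x)) * \<psi> t * ?g (\<sigma> * t) \<partial>lborel)"
    (is "complex_of_real ?L = ?R") if \<sigma>: "0 < \<sigma>" for \<sigma>
  proof -
    let ?H = "\<lambda>y u. iexp (((y - x) / \<sigma>) * u) * ?g u * f y"
    have meas: "(\<lambda>(y, u). ?H y u) \<in> borel_measurable (lborel \<Otimes>\<^sub>M lborel)" by measurable
    have Hint: "integrable (lborel \<Otimes>\<^sub>M lborel) (\<lambda>(y, u). ?H y u)"
    proof (rule lborel_pair.Fubini_integrable[OF meas])
      have "(\<integral>u. norm (case (y, u) of (y, u) \<Rightarrow> ?H y u) \<partial>lborel) = f y" for y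
        using f0 by (simp add: norm_mult integral_normal_density)
      then show "integrable lborel (\<lambda>y. \<integral>u. norm (case (y, u) of (y, u) \<Rightarrow> ?H y u) \<partial>lborel)" using f_int by simp
      show "AE y in lborel. integrable lborel (\<lambda>u. case (y, u) of (y, u) \<Rightarrow> ?H y u)"
      proof (rule AE_I2)
        fix y
        have "integrable lborel (\<lambda>u. f y * ?g u)" by (intro integrable_mult_right integrable_normal_density) auto
        then show "integrable lborel (\<lambda>u. case (y, u) of (y, u) \<Rightarrow> ?H y u)" by (rule L1_bound) (auto simp: norm_mult abs_mult)
      qed
    qed
    have 1: "(\<integral>u. ?H y u \<partial>lborel) = exp (- ((y - x) / \<sigma>)\<^sup>2 / 2) * f y" for y
      unfolding integral_mult_left_zero ch by (simp only: of_real_mult)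
    have 2: "(\<integral>y. ?H y u \<partial>lborel) = ?g u * (iexp (- (u / \<sigma> * x)) * \<psi> (u / \<sigma>))" for u
    proof -
      have "?H y u = (?g u * iexp (- (u / \<sigma> * x))) * (iexp (u / \<sigma> * y) * f y)" for y
      proof -
        have "iexp (((y - x) / \<sigma>) * u) = iexp (- (u / \<sigma> * x)) * iexp (u / \<sigma> * y)"
        proof -
          have "((y - x) / \<sigma>) * u = - (u / \<sigma> * x) + u / \<sigma> * y" by (simp add: algebra_simps diff_divide_distrib)
          then show ?thesis by (simp only: of_real_add distrib_left exp_add)
        qed
        then show ?thesis by (simp only: mult_ac)
      qed
      then have "(\<integral>y. ?H y u \<partial>lborel) = (?g u * iexp (- (u / \<sigma> * x))) * (\<integral>y. iexp (u / \<sigma> * y) * f y \<partial>lborel)"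
        by (simp only: integral_mult_right_zero)
      then show ?thesis by (simp only: \<psi>[symmetric] mult.assoc)
    qed
    have gz: "?g z = exp (- z\<^sup>2 / 2) / sqrt (2 * pi)" for z by (simp add: normal_density_def)
    have "?L = (\<integral>z. f (x + \<sigma> * z) * exp (- z\<^sup>2 / 2) \<partial>lborel) / sqrt (2 * pi)" unfolding gz by simp
    also have "(\<integral>z. f (x + \<sigma> * z) * exp (- z\<^sup>2 / 2) \<partial>lborel) = (1 / \<sigma>) * (\<integral>y. exp (- ((y - x) / \<sigma>)\<^sup>2 / 2) * f y \<partial>lborel)"
      using lborel_integral_real_affine[of \<sigma> "\<lambda>y. exp (- ((y - x) / \<sigma>)\<^sup>2 / 2) * f y" x] \<sigma>
      by (simp add: mult.commute)
    finally have "complex_of_real ?L = (1 / \<sigma>) * (\<integral>y. (\<integral>u. ?H y u \<partial>lborel) \<partial>lborel) / sqrt (2 * pi)"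
      unfolding 1 by (simp add: integral_complex_of_real[symmetric] del: integral_complex_of_real)
    also have "(\<integral>y. (\<integral>u. ?H y u \<partial>lborel) \<partial>lborel) = (\<integral>u. (\<integral>y. ?H y u \<partial>lborel) \<partial>lborel)"
      by (rule lborel_pair.Fubini_integral[OF Hint, symmetric])
    also have "\<dots> = (\<integral>u. ?g u * (iexp (- (u / \<sigma> * x)) * \<psi> (u / \<sigma>)) \<partial>lborel)" unfolding 2 ..
    also have "\<dots> = \<sigma> * (\<integral>t. iexp (- (t * x)) * \<psi> t * ?g (\<sigma> * t) \<partial>lborel)"
      using lborel_integral_real_affine[of \<sigma> "\<lambda>u. ?g u * (iexp (- (u / \<sigma> * x)) * \<psi> (u / \<sigma>))" 0] \<sigma>
      by (simp add: scaleR_conv_of_real mult_ac)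
    finally show ?thesis using \<sigma> by simp
  qed
  define \<sigma> where "\<sigma> = (\<lambda>n::nat. 1 / real (Suc n))"
  have s: "0 < \<sigma> n" "\<sigma> n \<le> 1" for n by (auto simp: \<sigma>_def)
  have s0: "\<sigma> \<longlonglongrightarrow> 0" unfolding \<sigma>_def by (rule LIMSEQ_Suc[OF lim_1_over_n])
  have "(\<lambda>n. \<integral>z. f (x + \<sigma> n * z) * ?g z \<partial>lborel) \<longlonglongrightarrow> (\<integral>z. f x * ?g z \<partial>lborel)"
  proof (rule integral_dominated_convergence[where w="\<lambda>z. A * (?g z + \<bar>?g z * z ^ k\<bar>)"])
    show "integrable lborel (\<lambda>z. A * (?g z + \<bar>?g z * z ^ k\<bar>))"
      by (intro integrable_mult_right L1_add integrable_abs integrable_std_normal_moment) auto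
    show "AE z in lborel. (\<lambda>n. f (x + \<sigma> n * z) * ?g z) \<longlonglongrightarrow> f x * ?g z"
    proof (intro AE_I2 tendsto_mult tendsto_const)
      fix z
      have "(\<lambda>n. x + \<sigma> n * z) \<longlonglongrightarrow> x + 0 * z" by (intro tendsto_intros s0)
      then show "(\<lambda>n. f (x + \<sigma> n * z)) \<longlonglongrightarrow> f x" using isCont_tendsto_compose[OF cont] by simp
    qed
    show "AE z in lborel. norm (f (x + \<sigma> n * z) * ?g z) \<le> A * (?g z + \<bar>?g z * z ^ k\<bar>)" for n
    proof (rule AE_I2)
      fix z
      have A0: "0 \<le> A" using order_trans[OF abs_ge_zero growth[of 0]] by (auto simp: zero_le_mult_iff power_0_left split: if_splits)
      have "\<bar>\<sigma> n * z\<bar> ^ k \<le> \<bar>z\<bar> ^ k"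
        using s[of n] mult_right_mono[of "\<sigma> n" 1 "\<bar>z\<bar>"] by (intro power_mono) (auto simp: abs_mult)
      then have "A * (1 + \<bar>\<sigma> n * z\<bar> ^ k) \<le> A * (1 + \<bar>z\<bar> ^ k)" using A0 by (intro mult_left_mono) auto
      then have "\<bar>f (x + \<sigma> n * z)\<bar> \<le> A * (1 + \<bar>z\<bar> ^ k)" using growth[of "\<sigma> n * z"] by linarith
      then have "\<bar>f (x + \<sigma> n * z)\<bar> * ?g z \<le> A * (1 + \<bar>z\<bar> ^ k) * ?g z" by (intro mult_right_mono g_le)
      then show "norm (f (x + \<sigma> n * z) * ?g z) \<le> A * (?g z + \<bar>?g z * z ^ k\<bar>)"
        using g_le(2)[of z] by (simp add: abs_mult power_abs algebra_simps)
    qed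
  qed measurable
  also have "(\<integral>z. f x * ?g z \<partial>lborel) = f x" by (simp add: integral_normal_density)
  finally have L1: "(\<lambda>n. complex_of_real (\<integral>z. f (x + \<sigma> n * z) * ?g z \<partial>lborel)) \<longlonglongrightarrow> f x"
    by (rule tendsto_of_real)
  have "(\<lambda>n. \<integral>t. iexp (- (t * x)) * \<psi> t * ?g (\<sigma> n * t) \<partial>lborel) \<longlonglongrightarrow> (\<integral>t. iexp (- (t * x)) * \<psi> t * (1 / sqrt (2 * pi)) \<partial>lborel)"
  proof (rule integral_dominated_convergence[where w="\<lambda>t. cmod (\<psi> t) * (1 / sqrt (2 * pi))"])
    show "integrable lborel (\<lambda>t. cmod (\<psi> t) * (1 / sqrt (2 * pi)))" using \<psi>_int by (rule integrable_mult_left)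
    show "AE t in lborel. (\<lambda>n. iexp (- (t * x)) * \<psi> t * ?g (\<sigma> n * t)) \<longlonglongrightarrow> iexp (- (t * x)) * \<psi> t * (1 / sqrt (2 * pi))"
    proof (intro AE_I2 tendsto_mult tendsto_const)
      fix t
      have "(\<lambda>n. exp (- (\<sigma> n * t)\<^sup>2 / 2) / sqrt (2 * pi)) \<longlonglongrightarrow> exp (- (0 * t)\<^sup>2 / 2) / sqrt (2 * pi)"
        by (intro tendsto_intros s0) auto
      then have "(\<lambda>n. ?g (\<sigma> n * t)) \<longlonglongrightarrow> 1 / sqrt (2 * pi)" by (simp add: normal_density_def)
      then show "(\<lambda>n. complex_of_real (?g (\<sigma> n * t))) \<longlonglongrightarrow> (1 / sqrt (2 * pi))" by (rule tendsto_of_real)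
    qed
    show "AE t in lborel. norm (iexp (- (t * x)) * \<psi> t * ?g (\<sigma> n * t)) \<le> cmod (\<psi> t) * (1 / sqrt (2 * pi))" for n
    proof (rule AE_I2)
      fix t
      show "norm (iexp (- (t * x)) * \<psi> t * ?g (\<sigma> n * t)) \<le> cmod (\<psi> t) * (1 / sqrt (2 * pi))"
        using mult_left_mono[OF g_le(1)[of "\<sigma> n * t"], of "cmod (\<psi> t)"] g_le(2)[of "\<sigma> n * t"]
        unfolding norm_mult norm_of_real by (simp only: norm_exp_i_times abs_of_nonneg) simp
    qed
  qed measurable
  then have "(\<lambda>n. 1 / sqrt (2 * pi) * (\<integral>t. iexp (- (t * x)) * \<psi> t * ?g (\<sigma> n * t) \<partial>lborel))
      \<longlonglongrightarrow> 1 / sqrt (2 * pi) * (\<integral>t. iexp (- (t * x)) * \<psi> t * (1 / sqrt (2 * pi)) \<partial>lborel)"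
    by (intro tendsto_intros)
  then have "(\<lambda>n. complex_of_real (\<integral>z. f (x + \<sigma> n * z) * ?g z \<partial>lborel))
      \<longlonglongrightarrow> 1 / sqrt (2 * pi) * (\<integral>t. iexp (- (t * x)) * \<psi> t * (1 / sqrt (2 * pi)) \<partial>lborel)"
    unfolding fgauss[OF s(1)] .
  from LIMSEQ_unique[OF L1 this]
  have "complex_of_real (f x) = 1 / sqrt (2 * pi) * ((\<integral>t. iexp (- (t * x)) * \<psi> t \<partial>lborel) * (1 / sqrt (2 * pi)))"
    by (simp only: integral_mult_left_zero)
  also have "\<dots> = complex_of_real (1 / sqrt (2 * pi) * (1 / sqrt (2 * pi))) * (\<integral>t. iexp (- (t * x)) * \<psi> t \<partial>lborel)"
    by (simp only: of_real_mult of_real_divide of_real_1 mult_ac)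
  also have "1 / sqrt (2 * pi) * (1 / sqrt (2 * pi)) = 1 / (2 * pi)" by simp
  finally show ?thesis by simp
qed

section \<open>Smoothing bias\<close>
lemma fourier_cnj: "fourier K (- t) = cnj (fourier K t)"
proof -
  have "fourier K (- t) = (\<integral>x. cnj (iexp (t * x) * complex_of_real (K x)) \<partial>lborel)"
    unfolding fourier_def by (intro lebesgue_cong refl) (simp add: exp_cnj)
  then show ?thesis unfolding fourier_def by (simp only: Bochner_Integration.integral_cnj)
qed

lemma abs_powr_le: 
  fixes u :: real
  assumes "0 < \<beta>" "\<beta> \<le> real k + 1"
  shows "\<bar>u\<bar> powr \<beta> \<le> 1 + \<bar>u\<bar> ^ (k + 1)"
proof (cases "\<bar>u\<bar> \<le> 1")
  case True
  then have "\<bar>u\<bar> powr \<beta> \<le> 1" using assms by (intro powr_le1) auto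
  then show ?thesis by (simp add: add_increasing2)
next
  case False
  then have "\<bar>u\<bar> powr \<beta> \<le> \<bar>u\<bar> powr (real (k + 1))" using assms by (intro powr_mono) auto
  also have "\<dots> = \<bar>u\<bar> ^ (k + 1)" using False by (subst powr_realpow) auto
  finally show ?thesis by simp
qed

lemma abs_power_le: 
  fixes u :: real
  assumes "j \<le> m"
  shows "\<bar>u\<bar> ^ j \<le> 1 + \<bar>u\<bar> ^ m"
proof (cases "\<bar>u\<bar> \<le> 1")
  case True
  then have "\<bar>u\<bar> ^ j \<le> 1" by (intro power_le_one) auto
  then show ?thesis by (simp add: add_increasing2)
next
  case False
  then have "\<bar>u\<bar> ^ j \<le> \<bar>u\<bar> ^ m" using assms by (intro power_increasing) auto
  then show ?thesis by simp
qed

text \<open>\<open>h\<close> times the value at \<open>x\<close> of the convolution of a density with the kernel at bandwidth \<open>h\<close>, computed from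
  the characteristic function \<open>\<psi>\<close> of the density.\<close>

abbreviation smoothed_value :: "(real \<Rightarrow> real) \<Rightarrow> (real \<Rightarrow> complex) \<Rightarrow> real \<Rightarrow> real \<Rightarrow> real" where
  "smoothed_value K \<psi> h x \<equiv> 1 / pi * Re (\<integral>s. indicator {0..1} s * (iexp (- (s * x / h)) * (fourier K s * \<psi> (s / h))) \<partial>lborel)"

text \<open>Fourier inversion identifies the integral with the convolution of \<open>f\<close> with the kernel at bandwidth \<open>h\<close>, and the
  vanishing moments of \<open>K\<close> cancel the Taylor polynomial of \<open>f\<close>, leaving the Hoelder remainder. Conjugation
  symmetry accounts for integrating over the positive half only.\<close>

lemma smoothing_bias:
  fixes f K :: "real \<Rightarrow> real" and \<psi> :: "real \<Rightarrow> complex"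
  assumes f0: "\<And>x. 0 \<le> f x" and f_int: "integrable lborel f"
    and hol: "f \<in> holder_class \<beta> B" and k: "real k < \<beta>" "\<beta> \<le> real k + 1" and B0: "0 < B" and \<beta>0: "0 < \<beta>"
    and K: "kernel_function K"
    and supp: "\<And>t. 1 < \<bar>t\<bar> \<Longrightarrow> fourier K t = 0"
    and K_mom: "integrable lborel (\<lambda>x. \<bar>x\<bar> ^ (k + 1) * \<bar>K x\<bar>)"
    and K_orth: "\<And>l. l \<in> {1..k} \<Longrightarrow> (\<integral>x. x ^ l * K x \<partial>lborel) = 0"
    and \<psi>: "\<And>t. \<psi> t = (\<integral>y. iexp (t * y) * f y \<partial>lborel)"
    and \<psi>_int: "integrable lborel (\<lambda>t. cmod (\<psi> t))"
  shows "\<exists>C\<ge>0. \<forall>h x. 0 < h \<longrightarrow>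
    \<bar>smoothed_value K \<psi> h x - h * f x\<bar> \<le> C * h powr (1 + \<beta>)"
proof -
  have K_int: "integrable lborel K" and K1: "(\<integral>x. K x \<partial>lborel) = 1" using K by (auto simp: kernel_function_def)
  have [measurable]: "K \<in> borel_measurable borel" "f \<in> borel_measurable borel" using K_int f_int by auto
  have [measurable]: "\<psi> \<in> borel_measurable borel" unfolding \<psi>[abs_def] by measurable
  have \<psi>_int': "integrable lborel \<psi>" using \<psi>_int by (rule integrable_norm_cancel) measurable
  have fK_meas[measurable]: "fourier K \<in> borel_measurable borel" by measurable
  define \<delta> where "\<delta> = (\<lambda>x u. f (x + u) - (\<Sum>j\<le>k. (deriv ^^ j) f x / fact j * u ^ j))"
  have taylor: "\<bar>\<delta> x u\<bar> \<le> B * \<bar>u\<bar> powr \<beta> / fact k" for x u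
    unfolding \<delta>_def by (rule holder_class_taylor(1)[OF hol k])
  have cont: "isCont f x" for x by (rule holder_class_taylor(2)[OF hol k])
  have growth: "\<exists>A. \<forall>u. \<bar>f (x + u)\<bar> \<le> A * (1 + \<bar>u\<bar> ^ (k + 1))" for x
  proof (intro exI allI)
    fix u
    let ?A = "(\<Sum>j\<le>k. \<bar>(deriv ^^ j) f x / fact j\<bar>) + B / fact k"
    have "\<bar>\<Sum>j\<le>k. (deriv ^^ j) f x / fact j * u ^ j\<bar> \<le> (\<Sum>j\<le>k. \<bar>(deriv ^^ j) f x / fact j\<bar> * (1 + \<bar>u\<bar> ^ (k + 1)))"
    proof (rule order_trans[OF sum_abs sum_mono])
      fix j assume "j \<in> {..k}"
      then show "\<bar>(deriv ^^ j) f x / fact j * u ^ j\<bar> \<le> \<bar>(deriv ^^ j) f x / fact j\<bar> * (1 + \<bar>u\<bar> ^ (k + 1))"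
        unfolding abs_mult power_abs by (intro mult_left_mono abs_power_le) auto
    qed
    moreover have "\<bar>\<delta> x u\<bar> \<le> B / fact k * (1 + \<bar>u\<bar> ^ (k + 1))"
    proof -
      have "B / fact k * \<bar>u\<bar> powr \<beta> \<le> B / fact k * (1 + \<bar>u\<bar> ^ (k + 1))"
        using B0 by (intro mult_left_mono abs_powr_le \<beta>0 k(2)) auto
      then show ?thesis using taylor[of x u] by simp
    qed
    ultimately show "\<bar>f (x + u)\<bar> \<le> ?A * (1 + \<bar>u\<bar> ^ (k + 1))"
      unfolding \<delta>_def distrib_right sum_distrib_right[symmetric] by linarith
  qed
  have inv: "complex_of_real (f x) = 1 / (2 * pi) * (\<integral>t. iexp (- (t * x)) * \<psi> t \<partial>lborel)" for x
  proof -
    obtain A where "\<And>u. \<bar>f (x + u)\<bar> \<le> A * (1 + \<bar>u\<bar> ^ (k + 1))" using growth by blast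
    then show ?thesis by (rule density_fourier_inversion[OF f0 f_int cont _ \<psi> \<psi>_int])
  qed
  have KM: "integrable lborel (\<lambda>v. \<bar>K v\<bar> + \<bar>v\<bar> ^ (k + 1) * \<bar>K v\<bar>)" using K_int K_mom by auto
  have Kj: "integrable lborel (\<lambda>v. v ^ j * K v)" if "j \<le> k" for j
  proof (rule L1_bound[OF KM])
    show "AE v in lborel. norm (v ^ j * K v) \<le> norm (\<bar>K v\<bar> + \<bar>v\<bar> ^ (k + 1) * \<bar>K v\<bar>)"
    proof (rule AE_I2)
      fix v :: real
      have "\<bar>v\<bar> ^ j * \<bar>K v\<bar> \<le> (1 + \<bar>v\<bar> ^ (k + 1)) * \<bar>K v\<bar>"
        using that by (intro mult_right_mono abs_power_le) auto
      then show "norm (v ^ j * K v) \<le> norm (\<bar>K v\<bar> + \<bar>v\<bar> ^ (k + 1) * \<bar>K v\<bar>)"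
        by (simp add: abs_mult power_abs distrib_right)
    qed
  qed measurable
  have K\<beta>: "integrable lborel (\<lambda>v. \<bar>v\<bar> powr \<beta> * \<bar>K v\<bar>)"
  proof (rule L1_bound[OF KM])
    show "AE v in lborel. norm (\<bar>v\<bar> powr \<beta> * \<bar>K v\<bar>) \<le> norm (\<bar>K v\<bar> + \<bar>v\<bar> ^ (k + 1) * \<bar>K v\<bar>)"
    proof (rule AE_I2)
      fix v :: real
      have "\<bar>v\<bar> powr \<beta> * \<bar>K v\<bar> \<le> (1 + \<bar>v\<bar> ^ (k + 1)) * \<bar>K v\<bar>"
        by (intro mult_right_mono abs_powr_le \<beta>0 k(2)) auto
      then show "norm (\<bar>v\<bar> powr \<beta> * \<bar>K v\<bar>) \<le> norm (\<bar>K v\<bar> + \<bar>v\<bar> ^ (k + 1) * \<bar>K v\<bar>)"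
        by (simp add: abs_mult distrib_right)
    qed
  qed measurable
  define C where "C = B / fact k * (\<integral>v. \<bar>v\<bar> powr \<beta> * \<bar>K v\<bar> \<partial>lborel)"
  have C: "0 \<le> C" using B0 unfolding C_def by (intro mult_nonneg_nonneg lebesgue_nonneg) auto
  have "\<bar>smoothed_value K \<psi> h x - h * f x\<bar> \<le> C * h powr (1 + \<beta>)"
    if h: "0 < h" for h x
  proof -
    let ?J = "\<integral>s. indicator {0..1} s * (iexp (- (s * x / h)) * (fourier K s * \<psi> (s / h))) \<partial>lborel"
    let ?G = "\<lambda>s. iexp (- (s * x / h)) * (fourier K s * \<psi> (s / h))"
    let ?H = "\<lambda>v t. (iexp (- (t * (x - h * v))) * \<psi> t) * K v"
    have meas: "(\<lambda>(v, t). ?H v t) \<in> borel_measurable (lborel \<Otimes>\<^sub>M lborel)" by measurable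
    have Hint: "integrable (lborel \<Otimes>\<^sub>M lborel) (\<lambda>(v, t). ?H v t)"
    proof (rule lborel_pair.Fubini_integrable[OF meas])
      have "(\<integral>t. norm (case (v, t) of (v, t) \<Rightarrow> ?H v t) \<partial>lborel) = (\<integral>t. cmod (\<psi> t) \<partial>lborel) * \<bar>K v\<bar>" for v
        by (simp add: norm_mult)
      then show "integrable lborel (\<lambda>v. \<integral>t. norm (case (v, t) of (v, t) \<Rightarrow> ?H v t) \<partial>lborel)" using K_int by auto
      show "AE v in lborel. integrable lborel (\<lambda>t. case (v, t) of (v, t) \<Rightarrow> ?H v t)"
      proof (rule AE_I2)
        fix v :: real
        have "integrable lborel (\<lambda>t. cmod (\<psi> t) * K v)" using \<psi>_int by auto
        then show "integrable lborel (\<lambda>t. case (v, t) of (v, t) \<Rightarrow> ?H v t)" by (rule L1_bound) (auto simp: norm_mult abs_mult)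
      qed
    qed
    have inner1: "(\<integral>t. ?H v t \<partial>lborel) = 2 * pi * (f (x - h * v) * K v)" for v
    proof -
      have "(\<integral>t. ?H v t \<partial>lborel) = (\<integral>t. iexp (- (t * (x - h * v))) * \<psi> t \<partial>lborel) * K v"
        by (rule integral_mult_left_zero)
      also have "(\<integral>t. iexp (- (t * (x - h * v))) * \<psi> t \<partial>lborel) = 2 * pi * f (x - h * v)"
        unfolding of_real_mult[of "2 * pi"] inv by simp
      finally show ?thesis by (simp add: mult.assoc)
    qed
    have inner2: "(\<integral>v. ?H v t \<partial>lborel) = iexp (- (t * x)) * \<psi> t * fourier K (h * t)" for t
    proof -
      have "?H v t = (iexp (- (t * x)) * \<psi> t) * (iexp (h * t * v) * K v)" for v
      proof -
        have "- (t * (x - h * v)) = - (t * x) + h * t * v" by (simp add: algebra_simps)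
        then have "iexp (- (t * (x - h * v))) = iexp (- (t * x)) * iexp (h * t * v)" by (simp only: of_real_add distrib_left exp_add)
        then show ?thesis by (simp only: mult_ac)
      qed
      then show ?thesis unfolding fourier_def by (simp only: integral_mult_right_zero)
    qed
    have fubini: "(\<integral>v. 2 * pi * (f (x - h * v) * K v) \<partial>lborel) = (\<integral>t. iexp (- (t * x)) * \<psi> t * fourier K (h * t) \<partial>lborel)"
    proof -
      have "(\<integral>v. complex_of_real (2 * pi * (f (x - h * v) * K v)) \<partial>lborel) = (\<integral>v. (\<integral>t. ?H v t \<partial>lborel) \<partial>lborel)"
        unfolding inner1 by simp
      also have "\<dots> = (\<integral>t. (\<integral>v. ?H v t \<partial>lborel) \<partial>lborel)"
        by (rule lborel_pair.Fubini_integral[OF Hint, symmetric])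
      finally show ?thesis unfolding inner2 by (simp only: integral_complex_of_real)
    qed
    have sub: "h * (\<integral>t. iexp (- (t * x)) * \<psi> t * fourier K (h * t) \<partial>lborel) = (\<integral>s. ?G s \<partial>lborel)"
    proof -
      have "(\<integral>t. iexp (- (t * x)) * \<psi> t * fourier K (h * t) \<partial>lborel)
          = \<bar>1 / h\<bar> *\<^sub>R (\<integral>s. iexp (- ((0 + 1 / h * s) * x)) * \<psi> (0 + 1 / h * s) * fourier K (h * (0 + 1 / h * s)) \<partial>lborel)"
        by (rule lborel_integral_real_affine) (use h in auto)
      also have "(\<lambda>s. iexp (- ((0 + 1 / h * s) * x)) * \<psi> (0 + 1 / h * s) * fourier K (h * (0 + 1 / h * s))) = ?G"
        using h by (simp add: fun_eq_iff mult_ac)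
      finally show ?thesis using h by (simp add: scaleR_conv_of_real)
    qed
    have G_int: "integrable lborel ?G"
    proof (rule L1_bound)
      show "integrable lborel (\<lambda>s. (\<integral>x. \<bar>K x\<bar> \<partial>lborel) * cmod (\<psi> (s / h)))"
        using lborel_integrable_real_affine[OF \<psi>_int, of "1 / h" 0] h by (intro integrable_mult_right) auto
      show "AE s in lborel. norm (?G s) \<le> norm ((\<integral>x. \<bar>K x\<bar> \<partial>lborel) * cmod (\<psi> (s / h)))"
        using mult_right_mono[OF fourier_bound[of K]] by (intro AE_I2) (simp add: norm_mult)
    qed measurable
    have \<psi>_cnj: "\<psi> (- t) = cnj (\<psi> t)" for t
    proof -
      have "\<psi> (- t) = (\<integral>x. cnj (iexp (t * x) * complex_of_real (f x)) \<partial>lborel)"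
        unfolding \<psi> by (intro lebesgue_cong refl) (simp add: exp_cnj)
      then show ?thesis unfolding \<psi> by (simp only: Bochner_Integration.integral_cnj)
    qed
    have G_fold: "(\<integral>s. ?G s \<partial>lborel) = of_real (2 * Re ?J)"
    proof -
      have "?G (- s) = cnj (?G s)" for s using \<psi>_cnj[of "s / h"] fourier_cnj[of K s] by (simp add: exp_cnj)
      then have "(\<integral>s. ?G s \<partial>lborel) = of_real (2 * Re (\<integral>s. indicator {0..} s * ?G s \<partial>lborel))"
        by (rule conj_symmetric_integral[OF G_int])
      also have "(\<lambda>s. indicator {0..} s * ?G s) = (\<lambda>s. indicator {0..1} s * ?G s)" using supp by (auto simp: fun_eq_iff indicator_def)
      finally show ?thesis .
    qed
    let ?I = "\<integral>v. f (x - h * v) * K v \<partial>lborel"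
    have "complex_of_real (h * (2 * pi * ?I)) = of_real (2 * Re ?J)"
      using fubini sub G_fold by (simp only: of_real_mult[of h] integral_mult_right_zero)
    then have J: "1 / pi * Re ?J = h * ?I" by (simp only: of_real_eq_iff) (simp add: field_simps)
    have f_eq: "f (x - h * v) * K v = \<delta> x (- h * v) * K v + (\<Sum>j\<le>k. ((deriv ^^ j) f x / fact j * (- h) ^ j) * (v ^ j * K v))" for v
    proof -
      have "f (x - h * v) = \<delta> x (- h * v) + (\<Sum>j\<le>k. (deriv ^^ j) f x / fact j * (- h * v) ^ j)" unfolding \<delta>_def by simp
      then show ?thesis unfolding power_mult_distrib by (simp add: distrib_right sum_distrib_right mult.assoc)
    qed
    have d_le: "\<bar>\<delta> x (- h * v) * K v\<bar> \<le> (B / fact k * h powr \<beta>) * (\<bar>v\<bar> powr \<beta> * \<bar>K v\<bar>)" for v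
    proof -
      have "\<bar>\<delta> x (- h * v)\<bar> \<le> B / fact k * h powr \<beta> * \<bar>v\<bar> powr \<beta>"
        using taylor[of x "- h * v"] h by (simp add: abs_mult powr_mult)
      from mult_right_mono[OF this abs_ge_zero[of "K v"]] show ?thesis by (simp only: abs_mult mult.assoc)
    qed
    have b_int: "integrable lborel (\<lambda>v. (B / fact k * h powr \<beta>) * (\<bar>v\<bar> powr \<beta> * \<bar>K v\<bar>))"
      using K\<beta> by (rule integrable_mult_right)
    have d_int: "integrable lborel (\<lambda>v. \<delta> x (- h * v) * K v)"
    proof (rule L1_bound[OF b_int])
      show "(\<lambda>v. \<delta> x (- h * v) * K v) \<in> borel_measurable lborel" unfolding \<delta>_def by measurable
      show "AE v in lborel. norm (\<delta> x (- h * v) * K v) \<le> norm ((B / fact k * h powr \<beta>) * (\<bar>v\<bar> powr \<beta> * \<bar>K v\<bar>))"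
        using d_le order_trans[OF _ abs_ge_self] by (intro AE_I2) (simp only: real_norm_def, blast)
    qed
    have "?I = (\<integral>v. \<delta> x (- h * v) * K v \<partial>lborel) + (\<integral>v. (\<Sum>j\<le>k. ((deriv ^^ j) f x / fact j * (- h) ^ j) * (v ^ j * K v)) \<partial>lborel)"
      unfolding f_eq by (rule lebesgue_add[OF d_int]) (use Kj in auto)
    also have "(\<integral>v. (\<Sum>j\<le>k. ((deriv ^^ j) f x / fact j * (- h) ^ j) * (v ^ j * K v)) \<partial>lborel)
        = (\<Sum>j\<le>k. ((deriv ^^ j) f x / fact j * (- h) ^ j) * (\<integral>v. v ^ j * K v \<partial>lborel))"
      using Kj by (subst lebesgue_sum) auto
    also have "\<dots> = (\<Sum>j\<in>{0}. ((deriv ^^ j) f x / fact j * (- h) ^ j) * (\<integral>v. v ^ j * K v \<partial>lborel))"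
      using K_orth by (intro sum.mono_neutral_right) auto
    also have "\<dots> = f x" using K1 by simp
    finally have "\<bar>?I - f x\<bar> = \<bar>\<integral>v. \<delta> x (- h * v) * K v \<partial>lborel\<bar>" by simp
    also have "\<dots> \<le> (\<integral>v. (B / fact k * h powr \<beta>) * (\<bar>v\<bar> powr \<beta> * \<bar>K v\<bar>) \<partial>lborel)"
      by (rule order_trans[OF integral_abs_bound integral_mono[OF integrable_abs[OF d_int] b_int d_le]])
    also have "\<dots> = C * h powr \<beta>" by (simp add: C_def)
    finally have "h * \<bar>?I - f x\<bar> \<le> h * (C * h powr \<beta>)" using h by (intro mult_left_mono) auto
    moreover have "\<bar>1 / pi * Re ?J - h * f x\<bar> = h * \<bar>?I - f x\<bar>"
      unfolding J right_diff_distrib[symmetric] using h by (simp add: abs_mult)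
    moreover have "h * (C * h powr \<beta>) = C * h powr (1 + \<beta>)" using h by (simp add: powr_add)
    ultimately show ?thesis by simp
  qed
  then show ?thesis using C by blast
qed

section \<open>Reduction of band-limited integrals to a single frequency\<close>
lemma iexp_lipschitz: "cmod (iexp a - iexp b) \<le> \<bar>a - b\<bar>"
proof -
  have "iexp a - iexp b = iexp b * (iexp (a - b) - 1)" by (simp add: right_diff_distrib mult_exp_exp algebra_simps)
  then have "cmod (iexp a - iexp b) = cmod (iexp (a - b) - 1)" by (simp only: norm_mult norm_exp_i_times mult_1)
  also have "\<dots> \<le> \<bar>a - b\<bar>" using iexp_approx1[of "a - b" 0] by simp
  finally show ?thesis .
qed

lemma emp_cf_cnj: "emp_cf n y (- s) = cnj (emp_cf n y s)"
  unfolding emp_cf_def by (simp add: exp_cnj)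

lemma emp_cf_continuous: "continuous_on A (emp_cf n y)"
  unfolding emp_cf_def[abs_def] divide_inverse by (intro continuous_intros)

lemma emp_cf_measurable [measurable]: "emp_cf n y \<in> borel_measurable borel"
  by (rule borel_measurable_continuous_onI[OF emp_cf_continuous])

lemma emp_cf_norm_le: "cmod (emp_cf n y s) \<le> 1"
proof (cases "n = 0")
  case False
  have "cmod (\<Sum>j<n. iexp (s * y j)) \<le> (\<Sum>j<n. cmod (iexp (s * y j)))" by (rule norm_sum)
  then have "cmod (\<Sum>j<n. iexp (s * y j)) \<le> real n" by simp
  then show ?thesis using False by (simp add: emp_cf_def norm_divide divide_le_eq)
qed (simp add: emp_cf_def)

definition multiplier_cf :: "nat \<Rightarrow> (nat \<Rightarrow> real) \<Rightarrow> (nat \<Rightarrow> real) \<Rightarrow> real \<Rightarrow> complex" where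
  "multiplier_cf n y z s = (\<Sum>j<n. z j * iexp (s * y j)) / sqrt (real n)"

lemma multiplier_cf_measurable [measurable]: "multiplier_cf n y z \<in> borel_measurable borel"
  unfolding multiplier_cf_def by measurable

lemma multiplier_cf_bounded: "cmod (multiplier_cf n y z s) \<le> (\<Sum>j<n. \<bar>z j\<bar>) / sqrt (real n)"
proof -
  have "cmod (\<Sum>j<n. z j * iexp (s * y j)) \<le> (\<Sum>j<n. cmod (z j * iexp (s * y j)))" by (rule norm_sum)
  then show ?thesis by (simp add: multiplier_cf_def norm_divide norm_mult divide_right_mono)
qed

context supersmooth_edge
begin

definition height :: "real \<Rightarrow> real" where
  "height h = edge_const * edge_scale h"

definition emp_weight :: "real \<Rightarrow> nat \<Rightarrow> (nat \<Rightarrow> real) \<Rightarrow> real \<Rightarrow> complex" where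
  "emp_weight h m e t = indicator {0..1} t * (fourier K t / emp_cf m e (t / h))"

text \<open>Closeness relative to \<open>\<phi>\<close>, since the inverse of \<open>\<phi>\<close> amplifies absolute errors without bound.\<close>

definition rel_close :: "real \<Rightarrow> real \<Rightarrow> nat \<Rightarrow> (nat \<Rightarrow> real) \<Rightarrow> bool" where
  "rel_close r h m e \<longleftrightarrow> (\<forall>s. \<bar>s\<bar> \<le> 1 / h \<longrightarrow> cmod (emp_cf m e s - \<phi> s) \<le> r * cmod (\<phi> s))"

definition edge_gap :: "real \<Rightarrow> (real \<Rightarrow> complex) \<Rightarrow> real" where
  "edge_gap h G = (\<integral>t. cmod (weight h t) * cmod (G (t / h) - G (1 / h)) \<partial>lborel) / height h"

text \<open>The four functionals \<open>edge_gap\<close>, \<open>mass\<close>, \<open>spread\<close> and \<open>edge_dev\<close> are relative to \<open>height h\<close>, the asymptotic total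
  mass. The extra \<open>h\<close> in \<open>spread\<close> measures distances on the frequency scale \<open>t / h\<close>; it tends to \<open>0\<close> because the
  weight has width \<open>h powr \<gamma>\<close> with \<open>\<gamma> > 1\<close>.\<close>

definition mass :: "real \<Rightarrow> real" where
  "mass h = (\<integral>t. cmod (weight h t) \<partial>lborel) / height h"

definition spread :: "real \<Rightarrow> real" where
  "spread h = (\<integral>t. cmod (weight h t) * (1 - t) \<partial>lborel) / (h * height h)"

definition edge_dev :: "real \<Rightarrow> real" where
  "edge_dev h = cmod ((\<integral>t. weight h t \<partial>lborel) - height h) / height h"

lemma edge_const_pos: "0 < edge_const"
proof -
  have 1: "0 < inverse (real (Suc n))" for n by simp
  show ?thesis by (rule weight_limit(2)[of "\<lambda>n. inverse (real (Suc n))", OF 1 LIMSEQ_inverse_real_of_nat])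
qed

lemma height_pos: "0 < h \<Longrightarrow> 0 < height h"
  unfolding height_def by (intro mult_pos_pos edge_const_pos edge_scale_pos)

lemma weight_integrable:
  assumes "0 < h" "h \<le> 1"
  shows "integrable lborel (weight h)" "integrable lborel (\<lambda>t. cmod (weight h t) * (1 - t))"
  using weight_integrals_bound assms by auto

lemma fourier_supp: "1 < \<bar>t\<bar> \<Longrightarrow> fourier K t = 0"
proof (rule ccontr)
  assume t: "1 < \<bar>t\<bar>" "fourier K t \<noteq> 0"
  have "t \<in> closure {t. fourier K t \<noteq> 0}" by (rule subsetD[OF closure_subset]) (use t in simp)
  then have "t \<in> {-1..1}" by (simp only: supp)
  then show False using t by auto
qed

lemma emp_weight_measurable [measurable]: "emp_weight h m e \<in> borel_measurable borel"
  unfolding emp_weight_def by measurable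

lemma rel_close_lower:
  assumes "rel_close r h m e" "r \<le> 1/2" "\<bar>s\<bar> \<le> 1 / h"
  shows "cmod (\<phi> s) / 2 \<le> cmod (emp_cf m e s)" "emp_cf m e s \<noteq> 0"
proof -
  have "cmod (emp_cf m e s - \<phi> s) \<le> r * cmod (\<phi> s)" using assms unfolding rel_close_def by blast
  also have "\<dots> \<le> 1/2 * cmod (\<phi> s)" using assms(2) by (intro mult_right_mono) auto
  finally show 1: "cmod (\<phi> s) / 2 \<le> cmod (emp_cf m e s)"
    using norm_triangle_ineq2[of "\<phi> s" "emp_cf m e s"] by (simp add: norm_minus_commute)
  show "emp_cf m e s \<noteq> 0" using 1 \<phi>_nz[of s] by auto
qed

lemma emp_weight_diff_le:
  assumes rc: "rel_close r h m e" "r \<le> 1/2" and h: "0 < h"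
  shows "cmod (emp_weight h m e t - weight h t) \<le> 2 * (cmod (weight h t) / cmod (\<phi> (t / h)) * cmod (emp_cf m e (t / h) - \<phi> (t / h)))"
    and "cmod (emp_weight h m e t - weight h t) \<le> 2 * r * cmod (weight h t)"
    and "cmod (emp_weight h m e t) \<le> 2 * cmod (weight h t)"
proof -
  consider "t \<notin> {0..1}" | "t \<in> {0..1}" by blast
  then have *: "cmod (emp_weight h m e t - weight h t) \<le> 2 * (cmod (weight h t) / cmod (\<phi> (t / h)) * cmod (emp_cf m e (t / h) - \<phi> (t / h)))
    \<and> cmod (emp_weight h m e t - weight h t) \<le> 2 * r * cmod (weight h t)
    \<and> cmod (emp_weight h m e t) \<le> 2 * cmod (weight h t)"
  proof cases
    case 1
    then show ?thesis by (auto simp: emp_weight_def weight_def)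
  next
    case 2
    let ?s = "t / h"
    have s: "\<bar>?s\<bar> \<le> 1 / h" using 2 h by (simp add: divide_right_mono)
    note lo = rel_close_lower[OF rc s]
    have w: "weight h t = fourier K t / \<phi> ?s" "emp_weight h m e t = fourier K t / emp_cf m e ?s"
      using 2 by (auto simp: weight_def emp_weight_def)
    have p: "0 < cmod (\<phi> ?s)" using \<phi>_nz by simp
    have inv_le: "1 / cmod (emp_cf m e ?s) \<le> 2 / cmod (\<phi> ?s)" using lo p by (simp add: field_simps)
    have eq: "emp_weight h m e t - weight h t = weight h t * ((\<phi> ?s - emp_cf m e ?s) / emp_cf m e ?s)"
      using lo(2) \<phi>_nz[of ?s] unfolding w by (simp add: field_simps)
    have "cmod (emp_weight h m e t - weight h t) = cmod (weight h t) * cmod (emp_cf m e ?s - \<phi> ?s) * (1 / cmod (emp_cf m e ?s))"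
      unfolding eq by (simp add: norm_mult norm_divide norm_minus_commute)
    also have "\<dots> \<le> cmod (weight h t) * cmod (emp_cf m e ?s - \<phi> ?s) * (2 / cmod (\<phi> ?s))"
      using inv_le by (intro mult_left_mono) auto
    also have "\<dots> = 2 * (cmod (weight h t) / cmod (\<phi> ?s) * cmod (emp_cf m e ?s - \<phi> ?s))" by (simp only: divide_inverse mult_ac)
    finally have a: "cmod (emp_weight h m e t - weight h t) \<le> 2 * (cmod (weight h t) / cmod (\<phi> ?s) * cmod (emp_cf m e ?s - \<phi> ?s))" .
    also have "\<dots> \<le> 2 * (cmod (weight h t) / cmod (\<phi> ?s) * (r * cmod (\<phi> ?s)))"
      using rc(1) s unfolding rel_close_def by (intro mult_left_mono) auto
    also have "\<dots> = 2 * r * cmod (weight h t)" using p by simp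
    finally have b: "cmod (emp_weight h m e t - weight h t) \<le> 2 * r * cmod (weight h t)" .
    have "cmod (emp_weight h m e t) = cmod (fourier K t) * (1 / cmod (emp_cf m e ?s))" unfolding w by (simp add: norm_divide)
    also have "\<dots> \<le> cmod (fourier K t) * (2 / cmod (\<phi> ?s))" using inv_le by (intro mult_left_mono) auto
    also have "\<dots> = 2 * cmod (weight h t)" unfolding w by (simp add: norm_divide)
    finally show ?thesis using a b by blast
  qed
  then show "cmod (emp_weight h m e t - weight h t) \<le> 2 * (cmod (weight h t) / cmod (\<phi> (t / h)) * cmod (emp_cf m e (t / h) - \<phi> (t / h)))"
    and "cmod (emp_weight h m e t - weight h t) \<le> 2 * r * cmod (weight h t)"
    and "cmod (emp_weight h m e t) \<le> 2 * cmod (weight h t)" by auto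
qed

lemma emp_weight_integrable:
  assumes rc: "rel_close r h m e" "r \<le> 1/2" and h: "0 < h" "h \<le> 1"
    and [measurable]: "G \<in> borel_measurable borel" and G: "\<And>t. cmod (G t) \<le> B"
  shows "integrable lborel (\<lambda>t. emp_weight h m e t * G t)"
proof (rule L1_bound)
  show "integrable lborel (\<lambda>t. 2 * B * cmod (weight h t))" using weight_integrable(1)[OF h] by auto
  show "AE t in lborel. norm (emp_weight h m e t * G t) \<le> norm (2 * B * cmod (weight h t))"
  proof (rule AE_I2)
    fix t
    have "norm (emp_weight h m e t * G t) \<le> (2 * cmod (weight h t)) * B"
      unfolding norm_mult by (intro mult_mono emp_weight_diff_le(3)[OF rc h(1)] G) auto
    then show "norm (emp_weight h m e t * G t) \<le> norm (2 * B * cmod (weight h t))"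
      using abs_ge_self[of "2 * B * cmod (weight h t)"] by (simp add: mult_ac)
  qed
qed measurable

text \<open>The values at \<open>- t\<close> are complex conjugates of those at \<open>t\<close>, so the kernel is twice the real part of the half-line
  integral.\<close>

lemma dec_kernel_fold:
  assumes nz: "\<And>s. \<bar>s\<bar> \<le> 1 / h \<Longrightarrow> emp_cf m e s \<noteq> 0" and h: "0 < h"
  shows "dec_kernel K h m e x = 1 / pi * Re (\<integral>t. emp_weight h m e t * iexp (- (t * x)) \<partial>lborel)"
    and "integrable lborel (\<lambda>t. iexp (- (t * x)) * (fourier K t / emp_cf m e (t / h)))"
    and "integrable lborel (emp_weight h m e)"
proof -
  let ?G = "\<lambda>t. iexp (- (t * x)) * (fourier K t / emp_cf m e (t / h))"
  have "compact ((\<lambda>s. 1 / cmod (emp_cf m e s)) ` {-(1/h)..1/h})"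
    by (intro compact_continuous_image continuous_intros emp_cf_continuous) (use nz in \<open>auto simp: abs_le_iff\<close>)
  then obtain b where "\<forall>v\<in>(\<lambda>s. 1 / cmod (emp_cf m e s)) ` {-(1/h)..1/h}. norm v \<le> b"
    using compact_imp_bounded bounded_iff by blast
  then have b: "1 / cmod (emp_cf m e s) \<le> b" if "\<bar>s\<bar> \<le> 1 / h" for s using that by (force simp: abs_le_iff)
  define A where "A = (\<integral>x. \<bar>K x\<bar> \<partial>lborel)"
  have A: "0 \<le> A" by (simp add: A_def)
  have b0: "0 \<le> b" using b[of 0] h order_trans[OF _ b[of 0]] by simp
  have bound: "cmod (fourier K t / emp_cf m e (t / h)) \<le> A * b * indicator {-1..1} t" for t
  proof (cases "\<bar>t\<bar> \<le> 1")
    case True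
    have "\<bar>t / h\<bar> \<le> 1 / h" using True h by (simp add: divide_right_mono)
    from mult_mono[OF fourier_bound[of K t] b[OF this]] show ?thesis using True A by (simp add: norm_divide A_def abs_le_iff)
  next
    case False
    then show ?thesis using fourier_supp[of t] by (auto simp: indicator_def abs_le_iff)
  qed
  have ind: "integrable lborel (\<lambda>t::real. A * b * indicator {-1..1} t)" by (intro integrable_mult_right) simp
  show G_int: "integrable lborel ?G"
  proof (rule L1_bound[OF ind])
    show "AE t in lborel. norm (?G t) \<le> norm (A * b * indicator {-1..1} t)"
    proof (rule AE_I2)
      fix t
      have "norm (?G t) = cmod (fourier K t / emp_cf m e (t / h))" by (simp only: norm_mult norm_exp_i_times mult_1)
      then show "norm (?G t) \<le> norm (A * b * indicator {-1..1} t)" using bound[of t] A b0 by (simp add: abs_mult)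
    qed
  qed measurable
  show "integrable lborel (emp_weight h m e)"
  proof (rule L1_bound[OF ind])
    show "AE t in lborel. norm (emp_weight h m e t) \<le> norm (A * b * indicator {-1..1} t)"
    proof (rule AE_I2)
      fix t
      have "norm (emp_weight h m e t) \<le> cmod (fourier K t / emp_cf m e (t / h))" by (simp add: emp_weight_def indicator_def)
      then show "norm (emp_weight h m e t) \<le> norm (A * b * indicator {-1..1} t)" using bound[of t] A b0 by (simp add: abs_mult)
    qed
  qed measurable
  have "?G (- t) = cnj (?G t)" for t using emp_cf_cnj[of m e "t / h"] fourier_cnj[of K t] by (simp add: exp_cnj)
  then have "(\<integral>t. ?G t \<partial>lborel) = of_real (2 * Re (\<integral>t. indicator {0..} t * ?G t \<partial>lborel))"
    by (rule conj_symmetric_integral[OF G_int])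
  also have "(\<lambda>t. indicator {0..} t * ?G t) = (\<lambda>t. emp_weight h m e t * iexp (- (t * x)))"
    using fourier_supp by (auto simp: fun_eq_iff emp_weight_def indicator_def)
  finally have "1 / (2 * complex_of_real pi) * (\<integral>t. ?G t \<partial>lborel)
      = complex_of_real (1 / pi * Re (\<integral>t. emp_weight h m e t * iexp (- (t * x)) \<partial>lborel))" by simp
  then show "dec_kernel K h m e x = 1 / pi * Re (\<integral>t. emp_weight h m e t * iexp (- (t * x)) \<partial>lborel)"
    unfolding dec_kernel_def by (simp only: Re_complex_of_real)
qed

definition band_transform :: "real \<Rightarrow> nat \<Rightarrow> (nat \<Rightarrow> real) \<Rightarrow> (real \<Rightarrow> complex) \<Rightarrow> real \<Rightarrow> real" where
  "band_transform h m e G x = Re (\<integral>t. emp_weight h m e t * (iexp (- (t * x / h)) * G (t / h)) \<partial>lborel)"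

lemma dec_kernel_sum:
  fixes y z :: "nat \<Rightarrow> real"
  assumes rc: "rel_close r h m e" "r \<le> 1/2" and h: "0 < h" "h \<le> 1"
  shows "(\<Sum>j<n. z j * dec_kernel K h m e ((x - y j) / h))
      = 1 / pi * band_transform h m e (\<lambda>s. \<Sum>j<n. z j * iexp (s * y j)) x"
proof -
  have dk: "dec_kernel K h m e ((x - y j) / h) = 1 / pi * Re (\<integral>t. emp_weight h m e t * (iexp (- (t * x / h)) * iexp (t / h * y j)) \<partial>lborel)" for j
  proof -
    have "iexp (- (t * ((x - y j) / h))) = iexp (- (t * x / h)) * iexp (t / h * y j)" for t
    proof -
      have "- (t * ((x - y j) / h)) = - (t * x / h) + t / h * y j" unfolding diff_divide_distrib right_diff_distrib by simp
      then show ?thesis by (simp only: of_real_add distrib_left exp_add)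
    qed
    then show ?thesis using dec_kernel_fold(1)[OF rel_close_lower(2)[OF rc] h(1), of "(x - y j) / h"] by simp
  qed
  have int: "integrable lborel (\<lambda>t. emp_weight h m e t * (iexp (- (t * x / h)) * iexp (t / h * y j)))" for j
    by (rule emp_weight_integrable[OF rc h, where B=1]) (auto simp: norm_mult)
  have "(\<Sum>j<n. z j * dec_kernel K h m e ((x - y j) / h))
      = 1 / pi * Re (\<Sum>j<n. of_real (z j) * (\<integral>t. emp_weight h m e t * (iexp (- (t * x / h)) * iexp (t / h * y j)) \<partial>lborel))"
    unfolding dk by (simp add: sum_distrib_left mult.left_commute del: times_divide_eq_left times_divide_eq_right)
  also have "(\<Sum>j<n. of_real (z j) * (\<integral>t. emp_weight h m e t * (iexp (- (t * x / h)) * iexp (t / h * y j)) \<partial>lborel))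
      = (\<integral>t. (\<Sum>j<n. of_real (z j) * (emp_weight h m e t * (iexp (- (t * x / h)) * iexp (t / h * y j)))) \<partial>lborel)"
    using int by (subst lebesgue_sum) auto
  also have "\<dots> = (\<integral>t. emp_weight h m e t * (iexp (- (t * x / h)) * (\<Sum>j<n. z j * iexp (t / h * y j))) \<partial>lborel)"
    by (simp only: sum_distrib_left mult_ac)
  finally show ?thesis by (simp only: band_transform_def)
qed

text \<open>The heart of the proof: an integral against the empirical weight is nearly the total mass of the weight times the
  integrand at \<open>t = 1\<close>. The four errors are the variation of \<open>G\<close> near the edge (\<open>edge_gap\<close>), the rotation of
  \<open>iexp (- (t * x / h))\<close> over the width of the weight (\<open>spread\<close>), the relative error of the empirical
  characteristic function (\<open>r * mass\<close>), and the deviation of the mass from its limit (\<open>edge_dev\<close>).\<close>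

lemma edge_approximation:
  assumes rc: "rel_close r h m e" "r \<le> 1/2" and h: "0 < h" "h \<le> 1"
    and [measurable]: "G \<in> borel_measurable borel" and G: "\<And>s. cmod (G s) \<le> B" and x: "\<bar>x\<bar> \<le> X"
  shows "\<bar>band_transform h m e G x / height h - Re (iexp (- (x / h)) * G (1 / h))\<bar>
      \<le> 2 * edge_gap h G + (2 * X * spread h + 2 * r * mass h + edge_dev h) * cmod (G (1 / h))"
proof -
  let ?w = "weight h" and ?v = "emp_weight h m e" and ?g = "cmod (G (1 / h))"
  let ?c = "iexp (- (x / h)) * G (1 / h)"
  let ?D = "\<lambda>t. iexp (- (t * x / h)) * G (t / h) - ?c"
  have H: "0 < height h" by (rule height_pos[OF h(1)])
  have X0: "0 \<le> X" using x by linarith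
  have B0: "0 \<le> B" using order_trans[OF norm_ge_zero G[of 0]] .
  have i1: "integrable lborel (\<lambda>t. ?v t * (iexp (- (t * x / h)) * G (t / h)))"
    by (rule emp_weight_integrable[OF rc h, where B=B]) (use G in \<open>auto simp: norm_mult\<close>)
  have i2: "integrable lborel (\<lambda>t. ?v t * ?c)"
    by (rule emp_weight_integrable[OF rc h, where B=B]) (use G in \<open>auto simp: norm_mult\<close>)
  have iv: "integrable lborel ?v" using emp_weight_integrable[OF rc h, of "\<lambda>_. 1" 1] by simp
  have iw: "integrable lborel ?w" "integrable lborel (\<lambda>t. cmod (?w t))" using weight_integrable(1)[OF h] by auto
  have ig: "integrable lborel (\<lambda>t. cmod (?w t) * cmod (G (t / h) - G (1 / h)))"
  proof (rule L1_bound)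
    show "integrable lborel (\<lambda>t. cmod (?w t) * (2 * B))" using iw(2) by auto
    show "AE t in lborel. norm (cmod (?w t) * cmod (G (t / h) - G (1 / h))) \<le> norm (cmod (?w t) * (2 * B))"
    proof (rule AE_I2)
      fix t
      have "cmod (G (t / h) - G (1 / h)) \<le> 2 * B" using norm_triangle_le_diff[OF add_mono[OF G[of "t / h"] G[of "1 / h"]]] by simp
      then show "norm (cmod (?w t) * cmod (G (t / h) - G (1 / h))) \<le> norm (cmod (?w t) * (2 * B))" using B0 by (simp add: abs_mult mult_left_mono)
    qed
  qed measurable
  have isp: "integrable lborel (\<lambda>t. cmod (?w t) * (1 - t))" by (rule weight_integrable(2)[OF h])
  have step: "(\<integral>t. ?v t * (iexp (- (t * x / h)) * G (t / h)) \<partial>lborel) - of_real (height h) * ?c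
      = (\<integral>t. ?v t * ?D t \<partial>lborel) + ((\<integral>t. ?v t \<partial>lborel) - height h) * ?c"
  proof -
    have "(\<integral>t. ?v t * ?D t \<partial>lborel) = (\<integral>t. ?v t * (iexp (- (t * x / h)) * G (t / h)) - ?v t * ?c \<partial>lborel)"
      by (simp only: right_diff_distrib)
    also have "\<dots> = (\<integral>t. ?v t * (iexp (- (t * x / h)) * G (t / h)) \<partial>lborel) - (\<integral>t. ?v t * ?c \<partial>lborel)"
      by (rule lebesgue_diff[OF i1 i2])
    also have "(\<integral>t. ?v t * ?c \<partial>lborel) = (\<integral>t. ?v t \<partial>lborel) * ?c" by (rule integral_mult_left_zero)
    finally show ?thesis by (simp only: left_diff_distrib) simp
  qed
  have D_le: "cmod (?v t * ?D t) \<le> 2 * (cmod (?w t) * cmod (G (t / h) - G (1 / h))) + (2 * X / h * ?g) * (cmod (?w t) * (1 - t))" for t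
  proof (cases "t \<in> {0..1}")
    case False
    then show ?thesis by (simp add: emp_weight_def weight_def)
  next
    case True
    have "?D t = iexp (- (t * x / h)) * (G (t / h) - G (1 / h)) + (iexp (- (t * x / h)) - iexp (- (x / h))) * G (1 / h)" by (simp add: algebra_simps)
    then have "cmod (?D t) \<le> cmod (iexp (- (t * x / h)) * (G (t / h) - G (1 / h))) + cmod ((iexp (- (t * x / h)) - iexp (- (x / h))) * G (1 / h))"
      by (simp only: norm_triangle_ineq)
    also have "\<dots> = cmod (G (t / h) - G (1 / h)) + cmod (iexp (- (t * x / h)) - iexp (- (x / h))) * ?g"
      by (simp only: norm_mult norm_exp_i_times mult_1)
    also have "cmod (iexp (- (t * x / h)) - iexp (- (x / h))) \<le> X / h * (1 - t)"
    proof -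
      have "- (t * x / h) - - (x / h) = (1 - t) * x / h" by (simp add: algebra_simps diff_divide_distrib)
      then have "cmod (iexp (- (t * x / h)) - iexp (- (x / h))) \<le> \<bar>(1 - t) * x / h\<bar>"
        using iexp_lipschitz[of "- (t * x / h)" "- (x / h)"] by (simp only:)
      also have "\<dots> = (1 - t) / h * \<bar>x\<bar>" using True h by (simp add: abs_mult)
      also have "\<dots> \<le> (1 - t) / h * X" using True h x by (intro mult_left_mono) auto
      finally show ?thesis by (simp add: mult_ac)
    qed
    finally have "cmod (?D t) \<le> cmod (G (t / h) - G (1 / h)) + X / h * (1 - t) * ?g" by (simp add: mult_right_mono)
    then have "cmod (?v t * ?D t) \<le> (2 * cmod (?w t)) * (cmod (G (t / h) - G (1 / h)) + X / h * (1 - t) * ?g)"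
      unfolding norm_mult[of "?v t"] by (intro mult_mono emp_weight_diff_le(3)[OF rc h(1)]) auto
    also have "\<dots> = 2 * (cmod (?w t) * cmod (G (t / h) - G (1 / h))) + (2 * X / h * ?g) * (cmod (?w t) * (1 - t))"
      unfolding distrib_left by (simp only: divide_inverse mult_ac)
    finally show ?thesis .
  qed
  have ib: "integrable lborel (\<lambda>t. 2 * (cmod (?w t) * cmod (G (t / h) - G (1 / h))) + (2 * X / h * ?g) * (cmod (?w t) * (1 - t)))"
    by (intro L1_add integrable_mult_right ig isp)
  have iD: "integrable lborel (\<lambda>t. ?v t * ?D t)" unfolding right_diff_distrib by (rule L1_diff[OF i1 i2])
  have "cmod (\<integral>t. ?v t * ?D t \<partial>lborel) \<le> (\<integral>t. cmod (?v t * ?D t) \<partial>lborel)" by (rule integral_norm_bound)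
  also have "\<dots> \<le> (\<integral>t. 2 * (cmod (?w t) * cmod (G (t / h) - G (1 / h))) + (2 * X / h * ?g) * (cmod (?w t) * (1 - t)) \<partial>lborel)"
    by (rule integral_mono[OF integrable_norm[OF iD] ib D_le])
  also have "\<dots> = 2 * (\<integral>t. cmod (?w t) * cmod (G (t / h) - G (1 / h)) \<partial>lborel) + (2 * X / h * ?g) * (\<integral>t. cmod (?w t) * (1 - t) \<partial>lborel)"
    using ig isp by simp
  finally have b1: "cmod (\<integral>t. ?v t * ?D t \<partial>lborel) \<le> 2 * (edge_gap h G * height h) + (2 * X * ?g) * (spread h * height h)"
    using H h unfolding edge_gap_def spread_def by simp
  have "cmod ((\<integral>t. ?v t \<partial>lborel) - (\<integral>t. ?w t \<partial>lborel)) = cmod (\<integral>t. ?v t - ?w t \<partial>lborel)"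
    using iv iw(1) by simp
  also have "\<dots> \<le> (\<integral>t. cmod (?v t - ?w t) \<partial>lborel)" by (rule integral_norm_bound)
  also have "\<dots> \<le> (\<integral>t. 2 * r * cmod (?w t) \<partial>lborel)"
    using iv iw by (intro integral_mono emp_weight_diff_le(2)[OF rc h(1)]) auto
  also have "\<dots> = 2 * r * (mass h * height h)" using H by (simp add: mass_def)
  finally have b2: "cmod ((\<integral>t. ?v t \<partial>lborel) - (\<integral>t. ?w t \<partial>lborel)) \<le> 2 * r * (mass h * height h)" .
  have "cmod ((\<integral>t. ?v t \<partial>lborel) - height h) \<le> 2 * r * (mass h * height h) + edge_dev h * height h"
    using norm_triangle_ineq[of "(\<integral>t. ?v t \<partial>lborel) - (\<integral>t. ?w t \<partial>lborel)" "(\<integral>t. ?w t \<partial>lborel) - height h"] b2 H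
    by (simp add: edge_dev_def)
  then have b3: "cmod (((\<integral>t. ?v t \<partial>lborel) - height h) * ?c) \<le> (2 * r * (mass h * height h) + edge_dev h * height h) * ?g"
    by (simp add: norm_mult mult_right_mono)
  have "\<bar>band_transform h m e G x - height h * Re ?c\<bar> = \<bar>Re ((\<integral>t. ?v t * (iexp (- (t * x / h)) * G (t / h)) \<partial>lborel) - of_real (height h) * ?c)\<bar>"
    by (simp add: band_transform_def)
  also have "\<dots> \<le> cmod ((\<integral>t. ?v t * ?D t \<partial>lborel) + ((\<integral>t. ?v t \<partial>lborel) - height h) * ?c)"
    unfolding step by (rule abs_Re_le_cmod)
  also have "\<dots> \<le> height h * (2 * edge_gap h G + (2 * X * spread h + 2 * r * mass h + edge_dev h) * ?g)"
    using norm_triangle_ineq[of "\<integral>t. ?v t * ?D t \<partial>lborel" "((\<integral>t. ?v t \<partial>lborel) - height h) * ?c"] b1 b3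
    by (simp add: algebra_simps)
  finally have fin: "\<bar>band_transform h m e G x - height h * Re ?c\<bar> \<le> height h * (2 * edge_gap h G + (2 * X * spread h + 2 * r * mass h + edge_dev h) * ?g)" .
  have "\<bar>band_transform h m e G x / height h - Re ?c\<bar> = \<bar>band_transform h m e G x - height h * Re ?c\<bar> / height h"
  proof -
    have "u / height h - v = (u - height h * v) / height h" for u v using H by (simp add: diff_divide_distrib)
    then show ?thesis by (simp only: abs_divide abs_of_pos[OF H])
  qed
  also have "\<dots> \<le> 2 * edge_gap h G + (2 * X * spread h + 2 * r * mass h + edge_dev h) * ?g"
    using fin H by (simp add: pos_divide_le_eq mult.commute)
  finally show ?thesis .
qed

lemma edge_gap_iexp:
  assumes h: "0 < h" "h \<le> 1"
  shows "edge_gap h (\<lambda>s. iexp (s * y)) \<le> spread h * \<bar>y\<bar>"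
proof -
  have H: "0 < height h" by (rule height_pos[OF h(1)])
  have le: "cmod (weight h t) * cmod (iexp (t / h * y) - iexp (1 / h * y)) \<le> (\<bar>y\<bar> / h) * (cmod (weight h t) * (1 - t))" for t
  proof (cases "t \<in> {0..1}")
    case True
    have "cmod (iexp (t / h * y) - iexp (1 / h * y)) \<le> \<bar>t / h * y - 1 / h * y\<bar>" by (rule iexp_lipschitz)
    also have "t / h * y - 1 / h * y = - ((1 - t) * y / h)" by (simp add: algebra_simps diff_divide_distrib)
    also have "\<bar>- ((1 - t) * y / h)\<bar> = (\<bar>y\<bar> / h) * (1 - t)" using True h by (simp add: abs_mult)
    finally have "cmod (weight h t) * cmod (iexp (t / h * y) - iexp (1 / h * y)) \<le> cmod (weight h t) * ((\<bar>y\<bar> / h) * (1 - t))"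
      by (rule mult_left_mono) simp
    then show ?thesis by (simp only: mult_ac)
  qed (simp add: weight_def)
  have ib: "integrable lborel (\<lambda>t. (\<bar>y\<bar> / h) * (cmod (weight h t) * (1 - t)))"
    by (rule integrable_mult_right[OF weight_integrable(2)[OF h]])
  have "(\<integral>t. cmod (weight h t) * cmod (iexp (t / h * y) - iexp (1 / h * y)) \<partial>lborel) \<le> (\<integral>t. (\<bar>y\<bar> / h) * (cmod (weight h t) * (1 - t)) \<partial>lborel)"
  proof (rule integral_mono[OF _ ib le])
    show "integrable lborel (\<lambda>t. cmod (weight h t) * cmod (iexp (t / h * y) - iexp (1 / h * y)))"
    proof (rule L1_bound[OF ib _ AE_I2])
      fix t
      show "norm (cmod (weight h t) * cmod (iexp (t / h * y) - iexp (1 / h * y))) \<le> norm ((\<bar>y\<bar> / h) * (cmod (weight h t) * (1 - t)))"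
        using le[of t] abs_ge_self[of "(\<bar>y\<bar> / h) * (cmod (weight h t) * (1 - t))"]
        unfolding real_norm_def abs_mult[of "cmod (weight h t)"] abs_norm_cancel by linarith
    qed measurable
  qed
  also have "\<dots> = (\<bar>y\<bar> / h) * (\<integral>t. cmod (weight h t) * (1 - t) \<partial>lborel)" by (rule integral_mult_right_zero)
  finally have "(\<integral>t. cmod (weight h t) * cmod (iexp (t / h * y) - iexp (1 / h * y)) \<partial>lborel) / height h
      \<le> (\<bar>y\<bar> / h) * (\<integral>t. cmod (weight h t) * (1 - t) \<partial>lborel) / height h" using H by (intro divide_right_mono) auto
  also have "\<dots> = spread h * \<bar>y\<bar>" unfolding spread_def by (simp add: mult.commute)
  finally show ?thesis by (simp only: edge_gap_def)
qed

end

section \<open>Studentization\<close>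
lemma sup_norm_on_close:
  assumes A: "A \<noteq> {}" and d: "\<And>x. x \<in> A \<Longrightarrow> \<bar>f x - g x\<bar> \<le> d" and B: "\<And>x. x \<in> A \<Longrightarrow> \<bar>g x\<bar> \<le> B"
  shows "\<bar>sup_norm_on A f - sup_norm_on A g\<bar> \<le> d"
    and "sup_norm_on A f \<le> c \<longleftrightarrow> (\<forall>x\<in>A. \<bar>f x\<bar> \<le> c)"
proof -
  have fB: "\<bar>f x\<bar> \<le> B + d" if "x \<in> A" for x using d[OF that] B[OF that] by linarith
  have bf: "bdd_above ((\<lambda>x. \<bar>f x\<bar>) ` A)" by (rule bdd_aboveI2[OF fB])
  have bg: "bdd_above ((\<lambda>x. \<bar>g x\<bar>) ` A)" by (rule bdd_aboveI2[OF B])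
  have 1: "sup_norm_on A f \<le> sup_norm_on A g + d" unfolding sup_norm_on_def
  proof (rule cSUP_least[OF A])
    fix x assume x: "x \<in> A"
    then show "\<bar>f x\<bar> \<le> (SUP x\<in>A. \<bar>g x\<bar>) + d" using d[OF x] cSUP_upper[OF x bg] by linarith
  qed
  have 2: "sup_norm_on A g \<le> sup_norm_on A f + d" unfolding sup_norm_on_def
  proof (rule cSUP_least[OF A])
    fix x assume x: "x \<in> A"
    then show "\<bar>g x\<bar> \<le> (SUP x\<in>A. \<bar>f x\<bar>) + d" using d[OF x] cSUP_upper[OF x bf] by linarith
  qed
  show "\<bar>sup_norm_on A f - sup_norm_on A g\<bar> \<le> d" using 1 2 by linarith
  show "sup_norm_on A f \<le> c \<longleftrightarrow> (\<forall>x\<in>A. \<bar>f x\<bar> \<le> c)"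
    unfolding sup_norm_on_def by (rule cSUP_le_iff[OF A bf])
qed

text \<open>With \<open>V\<close> close to \<open>1 / 2\<close> the quotient is \<open>sqrt 2 * N\<close> up to a relative error of the order of \<open>v\<close>.\<close>

lemma studentization_error:
  fixes N N0 V :: real
  assumes V: "\<bar>2 * V - 1\<bar> \<le> v" "v \<le> 1/2" and N: "\<bar>N - N0\<bar> \<le> \<epsilon>"
  shows "\<bar>N / sqrt V - sqrt 2 * N0\<bar> \<le> 2 * \<epsilon> + 2 * (\<bar>N0\<bar> + \<epsilon>) * v"
proof -
  define s where "s = sqrt (2 * V)"
  have V2: "1/2 \<le> 2 * V" using V by linarith
  have s0: "1/2 \<le> s" unfolding s_def using V2 real_sqrt_le_mono[of "1/4" "2 * V"] by (simp add: real_sqrt_divide)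
  have s2: "s^2 = 2 * V" using V2 by (simp add: s_def)
  have "\<bar>s - 1\<bar> * (s + 1) = \<bar>(s - 1) * (s + 1)\<bar>" using s0 by (simp add: abs_mult)
  also have "(s - 1) * (s + 1) = s^2 - 1" by (simp add: algebra_simps power2_eq_square)
  finally have "\<bar>s - 1\<bar> * (s + 1) = \<bar>s^2 - 1\<bar>" .
  then have s1: "\<bar>s - 1\<bar> * (s + 1) \<le> v" using V s2 by simp
  have "\<bar>1 / s - 1\<bar> = \<bar>s - 1\<bar> / s" using s0 by (simp add: abs_div_pos[symmetric] field_simps abs_minus_commute)
  also have "\<dots> \<le> v / (s + 1) / s" using s1 s0 by (intro divide_right_mono) (auto simp: pos_le_divide_eq)
  also have "\<dots> = v / ((s + 1) * s)" by simp
  also have "\<dots> \<le> v / (3/4)" using s0 V mult_mono[of "3/2" "s + 1" "1/2" s] by (intro divide_left_mono) auto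
  finally have inv: "\<bar>1 / s - 1\<bar> \<le> 4/3 * v" by simp
  have sq2: "sqrt 2 \<le> 3/2" by (rule real_le_lsqrt) (auto simp: power2_eq_square)
  have "sqrt V = s / sqrt 2" using V2 by (simp add: s_def real_sqrt_mult)
  then have "N / sqrt V = sqrt 2 * (N * (1 / s))" by simp
  then have "N / sqrt V - sqrt 2 * N0 = sqrt 2 * ((N - N0) + N * (1 / s - 1))" by (simp only: right_diff_distrib distrib_left)
  then have "\<bar>N / sqrt V - sqrt 2 * N0\<bar> = sqrt 2 * \<bar>(N - N0) + N * (1 / s - 1)\<bar>" by (simp add: abs_mult)
  also have "\<dots> \<le> 3/2 * (\<epsilon> + (\<bar>N0\<bar> + \<epsilon>) * (4/3 * v))"
  proof (rule mult_mono[OF sq2])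
    have "\<bar>N\<bar> * \<bar>1 / s - 1\<bar> \<le> (\<bar>N0\<bar> + \<epsilon>) * (4/3 * v)" using N inv by (intro mult_mono) auto
    then show "\<bar>(N - N0) + N * (1 / s - 1)\<bar> \<le> \<epsilon> + (\<bar>N0\<bar> + \<epsilon>) * (4/3 * v)"
      using N abs_triangle_ineq[of "N - N0" "N * (1 / s - 1)"] by (simp add: abs_mult)
  qed auto
  also have "\<dots> = 3/2 * \<epsilon> + 2 * (\<bar>N0\<bar> + \<epsilon>) * v" by simp
  also have "\<dots> \<le> 2 * \<epsilon> + 2 * (\<bar>N0\<bar> + \<epsilon>) * v" using N by simp
  finally show ?thesis .
qed

lemma empirical_variance_perturbation:
  fixes \<kappa> c e :: "nat \<Rightarrow> real"
  assumes n: "0 < n" and e: "\<And>j. j < n \<Longrightarrow> \<bar>\<kappa> j - c j\<bar> \<le> e j" and c: "\<And>j. \<bar>c j\<bar> \<le> 1"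
    and E1: "(\<Sum>j<n. e j) / real n \<le> E1" and E2: "(\<Sum>j<n. (e j)^2) / real n \<le> E2"
  shows "\<bar>2 * ((\<Sum>j<n. (\<kappa> j)^2) / real n - ((\<Sum>j<n. \<kappa> j) / real n)^2) - 1\<bar>
      \<le> 4 * E1 + 2 * E2 + \<bar>2 * ((\<Sum>j<n. (c j)^2) / real n) - 1\<bar> + 2 * (\<bar>(\<Sum>j<n. c j) / real n\<bar> + E1)^2"
    and "\<bar>(\<Sum>j<n. \<kappa> j) / real n\<bar> \<le> \<bar>(\<Sum>j<n. c j) / real n\<bar> + E1"
proof -
  have sq: "\<bar>(\<kappa> j)^2 - (c j)^2\<bar> \<le> 2 * e j + (e j)^2" if j: "j < n" for j
  proof -
    have "\<bar>(\<kappa> j)^2 - (c j)^2\<bar> = \<bar>\<kappa> j - c j\<bar> * \<bar>\<kappa> j + c j\<bar>"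
      by (simp add: abs_mult[symmetric] power2_eq_square algebra_simps)
    also have "\<dots> \<le> e j * (2 + e j)" using e[OF j] c[of j] by (intro mult_mono) auto
    finally show ?thesis by (simp add: algebra_simps power2_eq_square)
  qed
  have "\<bar>(\<Sum>j<n. (\<kappa> j)^2) - (\<Sum>j<n. (c j)^2)\<bar> \<le> (\<Sum>j<n. 2 * e j + (e j)^2)"
    unfolding sum_subtractf[symmetric] using sq by (intro order_trans[OF sum_abs] sum_mono) auto
  then have "\<bar>(\<Sum>j<n. (\<kappa> j)^2) - (\<Sum>j<n. (c j)^2)\<bar> / n \<le> (2 * (\<Sum>j<n. e j) + (\<Sum>j<n. (e j)^2)) / n"
    using n by (intro divide_right_mono) (auto simp: sum.distrib sum_distrib_left)
  then have a: "\<bar>(\<Sum>j<n. (\<kappa> j)^2) / n - (\<Sum>j<n. (c j)^2) / n\<bar> \<le> 2 * E1 + E2"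
    using n E1 E2 unfolding diff_divide_distrib[symmetric] by (simp add: abs_divide add_divide_distrib)
  have "\<bar>(\<Sum>j<n. \<kappa> j) - (\<Sum>j<n. c j)\<bar> \<le> (\<Sum>j<n. e j)"
    unfolding sum_subtractf[symmetric] using e by (intro order_trans[OF sum_abs] sum_mono) auto
  then have "\<bar>(\<Sum>j<n. \<kappa> j) - (\<Sum>j<n. c j)\<bar> / n \<le> (\<Sum>j<n. e j) / n" using n by (intro divide_right_mono) auto
  then have "\<bar>(\<Sum>j<n. \<kappa> j) / n - (\<Sum>j<n. c j) / n\<bar> \<le> E1"
    using E1 unfolding diff_divide_distrib[symmetric] by (simp add: abs_divide)
  then show b: "\<bar>(\<Sum>j<n. \<kappa> j) / real n\<bar> \<le> \<bar>(\<Sum>j<n. c j) / real n\<bar> + E1" by linarith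
  have "((\<Sum>j<n. \<kappa> j) / real n)^2 \<le> (\<bar>(\<Sum>j<n. c j) / real n\<bar> + E1)^2"
    using b power_mono[OF b abs_ge_zero, of 2] by (simp only: power2_abs)
  then show "\<bar>2 * ((\<Sum>j<n. (\<kappa> j)^2) / real n - ((\<Sum>j<n. \<kappa> j) / real n)^2) - 1\<bar>
      \<le> 4 * E1 + 2 * E2 + \<bar>2 * ((\<Sum>j<n. (c j)^2) / real n) - 1\<bar> + 2 * (\<bar>(\<Sum>j<n. c j) / real n\<bar> + E1)^2"
  proof -
    have "\<bar>2 * (A - m) - 1\<bar> \<le> 4 * E1 + 2 * E2 + \<bar>2 * C - 1\<bar> + 2 * P"
      if "\<bar>A - C\<bar> \<le> 2 * E1 + E2" "m \<le> P" "0 \<le> m" for A C m P :: real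
      using that abs_ge_self[of "2 * C - 1"] abs_ge_minus_self[of "2 * C - 1"] by (intro abs_leI) (simp_all add: abs_le_iff)
    from this[OF a \<open>_ \<le> (\<bar>(\<Sum>j<n. c j) / real n\<bar> + E1)^2\<close> zero_le_power2] show ?thesis .
  qed
qed

text \<open>The average of \<open>cos\<^sup>2\<close> is \<open>1 / 2\<close> up to the empirical characteristic function at the doubled frequency. This is
  why the empirical variance of the rescaled kernel tends to \<open>1 / 2\<close>.\<close>

lemma empirical_cosine_moments:
  fixes y :: "nat \<Rightarrow> real"
  assumes n: "0 < n"
  shows "(\<Sum>j<n. cos ((x - y j) / h)) / real n = Re (iexp (- (x / h)) * emp_cf n y (1 / h))"
    and "2 * ((\<Sum>j<n. (cos ((x - y j) / h))^2) / real n) - 1 = Re (iexp (- (2 * x / h)) * emp_cf n y (2 / h))"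
proof -
  have *: "(\<Sum>j<n. cos (s * (x - y j))) / real n = Re (iexp (- (s * x)) * emp_cf n y s)" for s
  proof -
    have "iexp (- (s * x)) * emp_cf n y s = (\<Sum>j<n. iexp (- (s * (x - y j)))) / of_nat n"
    proof -
      have "iexp (- (s * x)) * iexp (s * y j) = iexp (- (s * (x - y j)))" for j unfolding mult_exp_exp by (simp add: algebra_simps)
      then show ?thesis unfolding emp_cf_def times_divide_eq_right sum_distrib_left by (simp only:)
    qed
    also have "Re \<dots> = (\<Sum>j<n. cos (s * (x - y j))) / real n"
    proof -
      have "Re (iexp (- t)) = cos t" for t by (simp add: Re_exp)
      then show ?thesis by (simp only: Re_divide_of_nat Re_sum)
    qed
    finally show ?thesis ..
  qed
  show "(\<Sum>j<n. cos ((x - y j) / h)) / real n = Re (iexp (- (x / h)) * emp_cf n y (1 / h))" using *[of "1 / h"] by simp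
  have "2 * ((\<Sum>j<n. (cos ((x - y j) / h))^2) / real n) - 1 = (\<Sum>j<n. 2 * (cos ((x - y j) / h))^2 - 1) / real n"
    using n by (simp add: sum_subtractf sum_distrib_left[symmetric] diff_divide_distrib)
  also have "(\<Sum>j<n. 2 * (cos ((x - y j) / h))^2 - 1) = (\<Sum>j<n. cos (2 / h * (x - y j)))" by (simp add: cos_double_cos[symmetric])
  also have "\<dots> / real n = Re (iexp (- (2 * x / h)) * emp_cf n y (2 / h))" unfolding * by simp
  finally show "2 * ((\<Sum>j<n. (cos ((x - y j) / h))^2) / real n) - 1 = Re (iexp (- (2 * x / h)) * emp_cf n y (2 / h))" .
qed

lemma Re_iexp_mult_le: "\<bar>Re (iexp t * z)\<bar> \<le> cmod z"
  using abs_Re_le_cmod[of "iexp t * z"] by (simp only: norm_mult norm_exp_i_times mult_1)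

context supersmooth_edge
begin

definition scaled_kernel :: "real \<Rightarrow> nat \<Rightarrow> (nat \<Rightarrow> real) \<Rightarrow> real \<Rightarrow> real \<Rightarrow> real" where
  "scaled_kernel h m e y x = pi / height h * dec_kernel K h m e ((x - y) / h)"

text \<open>\<open>edge_approximation\<close> for a point mass at \<open>y\<close>: the empirical kernel is asymptotically a pure cosine of frequency
  \<open>1 / h\<close>.\<close>

lemma scaled_kernel_approx:
  assumes rc: "rel_close r h m e" "r \<le> 1/2" and h: "0 < h" "h \<le> 1" and x: "\<bar>x\<bar> \<le> X"
  shows "\<bar>scaled_kernel h m e y x - cos ((x - y) / h)\<bar>
      \<le> 2 * spread h * \<bar>y\<bar> + (2 * X * spread h + 2 * r * mass h + edge_dev h)"
proof -
  have H: "0 < height h" by (rule height_pos[OF h(1)])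
  have "dec_kernel K h m e ((x - y) / h) = 1 / pi * band_transform h m e (\<lambda>s. iexp (s * y)) x"
    using dec_kernel_sum[OF rc h, where n=1 and z="\<lambda>_. 1" and x=x and y="\<lambda>_. y"] by simp
  then have eq: "scaled_kernel h m e y x = band_transform h m e (\<lambda>s. iexp (s * y)) x / height h" by (simp add: scaled_kernel_def)
  have cos: "Re (iexp (- (x / h)) * iexp (1 / h * y)) = cos ((x - y) / h)"
  proof -
    have "iexp (- (x / h)) * iexp (1 / h * y) = iexp (- ((x - y) / h))" unfolding mult_exp_exp by (simp add: diff_divide_distrib algebra_simps)
    then show ?thesis by (simp add: Re_exp)
  qed
  have "\<bar>band_transform h m e (\<lambda>s. iexp (s * y)) x / height h - Re (iexp (- (x / h)) * iexp (1 / h * y))\<bar>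
      \<le> 2 * edge_gap h (\<lambda>s. iexp (s * y)) + (2 * X * spread h + 2 * r * mass h + edge_dev h) * cmod (iexp (1 / h * y))"
    by (rule edge_approximation[OF rc h _ _ x, where B=1]) auto
  moreover have "2 * edge_gap h (\<lambda>s. iexp (s * y)) \<le> 2 * spread h * \<bar>y\<bar>" using edge_gap_iexp[OF h, of y] by simp
  ultimately show ?thesis unfolding eq cos norm_exp_i_times mult_1_right by (rule order_trans[OF _ add_right_mono])
qed

lemma dec_sd_scaled:
  assumes "0 < h"
  shows "dec_sd K h n m y e x = height h / pi * sqrt ((\<Sum>j<n. (scaled_kernel h m e (y j) x)^2) / real n - ((\<Sum>j<n. scaled_kernel h m e (y j) x) / real n)^2)"
    and "dec_mean K h n m y e x = height h / pi * ((\<Sum>j<n. scaled_kernel h m e (y j) x) / real n)"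
proof -
  have H: "0 < height h" by (rule height_pos[OF assms])
  have dk: "dec_kernel K h m e ((x - y j) / h) = height h / pi * scaled_kernel h m e (y j) x" for j using H by (simp add: scaled_kernel_def)
  show mean: "dec_mean K h n m y e x = height h / pi * ((\<Sum>j<n. scaled_kernel h m e (y j) x) / real n)"
    unfolding dec_mean_def dk by (simp add: sum_distrib_left[symmetric] sum_divide_distrib[symmetric])
  have "(1 / real n) * (\<Sum>j<n. (dec_kernel K h m e ((x - y j) / h))^2) - (dec_mean K h n m y e x)^2
      = (height h / pi)^2 * ((\<Sum>j<n. (scaled_kernel h m e (y j) x)^2) / real n - ((\<Sum>j<n. scaled_kernel h m e (y j) x) / real n)^2)"
    unfolding mean dk power_mult_distrib sum_distrib_left[symmetric] by (simp add: right_diff_distrib)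
  then show "dec_sd K h n m y e x = height h / pi * sqrt ((\<Sum>j<n. (scaled_kernel h m e (y j) x)^2) / real n - ((\<Sum>j<n. scaled_kernel h m e (y j) x) / real n)^2)"
    unfolding dec_sd_def using H by (simp add: real_sqrt_mult)
qed

end

section \<open>Linearization on good samples\<close>
context supersmooth_edge
begin

text \<open>The deterministic conditions under which all approximations hold with error of order \<open>\<delta>\<close>. They enter at level
  \<open>\<delta>\<^sup>2\<close> since they multiply processes whose size is only known to be at most \<open>1 / \<delta>\<close>.\<close>

definition good_sample :: "real \<Rightarrow> real \<Rightarrow> real \<Rightarrow> nat \<Rightarrow> nat \<Rightarrow> (nat \<Rightarrow> real) \<Rightarrow> (nat \<Rightarrow> real) \<Rightarrow> bool" where
  "good_sample \<delta> L h n m y e \<longleftrightarrow> rel_close (\<delta>^2) h m e \<and> mass h \<le> L \<and> edge_dev h \<le> \<delta>^2 \<and>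
     spread h \<le> \<delta>^2 \<and> spread h * ((\<Sum>j<n. (y j)^2) / real n) \<le> \<delta>^2 \<and>
     cmod (emp_cf n y (1 / h)) \<le> \<delta>^2 \<and> cmod (emp_cf n y (2 / h)) \<le> \<delta>^2"

text \<open>Constants collecting the error terms; only their independence of \<open>\<delta>\<close> and \<open>h\<close> matters.\<close>

definition slack :: "real \<Rightarrow> real \<Rightarrow> real" where
  "slack X L = 2 * X + 2 * L + 1"

definition var_slack :: "real \<Rightarrow> real \<Rightarrow> real" where
  "var_slack X L = 33 + 4 * slack X L + 4 * (slack X L)^2 + 2 * (5 + slack X L)^2"

definition band_slack :: "real \<Rightarrow> real \<Rightarrow> real" where
  "band_slack X L = 3 * (7 + 2 * slack X L) + 2 * var_slack X L"

definition noise_gap :: "real \<Rightarrow> nat \<Rightarrow> (nat \<Rightarrow> real) \<Rightarrow> real" where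
  "noise_gap h m e = (\<integral>t. cmod (weight h t) * cmod (emp_cf m e (t / h) - \<phi> (t / h)) \<partial>lborel) / height h"

lemma spread_nonneg: "0 < h \<Longrightarrow> 0 \<le> spread h"
  unfolding spread_def using height_pos[of h] by (intro divide_nonneg_nonneg lebesgue_nonneg) (auto simp: weight_def indicator_def)

lemma mass_nonneg: "0 < h \<Longrightarrow> 0 \<le> mass h"
  unfolding mass_def using height_pos[of h] by (intro divide_nonneg_nonneg lebesgue_nonneg) auto

lemma band_transform_divide: "band_transform h m e (\<lambda>s. G s / of_real c) x = band_transform h m e G x / c"
proof -
  have "(\<integral>t. emp_weight h m e t * (iexp (- (t * x / h)) * (G (t / h) / of_real c)) \<partial>lborel)
     = (\<integral>t. emp_weight h m e t * (iexp (- (t * x / h)) * G (t / h)) \<partial>lborel) / of_real c"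
    unfolding times_divide_eq_right by (rule integral_divide_zero)
  then show ?thesis by (simp only: band_transform_def Re_divide_of_real)
qed

context
  fixes \<delta> L X h :: real and n m :: nat and y e :: "nat \<Rightarrow> real"
  assumes good: "good_sample \<delta> L h n m y e" and \<delta>: "0 < \<delta>" "\<delta> \<le> 1/2"
    and h: "0 < h" "h \<le> 1" and n: "0 < n" and X: "0 \<le> X"
    and vs: "var_slack X L * \<delta>^2 \<le> 1/2"
begin

lemma \<delta>2: "0 \<le> \<delta>^2" "\<delta>^2 \<le> \<delta>" "\<delta>^2 \<le> 1/2" "\<delta>^2 \<le> 1"
proof -
  show "0 \<le> \<delta>^2" by simp
  have "\<delta> * \<delta> \<le> \<delta> * (1/2)" using \<delta> by (intro mult_left_mono) auto
  then have "\<delta>^2 \<le> \<delta> * (1/2)" by (simp only: power2_eq_square)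
  then show "\<delta>^2 \<le> \<delta>" "\<delta>^2 \<le> 1/2" "\<delta>^2 \<le> 1" using \<delta> by auto
qed

lemma rc: "rel_close (\<delta>^2) h m e" "\<delta>^2 \<le> 1/2"
  using good \<delta>2 by (auto simp: good_sample_def)

lemma L0: "0 \<le> L"
  using good mass_nonneg[OF h(1)] by (auto simp: good_sample_def)

lemma slack1: "1 \<le> slack X L"
  using L0 X by (simp add: slack_def)

lemma remainder_le: "2 * X * spread h + 2 * \<delta>^2 * mass h + edge_dev h \<le> slack X L * \<delta>^2"
proof -
  have "2 * X * spread h \<le> 2 * X * \<delta>^2" using good X by (intro mult_left_mono) (auto simp: good_sample_def)
  moreover have "2 * \<delta>^2 * mass h \<le> 2 * \<delta>^2 * L" using good by (intro mult_left_mono) (auto simp: good_sample_def)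
  moreover have "edge_dev h \<le> \<delta>^2" using good by (auto simp: good_sample_def)
  moreover have "slack X L * \<delta>^2 = 2 * X * \<delta>^2 + 2 * \<delta>^2 * L + \<delta>^2" by (simp add: slack_def algebra_simps)
  ultimately show ?thesis by linarith
qed

lemma good_sample_edge:
  assumes [measurable]: "G \<in> borel_measurable borel" and G: "\<And>s. cmod (G s) \<le> B" and x: "\<bar>x\<bar> \<le> X"
  shows "\<bar>band_transform h m e G x / height h - Re (iexp (- (x / h)) * G (1 / h))\<bar>
      \<le> 2 * edge_gap h G + slack X L * \<delta>^2 * cmod (G (1 / h))"
  by (rule order_trans[OF edge_approximation[OF rc h assms]]) (intro add_left_mono mult_right_mono remainder_le norm_ge_zero)

definition V :: "real \<Rightarrow> real" where
  "V x = (\<Sum>j<n. (scaled_kernel h m e (y j) x)^2) / real n - ((\<Sum>j<n. scaled_kernel h m e (y j) x) / real n)^2"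

lemma good_sample_variance:
  assumes x: "\<bar>x\<bar> \<le> X"
  shows "\<bar>2 * V x - 1\<bar> \<le> var_slack X L * \<delta>^2"
    and "\<bar>(\<Sum>j<n. scaled_kernel h m e (y j) x) / real n\<bar> \<le> (5 + slack X L) * \<delta>^2"
proof -
  let ?Q = "slack X L" and ?m2 = "(\<Sum>j<n. (y j)^2) / real n"
  define r where "r = (\<lambda>j. 2 * spread h * \<bar>y j\<bar> + ?Q * \<delta>^2)"
  have sp: "0 \<le> spread h" "spread h \<le> \<delta>^2" "spread h * ?m2 \<le> \<delta>^2"
    using spread_nonneg[OF h(1)] good by (auto simp: good_sample_def)
  have Q: "1 \<le> ?Q" by (rule slack1)
  have r: "\<bar>scaled_kernel h m e (y j) x - cos ((x - y j) / h)\<bar> \<le> r j" for j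
    using scaled_kernel_approx[OF rc h x, of "y j"] remainder_le unfolding r_def by linarith
  have E1: "(\<Sum>j<n. r j) / real n \<le> (4 + ?Q) * \<delta>^2"
  proof -
    have "r j \<le> 2 * spread h + 2 * spread h * (y j)^2 + ?Q * \<delta>^2" for j
    proof -
      have "\<bar>y j\<bar> \<le> 1 + (y j)^2" using abs_power_le[of 1 2 "y j"] by simp
      then have "2 * spread h * \<bar>y j\<bar> \<le> 2 * spread h * (1 + (y j)^2)" using sp by (intro mult_left_mono) auto
      then show ?thesis by (simp add: r_def algebra_simps)
    qed
    then have "(\<Sum>j<n. r j) \<le> (\<Sum>j<n. 2 * spread h + 2 * spread h * (y j)^2 + ?Q * \<delta>^2)" by (intro sum_mono) auto
    also have "\<dots> = real n * (2 * spread h + 2 * (spread h * ?m2) + ?Q * \<delta>^2)"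
      using n by (simp add: sum.distrib sum_distrib_left[symmetric] distrib_left)
    finally have "(\<Sum>j<n. r j) / real n \<le> 2 * spread h + 2 * (spread h * ?m2) + ?Q * \<delta>^2"
      using n by (simp only: pos_divide_le_eq of_nat_0_less_iff mult.commute)
    then show ?thesis using sp by (simp add: algebra_simps)
  qed
  have E2: "(\<Sum>j<n. (r j)^2) / real n \<le> (8 + 2 * ?Q^2) * \<delta>^2"
  proof -
    have "(r j)^2 \<le> 8 * (spread h)^2 * (y j)^2 + 2 * (?Q * \<delta>^2)^2" for j
    proof -
      have "(a + b)^2 \<le> 2 * a^2 + 2 * b^2" for a b :: real using sum_squares_bound[of a b] by (simp add: power2_sum)
      from this[of "2 * spread h * \<bar>y j\<bar>" "?Q * \<delta>^2"] show ?thesis by (simp add: r_def power_mult_distrib)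
    qed
    then have "(\<Sum>j<n. (r j)^2) \<le> (\<Sum>j<n. 8 * (spread h)^2 * (y j)^2 + 2 * (?Q * \<delta>^2)^2)" by (intro sum_mono) auto
    also have "\<dots> = real n * (8 * (spread h * (spread h * ?m2)) + 2 * (?Q * \<delta>^2)^2)"
      using n by (simp add: sum.distrib sum_distrib_left[symmetric] distrib_left power2_eq_square)
    finally have "(\<Sum>j<n. (r j)^2) / real n \<le> 8 * (spread h * (spread h * ?m2)) + 2 * (?Q * \<delta>^2)^2"
      using n by (simp only: pos_divide_le_eq of_nat_0_less_iff mult.commute)
    also have "\<dots> \<le> 8 * (1 * \<delta>^2) + 2 * (?Q^2 * \<delta>^2)"
    proof (intro add_mono mult_left_mono)
      have m2: "0 \<le> ?m2" by (intro divide_nonneg_nonneg sum_nonneg) auto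
      show "spread h * (spread h * ?m2) \<le> 1 * \<delta>^2" using sp \<delta>2 mult_nonneg_nonneg[OF sp(1) m2] by (intro mult_mono) linarith+
      have "(?Q * \<delta>^2)^2 = ?Q^2 * (\<delta>^2 * \<delta>^2)" by (simp add: power_mult_distrib power2_eq_square)
      also have "\<dots> \<le> ?Q^2 * (1 * \<delta>^2)" using \<delta>2 by (intro mult_left_mono mult_right_mono) auto
      finally show "(?Q * \<delta>^2)^2 \<le> ?Q^2 * \<delta>^2" by simp
    qed auto
    finally show ?thesis by (simp add: algebra_simps)
  qed
  have c1: "\<bar>(\<Sum>j<n. cos ((x - y j) / h)) / real n\<bar> \<le> \<delta>^2" unfolding empirical_cosine_moments(1)[OF n]
    by (rule order_trans[OF Re_iexp_mult_le]) (use good in \<open>auto simp: good_sample_def\<close>)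
  have c2: "\<bar>2 * ((\<Sum>j<n. (cos ((x - y j) / h))^2) / real n) - 1\<bar> \<le> \<delta>^2" unfolding empirical_cosine_moments(2)[OF n]
    by (rule order_trans[OF Re_iexp_mult_le]) (use good in \<open>auto simp: good_sample_def\<close>)
  note pert = empirical_variance_perturbation[OF n r abs_cos_le_one E1 E2]
  show "\<bar>(\<Sum>j<n. scaled_kernel h m e (y j) x) / real n\<bar> \<le> (5 + ?Q) * \<delta>^2" using pert(2) c1 by (simp add: algebra_simps)
  have "(\<bar>(\<Sum>j<n. cos ((x - y j) / h)) / real n\<bar> + (4 + ?Q) * \<delta>^2)^2 \<le> ((5 + ?Q) * \<delta>^2)^2"
    using c1 Q \<delta>2 by (intro power_mono) (auto simp: algebra_simps)
  also have "\<dots> = (5 + ?Q)^2 * (\<delta>^2 * \<delta>^2)" by (simp add: power_mult_distrib power2_eq_square)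
  also have "\<dots> \<le> (5 + ?Q)^2 * (1 * \<delta>^2)" using \<delta>2 by (intro mult_left_mono mult_right_mono) auto
  finally have sq: "(\<bar>(\<Sum>j<n. cos ((x - y j) / h)) / real n\<bar> + (4 + ?Q) * \<delta>^2)^2 \<le> (5 + ?Q)^2 * \<delta>^2" by simp
  have "var_slack X L * \<delta>^2 = 4 * ((4 + ?Q) * \<delta>^2) + 2 * ((8 + 2 * ?Q^2) * \<delta>^2) + \<delta>^2 + 2 * ((5 + ?Q)^2 * \<delta>^2)"
    by (simp add: var_slack_def algebra_simps)
  then show "\<bar>2 * V x - 1\<bar> \<le> var_slack X L * \<delta>^2" using pert(1) c2 sq unfolding V_def by linarith
qed

lemma V_lower: "\<bar>x\<bar> \<le> X \<Longrightarrow> 1/4 \<le> V x"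
  using good_sample_variance(1)[of x] vs by linarith

lemma dec_sd_eq: "dec_sd K h n m y e x = height h / pi * sqrt (V x)"
  unfolding V_def by (rule dec_sd_scaled(1)[OF h(1)])

lemma good_sample_studentized:
  assumes x: "\<bar>x\<bar> \<le> X" and N: "\<bar>N - N0\<bar> \<le> (7 + 2 * slack X L) * \<delta>" and N0: "\<bar>N0\<bar> \<le> 1 / \<delta>"
  shows "\<bar>N / sqrt (V x) - sqrt 2 * N0\<bar> \<le> band_slack X L * \<delta>"
proof -
  let ?A = "(7 + 2 * slack X L) * \<delta>"
  have A0: "0 \<le> ?A" using N by linarith
  have vs0: "0 \<le> var_slack X L * \<delta>^2" using good_sample_variance(1)[OF x] by linarith
  have "\<bar>N / sqrt (V x) - sqrt 2 * N0\<bar> \<le> 2 * ?A + 2 * (\<bar>N0\<bar> + ?A) * (var_slack X L * \<delta>^2)"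
    by (rule studentization_error[OF good_sample_variance(1)[OF x] vs N])
  also have "\<dots> \<le> 2 * ?A + 2 * (1 / \<delta> * (var_slack X L * \<delta>^2) + ?A * (1/2))"
  proof -
    have "\<bar>N0\<bar> * (var_slack X L * \<delta>^2) \<le> 1 / \<delta> * (var_slack X L * \<delta>^2)" by (rule mult_right_mono[OF N0 vs0])
    moreover have "?A * (var_slack X L * \<delta>^2) \<le> ?A * (1/2)" by (rule mult_left_mono[OF vs A0])
    moreover have "2 * (\<bar>N0\<bar> + ?A) * (var_slack X L * \<delta>^2)
        = 2 * (\<bar>N0\<bar> * (var_slack X L * \<delta>^2) + ?A * (var_slack X L * \<delta>^2))" by (simp only: mult.assoc distrib_right)
    ultimately show ?thesis by (simp only:) (intro add_left_mono mult_left_mono add_mono mult_right_mono N0 vs vs0 A0, auto)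
  qed
  also have "1 / \<delta> * (var_slack X L * \<delta>^2) = var_slack X L * \<delta>" using \<delta> by (simp add: power2_eq_square)
  also have "2 * ?A + 2 * (var_slack X L * \<delta> + ?A * (1/2)) = band_slack X L * \<delta>" by (simp add: band_slack_def algebra_simps)
  finally show ?thesis .
qed

lemma good_sample_well_defined:
  assumes I: "I \<noteq> {}" "\<And>x. x \<in> I \<Longrightarrow> \<bar>x\<bar> \<le> X"
  shows "well_defined K I h n m y e"
proof -
  have "continuous_on {t. \<bar>t\<bar> \<le> 1 / h} (\<lambda>t. cmod (\<phi> t))"
    by (intro continuous_on_norm continuous_on_subset[OF \<phi>_cont]) auto
  moreover have "compact {t. \<bar>t\<bar> \<le> 1 / h}"
  proof -
    have "{t. \<bar>t\<bar> \<le> 1 / h} = {-(1/h)..1/h}" by (auto simp: abs_le_iff)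
    then show ?thesis by simp
  qed
  moreover have ne: "{t. \<bar>t\<bar> \<le> 1 / h} \<noteq> {}" using h by (auto intro!: exI[of _ 0])
  ultimately obtain t0 where t0: "\<And>t. \<bar>t\<bar> \<le> 1 / h \<Longrightarrow> cmod (\<phi> t0) \<le> cmod (\<phi> t)"
    using continuous_attains_inf[of "{t. \<bar>t\<bar> \<le> 1 / h}" "\<lambda>t. cmod (\<phi> t)"] by auto
  have "cmod (\<phi> t0) / 2 \<le> (INF t\<in>{t. \<bar>t\<bar> \<le> 1 / h}. cmod (emp_cf m e t))"
  proof (rule cINF_greatest[OF ne])
    fix t assume "t \<in> {t. \<bar>t\<bar> \<le> 1 / h}"
    then show "cmod (\<phi> t0) / 2 \<le> cmod (emp_cf m e t)" using t0[of t] rel_close_lower(1)[OF rc, of t] by auto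
  qed
  moreover have "0 < cmod (\<phi> t0) / 2" using \<phi>_nz by simp
  ultimately have 1: "0 < (INF t\<in>{t. \<bar>t\<bar> \<le> 1 / h}. cmod (emp_cf m e t))" by linarith
  have H: "0 < height h" by (rule height_pos[OF h(1)])
  have "height h / pi * (1/2) \<le> (INF x\<in>I. dec_sd K h n m y e x)"
  proof (rule cINF_greatest[OF I(1)])
    fix x assume "x \<in> I"
    then have "sqrt (1/4) \<le> sqrt (V x)" using V_lower I by (intro real_sqrt_le_mono) auto
    then have "1/2 \<le> sqrt (V x)" by (simp add: real_sqrt_divide)
    then show "height h / pi * (1/2) \<le> dec_sd K h n m y e x" unfolding dec_sd_eq using H by (intro mult_left_mono) auto
  qed
  moreover have "0 < height h / pi * (1/2)" using H by simp
  ultimately show ?thesis using 1 unfolding well_defined_def by linarith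
qed

text \<open>Centring replaces the kernel by its deviation from the empirical mean; the mean is of order \<open>\<delta>\<^sup>2\<close> and multiplies
  \<open>multiplier_cf\<close> at \<open>0\<close>, the normalized sum of the multipliers.\<close>

lemma multiplier_process_linearization:
  assumes I: "I \<noteq> {}" "\<And>x. x \<in> I \<Longrightarrow> \<bar>x\<bar> \<le> X" and x: "x \<in> I"
    and gap: "edge_gap h (multiplier_cf n y z) \<le> \<delta>^2"
    and size: "cmod (multiplier_cf n y z (1 / h)) \<le> 1 / \<delta>" "cmod (multiplier_cf n y z 0) \<le> 1 / \<delta>"
  shows "\<bar>multiplier_process K I h n m y e z x - sqrt 2 * Re (iexp (- (x / h)) * multiplier_cf n y z (1 / h))\<bar>
      \<le> band_slack X L * \<delta>"
proof -
  let ?Q = "slack X L" and ?S = "\<lambda>j. scaled_kernel h m e (y j) x"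
  have xX: "\<bar>x\<bar> \<le> X" by (rule I(2)[OF x])
  have H: "0 < height h" by (rule height_pos[OF h(1)])
  define N where "N = (\<Sum>j<n. z j * ?S j) / sqrt (real n) - (\<Sum>j<n. z j) / sqrt (real n) * ((\<Sum>j<n. ?S j) / real n)"
  let ?N0 = "Re (iexp (- (x / h)) * multiplier_cf n y z (1 / h))"
  have dk: "dec_kernel K h m e ((x - y j) / h) = height h / pi * ?S j" for j using H by (simp add: scaled_kernel_def)
  have sd: "0 < sqrt (V x)" using V_lower[OF xX] by simp
  have "multiplier_process K I h n m y e z x
      = 1 / (height h / pi * sqrt (V x) * sqrt (real n)) * (\<Sum>j<n. z j * (height h / pi * ?S j - height h / pi * ((\<Sum>j<n. ?S j) / real n)))"
    unfolding multiplier_process_def dec_sd_eq dec_sd_scaled(2)[OF h(1)] dk using good_sample_well_defined[OF I] by simp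
  also have "(\<Sum>j<n. z j * (height h / pi * ?S j - height h / pi * ((\<Sum>j<n. ?S j) / real n)))
      = height h / pi * (\<Sum>j<n. z j * ?S j - z j * ((\<Sum>j<n. ?S j) / real n))"
    unfolding sum_distrib_left[of "height h / pi"] by (intro sum.cong refl) (simp only: right_diff_distrib mult_ac)
  also have "(\<Sum>j<n. z j * ?S j - z j * ((\<Sum>j<n. ?S j) / real n)) = sqrt (real n) * N"
    using n unfolding N_def sum_subtractf sum_distrib_right[symmetric] by (simp add: right_diff_distrib)
  also have "1 / (height h / pi * sqrt (V x) * sqrt (real n)) * (height h / pi * (sqrt (real n) * N)) = N / sqrt (V x)"
    using H n sd by (simp add: field_simps)
  finally have proc: "multiplier_process K I h n m y e z x = N / sqrt (V x)" .
  have first: "(\<Sum>j<n. z j * ?S j) / sqrt (real n) = band_transform h m e (multiplier_cf n y z) x / height h"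
  proof -
    have "(\<Sum>j<n. z j * ?S j) = pi / height h * (\<Sum>j<n. z j * dec_kernel K h m e ((x - y j) / h))"
      unfolding scaled_kernel_def sum_distrib_left by (intro sum.cong refl) (simp only: mult_ac)
    also have "\<dots> = band_transform h m e (\<lambda>s. \<Sum>j<n. z j * iexp (s * y j)) x / height h" unfolding dec_kernel_sum[OF rc h] by simp
    finally show ?thesis unfolding multiplier_cf_def[abs_def] band_transform_divide by simp
  qed
  have zero: "multiplier_cf n y z 0 = complex_of_real ((\<Sum>j<n. z j) / sqrt (real n))" by (simp add: multiplier_cf_def)
  have b0: "\<bar>(\<Sum>j<n. z j) / sqrt (real n)\<bar> \<le> 1 / \<delta>" using size(2) unfolding zero norm_of_real .
  have a: "\<bar>(\<Sum>j<n. z j * ?S j) / sqrt (real n) - ?N0\<bar> \<le> 2 * edge_gap h (multiplier_cf n y z) + ?Q * \<delta>^2 * cmod (multiplier_cf n y z (1 / h))"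
    unfolding first by (rule good_sample_edge[OF _ multiplier_cf_bounded xX]) measurable
  have b: "\<bar>(\<Sum>j<n. z j) / sqrt (real n) * ((\<Sum>j<n. ?S j) / real n)\<bar> \<le> 1 / \<delta> * ((5 + ?Q) * \<delta>^2)"
    unfolding abs_mult by (rule mult_mono[OF b0 good_sample_variance(2)[OF xX]]) (use \<delta> in auto)
  have c: "?Q * \<delta>^2 * cmod (multiplier_cf n y z (1 / h)) \<le> ?Q * \<delta>^2 * (1 / \<delta>)"
    using slack1 by (intro mult_left_mono size) auto
  have d: "?Q * \<delta>^2 * (1 / \<delta>) = ?Q * \<delta>" "1 / \<delta> * ((5 + ?Q) * \<delta>^2) = (5 + ?Q) * \<delta>"
    using \<delta> by (simp_all add: power2_eq_square)
  have "(7 + 2 * ?Q) * \<delta> = 2 * \<delta> + ?Q * \<delta> + (5 + ?Q) * \<delta>" by (simp add: algebra_simps)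
  then have "\<bar>N - ?N0\<bar> \<le> (7 + 2 * ?Q) * \<delta>" using a b c d gap \<delta>2(2) unfolding N_def by linarith
  moreover have "\<bar>?N0\<bar> \<le> 1 / \<delta>" using Re_iexp_mult_le[of "- (x / h)" "multiplier_cf n y z (1 / h)"] size(1) by linarith
  ultimately show ?thesis unfolding proc by (rule good_sample_studentized[OF xX])
qed

text \<open>The deviation splits into the integral of the empirical process \<open>Gc\<close> against the empirical weight, the effect of
  replacing \<open>\<phi>\<close> by its empirical version in the mean (\<open>noise_gap\<close>), and the smoothing bias. Only the first part
  survives, and \<open>edge_approximation\<close> reduces it to \<open>Gc (1 / h)\<close>.\<close>

lemma density_linearization:
  fixes \<psi> :: "real \<Rightarrow> complex" and f :: "real \<Rightarrow> real"
  defines "Gc \<equiv> \<lambda>s. sqrt (real n) * (emp_cf n y s - \<psi> s * \<phi> s)"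
  assumes x: "\<bar>x\<bar> \<le> X"
    and [measurable]: "\<psi> \<in> borel_measurable borel" and \<psi>1: "\<And>s. cmod (\<psi> s) \<le> 1" and \<phi>1: "\<And>s. cmod (\<phi> s) \<le> 1"
    and gap: "edge_gap h Gc \<le> \<delta>^2" and size: "cmod (Gc (1 / h)) \<le> 1 / \<delta>"
    and noise: "sqrt (real n) * noise_gap h m e \<le> \<delta>^2"
    and bias: "\<bar>smoothed_value K \<psi> h x - h * f x\<bar> \<le> b"
    and bias_small: "sqrt (real n) * (pi * b / height h) \<le> \<delta>^2"
  shows "\<bar>(dec_density K h n m y e x - f x) * (sqrt (real n) * h) / dec_sd K h n m y e x - sqrt 2 * Re (iexp (- (x / h)) * Gc (1 / h))\<bar>
      \<le> band_slack X L * \<delta>"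
proof -
  let ?Q = "slack X L" and ?r = "sqrt (real n)"
  have H: "0 < height h" by (rule height_pos[OF h(1)])
  have sd: "0 < sqrt (V x)" using V_lower[OF x] by simp
  have rn: "0 < ?r" "?r * ?r = real n" using n by auto
  let ?J = "\<integral>s. indicator {0..1} s * (iexp (- (s * x / h)) * (fourier K s * \<psi> (s / h))) \<partial>lborel"
  let ?sum = "\<Sum>j<n. dec_kernel K h m e ((x - y j) / h)"
  define N where "N = pi / height h * (?sum / ?r - ?r * h * f x)"
  let ?N0 = "Re (iexp (- (x / h)) * Gc (1 / h))"
  have stat: "(dec_density K h n m y e x - f x) * (?r * h) / dec_sd K h n m y e x = N / sqrt (V x)"
  proof -
    have "(dec_density K h n m y e x - f x) * (?r * h) = ?sum / ?r - ?r * h * f x"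
    proof -
      have "dec_density K h n m y e x * (?r * h) = ?sum * (?r / real n)" using h by (simp add: dec_density_def)
      also have "?r / real n = 1 / ?r" using rn by (simp add: field_simps)
      finally have "dec_density K h n m y e x * (?r * h) = ?sum / ?r" by simp
      moreover have "(dec_density K h n m y e x - f x) * (?r * h) = dec_density K h n m y e x * (?r * h) - ?r * h * f x" by (simp add: algebra_simps)
      ultimately show ?thesis by (simp only:)
    qed
    then show ?thesis unfolding dec_sd_eq N_def using H sd by (simp add: field_simps)
  qed
  have emp_eq: "complex_of_real ?r * emp_cf n y s = (\<Sum>j<n. iexp (s * y j)) / ?r" for s
  proof -
    have "complex_of_real ?r * complex_of_real ?r = of_nat n" using rn by (simp flip: of_real_mult)
    then show ?thesis using rn by (simp add: emp_cf_def field_simps)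
  qed
  have sum_eq: "pi * (?sum / ?r) = band_transform h m e (\<lambda>s. ?r * emp_cf n y s) x"
    unfolding emp_eq band_transform_divide using dec_kernel_sum[OF rc h, where n=n and z="\<lambda>_. 1" and x=x and y=y] by simp
  have \<psi>\<phi>: "cmod (\<psi> s * \<phi> s) \<le> 1" for s using mult_mono[OF \<psi>1[of s] \<phi>1[of s]] by (simp add: norm_mult)
  have Gc_meas[measurable]: "Gc \<in> borel_measurable borel" unfolding Gc_def by measurable
  have Gc_bd: "cmod (Gc s) \<le> ?r * 2" for s
  proof -
    have "cmod (emp_cf n y s - \<psi> s * \<phi> s) \<le> 2"
      using norm_triangle_le_diff[OF add_mono[OF emp_cf_norm_le[of n y s] \<psi>\<phi>[of s]]] by simp
    then show ?thesis unfolding Gc_def norm_mult using rn by (simp add: mult_left_mono)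
  qed
  let ?v = "emp_weight h m e" and ?w = "weight h"
  let ?E = "\<lambda>t. iexp (- (t * x / h))"
  have i1: "integrable lborel (\<lambda>t. ?v t * (?E t * Gc (t / h)))"
    by (rule emp_weight_integrable[OF rc h, where B="?r * 2"]) (use Gc_bd in \<open>auto simp: norm_mult\<close>)
  have i2: "integrable lborel (\<lambda>t. ?v t * (?E t * (\<psi> (t / h) * \<phi> (t / h))))"
    by (rule emp_weight_integrable[OF rc h, where B=1]) (use \<psi>\<phi> in \<open>auto simp: norm_mult\<close>)
  have i3: "integrable lborel (\<lambda>t. ?w t * (?E t * (\<psi> (t / h) * \<phi> (t / h))))"
  proof (rule L1_bound[OF integrable_norm[OF weight_integrable(1)[OF h]]])
    show "AE t in lborel. norm (?w t * (?E t * (\<psi> (t / h) * \<phi> (t / h)))) \<le> norm (norm (?w t))"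
    proof (rule AE_I2)
      fix t
      show "norm (?w t * (?E t * (\<psi> (t / h) * \<phi> (t / h)))) \<le> norm (norm (?w t))"
        using mult_left_mono[OF \<psi>\<phi>[of "t / h"] norm_ge_zero[of "?w t"]]
        by (simp only: norm_mult[of "?w t"] norm_mult[of "?E t"] norm_exp_i_times mult_1 real_norm_def abs_norm_cancel mult_1_right)
    qed
  qed measurable
  have wJ: "(\<integral>t. ?w t * (?E t * (\<psi> (t / h) * \<phi> (t / h))) \<partial>lborel) = ?J"
    by (intro lebesgue_cong refl) (simp add: weight_def \<phi>_nz)
  have iw: "integrable lborel (\<lambda>t. 2 * (cmod (?w t) * cmod (emp_cf m e (t / h) - \<phi> (t / h))))"
  proof (rule integrable_mult_right, rule L1_bound)
    show "integrable lborel (\<lambda>t. cmod (?w t) * 2)" using weight_integrable(1)[OF h] by auto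
    show "AE t in lborel. norm (cmod (?w t) * cmod (emp_cf m e (t / h) - \<phi> (t / h))) \<le> norm (cmod (?w t) * 2)"
    proof (rule AE_I2)
      fix t
      have "cmod (emp_cf m e (t / h) - \<phi> (t / h)) \<le> 2"
        using norm_triangle_le_diff[OF add_mono[OF emp_cf_norm_le[of m e "t / h"] \<phi>1[of "t / h"]]] by simp
      then show "norm (cmod (?w t) * cmod (emp_cf m e (t / h) - \<phi> (t / h))) \<le> norm (cmod (?w t) * 2)" by (simp add: abs_mult mult_left_mono)
    qed
  qed measurable
  have split: "band_transform h m e (\<lambda>s. ?r * emp_cf n y s) x
      = band_transform h m e Gc x + ?r * Re (\<integral>t. (?v t - ?w t) * (?E t * (\<psi> (t / h) * \<phi> (t / h))) \<partial>lborel) + ?r * Re ?J"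
  proof -
    have "(\<integral>t. ?v t * (?E t * (?r * emp_cf n y (t / h))) \<partial>lborel)
        = (\<integral>t. ?v t * (?E t * Gc (t / h)) + complex_of_real ?r * (?v t * (?E t * (\<psi> (t / h) * \<phi> (t / h)))) \<partial>lborel)"
      by (intro lebesgue_cong refl) (simp add: Gc_def algebra_simps)
    also have "\<dots> = (\<integral>t. ?v t * (?E t * Gc (t / h)) \<partial>lborel) + complex_of_real ?r * (\<integral>t. ?v t * (?E t * (\<psi> (t / h) * \<phi> (t / h))) \<partial>lborel)"
      using i1 i2 by simp
    also have "(\<integral>t. ?v t * (?E t * (\<psi> (t / h) * \<phi> (t / h))) \<partial>lborel)
        = (\<integral>t. (?v t - ?w t) * (?E t * (\<psi> (t / h) * \<phi> (t / h))) \<partial>lborel) + ?J"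
      unfolding wJ[symmetric] left_diff_distrib using i2 i3 by simp
    finally show ?thesis unfolding band_transform_def by (simp add: distrib_left)
  qed
  have diff: "\<bar>Re (\<integral>t. (?v t - ?w t) * (?E t * (\<psi> (t / h) * \<phi> (t / h))) \<partial>lborel)\<bar> \<le> 2 * (noise_gap h m e * height h)"
  proof -
    have le: "cmod ((?v t - ?w t) * (?E t * (\<psi> (t / h) * \<phi> (t / h)))) \<le> 2 * (cmod (?w t) * cmod (emp_cf m e (t / h) - \<phi> (t / h)))" for t
    proof -
      have "cmod ((?v t - ?w t) * (?E t * (\<psi> (t / h) * \<phi> (t / h)))) = cmod (?v t - ?w t) * (cmod (\<psi> (t / h)) * cmod (\<phi> (t / h)))"
        by (simp only: norm_mult norm_exp_i_times mult_1)
      also have "\<dots> \<le> cmod (?v t - ?w t) * (1 * cmod (\<phi> (t / h)))" using \<psi>1 by (intro mult_left_mono mult_right_mono) auto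
      also have "\<dots> \<le> (2 * (cmod (?w t) / cmod (\<phi> (t / h)) * cmod (emp_cf m e (t / h) - \<phi> (t / h)))) * (1 * cmod (\<phi> (t / h)))"
        by (intro mult_right_mono emp_weight_diff_le(1)[OF rc h(1)]) auto
      also have "\<dots> = 2 * (cmod (?w t) * cmod (emp_cf m e (t / h) - \<phi> (t / h)))" using \<phi>_nz[of "t / h"] by simp
      finally show ?thesis .
    qed
    have id: "integrable lborel (\<lambda>t. (?v t - ?w t) * (?E t * (\<psi> (t / h) * \<phi> (t / h))))"
      unfolding left_diff_distrib using i2 i3 by simp
    have "\<bar>Re (\<integral>t. (?v t - ?w t) * (?E t * (\<psi> (t / h) * \<phi> (t / h))) \<partial>lborel)\<bar>
        \<le> cmod (\<integral>t. (?v t - ?w t) * (?E t * (\<psi> (t / h) * \<phi> (t / h))) \<partial>lborel)" by (rule abs_Re_le_cmod)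
    also have "\<dots> \<le> (\<integral>t. cmod ((?v t - ?w t) * (?E t * (\<psi> (t / h) * \<phi> (t / h)))) \<partial>lborel)" by (rule integral_norm_bound)
    also have "\<dots> \<le> (\<integral>t. 2 * (cmod (?w t) * cmod (emp_cf m e (t / h) - \<phi> (t / h))) \<partial>lborel)"
      by (rule integral_mono[OF integrable_norm[OF id] iw le])
    also have "\<dots> = 2 * (noise_gap h m e * height h)" unfolding noise_gap_def using H by simp
    finally show ?thesis .
  qed
  have N_eq: "N = band_transform h m e Gc x / height h
      + ?r * Re (\<integral>t. (?v t - ?w t) * (?E t * (\<psi> (t / h) * \<phi> (t / h))) \<partial>lborel) / height h
      + ?r * (pi * (1 / pi * Re ?J - h * f x) / height h)"
  proof -
    have "N = (pi * (?sum / ?r) - pi * (?r * h * f x)) / height h" unfolding N_def by (simp add: right_diff_distrib diff_divide_distrib)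
    also have "\<dots> = (band_transform h m e Gc x + ?r * Re (\<integral>t. (?v t - ?w t) * (?E t * (\<psi> (t / h) * \<phi> (t / h))) \<partial>lborel) + ?r * Re ?J
        - pi * (?r * h * f x)) / height h" unfolding sum_eq split ..
    also have "?r * Re ?J = ?r * (pi * (1 / pi * Re ?J))" by simp
    finally show ?thesis by (simp only: add_divide_distrib diff_divide_distrib right_diff_distrib times_divide_eq_right[symmetric] mult_ac) simp
  qed
  have e1: "\<bar>band_transform h m e Gc x / height h - ?N0\<bar> \<le> 2 * edge_gap h Gc + ?Q * \<delta>^2 * cmod (Gc (1 / h))"
    by (rule good_sample_edge[OF Gc_meas Gc_bd x])
  have e2: "\<bar>?r * Re (\<integral>t. (?v t - ?w t) * (?E t * (\<psi> (t / h) * \<phi> (t / h))) \<partial>lborel) / height h\<bar> \<le> 2 * (?r * noise_gap h m e)"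
  proof -
    have "?r * \<bar>Re (\<integral>t. (?v t - ?w t) * (?E t * (\<psi> (t / h) * \<phi> (t / h))) \<partial>lborel)\<bar> / height h \<le> ?r * (2 * (noise_gap h m e * height h)) / height h"
      using diff H rn by (intro divide_right_mono mult_left_mono) auto
    then show ?thesis using H rn by (simp add: abs_mult mult_ac)
  qed
  have e3: "\<bar>?r * (pi * (1 / pi * Re ?J - h * f x) / height h)\<bar> \<le> ?r * (pi * b / height h)"
  proof -
    have "?r * (pi * \<bar>1 / pi * Re ?J - h * f x\<bar> / height h) \<le> ?r * (pi * b / height h)"
      using bias H rn by (intro mult_left_mono divide_right_mono) auto
    then show ?thesis using H rn by (simp only: abs_mult abs_divide abs_of_pos[OF H] abs_of_pos[OF rn(1)] abs_of_pos[OF pi_gt_zero])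
  qed
  have c: "?Q * \<delta>^2 * cmod (Gc (1 / h)) \<le> ?Q * \<delta>"
  proof -
    have "?Q * \<delta>^2 * cmod (Gc (1 / h)) \<le> ?Q * \<delta>^2 * (1 / \<delta>)" using slack1 by (intro mult_left_mono size) auto
    then show ?thesis using \<delta> by (simp add: power2_eq_square)
  qed
  have Qd: "0 \<le> ?Q * \<delta>" using slack1 \<delta> by simp
  have "(7 + 2 * ?Q) * \<delta> = 7 * \<delta> + 2 * (?Q * \<delta>)" by (simp add: algebra_simps)
  then have "\<bar>N - ?N0\<bar> \<le> (7 + 2 * ?Q) * \<delta>"
    using e1 e2 e3 c Qd gap noise bias_small \<delta>2(2) \<delta>(1) unfolding N_eq by linarith
  moreover have "\<bar>?N0\<bar> \<le> 1 / \<delta>" using Re_iexp_mult_le[of "- (x / h)" "Gc (1 / h)"] size by linarith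
  ultimately show ?thesis unfolding stat by (rule good_sample_studentized[OF x])
qed

end

end

section \<open>Measurability of suprema and of the coverage event\<close>
text \<open>A countable dense subset of \<open>S\<close> suffices by continuity.\<close>

lemma sets_Collect_continuous_Ball:
  fixes g :: "'a \<Rightarrow> real \<Rightarrow> real"
  assumes S: "compact S"
    and cont: "\<And>w. w \<in> space M \<Longrightarrow> continuous_on S (g w)"
    and meas: "\<And>t. t \<in> S \<Longrightarrow> (\<lambda>w. g w t) \<in> borel_measurable M"
  shows "{w\<in>space M. \<forall>t\<in>S. a \<le> g w t} \<in> sets M"
proof -
  obtain D where D: "countable D" "D \<subseteq> S" "S \<subseteq> closure D" using separable by blast
  have cl: "closure D = S" using D closure_minimal[OF D(2) compact_imp_closed[OF S]] by auto
  have "(\<forall>t\<in>S. a \<le> g w t) \<longleftrightarrow> (\<forall>t\<in>D. a \<le> g w t)" if w: "w \<in> space M" for w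
  proof
    assume *: "\<forall>t\<in>D. a \<le> g w t"
    show "\<forall>t\<in>S. a \<le> g w t"
    proof
      fix t assume "t \<in> S"
      then show "a \<le> g w t" using continuous_ge_on_closure[of D "g w" t a] cont[OF w] * unfolding cl by blast
    qed
  qed (use D in auto)
  then have "{w\<in>space M. \<forall>t\<in>S. a \<le> g w t} = {w\<in>space M. \<forall>t\<in>D. a \<le> g w t}" by auto
  also have "\<dots> \<in> sets M"
  proof (rule sets.sets_Collect_countable_All'[OF _ D(1)])
    fix t assume "t \<in> D"
    then have [measurable]: "(\<lambda>w. g w t) \<in> borel_measurable M" using meas D by auto
    show "{w\<in>space M. a \<le> g w t} \<in> sets M" by measurable
  qed
  finally show ?thesis .
qed

lemma borel_measurable_continuous_INF:
  fixes g :: "'a \<Rightarrow> real \<Rightarrow> real"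
  assumes S: "compact S" "S \<noteq> {}"
    and cont: "\<And>w. w \<in> space M \<Longrightarrow> continuous_on S (g w)"
    and meas: "\<And>t. t \<in> S \<Longrightarrow> (\<lambda>w. g w t) \<in> borel_measurable M"
  shows "(\<lambda>w. INF t\<in>S. g w t) \<in> borel_measurable M"
  unfolding borel_measurable_iff_ge
proof
  fix a
  have "(a \<le> (INF t\<in>S. g w t)) \<longleftrightarrow> (\<forall>t\<in>S. a \<le> g w t)" if "w \<in> space M" for w
  proof (rule le_cINF_iff[OF S(2)])
    show "bdd_below (g w ` S)" by (rule bounded_imp_bdd_below[OF compact_imp_bounded[OF compact_continuous_image[OF cont[OF that] S(1)]]])
  qed
  then have "{w\<in>space M. a \<le> (INF t\<in>S. g w t)} = {w\<in>space M. \<forall>t\<in>S. a \<le> g w t}" by auto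
  then show "{w\<in>space M. a \<le> (INF t\<in>S. g w t)} \<in> sets M" using sets_Collect_continuous_Ball[OF S(1) cont meas] by simp
qed

lemma borel_measurable_sup_norm_on:
  fixes g :: "'a \<Rightarrow> real \<Rightarrow> real"
  assumes S: "compact S" "S \<noteq> {}"
    and cont: "\<And>w. w \<in> space M \<Longrightarrow> continuous_on S (g w)"
    and meas: "\<And>t. t \<in> S \<Longrightarrow> (\<lambda>w. g w t) \<in> borel_measurable M"
  shows "(\<lambda>w. sup_norm_on S (g w)) \<in> borel_measurable M"
proof -
  have "(\<lambda>w. INF t\<in>S. - \<bar>g w t\<bar>) \<in> borel_measurable M"
    by (rule borel_measurable_continuous_INF[OF S]) (use cont meas in \<open>auto intro!: continuous_intros\<close>)
  then have "(\<lambda>w. - (INF t\<in>S. - \<bar>g w t\<bar>)) \<in> borel_measurable M" by measurable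
  moreover have "sup_norm_on S (g w) = - (INF t\<in>S. - \<bar>g w t\<bar>)" for w unfolding sup_norm_on_def Inf_real_def by (simp add: image_image)
  ultimately show ?thesis by simp
qed

lemma emp_cf_joint_measurable:
  assumes V: "\<And>j. j < n \<Longrightarrow> V j \<in> borel_measurable M"
  shows "(\<lambda>(w, t). emp_cf n (\<lambda>j. V j w) t) \<in> borel_measurable (M \<Otimes>\<^sub>M borel)"
  unfolding emp_cf_def split_beta'
proof (intro borel_measurable_divide borel_measurable_const borel_measurable_sum)
  fix j assume "j \<in> {..<n}"
  then have [measurable]: "V j \<in> borel_measurable M" using V by simp
  show "(\<lambda>x. iexp (snd x * V j (fst x))) \<in> borel_measurable (M \<Otimes>\<^sub>M borel)" by measurable
qed

lemma emp_cf_rv: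
  assumes V: "\<And>j. j < n \<Longrightarrow> V j \<in> borel_measurable M"
  shows "(\<lambda>w. emp_cf n (\<lambda>j. V j w) t) \<in> borel_measurable M"
  using measurable_compose[OF _ emp_cf_joint_measurable[OF V], of "\<lambda>w. (w, t)" M n] by simp

lemma dec_kernel_rv:
  assumes K[measurable]: "K \<in> borel_measurable borel"
    and E: "\<And>j. j < m \<Longrightarrow> E j \<in> borel_measurable M"
    and g[measurable]: "g \<in> borel_measurable M"
  shows "(\<lambda>w. dec_kernel K h m (\<lambda>j. E j w) (g w)) \<in> borel_measurable M"
proof -
  have e1: "(\<lambda>x. emp_cf m (\<lambda>j. E j (fst x)) (snd x / h)) \<in> borel_measurable (M \<Otimes>\<^sub>M lborel)"
  proof -
    have "(\<lambda>x. (fst x, snd x / h)) \<in> M \<Otimes>\<^sub>M lborel \<rightarrow>\<^sub>M M \<Otimes>\<^sub>M borel" by measurable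
    from measurable_compose[OF this emp_cf_joint_measurable[OF E]] show ?thesis by simp
  qed
  have "(\<lambda>(w, t). iexp (- (t * g w)) * (fourier K t / emp_cf m (\<lambda>j. E j w) (t / h))) \<in> borel_measurable (M \<Otimes>\<^sub>M lborel)"
    unfolding split_beta' using e1 by measurable
  then have "(\<lambda>w. \<integral>t. iexp (- (t * g w)) * (fourier K t / emp_cf m (\<lambda>j. E j w) (t / h)) \<partial>lborel) \<in> borel_measurable M"
    by (rule lborel.borel_measurable_lebesgue_integral)
  then show ?thesis unfolding dec_kernel_def by measurable
qed

context supersmooth_edge
begin

lemma dec_kernel_continuous:
  assumes nz: "\<And>s. \<bar>s\<bar> \<le> 1 / h \<Longrightarrow> emp_cf m e s \<noteq> 0" and h: "0 < h"
  shows "continuous_on UNIV (dec_kernel K h m e)"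
proof -
  let ?F = "\<lambda>t. fourier K t / emp_cf m e (t / h)"
  have F: "integrable lborel ?F" using dec_kernel_fold(2)[OF nz h, of 0] by simp
  have "isCont (\<lambda>x. \<integral>t. iexp (- (t * x)) * ?F t \<partial>lborel) x" for x unfolding continuous_at_sequentially
  proof (intro allI impI)
    fix u assume u: "u \<longlonglongrightarrow> x"
    show "((\<lambda>x. \<integral>t. iexp (- (t * x)) * ?F t \<partial>lborel) \<circ> u) \<longlonglongrightarrow> (\<integral>t. iexp (- (t * x)) * ?F t \<partial>lborel)"
      unfolding comp_def
    proof (rule integral_dominated_convergence[where w="\<lambda>t. cmod (?F t)"])
      show "integrable lborel (\<lambda>t. cmod (?F t))" using F by (rule integrable_norm)
      show "AE t in lborel. (\<lambda>i. iexp (- (t * u i)) * ?F t) \<longlonglongrightarrow> iexp (- (t * x)) * ?F t"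
        by (intro AE_I2 tendsto_intros u)
      show "AE t in lborel. norm (iexp (- (t * u i)) * ?F t) \<le> cmod (?F t)" for i by (intro AE_I2) (simp only: norm_mult norm_exp_i_times mult_1)
    qed measurable
  qed
  then have "continuous_on UNIV (\<lambda>x. \<integral>t. iexp (- (t * x)) * ?F t \<partial>lborel)" by (simp add: continuous_at_imp_continuous_on)
  then show ?thesis unfolding dec_kernel_def[abs_def] by (intro continuous_intros)
qed

context
  fixes M :: "'a measure" and Y E Z :: "nat \<Rightarrow> 'a \<Rightarrow> real" and h :: real and n m :: nat and I :: "real set"
  assumes Y: "\<And>j. j < n \<Longrightarrow> Y j \<in> borel_measurable M"
    and E: "\<And>j. j < m \<Longrightarrow> E j \<in> borel_measurable M"
    and Z: "\<And>j. j < n \<Longrightarrow> Z j \<in> borel_measurable M"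
    and h: "0 < h" and I: "compact I" "I \<noteq> {}"
begin

abbreviation "yy w \<equiv> (\<lambda>j. Y j w)"
abbreviation "ee w \<equiv> (\<lambda>j. E j w)"
abbreviation "zz w \<equiv> (\<lambda>j. Z j w)"
abbreviation "ok w \<equiv> 0 < (INF t\<in>{t. \<bar>t\<bar> \<le> 1 / h}. cmod (emp_cf m (ee w) t))"
abbreviation "wd w \<equiv> well_defined K I h n m (yy w) (ee w)"

lemma window: "compact {t. \<bar>t\<bar> \<le> 1 / h}" "{t. \<bar>t\<bar> \<le> 1 / h} \<noteq> {}"
proof -
  have "{t. \<bar>t\<bar> \<le> 1 / h} = {-(1/h)..1/h}" by (auto simp: abs_le_iff)
  then show "compact {t. \<bar>t\<bar> \<le> 1 / h}" by simp
  show "{t. \<bar>t\<bar> \<le> 1 / h} \<noteq> {}" using h by (auto intro!: exI[of _ 0])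
qed

lemma ok_measurable: "{w\<in>space M. ok w} \<in> sets M"
proof -
  have [measurable]: "(\<lambda>w. emp_cf m (ee w) t) \<in> borel_measurable M" for t by (rule emp_cf_rv[OF E])
  have [measurable]: "(\<lambda>w. INF t\<in>{t. \<bar>t\<bar> \<le> 1 / h}. cmod (emp_cf m (ee w) t)) \<in> borel_measurable M"
    by (rule borel_measurable_continuous_INF[OF window continuous_on_norm[OF emp_cf_continuous]]) measurable
  show ?thesis by measurable
qed

lemma ok_nonzero: "ok w \<Longrightarrow> \<bar>s\<bar> \<le> 1 / h \<Longrightarrow> emp_cf m (ee w) s \<noteq> 0"
proof
  assume *: "ok w" "\<bar>s\<bar> \<le> 1 / h" "emp_cf m (ee w) s = 0"
  have "(INF t\<in>{t. \<bar>t\<bar> \<le> 1 / h}. cmod (emp_cf m (ee w) t)) \<le> cmod (emp_cf m (ee w) s)"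
    by (rule cINF_lower) (use * in \<open>auto intro!: bdd_belowI2[of _ 0]\<close>)
  then show False using * by simp
qed

lemma kernel_cont: "ok w \<Longrightarrow> continuous_on A (\<lambda>x. dec_kernel K h m (ee w) ((x - c) / h))"
  by (rule continuous_on_compose2[OF dec_kernel_continuous[OF ok_nonzero h]])
    (auto intro!: continuous_intros simp: h less_imp_neq[OF h, symmetric])

lemma mean_cont: "ok w \<Longrightarrow> continuous_on A (dec_mean K h n m (yy w) (ee w))"
  unfolding dec_mean_def[abs_def] by (intro continuous_intros kernel_cont)

lemma sd_cont: "ok w \<Longrightarrow> continuous_on A (dec_sd K h n m (yy w) (ee w))"
  unfolding dec_sd_def[abs_def] by (intro continuous_intros kernel_cont mean_cont)

lemma density_cont: "ok w \<Longrightarrow> continuous_on A (dec_density K h n m (yy w) (ee w))"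
  unfolding dec_density_def[abs_def] by (intro continuous_intros kernel_cont)

lemma kernel_rv: "j < n \<Longrightarrow> (\<lambda>w. dec_kernel K h m (ee w) ((x - Y j w) / h)) \<in> borel_measurable M"
  by (rule dec_kernel_rv[OF K_meas E]) (use Y[of j] in measurable)

lemma mean_rv: "(\<lambda>w. dec_mean K h n m (yy w) (ee w) x) \<in> borel_measurable M"
  unfolding dec_mean_def by (intro borel_measurable_times borel_measurable_const borel_measurable_sum kernel_rv) auto

lemma sd_rv: "(\<lambda>w. dec_sd K h n m (yy w) (ee w) x) \<in> borel_measurable M"
proof -
  have [measurable]: "(\<lambda>w. dec_mean K h n m (yy w) (ee w) x) \<in> borel_measurable M" by (rule mean_rv)
  have [measurable]: "(\<lambda>w. \<Sum>j<n. (dec_kernel K h m (ee w) ((x - Y j w) / h))^2) \<in> borel_measurable M"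
    by (intro borel_measurable_sum borel_measurable_power kernel_rv) auto
  show ?thesis unfolding dec_sd_def by measurable
qed

lemma density_rv: "(\<lambda>w. dec_density K h n m (yy w) (ee w) x) \<in> borel_measurable M"
  unfolding dec_density_def by (intro borel_measurable_times borel_measurable_const borel_measurable_sum kernel_rv) auto

lemma wd_measurable: "{w\<in>space M. wd w} \<in> sets M"
proof -
  have [measurable]: "{w\<in>space M. ok w} \<in> sets M" by (rule ok_measurable)
  have [measurable]: "(\<lambda>w. dec_sd K h n m (yy w) (ee w) x) \<in> borel_measurable M" for x by (rule sd_rv)
  have [measurable]: "(\<lambda>w. INF x\<in>I. (if ok w then dec_sd K h n m (yy w) (ee w) x else 0)) \<in> borel_measurable M"
  proof (rule borel_measurable_continuous_INF[OF I])
    show "continuous_on I (\<lambda>x. if ok w then dec_sd K h n m (yy w) (ee w) x else 0)" for w by (cases "ok w") (simp_all add: sd_cont)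
  qed measurable
  have "{w\<in>space M. wd w} = {w\<in>space M. ok w \<and> 0 < (INF x\<in>I. (if ok w then dec_sd K h n m (yy w) (ee w) x else 0))}"
    by (auto simp: well_defined_def)
  also have "\<dots> \<in> sets M" by measurable
  finally show ?thesis .
qed

lemma wd_ok: "wd w \<Longrightarrow> ok w"
  by (simp add: well_defined_def)

lemma wd_sd_pos: "wd w \<Longrightarrow> x \<in> I \<Longrightarrow> 0 < dec_sd K h n m (yy w) (ee w) x"
proof -
  assume w: "wd w" and x: "x \<in> I"
  have "bdd_below (dec_sd K h n m (yy w) (ee w) ` I)"
    by (rule bounded_imp_bdd_below[OF compact_imp_bounded[OF compact_continuous_image[OF sd_cont[OF wd_ok[OF w]] I(1)]]])
  from cINF_lower[OF this x] show ?thesis using w unfolding well_defined_def by linarith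
qed

lemma multiplier_sup_measurable:
  "(\<lambda>w. sup_norm_on I (multiplier_process K I h n m (yy w) (ee w) (zz w))) \<in> borel_measurable M"
proof (rule borel_measurable_sup_norm_on[OF I])
  have [measurable]: "{w\<in>space M. wd w} \<in> sets M" by (rule wd_measurable)
  fix x assume "x \<in> I"
  have [measurable]: "(\<lambda>w. dec_sd K h n m (yy w) (ee w) x) \<in> borel_measurable M" by (rule sd_rv)
  have [measurable]: "(\<lambda>w. \<Sum>j<n. Z j w * (dec_kernel K h m (ee w) ((x - Y j w) / h) - dec_mean K h n m (yy w) (ee w) x)) \<in> borel_measurable M"
    by (intro borel_measurable_sum borel_measurable_times borel_measurable_diff kernel_rv mean_rv Z) auto
  show "(\<lambda>w. multiplier_process K I h n m (yy w) (ee w) (zz w) x) \<in> borel_measurable M" unfolding multiplier_process_def by measurable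
next
  fix w
  show "continuous_on I (multiplier_process K I h n m (yy w) (ee w) (zz w))"
  proof (cases "wd w")
    case True
    have "continuous_on I (\<lambda>x. 1 / (dec_sd K h n m (yy w) (ee w) x * sqrt (real n)) *
         (\<Sum>j<n. Z j w * (dec_kernel K h m (ee w) ((x - Y j w) / h) - dec_mean K h n m (yy w) (ee w) x)))"
    proof (cases "n = 0")
      case False
      then show ?thesis by (intro continuous_intros kernel_cont[OF wd_ok[OF True]] mean_cont[OF wd_ok[OF True]] sd_cont[OF wd_ok[OF True]])
          (use wd_sd_pos[OF True] in fastforce)
    qed simp
    then show ?thesis unfolding multiplier_process_def[abs_def] using True by simp
  next
    case False
    then show ?thesis unfolding multiplier_process_def[abs_def] by simp
  qed
qed

lemma coverage_measurable:
  assumes c[measurable]: "c \<in> borel_measurable M" and f: "\<And>x. isCont f x"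
  shows "{w\<in>space M. \<forall>x\<in>I. f x \<in> confidence_band K I h n m (yy w) (ee w) (c w) x} \<in> sets M"
proof -
  have [measurable]: "{w\<in>space M. wd w} \<in> sets M" by (rule wd_measurable)
  define g where "g = (\<lambda>w x. if wd w then dec_sd K h n m (yy w) (ee w) x / (sqrt (real n) * h) * c w - \<bar>dec_density K h n m (yy w) (ee w) x - f x\<bar> else 0)"
  have S[measurable]: "{w\<in>space M. \<forall>x\<in>I. 0 \<le> g w x} \<in> sets M"
  proof (rule sets_Collect_continuous_Ball[OF I(1)])
    fix x
    have [measurable]: "(\<lambda>w. dec_sd K h n m (yy w) (ee w) x) \<in> borel_measurable M" by (rule sd_rv)
    have [measurable]: "(\<lambda>w. dec_density K h n m (yy w) (ee w) x) \<in> borel_measurable M" by (rule density_rv)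
    show "(\<lambda>w. g w x) \<in> borel_measurable M" unfolding g_def by measurable
  next
    fix w
    show "continuous_on I (g w)"
    proof (cases "wd w")
      case True
      have "continuous_on I f" using f by (simp add: continuous_at_imp_continuous_on)
      then have "continuous_on I (\<lambda>x. dec_sd K h n m (yy w) (ee w) x * (1 / (sqrt (real n) * h)) * c w - \<bar>dec_density K h n m (yy w) (ee w) x - f x\<bar>)"
        by (intro continuous_intros sd_cont[OF wd_ok[OF True]] density_cont[OF wd_ok[OF True]])
      then show ?thesis using True by (simp add: g_def[abs_def])
    qed (simp add: g_def[abs_def])
  qed
  have "{w\<in>space M. \<forall>x\<in>I. f x \<in> confidence_band K I h n m (yy w) (ee w) (c w) x}
      = {w\<in>space M. (wd w \<and> (\<forall>x\<in>I. 0 \<le> g w x)) \<or> (\<not> wd w \<and> (\<forall>x\<in>I. f x = 0))}"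
    by (rule Collect_cong) (auto simp: confidence_band_def g_def abs_le_iff algebra_simps)
  also have "\<dots> \<in> sets M" using S by measurable
  finally show ?thesis .
qed

end

end

section \<open>Empirical and multiplier characteristic functions of the observations\<close>
lemma (in prob_space) centred_iid_average_L1:
  fixes g :: "real \<Rightarrow> complex"
  assumes n: "0 < n" and indep: "indep_vars (\<lambda>_. borel) V {..<n}"
    and law: "\<And>j. j < n \<Longrightarrow> distr M borel (V j) = P"
    and [measurable]: "g \<in> borel_measurable borel"
    and sq: "integrable P (\<lambda>v. (cmod (g v))^2)"
  shows "integrable M (\<lambda>w. cmod ((\<Sum>j<n. g (V j w) - (\<integral>v. g v \<partial>P)) / sqrt (real n)))"
    and "expectation (\<lambda>w. cmod ((\<Sum>j<n. g (V j w) - (\<integral>v. g v \<partial>P)) / sqrt (real n))) \<le> sqrt (\<integral>v. (cmod (g v))^2 \<partial>P)"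
proof -
  have V[measurable]: "V j \<in> borel_measurable M" if "j < n" for j using indep that by (auto simp: indep_vars_def2)
  let ?S = "\<lambda>w. (\<Sum>j<n. g (V j w) - (\<integral>v. g v \<partial>P))"
  have [measurable]: "?S \<in> borel_measurable M"
    by (intro borel_measurable_sum borel_measurable_diff borel_measurable_const measurable_compose[OF V]) auto
  have sq_eq: "(cmod (?S w / sqrt (real n)))^2 = (cmod (?S w))^2 / real n" for w by (simp add: norm_divide power_divide)
  note m = centred_iid_sum_second_moment[OF indep law assms(4) sq]
  have i: "integrable M (\<lambda>w. (cmod (?S w / sqrt (real n)))^2)" unfolding sq_eq using m(1) by auto
  have le: "expectation (\<lambda>w. (cmod (?S w / sqrt (real n)))^2) \<le> (\<integral>v. (cmod (g v))^2 \<partial>P)"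
    unfolding sq_eq using m(2) n by (simp add: divide_le_eq mult.commute)
  show "integrable M (\<lambda>w. cmod (?S w / sqrt (real n)))" by (rule expectation_le_sqrt_second_moment(1)[OF _ i le]) measurable
  show "expectation (\<lambda>w. cmod (?S w / sqrt (real n))) \<le> sqrt (\<integral>v. (cmod (g v))^2 \<partial>P)"
    by (rule expectation_le_sqrt_second_moment(2)[OF _ i le]) measurable
qed

lemma iexp_diff_le_2: "cmod (iexp a - iexp b) \<le> 2"
  using norm_triangle_ineq4[of "iexp a" "iexp b"] unfolding norm_exp_i_times by linarith

text \<open>The square of a coordinate on the circle has mean half its radius squared, up to a term of doubled frequency.
  This makes the limit covariance a multiple of the identity.\<close>

lemma Re_circle_square:
  "(Re (cnj c * iexp a))^2 = (cmod c)^2 / 2 + Re ((cnj c)^2 * iexp (2 * a)) / 2"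
proof -
  let ?z = "cnj c * iexp a"
  have "(Re ?z)^2 = ((cmod ?z)^2 + Re (?z^2)) / 2" unfolding cmod_power2 by (simp add: power2_eq_square)
  moreover have "cmod ?z = cmod c" by (simp only: norm_mult norm_exp_i_times mult_1_right complex_mod_cnj)
  moreover have "?z^2 = (cnj c)^2 * iexp (2 * a)" by (simp add: power_mult_distrib exp_double[symmetric] mult_ac)
  ultimately show ?thesis by (simp add: add_divide_distrib)
qed

lemma sample_row_apply: "j < n \<Longrightarrow> sample_row n V w j = V j w"
  by (simp add: sample_row_def)

lemma data_apply: "j < n \<Longrightarrow> data n m Y \<eta> w j = Y j w"
  by (simp add: data_def sample_row_def)

lemma row_component: "j < n \<Longrightarrow> (\<lambda>r. r j) \<in> borel_measurable (row_space n)"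
  unfolding row_space_def by measurable

lemma (in prob_space) std_normal_moments:
  assumes "distributed M lborel Z (\<lambda>x. ennreal (std_normal_density x))"
  shows "integrable M Z" "expectation Z = 0" "integrable M (\<lambda>w. (Z w)^2)" "expectation (\<lambda>w. (Z w)^2) = 1"
proof -
  have d: "integrable M (\<lambda>w. (Z w) ^ k) \<longleftrightarrow> integrable lborel (\<lambda>x. std_normal_density x * x ^ k)" for k
    using distributed_integrable[OF assms, of "\<lambda>x. x ^ k"] by simp
  have e: "expectation (\<lambda>w. (Z w) ^ k) = (\<integral>x. std_normal_density x * x ^ k \<partial>lborel)" for k
    using distributed_integral[OF assms, of "\<lambda>x. x ^ k"] by simp
  show "integrable M Z" using d[of 1] integrable_std_normal_moment[of 1] by simp
  show "integrable M (\<lambda>w. (Z w)^2)" using d[of 2] integrable_std_normal_moment[of 2] by simp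
  show "expectation Z = 0" by (rule standard_normal_distributed_expectation[OF assms])
  show "expectation (\<lambda>w. (Z w)^2) = 1"
    using standard_normal_distributed_variance[OF assms] standard_normal_distributed_expectation[OF assms] by simp
qed

locale multiplier_sample = prob_space M for M :: "'a measure" +
  fixes Y \<eta> \<xi> :: "nat \<Rightarrow> 'a \<Rightarrow> real" and n m :: nat and P :: "real measure"
  assumes Y_indep: "indep_vars (\<lambda>_. borel) Y {..<n}"
    and Y_law: "\<And>j. j < n \<Longrightarrow> distr M borel (Y j) = P"
    and P_prob: "prob_space P" and P_sets: "sets P = sets borel"
    and P_sq: "integrable P (\<lambda>v. v^2)"
    and \<eta>_meas: "\<And>j. j < m \<Longrightarrow> \<eta> j \<in> borel_measurable M"
    and \<xi>_indep: "indep_vars (\<lambda>_. borel) \<xi> {..<n}"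
    and \<xi>_law: "\<And>j. j < n \<Longrightarrow> distributed M lborel (\<xi> j) (\<lambda>x. ennreal (std_normal_density x))"
    and mult_indep: "indep_var (row_space n) (sample_row n \<xi>) (row_space (n + m)) (data n m Y \<eta>)"
    and n_pos: "0 < n"
begin

lemma Y_rv: "j < n \<Longrightarrow> Y j \<in> borel_measurable M"
  using Y_indep by (auto simp: indep_vars_def2)

lemma \<xi>_rv: "j < n \<Longrightarrow> \<xi> j \<in> borel_measurable M"
  using \<xi>_indep by (auto simp: indep_vars_def2)

lemma bounded_integrable_P:
  fixes g :: "real \<Rightarrow> 'b :: {banach, second_countable_topology}"
  assumes "g \<in> borel_measurable borel" "\<And>v. norm (g v) \<le> B"
  shows "integrable P g"
proof -
  interpret P: prob_space P by (rule P_prob)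
  show ?thesis by (rule P.integrable_const_bound[where B=B]) (use assms P_sets in \<open>auto cong: measurable_cong_sets\<close>)
qed

lemma iexp_increment_second_moment:
  "(\<integral>v. (cmod (iexp (s * v) - iexp (s' * v)))^2 \<partial>P) \<le> ((s - s') * sqrt (\<integral>v. v^2 \<partial>P))^2"
proof -
  have "(\<integral>v. (cmod (iexp (s * v) - iexp (s' * v)))^2 \<partial>P) \<le> (\<integral>v. (s - s')^2 * v^2 \<partial>P)"
  proof (rule integral_mono)
    show "integrable P (\<lambda>v. (cmod (iexp (s * v) - iexp (s' * v)))^2)"
    proof (rule bounded_integrable_P[where B=4])
      fix v
      have "cmod (iexp (s * v) - iexp (s' * v)) \<le> 2" by (rule iexp_diff_le_2)
      then have "(cmod (iexp (s * v) - iexp (s' * v)))^2 \<le> 2^2" by (rule power_mono) simp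
      then show "norm ((cmod (iexp (s * v) - iexp (s' * v)))^2) \<le> 4" by simp
    qed measurable
    fix v
    have "cmod (iexp (s * v) - iexp (s' * v)) \<le> \<bar>(s - s') * v\<bar>"
      using iexp_lipschitz[of "s * v" "s' * v"] by (simp only: left_diff_distrib)
    then have "(cmod (iexp (s * v) - iexp (s' * v)))^2 \<le> \<bar>(s - s') * v\<bar>^2" by (rule power_mono) simp
    then show "(cmod (iexp (s * v) - iexp (s' * v)))^2 \<le> (s - s')^2 * v^2" by (simp only: power2_abs power_mult_distrib)
  qed (use P_sq in auto)
  then show ?thesis by (simp add: power_mult_distrib)
qed

text \<open>The summands are orthogonal, because the multipliers are centred, uncorrelated and independent of the data.\<close>

lemma multiplier_sum_L1:
  fixes g :: "real \<Rightarrow> complex"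
  assumes g[measurable]: "g \<in> borel_measurable borel" and gB: "\<And>v. cmod (g v) \<le> B"
  shows "integrable M (\<lambda>w. cmod ((\<Sum>j<n. \<xi> j w * g (Y j w)) / sqrt (real n)))"
    and "expectation (\<lambda>w. cmod ((\<Sum>j<n. \<xi> j w * g (Y j w)) / sqrt (real n))) \<le> sqrt (\<integral>v. (cmod (g v))^2 \<partial>P)"
proof -
  have Y[measurable]: "Y j \<in> borel_measurable M" if "j < n" for j using Y_rv that .
  have \<xi>[measurable]: "\<xi> j \<in> borel_measurable M" if "j < n" for j using \<xi>_rv that .
  note mom = std_normal_moments[OF \<xi>_law]
  have split: "expectation (\<lambda>w. complex_of_real (\<xi> j w * \<xi> l w) * (g (Y j w) * cnj (g (Y l w))))
      = expectation (\<lambda>w. complex_of_real (\<xi> j w * \<xi> l w)) * expectation (\<lambda>w. g (Y j w) * cnj (g (Y l w)))"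
    and int_split: "integrable M (\<lambda>w. complex_of_real (\<xi> j w * \<xi> l w) * (g (Y j w) * cnj (g (Y l w))))"
    if jl: "j < n" "l < n" for j l
  proof -
    have r[measurable]: "(\<lambda>r. r j) \<in> borel_measurable (row_space n)" "(\<lambda>r. r l) \<in> borel_measurable (row_space n)"
      "(\<lambda>r. r j) \<in> borel_measurable (row_space (n + m))" "(\<lambda>r. r l) \<in> borel_measurable (row_space (n + m))"
      using jl by (auto intro: row_component)
    have "indep_var borel ((\<lambda>r. complex_of_real (r j * r l)) \<circ> sample_row n \<xi>) borel ((\<lambda>r. g (r j) * cnj (g (r l))) \<circ> data n m Y \<eta>)"
      by (rule indep_var_compose[OF mult_indep]) measurable
    then have ind: "indep_var borel (\<lambda>w. complex_of_real (\<xi> j w * \<xi> l w)) borel (\<lambda>w. g (Y j w) * cnj (g (Y l w)))"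
      using jl by (simp add: comp_def sample_row_apply data_apply)
    have i1: "integrable M (\<lambda>w. complex_of_real (\<xi> j w * \<xi> l w))"
    proof -
      have "integrable M (\<lambda>w. (\<xi> j w)^2 + (\<xi> l w)^2)" using mom(3) jl by auto
      then have "integrable M (\<lambda>w. \<xi> j w * \<xi> l w)"
      proof (rule L1_bound)
        show "(\<lambda>w. \<xi> j w * \<xi> l w) \<in> borel_measurable M" using \<xi> jl by measurable
        have "\<bar>a * b\<bar> \<le> a^2 + b^2" for a b :: real
        proof -
          have "2 * \<bar>a * b\<bar> \<le> a^2 + b^2" using sum_squares_bound[of "\<bar>a\<bar>" "\<bar>b\<bar>"] by (simp add: abs_mult mult.assoc)
          then show ?thesis using abs_ge_zero[of "a * b"] by linarith
        qed
        then show "AE w in M. norm (\<xi> j w * \<xi> l w) \<le> norm ((\<xi> j w)^2 + (\<xi> l w)^2)" by auto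
      qed
      then show ?thesis by (simp only: complex_of_real_integrable_eq)
    qed
    have i2: "integrable M (\<lambda>w. g (Y j w) * cnj (g (Y l w)))" by (rule integrable_const_bound[where B="B * B"])
        (use Y jl gB in \<open>auto simp: norm_mult intro!: mult_mono order_trans[OF norm_ge_zero gB]\<close>)
    show "expectation (\<lambda>w. complex_of_real (\<xi> j w * \<xi> l w) * (g (Y j w) * cnj (g (Y l w))))
      = expectation (\<lambda>w. complex_of_real (\<xi> j w * \<xi> l w)) * expectation (\<lambda>w. g (Y j w) * cnj (g (Y l w)))"
      by (rule indep_var_lebesgue_integral[OF ind i1 i2])
    show "integrable M (\<lambda>w. complex_of_real (\<xi> j w * \<xi> l w) * (g (Y j w) * cnj (g (Y l w))))"
      by (rule indep_var_integrable[OF ind i1 i2])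
  qed
  define f where "f = (\<lambda>j w. \<xi> j w * g (Y j w))"
  have fm: "f j \<in> borel_measurable M" if "j < n" for j using \<xi> Y that unfolding f_def by measurable
  have ff: "f j w * cnj (f l w) = complex_of_real (\<xi> j w * \<xi> l w) * (g (Y j w) * cnj (g (Y l w)))" for j l w by (simp add: f_def)
  have f2: "complex_of_real ((cmod (f j w))^2) = f j w * cnj (f j w)" for j w unfolding complex_norm_square ..
  have fsq: "integrable M (\<lambda>w. (cmod (f j w))^2)" "expectation (\<lambda>w. (cmod (f j w))^2) = (\<integral>v. (cmod (g v))^2 \<partial>P)"
    if j: "j < n" for j
  proof -
    have "integrable M (\<lambda>w. complex_of_real ((cmod (f j w))^2))" unfolding f2 ff by (rule int_split[OF j j])
    then show "integrable M (\<lambda>w. (cmod (f j w))^2)" by (simp only: complex_of_real_integrable_eq)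
    have "complex_of_real (expectation (\<lambda>w. (cmod (f j w))^2)) = expectation (\<lambda>w. complex_of_real (\<xi> j w * \<xi> j w)) * expectation (\<lambda>w. g (Y j w) * cnj (g (Y j w)))"
      unfolding integral_complex_of_real[symmetric] f2 ff by (rule split[OF j j])
    also have "expectation (\<lambda>w. complex_of_real (\<xi> j w * \<xi> j w)) = 1"
      using mom(4)[OF j] by (simp only: integral_complex_of_real power2_eq_square of_real_1)
    also have "expectation (\<lambda>w. g (Y j w) * cnj (g (Y j w))) = complex_of_real (expectation (\<lambda>w. (cmod (g (Y j w)))^2))"
      unfolding complex_norm_square[symmetric] by (rule integral_complex_of_real)
    also have "expectation (\<lambda>w. (cmod (g (Y j w)))^2) = (\<integral>v. (cmod (g v))^2 \<partial>P)"
      unfolding Y_law[OF j, symmetric] using Y[OF j] by (subst integral_distr) auto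
    finally show "expectation (\<lambda>w. (cmod (f j w))^2) = (\<integral>v. (cmod (g v))^2 \<partial>P)" by (simp only: mult_1 of_real_eq_iff)
  qed
  have orth: "expectation (\<lambda>w. f j w * cnj (f l w)) = 0" if jl: "j < n" "l < n" "j \<noteq> l" for j l
  proof -
    have "indep_var borel (\<xi> j) borel (\<xi> l)" using jl by (intro indep_vars_pair[OF \<xi>_indep]) auto
    then have "expectation (\<lambda>w. \<xi> j w * \<xi> l w) = expectation (\<xi> j) * expectation (\<xi> l)"
      using mom(1) jl by (intro indep_var_lebesgue_integral) auto
    then have "expectation (\<lambda>w. complex_of_real (\<xi> j w * \<xi> l w)) = 0" using mom(2) jl by (simp only: integral_complex_of_real) simp
    then show ?thesis unfolding ff split[OF jl(1,2)] by simp
  qed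
  have main: "integrable M (\<lambda>w. (cmod (\<Sum>j<n. f j w))^2)"
    "expectation (\<lambda>w. (cmod (\<Sum>j<n. f j w))^2) = (\<Sum>j<n. expectation (\<lambda>w. (cmod (f j w))^2))"
    by (rule second_moment_orthogonal_sum; (use fm fsq orth in auto))+
  have sq_eq: "(cmod ((\<Sum>j<n. f j w) / sqrt (real n)))^2 = (cmod (\<Sum>j<n. f j w))^2 / real n" for w by (simp add: norm_divide power_divide)
  have i: "integrable M (\<lambda>w. (cmod ((\<Sum>j<n. f j w) / sqrt (real n)))^2)" unfolding sq_eq using main(1) by auto
  have le: "expectation (\<lambda>w. (cmod ((\<Sum>j<n. f j w) / sqrt (real n)))^2) \<le> (\<integral>v. (cmod (g v))^2 \<partial>P)"
    unfolding sq_eq using main(2) fsq(2) n_pos by simp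
  have fsm: "(\<lambda>w. (\<Sum>j<n. f j w) / sqrt (real n)) \<in> borel_measurable M"
    using fm by (intro borel_measurable_divide borel_measurable_sum borel_measurable_const) auto
  show "integrable M (\<lambda>w. cmod ((\<Sum>j<n. \<xi> j w * g (Y j w)) / sqrt (real n)))"
    using expectation_le_sqrt_second_moment(1)[OF fsm i le] by (simp only: f_def)
  show "expectation (\<lambda>w. cmod ((\<Sum>j<n. \<xi> j w * g (Y j w)) / sqrt (real n))) \<le> sqrt (\<integral>v. (cmod (g v))^2 \<partial>P)"
    using expectation_le_sqrt_second_moment(2)[OF fsm i le] by (simp only: f_def)
qed

definition bootstrap_cf :: "'a \<Rightarrow> real \<Rightarrow> complex" where
  "bootstrap_cf w s = multiplier_cf n (\<lambda>j. Y j w) (\<lambda>j. \<xi> j w) s"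

definition sampling_cf :: "'a \<Rightarrow> real \<Rightarrow> complex" where
  "sampling_cf w s = sqrt (real n) * (emp_cf n (\<lambda>j. Y j w) s - char P s)"

lemma bootstrap_cf_L1:
  "integrable M (\<lambda>w. cmod (bootstrap_cf w s))"
  "expectation (\<lambda>w. cmod (bootstrap_cf w s)) \<le> 1"
  "integrable M (\<lambda>w. cmod (bootstrap_cf w s - bootstrap_cf w s'))"
  "expectation (\<lambda>w. cmod (bootstrap_cf w s - bootstrap_cf w s')) \<le> \<bar>s - s'\<bar> * sqrt (\<integral>v. v^2 \<partial>P)"
proof -
  interpret P: prob_space P by (rule P_prob)
  have eq1: "bootstrap_cf w s = (\<Sum>j<n. \<xi> j w * iexp (s * Y j w)) / sqrt (real n)" for w by (simp add: bootstrap_cf_def multiplier_cf_def)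
  have b1: "cmod (iexp (s * v)) \<le> 1" for v by simp
  note m1 = multiplier_sum_L1[of "\<lambda>v. iexp (s * v)", OF _ b1]
  show "integrable M (\<lambda>w. cmod (bootstrap_cf w s))" unfolding eq1 by (rule m1(1)) measurable
  have "expectation (\<lambda>w. cmod (bootstrap_cf w s)) \<le> sqrt (\<integral>v. (cmod (iexp (s * v)))^2 \<partial>P)"
    unfolding eq1 by (rule m1(2)) measurable
  also have "\<dots> = 1" by (simp only: norm_exp_i_times) (simp add: P.prob_space)
  finally show "expectation (\<lambda>w. cmod (bootstrap_cf w s)) \<le> 1" .
  have eq2: "bootstrap_cf w s - bootstrap_cf w s' = (\<Sum>j<n. \<xi> j w * (iexp (s * Y j w) - iexp (s' * Y j w))) / sqrt (real n)" for w
    by (simp only: bootstrap_cf_def multiplier_cf_def diff_divide_distrib[symmetric] sum_subtractf[symmetric] right_diff_distrib)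
  have bd: "cmod (iexp (s * v) - iexp (s' * v)) \<le> 2" for v by (rule iexp_diff_le_2)
  note m2 = multiplier_sum_L1[of "\<lambda>v. iexp (s * v) - iexp (s' * v)", OF _ bd]
  show "integrable M (\<lambda>w. cmod (bootstrap_cf w s - bootstrap_cf w s'))" unfolding eq2 by (rule m2(1)) measurable
  have "expectation (\<lambda>w. cmod (bootstrap_cf w s - bootstrap_cf w s')) \<le> sqrt (\<integral>v. (cmod (iexp (s * v) - iexp (s' * v)))^2 \<partial>P)"
    unfolding eq2 by (rule m2(2)) measurable
  also have "\<dots> \<le> sqrt (((s - s') * sqrt (\<integral>v. v^2 \<partial>P))^2)" by (rule real_sqrt_le_mono[OF iexp_increment_second_moment])
  also have "\<dots> = \<bar>s - s'\<bar> * sqrt (\<integral>v. v^2 \<partial>P)" by (simp add: abs_mult)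
  finally show "expectation (\<lambda>w. cmod (bootstrap_cf w s - bootstrap_cf w s')) \<le> \<bar>s - s'\<bar> * sqrt (\<integral>v. v^2 \<partial>P)" .
qed

lemma sampling_cf_sum: "sampling_cf w s = (\<Sum>j<n. iexp (s * Y j w) - (\<integral>v. iexp (s * v) \<partial>P)) / sqrt (real n)"
proof -
  let ?r = "complex_of_real (sqrt (real n))" and ?S = "\<Sum>j<n. iexp (s * Y j w)" and ?\<mu> = "\<integral>v. iexp (s * v) \<partial>P"
  have rr: "of_nat n = ?r * ?r" by (simp flip: of_real_mult)
  have r0: "?r \<noteq> 0" using n_pos by simp
  have "sampling_cf w s = ?r * (?S / (?r * ?r)) - ?r * ?\<mu>" unfolding sampling_cf_def emp_cf_def char_def rr by (rule right_diff_distrib)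
  also have "\<dots> = (?S - ?r * ?r * ?\<mu>) / ?r" using r0 by (simp add: diff_divide_distrib)
  also have "?S - ?r * ?r * ?\<mu> = (\<Sum>j<n. iexp (s * Y j w) - ?\<mu>)" unfolding rr[symmetric] by (simp add: sum_subtractf)
  finally show ?thesis .
qed

lemma sampling_cf_L1:
  "integrable M (\<lambda>w. cmod (sampling_cf w s))"
  "expectation (\<lambda>w. cmod (sampling_cf w s)) \<le> 1"
  "integrable M (\<lambda>w. cmod (sampling_cf w s - sampling_cf w s'))"
  "expectation (\<lambda>w. cmod (sampling_cf w s - sampling_cf w s')) \<le> \<bar>s - s'\<bar> * sqrt (\<integral>v. v^2 \<partial>P)"
proof -
  interpret P: prob_space P by (rule P_prob)
  have i1: "integrable P (\<lambda>v. (cmod (iexp (s * v)))^2)" by (rule bounded_integrable_P[where B=1]) auto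
  note m1 = centred_iid_average_L1[OF n_pos Y_indep Y_law _ i1]
  show "integrable M (\<lambda>w. cmod (sampling_cf w s))" unfolding sampling_cf_sum by (rule m1(1)) auto
  have "expectation (\<lambda>w. cmod (sampling_cf w s)) \<le> sqrt (\<integral>v. (cmod (iexp (s * v)))^2 \<partial>P)"
    unfolding sampling_cf_sum by (rule m1(2)) auto
  also have "\<dots> = 1" by (simp only: norm_exp_i_times) (simp add: P.prob_space)
  finally show "expectation (\<lambda>w. cmod (sampling_cf w s)) \<le> 1" .
  have ie: "integrable P (\<lambda>v. iexp (t * v))" for t by (rule bounded_integrable_P[where B=1]) auto
  have eq2: "sampling_cf w s - sampling_cf w s' = (\<Sum>j<n. (iexp (s * Y j w) - iexp (s' * Y j w)) - (\<integral>v. iexp (s * v) - iexp (s' * v) \<partial>P)) / sqrt (real n)" for w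
    unfolding sampling_cf_sum lebesgue_diff[OF ie ie] diff_divide_distrib[symmetric] sum_subtractf[symmetric]
    by (simp only: diff_diff_eq2 diff_add_eq add_diff_eq) (simp add: algebra_simps)
  have i2: "integrable P (\<lambda>v. (cmod (iexp (s * v) - iexp (s' * v)))^2)"
  proof (rule bounded_integrable_P[where B=4])
    fix v
    have "cmod (iexp (s * v) - iexp (s' * v)) \<le> 2" by (rule iexp_diff_le_2)
    then have "(cmod (iexp (s * v) - iexp (s' * v)))^2 \<le> 2^2" by (rule power_mono) simp
    then show "norm ((cmod (iexp (s * v) - iexp (s' * v)))^2) \<le> 4" by simp
  qed measurable
  note m2 = centred_iid_average_L1[OF n_pos Y_indep Y_law _ i2]
  show "integrable M (\<lambda>w. cmod (sampling_cf w s - sampling_cf w s'))" unfolding eq2 by (rule m2(1)) auto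
  have "expectation (\<lambda>w. cmod (sampling_cf w s - sampling_cf w s')) \<le> sqrt (\<integral>v. (cmod (iexp (s * v) - iexp (s' * v)))^2 \<partial>P)"
    unfolding eq2 by (rule m2(2)) auto
  also have "\<dots> \<le> sqrt (((s - s') * sqrt (\<integral>v. v^2 \<partial>P))^2)" by (rule real_sqrt_le_mono[OF iexp_increment_second_moment])
  also have "\<dots> = \<bar>s - s'\<bar> * sqrt (\<integral>v. v^2 \<partial>P)" by (simp add: abs_mult)
  finally show "expectation (\<lambda>w. cmod (sampling_cf w s - sampling_cf w s')) \<le> \<bar>s - s'\<bar> * sqrt (\<integral>v. v^2 \<partial>P)" .
qed

lemma emp_cf_L1:
  "integrable M (\<lambda>w. cmod (emp_cf n (\<lambda>j. Y j w) s))"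
  "expectation (\<lambda>w. cmod (emp_cf n (\<lambda>j. Y j w) s)) \<le> cmod (char P s) + 1 / sqrt (real n)"
proof -
  have r: "0 < sqrt (real n)" using n_pos by simp
  have le: "cmod (emp_cf n (\<lambda>j. Y j w) s) \<le> cmod (char P s) + cmod (sampling_cf w s) / sqrt (real n)" for w
  proof -
    have "emp_cf n (\<lambda>j. Y j w) s = char P s + sampling_cf w s / sqrt (real n)" using r by (simp add: sampling_cf_def)
    then show ?thesis using norm_triangle_ineq[of "char P s" "sampling_cf w s / sqrt (real n)"] by (simp add: norm_divide)
  qed
  have ib: "integrable M (\<lambda>w. cmod (char P s) + cmod (sampling_cf w s) / sqrt (real n))" using sampling_cf_L1(1) by auto
  have m: "(\<lambda>w. emp_cf n (\<lambda>j. Y j w) s) \<in> borel_measurable M" by (rule emp_cf_rv[OF Y_rv])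
  show i: "integrable M (\<lambda>w. cmod (emp_cf n (\<lambda>j. Y j w) s))"
    by (rule integrable_const_bound[where B=1]) (use m emp_cf_norm_le in auto)
  have "expectation (\<lambda>w. cmod (emp_cf n (\<lambda>j. Y j w) s)) \<le> expectation (\<lambda>w. cmod (char P s) + cmod (sampling_cf w s) / sqrt (real n))"
    by (rule integral_mono[OF i ib le])
  also have "\<dots> = cmod (char P s) + expectation (\<lambda>w. cmod (sampling_cf w s)) / sqrt (real n)"
    using sampling_cf_L1(1) by (simp add: prob_space)
  also have "\<dots> \<le> cmod (char P s) + 1 / sqrt (real n)" using sampling_cf_L1(2) r by (intro add_left_mono divide_right_mono) auto
  finally show "expectation (\<lambda>w. cmod (emp_cf n (\<lambda>j. Y j w) s)) \<le> cmod (char P s) + 1 / sqrt (real n)" .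
qed

text \<open>Given the data the multiplier sum is a linear form in independent Gaussians, so its characteristic function is
  explicit. Testing against data events expresses the conditioning.\<close>

lemma bootstrap_conditional_char:
  assumes B: "B \<in> sets (row_space (n + m))"
  shows "expectation (\<lambda>w. indicator B (data n m Y \<eta> w) * iexp (Re (cnj c * (sqrt 2 * bootstrap_cf w s))))
    = expectation (\<lambda>w. indicator B (data n m Y \<eta> w) * exp (- (\<Sum>j<n. (Re (cnj c * iexp (s * Y j w)))^2) / real n))"
proof -
  define t where "t = (\<lambda>d::nat \<Rightarrow> real. \<lambda>j. sqrt 2 / sqrt (real n) * Re (cnj c * iexp (s * d j)))"
  define g where "g = (\<lambda>(r, d). complex_of_real (indicator B d) * iexp (\<Sum>j<n. r j * t d j))"
  let ?D = "data n m Y \<eta>" and ?X = "sample_row n \<xi>"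
  have tm: "(\<lambda>d. t d j) \<in> borel_measurable (row_space (n + m))" if "j < n" for j
  proof -
    have [measurable]: "(\<lambda>d. d j) \<in> borel_measurable (row_space (n + m))" using that by (intro row_component) auto
    have [measurable]: "Re \<in> borel_measurable borel" by (intro borel_measurable_continuous_onI continuous_intros)
    show ?thesis unfolding t_def by measurable
  qed
  have gm: "g \<in> borel_measurable (row_space n \<Otimes>\<^sub>M row_space (n + m))"
  proof -
    have [measurable]: "(\<lambda>x. \<Sum>j<n. fst x j * t (snd x) j) \<in> borel_measurable (row_space n \<Otimes>\<^sub>M row_space (n + m))"
      by (intro borel_measurable_sum borel_measurable_times measurable_compose[OF measurable_snd tm]
          measurable_compose[OF measurable_fst row_component]) auto
    show ?thesis unfolding g_def split_beta' using B by measurable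
  qed
  have lin: "Re (cnj c * (sqrt 2 * bootstrap_cf w s)) = (\<Sum>j<n. \<xi> j w * t (\<lambda>j. Y j w) j)" for w
  proof -
    have "cnj c * (sqrt 2 * bootstrap_cf w s) = (\<Sum>j<n. complex_of_real (\<xi> j w * (sqrt 2 / sqrt (real n))) * (cnj c * iexp (s * Y j w)))"
      by (simp add: bootstrap_cf_def multiplier_cf_def sum_distrib_left sum_divide_distrib mult_ac)
    then show ?thesis by (simp only: Re_sum t_def) (simp add: mult.assoc)
  qed
  have "expectation (\<lambda>w. indicator B (?D w) * iexp (Re (cnj c * (sqrt 2 * bootstrap_cf w s)))) = expectation (\<lambda>w. g (?X w, ?D w))"
    unfolding lin by (intro lebesgue_cong refl) (simp add: g_def sample_row_apply data_apply t_def indicator_def)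
  also have "\<dots> = expectation (\<lambda>w. expectation (\<lambda>w'. g (?X w', ?D w)))"
    by (rule indep_var_iterated_expectation[OF mult_indep gm, where C=1]) (auto simp: g_def norm_mult indicator_def)
  also have "\<dots> = expectation (\<lambda>w. complex_of_real (indicator B (?D w) * exp (- (\<Sum>j<n. (Re (cnj c * iexp (s * Y j w)))^2) / real n)))"
  proof (intro lebesgue_cong refl)
    fix w
    have "expectation (\<lambda>w'. g (?X w', ?D w)) = expectation (\<lambda>w'. complex_of_real (indicator B (?D w)) * iexp (\<Sum>j<n. \<xi> j w' * t (?D w) j))"
      by (intro lebesgue_cong refl) (simp add: g_def sample_row_apply)
    also have "\<dots> = complex_of_real (indicator B (?D w)) * exp (- (\<Sum>j<n. (t (?D w) j)^2) / 2)"
      using gaussian_linear_form_char[OF \<xi>_indep \<xi>_law, of "t (?D w)"] by (simp only: integral_mult_right_zero)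
    also have "(\<Sum>j<n. (t (?D w) j)^2) = (\<Sum>j<n. 2 / real n * (Re (cnj c * iexp (s * Y j w)))^2)"
    proof (intro sum.cong refl)
      fix j assume "j \<in> {..<n}"
      then have "data n m Y \<eta> w j = Y j w" by (simp add: data_apply)
      then have "t (?D w) j = sqrt 2 / sqrt (real n) * Re (cnj c * iexp (s * Y j w))" by (simp only: t_def)
      then show "(t (?D w) j)^2 = 2 / real n * (Re (cnj c * iexp (s * Y j w)))^2" by (simp only: power_mult_distrib power_divide) simp
    qed
    also have "- (\<Sum>j<n. 2 / real n * (Re (cnj c * iexp (s * Y j w)))^2) / 2 = - (\<Sum>j<n. (Re (cnj c * iexp (s * Y j w)))^2) / real n"
      unfolding sum_distrib_left[symmetric] by simp
    finally show "expectation (\<lambda>w'. g (?X w', ?D w)) = complex_of_real (indicator B (?D w) * exp (- (\<Sum>j<n. (Re (cnj c * iexp (s * Y j w)))^2) / real n))"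
      by (simp only: of_real_mult)
  qed
  also have "\<dots> = complex_of_real (expectation (\<lambda>w. indicator B (?D w) * exp (- (\<Sum>j<n. (Re (cnj c * iexp (s * Y j w)))^2) / real n)))"
    by (rule integral_complex_of_real)
  finally show ?thesis .
qed

lemma circle_quadratic_form:
  "(\<Sum>j<n. (Re (cnj c * iexp (s * Y j w)))^2) / real n
     = (cmod c)^2 / 2 + Re ((cnj c)^2 * emp_cf n (\<lambda>j. Y j w) (2 * s)) / 2"
proof -
  have "(\<Sum>j<n. (Re (cnj c * iexp (s * Y j w)))^2) = real n * ((cmod c)^2 / 2) + Re ((cnj c)^2 * (\<Sum>j<n. iexp (2 * s * Y j w))) / 2"
  proof -
    have "(cnj c)^2 * (\<Sum>j<n. iexp (2 * s * Y j w)) = (\<Sum>j<n. (cnj c)^2 * iexp (2 * (s * Y j w)))" by (simp only: sum_distrib_left mult.assoc)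
    then have "Re ((cnj c)^2 * (\<Sum>j<n. iexp (2 * s * Y j w))) = (\<Sum>j<n. Re ((cnj c)^2 * iexp (2 * (s * Y j w))))" by (simp only: Re_sum)
    then show ?thesis unfolding Re_circle_square by (simp only: sum.distrib sum_constant card_lessThan sum_divide_distrib)
  qed
  moreover have "Re ((cnj c)^2 * emp_cf n (\<lambda>j. Y j w) (2 * s)) = Re ((cnj c)^2 * (\<Sum>j<n. iexp (2 * s * Y j w))) / real n"
    unfolding emp_cf_def times_divide_eq_right by (simp only: Re_divide_of_nat)
  ultimately show ?thesis using n_pos by (simp add: add_divide_distrib)
qed

end

section \<open>Error of the auxiliary sample\<close>
lemma iexp_increment_integral:
  assumes "a \<le> b"
  shows "(\<integral>s. indicator {a..b} s * (\<i> * x * iexp (s * x)) \<partial>lborel) = iexp (b * x) - iexp (a * x)"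
proof -
  have "(\<integral>s. indicator {a..b} s *\<^sub>R (\<i> * x * iexp (s * x)) \<partial>lborel) = iexp (b * x) - iexp (a * x)"
  proof (rule integral_FTC_atLeastAtMost[OF assms])
    fix s
    have "((\<lambda>s. iexp (s * x)) has_vector_derivative x *\<^sub>R (\<i> * iexp (s * x))) (at s within {a..b})"
      by (rule vector_diff_chain_within[where f="\<lambda>s. s * x" and g=iexp, unfolded comp_def])
        (auto intro!: derivative_eq_intros has_vector_derivative_iexp)
    then show "((\<lambda>s. iexp (s * x)) has_vector_derivative \<i> * x * iexp (s * x)) (at s within {a..b})"
      by (simp add: scaleR_conv_of_real mult_ac)
  qed (intro continuous_intros)
  moreover have "(\<lambda>s. indicator {a..b} s *\<^sub>R (\<i> * x * iexp (s * x))) = (\<lambda>s. indicator {a..b} s * (\<i> * x * iexp (s * x)))"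
    by (auto simp: fun_eq_iff indicator_def)
  ultimately show ?thesis by (simp only:)
qed

lemma integrable_interval_indicator: "integrable lborel (indicator {a..b::real} :: real \<Rightarrow> real)"
  by (rule integrable_real_indicator) (simp_all add: emeasure_lborel_Icc_eq)

locale noise_sample = prob_space M for M :: "'a measure" +
  fixes \<eta> :: "nat \<Rightarrow> 'a \<Rightarrow> real" and m :: nat and Q :: "real measure"
  assumes \<eta>_indep: "indep_vars (\<lambda>_. borel) \<eta> {..<m}"
    and \<eta>_law: "\<And>j. j < m \<Longrightarrow> distr M borel (\<eta> j) = Q"
    and Q_prob: "prob_space Q" and Q_sets: "sets Q = sets borel"
    and Q_sq: "integrable Q (\<lambda>v. v^2)"
    and m_pos: "0 < m"
begin

lemma \<eta>_rv: "j < m \<Longrightarrow> \<eta> j \<in> borel_measurable M"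
  using \<eta>_indep by (auto simp: indep_vars_def2)

lemma Q_meas: "f \<in> borel_measurable borel \<Longrightarrow> f \<in> borel_measurable Q"
  using Q_sets by (auto cong: measurable_cong_sets)

lemma average_L1:
  fixes g :: "real \<Rightarrow> complex"
  assumes [measurable]: "g \<in> borel_measurable borel" and sq: "integrable Q (\<lambda>v. (cmod (g v))^2)"
  shows "integrable M (\<lambda>w. cmod ((\<Sum>j<m. g (\<eta> j w)) / m - (\<integral>v. g v \<partial>Q)))"
    and "expectation (\<lambda>w. cmod ((\<Sum>j<m. g (\<eta> j w)) / m - (\<integral>v. g v \<partial>Q))) \<le> sqrt (\<integral>v. (cmod (g v))^2 \<partial>Q) / sqrt (real m)"
proof -
  let ?r = "complex_of_real (sqrt (real m))" and ?\<mu> = "\<integral>v. g v \<partial>Q"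
  have rr: "of_nat m = ?r * ?r" by (simp flip: of_real_mult)
  have r0: "?r \<noteq> 0" using m_pos by simp
  have eq: "cmod ((\<Sum>j<m. g (\<eta> j w)) / m - ?\<mu>) = cmod ((\<Sum>j<m. g (\<eta> j w) - ?\<mu>) / ?r) / sqrt (real m)" for w
  proof -
    have "(\<Sum>j<m. g (\<eta> j w)) / m - ?\<mu> = ((\<Sum>j<m. g (\<eta> j w)) - of_nat m * ?\<mu>) / of_nat m"
      using m_pos by (simp add: diff_divide_distrib)
    also have "\<dots> = (\<Sum>j<m. g (\<eta> j w) - ?\<mu>) / ?r / ?r" unfolding divide_divide_eq_left rr[symmetric] by (simp add: sum_subtractf)
    finally have "cmod ((\<Sum>j<m. g (\<eta> j w)) / m - ?\<mu>) = cmod ((\<Sum>j<m. g (\<eta> j w) - ?\<mu>) / ?r / ?r)" by (simp only:)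
    also have "\<dots> = cmod ((\<Sum>j<m. g (\<eta> j w) - ?\<mu>) / ?r) / sqrt (real m)" by (subst norm_divide) simp
    finally show ?thesis .
  qed
  note c = centred_iid_average_L1[OF m_pos \<eta>_indep \<eta>_law assms]
  show "integrable M (\<lambda>w. cmod ((\<Sum>j<m. g (\<eta> j w)) / m - ?\<mu>))" unfolding eq using c(1) by (intro integrable_divide_zero) auto
  have "expectation (\<lambda>w. cmod ((\<Sum>j<m. g (\<eta> j w)) / m - ?\<mu>)) = expectation (\<lambda>w. cmod ((\<Sum>j<m. g (\<eta> j w) - ?\<mu>) / ?r)) / sqrt (real m)"
    unfolding eq by (rule integral_divide_zero)
  also have "\<dots> \<le> sqrt (\<integral>v. (cmod (g v))^2 \<partial>Q) / sqrt (real m)" using c(2) by (intro divide_right_mono) auto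
  finally show "expectation (\<lambda>w. cmod ((\<Sum>j<m. g (\<eta> j w)) / m - ?\<mu>)) \<le> sqrt (\<integral>v. (cmod (g v))^2 \<partial>Q) / sqrt (real m)" .
qed

lemma emp_cf_error_L1:
  "integrable M (\<lambda>w. cmod (emp_cf m (\<lambda>j. \<eta> j w) s - char Q s))"
  "expectation (\<lambda>w. cmod (emp_cf m (\<lambda>j. \<eta> j w) s - char Q s)) \<le> 1 / sqrt (real m)"
proof -
  interpret Q: prob_space Q by (rule Q_prob)
  have i: "integrable Q (\<lambda>v. (cmod (iexp (s * v)))^2)" by (rule Q.integrable_const_bound[where B=1]) (auto intro!: Q_meas)
  have sq: "(\<integral>v. (cmod (iexp (s * v)))^2 \<partial>Q) = 1" by (simp only: norm_exp_i_times) (simp add: Q.prob_space)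
  note a = average_L1[of "\<lambda>v. iexp (s * v)", OF _ i]
  show "integrable M (\<lambda>w. cmod (emp_cf m (\<lambda>j. \<eta> j w) s - char Q s))" unfolding emp_cf_def char_def by (rule a(1)) measurable
  show "expectation (\<lambda>w. cmod (emp_cf m (\<lambda>j. \<eta> j w) s - char Q s)) \<le> 1 / sqrt (real m)"
    unfolding emp_cf_def char_def using a(2) unfolding sq real_sqrt_one by auto
qed

text \<open>The derivative of the error of the empirical characteristic function. Integrating its modulus over \<open>{-T..T}\<close> gives
  \<open>cf_error_bound\<close>, which dominates the error uniformly on that window because the error vanishes at \<open>0\<close>; its mean is
  easy to bound, in contrast to that of a supremum.\<close>

definition cf_slope_error :: "'a \<Rightarrow> real \<Rightarrow> complex" where
  "cf_slope_error w s = (\<Sum>j<m. \<i> * \<eta> j w * iexp (s * \<eta> j w)) / m - (\<integral>v. \<i> * v * iexp (s * v) \<partial>Q)"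

definition cf_error_bound :: "real \<Rightarrow> 'a \<Rightarrow> real" where
  "cf_error_bound T w = (\<integral>s. indicator {-T..T} s * cmod (cf_slope_error w s) \<partial>lborel)"

lemma slope_integrable_Q: "integrable Q (\<lambda>v. \<bar>v\<bar>)"
proof -
  interpret Q: prob_space Q by (rule Q_prob)
  have "integrable Q (\<lambda>v. v)" by (rule Q.square_integrable_imp_integrable[OF _ Q_sq]) (auto intro!: Q_meas)
  then show ?thesis by simp
qed

lemma slope_error_measurable:
  "(\<lambda>(w, s). cf_slope_error w s) \<in> borel_measurable (M \<Otimes>\<^sub>M lborel)"
proof -
  interpret Q: prob_space Q by (rule Q_prob)
  have 1: "(\<lambda>x. (\<Sum>j<m. \<i> * \<eta> j (fst x) * iexp (snd x * \<eta> j (fst x))) / m) \<in> borel_measurable (M \<Otimes>\<^sub>M lborel)"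
  proof (intro borel_measurable_divide borel_measurable_sum borel_measurable_const)
    fix j assume "j \<in> {..<m}"
    then have [measurable]: "\<eta> j \<in> borel_measurable M" using \<eta>_rv by simp
    show "(\<lambda>x. \<i> * \<eta> j (fst x) * iexp (snd x * \<eta> j (fst x))) \<in> borel_measurable (M \<Otimes>\<^sub>M lborel)" by measurable
  qed
  have "(\<lambda>(s, v). \<i> * complex_of_real v * iexp (s * v)) \<in> borel_measurable (lborel \<Otimes>\<^sub>M Q)"
    using Q_sets by (simp cong: measurable_cong_sets)
  then have [measurable]: "(\<lambda>s. \<integral>v. \<i> * v * iexp (s * v) \<partial>Q) \<in> borel_measurable lborel"
    by (rule Q.borel_measurable_lebesgue_integral)
  show ?thesis unfolding cf_slope_error_def split_beta' by (rule borel_measurable_diff[OF 1]) measurable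
qed

lemma cf_error_bound_L1:
  assumes T: "0 < T"
  shows "integrable M (cf_error_bound T)"
    and "expectation (cf_error_bound T) \<le> 2 * T * (sqrt (\<integral>v. v^2 \<partial>Q) / sqrt (real m))"
proof -
  let ?k = "sqrt (\<integral>v. v^2 \<partial>Q) / sqrt (real m)"
  have sq: "(cmod (\<i> * complex_of_real v * iexp (s * v)))^2 = v^2" for v s by (simp only: norm_mult norm_exp_i_times) simp
  have i: "integrable Q (\<lambda>v. (cmod (\<i> * complex_of_real v * iexp (s * v)))^2)" for s unfolding sq by (rule Q_sq)
  note a = average_L1[of "\<lambda>v. \<i> * complex_of_real v * iexp (s * v)" for s, OF _ i]
  have D: "integrable M (\<lambda>w. cmod (cf_slope_error w s))" "expectation (\<lambda>w. cmod (cf_slope_error w s)) \<le> ?k" for s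
    unfolding cf_slope_error_def using a[of s] unfolding sq by auto
  let ?H = "\<lambda>w s. indicator {-T..T} s * cmod (cf_slope_error w s)"
  have Hm: "case_prod ?H \<in> borel_measurable (M \<Otimes>\<^sub>M lborel)" using slope_error_measurable unfolding split_beta' by measurable
  have Hi: "integrable M (\<lambda>w. ?H w s)" for s using D(1)[of s] by auto
  have Hle: "expectation (\<lambda>w. ?H w s) \<le> indicator {-T..T} s * ?k" for s using D(2)[of s] by (auto simp: indicator_def)
  have ib: "integrable lborel (\<lambda>s. indicator {-T..T} s * ?k)" by (rule integrable_mult_left[OF integrable_interval_indicator])
  show "integrable M (cf_error_bound T)" unfolding cf_error_bound_def by (rule expected_integral_le(1)[OF Hm _ Hi Hle ib]) auto
  have "expectation (cf_error_bound T) \<le> (\<integral>s. indicator {-T..T} s * ?k \<partial>lborel)"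
    unfolding cf_error_bound_def by (rule expected_integral_le(2)[OF Hm _ Hi Hle ib]) auto
  also have "\<dots> = 2 * T * ?k" using T by simp
  finally show "expectation (cf_error_bound T) \<le> 2 * T * ?k" .
qed

lemma emp_cf_uniform_error:
  assumes w: "w \<in> space M" and T: "\<bar>t\<bar> \<le> T"
  shows "cmod (emp_cf m (\<lambda>j. \<eta> j w) t - char Q t) \<le> cf_error_bound T w"
proof -
  interpret Q: prob_space Q by (rule Q_prob)
  interpret P: pair_sigma_finite Q lborel ..
  define a b where "a = min 0 t" and "b = max 0 t"
  have ab: "a \<le> b" "{a..b} \<subseteq> {-T..T}" using T by (auto simp: a_def b_def abs_le_iff)
  let ?\<eta> = "\<lambda>j. \<eta> j w" and ?I = "\<lambda>s. indicator {a..b} s :: complex"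
  let ?g = "\<lambda>s v. \<i> * complex_of_real v * iexp (s * v)"
  have ind: "integrable lborel (\<lambda>s::real. indicator {a..b} s :: real)" by (rule integrable_interval_indicator)
  have gi: "integrable lborel (\<lambda>s. ?I s * ?g s v)" for v
  proof (rule L1_bound)
    show "integrable lborel (\<lambda>s. indicator {a..b} s * \<bar>v\<bar>)" using ind by (rule integrable_mult_left)
    show "AE s in lborel. norm (?I s * ?g s v) \<le> norm (indicator {a..b} s * \<bar>v\<bar>)" by (intro AE_I2) (auto simp: norm_mult indicator_def)
  qed measurable
  have emp: "emp_cf m ?\<eta> b - emp_cf m ?\<eta> a = (\<integral>s. ?I s * ((\<Sum>j<m. ?g s (?\<eta> j)) / m) \<partial>lborel)"
  proof -
    have "(\<integral>s. ?I s * ((\<Sum>j<m. ?g s (?\<eta> j)) / m) \<partial>lborel) = (\<integral>s. (\<Sum>j<m. ?I s * ?g s (?\<eta> j)) / m \<partial>lborel)"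
      by (simp only: sum_distrib_left times_divide_eq_right)
    also have "\<dots> = (\<Sum>j<m. (\<integral>s. ?I s * ?g s (?\<eta> j) \<partial>lborel)) / m"
      unfolding integral_divide_zero using gi by (subst lebesgue_sum) auto
    also have "\<dots> = (\<Sum>j<m. iexp (b * ?\<eta> j) - iexp (a * ?\<eta> j)) / m" by (simp only: iexp_increment_integral[OF ab(1)])
    finally show ?thesis by (simp add: emp_cf_def sum_subtractf diff_divide_distrib)
  qed
  have meas: "(\<lambda>(v, s). ?I s * ?g s v) \<in> borel_measurable (Q \<Otimes>\<^sub>M lborel)" using Q_sets by (simp cong: measurable_cong_sets)
  have int: "integrable (Q \<Otimes>\<^sub>M lborel) (\<lambda>(v, s). ?I s * ?g s v)"
  proof (rule P.Fubini_integrable[OF meas])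
    have "(\<integral>s. norm (case (v, s) of (v, s) \<Rightarrow> ?I s * ?g s v) \<partial>lborel) = (b - a) * \<bar>v\<bar>" for v
    proof -
      have "(\<integral>s. norm (case (v, s) of (v, s) \<Rightarrow> ?I s * ?g s v) \<partial>lborel) = (\<integral>s. indicator {a..b} s * \<bar>v\<bar> \<partial>lborel)"
        by (intro lebesgue_cong refl) (simp add: norm_mult indicator_def)
      then show ?thesis using ab(1) by simp
    qed
    then show "integrable Q (\<lambda>v. \<integral>s. norm (case (v, s) of (v, s) \<Rightarrow> ?I s * ?g s v) \<partial>lborel)"
      using slope_integrable_Q by simp
    show "AE v in Q. integrable lborel (\<lambda>s. case (v, s) of (v, s) \<Rightarrow> ?I s * ?g s v)" using gi by simp
  qed
  have ie: "integrable Q (\<lambda>v. iexp (s * v))" for s by (rule Q.integrable_const_bound[where B=1]) (auto intro!: Q_meas)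
  have ch: "char Q b - char Q a = (\<integral>s. ?I s * (\<integral>v. ?g s v \<partial>Q) \<partial>lborel)"
  proof -
    have "char Q b - char Q a = (\<integral>v. iexp (b * v) - iexp (a * v) \<partial>Q)" unfolding char_def using ie by simp
    also have "\<dots> = (\<integral>v. (\<integral>s. ?I s * ?g s v \<partial>lborel) \<partial>Q)" by (simp only: iexp_increment_integral[OF ab(1)])
    also have "\<dots> = (\<integral>s. (\<integral>v. ?I s * ?g s v \<partial>Q) \<partial>lborel)" by (rule P.Fubini_integral[OF int, symmetric])
    finally show ?thesis by (simp only: integral_mult_right_zero)
  qed
  have i1: "integrable lborel (\<lambda>s. ?I s * ((\<Sum>j<m. ?g s (?\<eta> j)) / m))" unfolding times_divide_eq_right sum_distrib_left
    by (intro integrable_divide_zero impI L1_sum gi)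
  have i2: "integrable lborel (\<lambda>s. ?I s * (\<integral>v. ?g s v \<partial>Q))"
    using P.integrable_snd[OF int] by (simp only: integral_mult_right_zero)
  have diff: "(emp_cf m ?\<eta> b - emp_cf m ?\<eta> a) - (char Q b - char Q a) = (\<integral>s. ?I s * cf_slope_error w s \<partial>lborel)"
    unfolding emp ch cf_slope_error_def right_diff_distrib by (rule lebesgue_diff[OF i1 i2, symmetric])
  have D_int: "integrable lborel (\<lambda>s. ?I s * cf_slope_error w s)" unfolding cf_slope_error_def right_diff_distrib by (rule L1_diff[OF i1 i2])
  have zero: "emp_cf m ?\<eta> 0 = 1" "char Q 0 = 1" using m_pos by (simp_all add: emp_cf_def char_def Q.prob_space)
  have "cmod (emp_cf m ?\<eta> t - char Q t) = cmod ((emp_cf m ?\<eta> b - emp_cf m ?\<eta> a) - (char Q b - char Q a))"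
  proof (cases "0 \<le> t")
    case True
    then have "a = 0" "b = t" by (auto simp: a_def b_def)
    then show ?thesis by (simp add: zero)
  next
    case False
    then have ab': "a = t" "b = 0" by (auto simp: a_def b_def)
    then have "(emp_cf m ?\<eta> b - emp_cf m ?\<eta> a) - (char Q b - char Q a) = - (emp_cf m ?\<eta> t - char Q t)" by (simp add: zero)
    then show ?thesis by (simp only: norm_minus_cancel)
  qed
  also have "\<dots> \<le> (\<integral>s. cmod (?I s * cf_slope_error w s) \<partial>lborel)" unfolding diff by (rule integral_norm_bound)
  also have "\<dots> \<le> cf_error_bound T w" unfolding cf_error_bound_def
  proof (rule integral_mono[OF integrable_norm[OF D_int]])
    show "cmod (?I s * cf_slope_error w s) \<le> indicator {-T..T} s * cmod (cf_slope_error w s)" for s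
      using ab(2) by (auto simp: norm_mult indicator_def)
    have sm: "cf_slope_error w \<in> borel_measurable lborel" using measurable_Pair2[OF slope_error_measurable w] by simp
    have bd: "cmod (cf_slope_error w s) \<le> (\<Sum>j<m. \<bar>?\<eta> j\<bar>) / m + (\<integral>v. \<bar>v\<bar> \<partial>Q)" for s
    proof -
      have "cmod ((\<Sum>j<m. ?g s (?\<eta> j)) / m) \<le> (\<Sum>j<m. \<bar>?\<eta> j\<bar>) / m"
        using norm_sum[of "\<lambda>j. ?g s (?\<eta> j)" "{..<m}"] by (simp add: norm_divide norm_mult divide_right_mono)
      moreover have "cmod (\<integral>v. ?g s v \<partial>Q) \<le> (\<integral>v. \<bar>v\<bar> \<partial>Q)"
        using integral_norm_bound[of Q "?g s"] by (simp add: norm_mult)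
      ultimately show ?thesis unfolding cf_slope_error_def by (intro norm_triangle_le_diff add_mono)
    qed
    show "integrable lborel (\<lambda>s. indicator {-T..T} s * cmod (cf_slope_error w s))"
    proof (rule L1_bound)
      show "integrable lborel (\<lambda>s. indicator {-T..T} s * ((\<Sum>j<m. \<bar>?\<eta> j\<bar>) / m + (\<integral>v. \<bar>v\<bar> \<partial>Q)))"
        by (rule integrable_mult_left[OF integrable_interval_indicator])
      show "AE s in lborel. norm (indicator {-T..T} s * cmod (cf_slope_error w s)) \<le> norm (indicator {-T..T} s * ((\<Sum>j<m. \<bar>?\<eta> j\<bar>) / m + (\<integral>v. \<bar>v\<bar> \<partial>Q)))"
        using bd order_trans[OF bd abs_ge_self] by (intro AE_I2) (auto simp: indicator_def)
    qed (use sm in measurable)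
  qed
  finally show ?thesis .
qed

end

context supersmooth_edge
begin

text \<open>Stochastic processes whose increments are Lipschitz in the mean have an edge gap of order \<open>spread h\<close>.\<close>

lemma edge_gap_expectation:
  assumes "prob_space M" and h: "0 < h" "h \<le> 1"
    and G[measurable]: "(\<lambda>(w, s). G w s) \<in> borel_measurable (M \<Otimes>\<^sub>M borel)"
    and int: "\<And>s s'. integrable M (\<lambda>w. cmod (G w s - G w s'))"
    and lip: "\<And>s s'. (\<integral>w. cmod (G w s - G w s') \<partial>M) \<le> \<bar>s - s'\<bar> * \<kappa>" and \<kappa>: "0 \<le> \<kappa>"
  shows "integrable M (\<lambda>w. edge_gap h (G w))" "(\<integral>w. edge_gap h (G w) \<partial>M) \<le> spread h * \<kappa>"
proof -
  interpret prob_space M by fact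
  have H: "0 < height h" by (rule height_pos[OF h(1)])
  let ?H = "\<lambda>w t. cmod (weight h t) * cmod (G w (t / h) - G w (1 / h))"
  have g1: "(\<lambda>x. G (fst x) (snd x / h)) \<in> borel_measurable (M \<Otimes>\<^sub>M lborel)"
  proof -
    have "(\<lambda>x. (fst x, snd x / h)) \<in> M \<Otimes>\<^sub>M lborel \<rightarrow>\<^sub>M M \<Otimes>\<^sub>M borel" by measurable
    from measurable_compose[OF this G] show ?thesis by simp
  qed
  have g2: "(\<lambda>x. G (fst x) (1 / h)) \<in> borel_measurable (M \<Otimes>\<^sub>M lborel)"
  proof -
    have "(\<lambda>x. (fst x, 1 / h)) \<in> M \<Otimes>\<^sub>M lborel \<rightarrow>\<^sub>M M \<Otimes>\<^sub>M borel" by measurable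
    from measurable_compose[OF this G] show ?thesis by simp
  qed
  have Hm: "case_prod ?H \<in> borel_measurable (M \<Otimes>\<^sub>M lborel)" unfolding split_beta' using g1 g2 by measurable
  have Hi: "integrable M (\<lambda>w. ?H w t)" for t using int by (rule integrable_mult_right)
  have Hle: "(\<integral>w. ?H w t \<partial>M) \<le> (\<kappa> / h) * (cmod (weight h t) * (1 - t))" for t
  proof (cases "t \<in> {0..1}")
    case True
    have "(\<integral>w. ?H w t \<partial>M) = cmod (weight h t) * (\<integral>w. cmod (G w (t / h) - G w (1 / h)) \<partial>M)" by simp
    also have "\<dots> \<le> cmod (weight h t) * (\<bar>t / h - 1 / h\<bar> * \<kappa>)" by (intro mult_left_mono lip) auto
    also have "\<bar>t / h - 1 / h\<bar> = (1 - t) / h" using True h by (simp add: diff_divide_distrib[symmetric] abs_divide)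
    finally show ?thesis by (simp add: mult_ac)
  qed (simp add: weight_def)
  have ib: "integrable lborel (\<lambda>t. (\<kappa> / h) * (cmod (weight h t) * (1 - t)))"
    by (rule integrable_mult_right[OF weight_integrable(2)[OF h]])
  note E = expected_integral_le[OF Hm _ Hi Hle ib]
  show "integrable M (\<lambda>w. edge_gap h (G w))" unfolding edge_gap_def using E(1) by (intro integrable_divide_zero) auto
  have "(\<integral>w. edge_gap h (G w) \<partial>M) = (\<integral>w. (\<integral>t. ?H w t \<partial>lborel) \<partial>M) / height h"
    unfolding edge_gap_def by (rule integral_divide_zero)
  also have "\<dots> \<le> (\<integral>t. (\<kappa> / h) * (cmod (weight h t) * (1 - t)) \<partial>lborel) / height h"
    using E(2) H by (intro divide_right_mono) auto
  also have "\<dots> = spread h * \<kappa>" by (simp add: spread_def mult.commute)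
  finally show "(\<integral>w. edge_gap h (G w) \<partial>M) \<le> spread h * \<kappa>" .
qed

lemma noise_gap_expectation:
  assumes "noise_sample M \<eta> m Q" and h: "0 < h" "h \<le> 1" and \<phi>: "\<And>s. \<phi> s = char Q s"
  shows "integrable M (\<lambda>w. noise_gap h m (\<lambda>j. \<eta> j w))" "(\<integral>w. noise_gap h m (\<lambda>j. \<eta> j w) \<partial>M) \<le> mass h / sqrt (real m)"
proof -
  interpret noise_sample M \<eta> m Q by fact
  have H: "0 < height h" by (rule height_pos[OF h(1)])
  let ?H = "\<lambda>w t. cmod (weight h t) * cmod (emp_cf m (\<lambda>j. \<eta> j w) (t / h) - \<phi> (t / h))"
  have g1: "(\<lambda>x. emp_cf m (\<lambda>j. \<eta> j (fst x)) (snd x / h)) \<in> borel_measurable (M \<Otimes>\<^sub>M lborel)"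
  proof -
    have "(\<lambda>x. (fst x, snd x / h)) \<in> M \<Otimes>\<^sub>M lborel \<rightarrow>\<^sub>M M \<Otimes>\<^sub>M borel" by measurable
    from measurable_compose[OF this emp_cf_joint_measurable[OF \<eta>_rv]] show ?thesis by simp
  qed
  have Hm: "case_prod ?H \<in> borel_measurable (M \<Otimes>\<^sub>M lborel)" unfolding split_beta' using g1 by measurable
  have Hi: "integrable M (\<lambda>w. ?H w t)" for t unfolding \<phi>[of "t / h"] using emp_cf_error_L1(1) by (rule integrable_mult_right)
  have Hle: "(\<integral>w. ?H w t \<partial>M) \<le> cmod (weight h t) * (1 / sqrt (real m))" for t
    using mult_left_mono[OF emp_cf_error_L1(2)[of "t / h"] norm_ge_zero[of "weight h t"]] unfolding \<phi>[of "t / h"] by simp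
  have ib: "integrable lborel (\<lambda>t. cmod (weight h t) * (1 / sqrt (real m)))"
    by (rule integrable_mult_left[OF integrable_norm[OF weight_integrable(1)[OF h]]])
  note E = expected_integral_le[OF Hm _ Hi Hle ib]
  show "integrable M (\<lambda>w. noise_gap h m (\<lambda>j. \<eta> j w))" unfolding noise_gap_def using E(1) by (intro integrable_divide_zero) auto
  have "(\<integral>w. noise_gap h m (\<lambda>j. \<eta> j w) \<partial>M) = (\<integral>w. (\<integral>t. ?H w t \<partial>lborel) \<partial>M) / height h"
    unfolding noise_gap_def by (rule integral_divide_zero)
  also have "\<dots> \<le> (\<integral>t. cmod (weight h t) * (1 / sqrt (real m)) \<partial>lborel) / height h"
    using E(2) H by (intro divide_right_mono) auto
  also have "\<dots> = mass h / sqrt (real m)" by (simp add: mass_def)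
  finally show "(\<integral>w. noise_gap h m (\<lambda>j. \<eta> j w) \<partial>M) \<le> mass h / sqrt (real m)" .
qed

end

section \<open>The deconvolution model and its rates\<close>
text \<open>Over a full period the rotation brings \<open>\<zeta>\<close> to the positive real axis.\<close>

lemma sup_over_full_period:
  fixes \<zeta> :: complex
  assumes h: "0 < h" and long: "2 * pi \<le> (b - a) / h"
  shows "sup_norm_on {a..b} (\<lambda>x. Re (iexp (- (x / h)) * \<zeta>)) = cmod \<zeta>"
proof -
  have ab: "a \<le> b"
  proof -
    have "0 \<le> (b - a) / h" using long pi_gt_zero by linarith
    then show ?thesis using h by (simp add: zero_le_divide_iff)
  qed
  have le: "\<bar>Re (iexp (- (x / h)) * \<zeta>)\<bar> \<le> cmod \<zeta>" for x by (rule Re_iexp_mult_le)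
  obtain \<theta> where \<theta>: "\<zeta> = cmod \<zeta> * iexp \<theta>" using rcis_cmod_Arg[of \<zeta>] by (metis cis_conv_exp rcis_def)
  define k where "k = \<lceil>(a / h - \<theta>) / (2 * pi)\<rceil>"
  \<comment> \<open>The first point of the interval at which the phase is that of \<open>\<zeta>\<close>.\<close>
  define x where "x = h * (\<theta> + 2 * pi * of_int k)"
  have k1: "(a / h - \<theta>) / (2 * pi) \<le> of_int k" and k2: "of_int k < (a / h - \<theta>) / (2 * pi) + 1" unfolding k_def by linarith+
  have "a / h - \<theta> \<le> 2 * pi * of_int k" using k1 by (simp add: pos_divide_le_eq mult.commute)
  then have "a / h \<le> \<theta> + 2 * pi * of_int k" by linarith
  then have xa: "a \<le> x" using h by (simp add: x_def pos_divide_le_eq mult.commute)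
  have "of_int k - 1 < (a / h - \<theta>) / (2 * pi)" using k2 by linarith
  then have "(of_int k - 1) * (2 * pi) < a / h - \<theta>" by (simp add: pos_less_divide_eq)
  then have "\<theta> + 2 * pi * of_int k < a / h + 2 * pi" by (simp add: algebra_simps)
  also have "\<dots> \<le> b / h" using long by (simp add: diff_divide_distrib)
  finally have xb: "x \<le> b" using h by (simp add: x_def pos_less_divide_eq mult.commute less_imp_le)
  have "x / h = \<theta> + 2 * pi * of_int k" using h by (simp add: x_def)
  then have "iexp (- (x / h)) * \<zeta> = cmod \<zeta> * (iexp (- (\<theta> + 2 * pi * of_int k)) * iexp \<theta>)" by (subst \<theta>) simp
  also have "iexp (- (\<theta> + 2 * pi * of_int k)) * iexp \<theta> = iexp (2 * pi * of_int (- k))"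
    unfolding mult_exp_exp by (simp add: algebra_simps)
  also have "\<dots> = 1" using exp_integer_2pi[of "of_int (- k)"] by (simp add: mult_ac)
  finally have "Re (iexp (- (x / h)) * \<zeta>) = cmod \<zeta>" by simp
  then have ge: "\<exists>x\<in>{a..b}. cmod \<zeta> \<le> \<bar>Re (iexp (- (x / h)) * \<zeta>)\<bar>" using xa xb by (intro bexI[of _ x]) auto
  show ?thesis unfolding sup_norm_on_def
  proof (rule antisym)
    show "(SUP x\<in>{a..b}. \<bar>Re (iexp (- (x / h)) * \<zeta>)\<bar>) \<le> cmod \<zeta>" using ab le by (intro cSUP_least) auto
    obtain x where "x \<in> {a..b}" "cmod \<zeta> \<le> \<bar>Re (iexp (- (x / h)) * \<zeta>)\<bar>" using ge by blast
    then show "cmod \<zeta> \<le> (SUP x\<in>{a..b}. \<bar>Re (iexp (- (x / h)) * \<zeta>)\<bar>)"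
      using le by (intro cSUP_upper2[of _ _ x]) (auto intro!: bdd_aboveI2)
  qed
qed

lemma quantile_le_iff:
  assumes "real_distribution \<mu>" and p: "0 < p" "p < 1"
  shows "quantile \<mu> p \<le> z \<longleftrightarrow> p \<le> cdf \<mu> z"
proof -
  interpret real_distribution \<mu> by fact
  let ?S = "{z. p \<le> cdf \<mu> z}"
  have bdd: "bdd_below ?S"
  proof -
    have "eventually (\<lambda>z. cdf \<mu> z < p) at_bot" using cdf_lim_at_bot p(1) by (rule order_tendstoD)
    then obtain z0 where z0: "\<And>z. z \<le> z0 \<Longrightarrow> cdf \<mu> z < p" by (auto simp: eventually_at_bot_linorder)
    show ?thesis
    proof (rule bdd_belowI[of _ z0])
      fix z assume "z \<in> ?S"
      then show "z0 \<le> z" using z0[of z] by (cases "z \<le> z0") auto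
    qed
  qed
  have ne: "?S \<noteq> {}"
  proof -
    have "eventually (\<lambda>z. p < cdf \<mu> z) at_top" using cdf_lim_at_top_prob p(2) by (rule order_tendstoD)
    then obtain z where "p < cdf \<mu> z" by (auto simp: eventually_at_top_linorder)
    then show ?thesis by (auto intro: less_imp_le)
  qed
  show ?thesis
  proof
    assume "p \<le> cdf \<mu> z"
    then show "quantile \<mu> p \<le> z" unfolding quantile_def by (intro cInf_lower bdd) simp
  next
    assume q: "quantile \<mu> p \<le> z"
    show "p \<le> cdf \<mu> z"
    proof (rule tendsto_lowerbound)
      show "(cdf \<mu> \<longlongrightarrow> cdf \<mu> z) (at_right z)" using cdf_is_right_cont[of z] by (simp add: continuous_within)
      show "eventually (\<lambda>y. p \<le> cdf \<mu> y) (at_right z)"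
      proof (rule eventually_at_rightI[of z "z + 1"])
        fix y assume "y \<in> {z<..<z + 1}"
        then have "Inf ?S < y" using q unfolding quantile_def by auto
        then obtain w where "w \<in> ?S" "w < y" using cInf_lessD[OF ne] by blast
        then show "p \<le> cdf \<mu> y" using cdf_nondecreasing[of w y] by auto
      qed simp
    qed simp
  qed
qed

text \<open>By Fubini \<open>(x + Z)\<^sup>2\<close> is integrable for almost every value \<open>x\<close> of \<open>X\<close>; one such value suffices.\<close>

lemma (in prob_space) indep_sum_square_integrable:
  fixes X Z :: "'a \<Rightarrow> real"
  assumes ind: "indep_var borel X borel Z" and sq: "integrable M (\<lambda>w. (X w + Z w)^2)"
  shows "integrable (distr M borel Z) (\<lambda>v. v^2)"
proof -
  have [measurable]: "X \<in> borel_measurable M" "Z \<in> borel_measurable M"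
    and eq: "distr M borel X \<Otimes>\<^sub>M distr M borel Z = distr M (borel \<Otimes>\<^sub>M borel) (\<lambda>w. (X w, Z w))"
    using ind by (auto simp: indep_var_distribution_eq)
  interpret pX: prob_space "distr M borel X" by (rule prob_space_distr) measurable
  interpret pZ: prob_space "distr M borel Z" by (rule prob_space_distr) measurable
  interpret P: pair_prob_space "distr M borel X" "distr M borel Z" ..
  have "integrable (distr M borel X \<Otimes>\<^sub>M distr M borel Z) (\<lambda>p. (fst p + snd p)^2)"
    unfolding eq using sq by (subst integrable_distr_eq) auto
  from P.AE_integrable_fst'[OF this]
  have "AE x in distr M borel X. integrable (distr M borel Z) (\<lambda>v. (x + v)^2)" by simp
  then have "\<exists>x. integrable (distr M borel Z) (\<lambda>v. (x + v)^2)"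
    using pX.prob_space AE_E2 eventually_happens'[OF pX.ae_filter_bot] by blast
  then obtain x where x: "integrable (distr M borel Z) (\<lambda>v. (x + v)^2)" by blast
  have "integrable (distr M borel Z) (\<lambda>v. 2 * (x + v)^2 + 2 * x^2)" using x by simp
  then show ?thesis
  proof (rule L1_bound)
    have "v^2 \<le> 2 * (x + v)^2 + 2 * x^2" for v :: real
      using zero_le_power2[of "v + 2 * x"] by (simp add: power2_sum power2_eq_square algebra_simps)
    then show "AE v in distr M borel Z. norm (v^2) \<le> norm (2 * (x + v)^2 + 2 * x^2)" by simp
  qed simp
qed

locale deconvolution = prob_space M for M :: "'a measure" +
  fixes X \<epsilon> :: "'a \<Rightarrow> real"
    and Y \<eta> \<xi> :: "nat \<Rightarrow> nat \<Rightarrow> 'a \<Rightarrow> real"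
    and fX f\<^sub>\<epsilon> K :: "real \<Rightarrow> real"
    and h :: "nat \<Rightarrow> real" and m :: "nat \<Rightarrow> nat"
    and a b C2 lam C3 \<gamma> \<gamma>0 \<nu> \<beta> B :: real and k :: nat
  assumes X_eps: "indep_var borel X borel \<epsilon>"
    and X_dens: "distributed M lborel X (\<lambda>x. ennreal (fX x))" and fX0: "\<And>x. 0 \<le> fX x"
    and eps_dens: "distributed M lborel \<epsilon> (\<lambda>x. ennreal (f\<^sub>\<epsilon> x))"
    and m_top: "filterlim m at_top sequentially"
    and Y_ind: "\<And>n. indep_vars (\<lambda>_. borel) (Y n) {..<n}"
    and Y_distr: "\<And>n j. j < n \<Longrightarrow> distr M borel (Y n j) = distr M borel (\<lambda>w. X w + \<epsilon> w)"
    and eta_ind: "\<And>n. indep_vars (\<lambda>_. borel) (\<eta> n) {..<m n}"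
    and eta_dens: "\<And>n j. j < m n \<Longrightarrow> distributed M lborel (\<eta> n j) (\<lambda>x. ennreal (f\<^sub>\<epsilon> x))"
    and xi_ind: "\<And>n. indep_vars (\<lambda>_. borel) (\<xi> n) {..<n}"
    and xi_dens: "\<And>n j. j < n \<Longrightarrow> distributed M lborel (\<xi> n j) (\<lambda>x. ennreal (std_normal_density x))"
    and xi_data: "\<And>n. indep_var (row_space n) (sample_row n (\<xi> n)) (row_space (n + m n)) (data n (m n) (Y n) (\<eta> n))"
    and h_pos: "\<And>n. 0 < h n" and h_lim: "h \<longlonglongrightarrow> 0"
    and charX_int: "integrable lborel (\<lambda>t. cmod (char (distr M borel X) t))"
    and kernel: "kernel_function K"
    and supp: "closure {t. fourier K t \<noteq> 0} = {-1..1}"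
    and C2: "0 < C2" and lam: "0 \<le> lam"
    and edge: "(\<lambda>t. fourier K (1 - t) - complex_of_real (C2 * t powr lam))
           \<in> o[at_right 0](\<lambda>t. complex_of_real (t powr lam))"
    and char_nz: "\<And>t. char (distr M borel \<epsilon>) t \<noteq> 0"
    and C3: "0 < C3" and gam: "1 < \<gamma>" and nu: "0 < \<nu>"
    and tail: "char (distr M borel \<epsilon>) \<sim>[at_infinity]
           (\<lambda>t. complex_of_real (C3 * \<bar>t\<bar> powr \<gamma>0 * exp (- \<nu> * \<bar>t\<bar> powr \<gamma>)))"
    and rate: "(\<lambda>n. max (real n * ln (1 / h n) / (real (m n) * h n powr (2 * \<gamma> * (1 + lam) - 2)))
                  (exp (2 * \<nu> * h n powr (- \<gamma>)) * (ln (1 / h n))^2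
                     / (real (m n) * h n powr (4 * \<gamma> * (1 + lam) - 2 * \<gamma>0)))) \<longlonglongrightarrow> 0"
    and Y_sq: "integrable M (\<lambda>w. (X w + \<epsilon> w)^2)" and ab: "a \<le> b"
    and beta: "0 < \<beta>" and B_pos: "0 < B" and hol: "fX \<in> holder_class \<beta> B"
    and k: "real k < \<beta>" "\<beta> \<le> real k + 1"
    and K_mom: "integrable lborel (\<lambda>x. \<bar>x\<bar> ^ (k + 1) * \<bar>K x\<bar>)"
    and K_orth: "\<And>l. l \<in> {1..k} \<Longrightarrow> (\<integral>x. x ^ l * K x \<partial>lborel) = 0"
    and undersmooth: "(\<lambda>n. h n powr (\<beta> + 1 - \<gamma> * (1 + lam) - \<gamma>0) * exp (- \<nu> * h n powr (- \<gamma>))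
               * sqrt (real n * ln (1 / h n))) \<longlonglongrightarrow> 0"
begin

abbreviation Q where "Q \<equiv> distr M borel \<epsilon>"
abbreviation P where "P \<equiv> distr M borel (\<lambda>w. X w + \<epsilon> w)"
abbreviation \<phi> where "\<phi> \<equiv> char Q"
abbreviation \<psi> where "\<psi> \<equiv> char (distr M borel X)"

lemma rv[measurable]: "X \<in> borel_measurable M" "\<epsilon> \<in> borel_measurable M"
  using X_dens eps_dens by (auto simp: distributed_def)

lemma rd: "real_distribution Q" "real_distribution P" "real_distribution (distr M borel X)"
  by (rule real_distribution_distr; measurable)+

lemma char_cnj:
  fixes \<mu> :: "real measure"
  shows "char \<mu> (- t) = cnj (char \<mu> t)"
proof -
  have "char \<mu> (- t) = (\<integral>x. cnj (iexp (t * x)) \<partial>\<mu>)" unfolding char_def by (intro lebesgue_cong refl) (simp add: exp_cnj)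
  then show ?thesis unfolding char_def by (simp only: Bochner_Integration.integral_cnj)
qed

sublocale supersmooth_edge K \<phi> C2 lam C3 \<gamma> \<gamma>0 \<nu>
proof
  show "integrable lborel K" using kernel by (simp add: kernel_function_def)
  show "continuous_on UNIV \<phi>" using real_distribution.isCont_char[OF rd(1)] by (simp add: continuous_at_imp_continuous_on)
qed (fact supp C2 lam edge char_cnj char_nz C3 gam nu tail)+

lemma char_P: "char P s = \<psi> s * \<phi> s"
  by (rule char_distr_add[OF X_eps])

lemma char_le_1: "cmod (\<phi> s) \<le> 1" "cmod (\<psi> s) \<le> 1"
  using real_distribution.cmod_char_le_1 rd by auto

lemma Q_sq: "integrable Q (\<lambda>v. v^2)"
  by (rule indep_sum_square_integrable[OF X_eps Y_sq])

lemma P_sq: "integrable P (\<lambda>v. v^2)"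
  using Y_sq by (subst integrable_distr_eq) auto

definition \<kappa> where "\<kappa> = sqrt (\<integral>v. v^2 \<partial>P)"
definition \<sigma> where "\<sigma> = sqrt (\<integral>v. v^2 \<partial>Q)"

lemma \<kappa>0: "0 \<le> \<kappa>" "\<kappa>^2 = (\<integral>v. v^2 \<partial>P)" by (auto simp: \<kappa>_def)
lemma \<sigma>0: "0 \<le> \<sigma>" by (auto simp: \<sigma>_def)

lemma sample:
  assumes n: "0 < n"
  shows "multiplier_sample M (Y n) (\<eta> n) (\<xi> n) n (m n) P"
proof (intro multiplier_sample.intro[OF prob_space_axioms] multiplier_sample_axioms.intro)
  show "prob_space P" by (rule prob_space_distr) simp
  show "\<And>j. j < m n \<Longrightarrow> \<eta> n j \<in> borel_measurable M" using eta_ind[of n] by (auto simp: indep_vars_def2)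
qed (fact n Y_ind Y_distr P_sq xi_ind xi_dens xi_data sets_distr)+

lemma noise:
  assumes m: "0 < m n"
  shows "noise_sample M (\<eta> n) (m n) Q"
proof (intro noise_sample.intro[OF prob_space_axioms] noise_sample_axioms.intro)
  show "prob_space Q" by (rule prob_space_distr) simp
  show "distr M borel (\<eta> n j) = Q" if "j < m n" for j
  proof -
    have "distr M lborel (\<eta> n j) = distr M lborel \<epsilon>" using eta_dens[OF that] eps_dens by (simp add: distributed_def)
    moreover have "distr M lborel Z = distr M borel Z" for Z :: "'a \<Rightarrow> real" by (rule distr_cong) auto
    ultimately show ?thesis by simp
  qed
qed (fact m eta_ind Q_sq sets_distr)+

lemma Y_rv: "j < n \<Longrightarrow> Y n j \<in> borel_measurable M"
  using Y_ind[of n] by (auto simp: indep_vars_def2)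
lemma eta_rv: "j < m n \<Longrightarrow> \<eta> n j \<in> borel_measurable M"
  using eta_ind[of n] by (auto simp: indep_vars_def2)
lemma xi_rv: "j < n \<Longrightarrow> \<xi> n j \<in> borel_measurable M"
  using xi_ind[of n] by (auto simp: indep_vars_def2)

lemma h_small: "eventually (\<lambda>n. h n \<le> exp (- 1)) sequentially"
  using order_tendstoD(2)[OF h_lim, of "exp (- 1)"] by (auto elim: eventually_mono)

lemma h_props:
  assumes "h n \<le> exp (- 1)"
  shows "h n \<le> 1" "1 \<le> ln (1 / h n)"
proof -
  have "exp (- 1) \<le> (1::real)" by simp
  then show "h n \<le> 1" using assms by linarith
  have "ln (h n) \<le> - 1" using assms h_pos[of n] by (metis ln_exp ln_le_cancel_iff exp_gt_zero)
  then show "1 \<le> ln (1 / h n)" using h_pos[of n] by (simp add: ln_div)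
qed

lemma m_pos_ev: "eventually (\<lambda>n. 0 < m n) sequentially"
  by (rule eventually_compose_filterlim[OF eventually_gt_at_top m_top])

definition mass_const where
  "mass_const = (SOME C. 0 < C \<and> (\<forall>h. 0 < h \<longrightarrow> h \<le> 1 \<longrightarrow> mass h \<le> C \<and> spread h \<le> C * h powr (\<gamma> - 1)))"

lemma mass_const: "0 < mass_const" "0 < h' \<Longrightarrow> h' \<le> 1 \<Longrightarrow> mass h' \<le> mass_const"
  "0 < h' \<Longrightarrow> h' \<le> 1 \<Longrightarrow> spread h' \<le> mass_const * h' powr (\<gamma> - 1)"
proof -
  obtain C where C: "0 < C" "\<And>h. 0 < h \<Longrightarrow> h \<le> 1 \<Longrightarrow> (\<integral>t. cmod (weight h t) \<partial>lborel) \<le> C * edge_scale h"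
     "\<And>h. 0 < h \<Longrightarrow> h \<le> 1 \<Longrightarrow> (\<integral>t. cmod (weight h t) * (1 - t) \<partial>lborel) \<le> C * edge_scale h * h powr \<gamma>"
    using weight_integrals_bound by blast
  have "mass h \<le> C / edge_const" if "0 < h" "h \<le> 1" for h
  proof -
    have "mass h \<le> C * edge_scale h / height h" unfolding mass_def using C(2)[OF that] height_pos[OF that(1)] by (intro divide_right_mono) auto
    then show ?thesis using edge_scale_pos[OF that(1)] by (simp add: height_def)
  qed
  moreover have "spread h \<le> C / edge_const * h powr (\<gamma> - 1)" if "0 < h" "h \<le> 1" for h
  proof -
    have "spread h \<le> C * edge_scale h * h powr \<gamma> / (h * height h)"
      unfolding spread_def using C(3)[OF that] height_pos[OF that(1)] that by (intro divide_right_mono) auto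
    then show ?thesis using edge_scale_pos[OF that(1)] that by (simp add: height_def powr_diff mult_ac)
  qed
  moreover have "0 < C / edge_const" using C(1) edge_const_pos by simp
  ultimately have "\<exists>C. 0 < C \<and> (\<forall>h. 0 < h \<longrightarrow> h \<le> 1 \<longrightarrow> mass h \<le> C \<and> spread h \<le> C * h powr (\<gamma> - 1))" by blast
  from someI_ex[OF this, folded mass_const_def]
  show "0 < mass_const" "0 < h' \<Longrightarrow> h' \<le> 1 \<Longrightarrow> mass h' \<le> mass_const"
    "0 < h' \<Longrightarrow> h' \<le> 1 \<Longrightarrow> spread h' \<le> mass_const * h' powr (\<gamma> - 1)" by blast+
qed

lemma spread_lim: "(\<lambda>n. spread (h n)) \<longlonglongrightarrow> 0"
proof -
  have "(\<lambda>n. mass_const * h n powr (\<gamma> - 1)) \<longlonglongrightarrow> mass_const * 0 powr (\<gamma> - 1)"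
    using gam h_pos by (intro tendsto_mult tendsto_const tendsto_powr' h_lim) (auto simp: less_imp_le)
  then have "(\<lambda>n. mass_const * h n powr (\<gamma> - 1)) \<longlonglongrightarrow> 0" by simp
  moreover have "eventually (\<lambda>n. norm (spread (h n)) \<le> mass_const * h n powr (\<gamma> - 1)) sequentially" using h_small
  proof eventually_elim
    case (elim n)
    then show ?case using mass_const(3)[OF h_pos h_props(1)[OF elim]] spread_nonneg[OF h_pos[of n]] by simp
  qed
  ultimately show ?thesis by (rule Lim_null_comparison[rotated])
qed

lemma edge_dev_lim: "(\<lambda>n. edge_dev (h n)) \<longlonglongrightarrow> 0"
proof -
  have "(\<lambda>n. (\<integral>t. weight (h n) t \<partial>lborel) / edge_scale (h n) - edge_const) \<longlonglongrightarrow> complex_of_real edge_const - complex_of_real edge_const"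
    by (intro tendsto_diff tendsto_const weight_limit(1) h_pos h_lim)
  then have "(\<lambda>n. (\<integral>t. weight (h n) t \<partial>lborel) / edge_scale (h n) - complex_of_real edge_const) \<longlonglongrightarrow> 0" by simp
  then have "(\<lambda>n. cmod ((\<integral>t. weight (h n) t \<partial>lborel) / edge_scale (h n) - complex_of_real edge_const)) \<longlonglongrightarrow> 0"
    by (rule tendsto_norm_zero)
  then have "(\<lambda>n. cmod ((\<integral>t. weight (h n) t \<partial>lborel) / edge_scale (h n) - complex_of_real edge_const) / edge_const) \<longlonglongrightarrow> 0 / edge_const"
    using edge_const_pos by (intro tendsto_divide tendsto_const) auto
  moreover have "cmod ((\<integral>t. weight (h n) t \<partial>lborel) / edge_scale (h n) - edge_const) / edge_const = edge_dev (h n)" for n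
  proof -
    have s: "0 < edge_scale (h n)" by (rule edge_scale_pos[OF h_pos])
    then have "(\<integral>t. weight (h n) t \<partial>lborel) / edge_scale (h n) - edge_const = ((\<integral>t. weight (h n) t \<partial>lborel) - height (h n)) / edge_scale (h n)"
      by (simp add: height_def diff_divide_distrib)
    then show ?thesis using s by (simp add: edge_dev_def height_def norm_divide mult.commute)
  qed
  ultimately show ?thesis by simp
qed

lemma rate1: "(\<lambda>n. sqrt (real n / real (m n))) \<longlonglongrightarrow> 0"
proof -
  let ?u = "\<lambda>n. real n * ln (1 / h n) / (real (m n) * h n powr (2 * \<gamma> * (1 + lam) - 2))"
  let ?v = "\<lambda>n. exp (2 * \<nu> * h n powr (- \<gamma>)) * (ln (1 / h n))^2 / (real (m n) * h n powr (4 * \<gamma> * (1 + lam) - 2 * \<gamma>0))"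
  have "1 * 1 \<le> \<gamma> * (1 + lam)" using gam lam by (intro mult_mono) auto
  then have e: "0 \<le> 2 * \<gamma> * (1 + lam) - 2" by (simp add: mult.assoc)
  have "eventually (\<lambda>n. norm (real n / real (m n)) \<le> max (?u n) (?v n)) sequentially" using h_small m_pos_ev
  proof eventually_elim
    case (elim n)
    have "h n powr (2 * \<gamma> * (1 + lam) - 2) \<le> 1" using h_pos[of n] h_props(1)[OF elim(1)] e by (intro powr_le1) auto
    then have "real n / real (m n) \<le> real n / (real (m n) * h n powr (2 * \<gamma> * (1 + lam) - 2))"
      using elim h_pos[of n] by (intro divide_left_mono mult_pos_pos) (auto simp: mult_le_cancel_left1)
    also have "\<dots> \<le> real n * ln (1 / h n) / (real (m n) * h n powr (2 * \<gamma> * (1 + lam) - 2))"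
      using h_props(2)[OF elim(1)] by (intro divide_right_mono) (auto simp: mult_le_cancel_left1)
    finally show ?case by simp
  qed
  then have "(\<lambda>n. real n / real (m n)) \<longlonglongrightarrow> 0" using rate by (rule Lim_null_comparison)
  then show ?thesis using tendsto_real_sqrt by fastforce
qed

text \<open>The uniform error of the empirical characteristic function on the window is of order \<open>1 / (h * sqrt m)\<close>, and the
  first factor is the order of the largest value of \<open>1 / \<phi>\<close> there.\<close>

lemma rate2: "(\<lambda>n. h n powr \<gamma>0 * exp (\<nu> * h n powr (- \<gamma>)) / (h n * sqrt (real (m n)))) \<longlonglongrightarrow> 0"
proof -
  let ?u = "\<lambda>n. real n * ln (1 / h n) / (real (m n) * h n powr (2 * \<gamma> * (1 + lam) - 2))"
  let ?v = "\<lambda>n. exp (2 * \<nu> * h n powr (- \<gamma>)) * (ln (1 / h n))^2 / (real (m n) * h n powr (4 * \<gamma> * (1 + lam) - 2 * \<gamma>0))"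
  let ?r = "\<lambda>n. h n powr \<gamma>0 * exp (\<nu> * h n powr (- \<gamma>)) / (h n * sqrt (real (m n)))"
  have "1 * 1 \<le> \<gamma> * (1 + lam)" using gam lam by (intro mult_mono) auto
  then have e: "0 \<le> 4 * \<gamma> * (1 + lam) - 2" by (simp add: mult.assoc)
  have "eventually (\<lambda>n. norm ((?r n)^2) \<le> max (?u n) (?v n)) sequentially" using h_small m_pos_ev
  proof eventually_elim
    case (elim n)
    have hn: "0 < h n" by (rule h_pos)
    have le1: "h n powr (4 * \<gamma> * (1 + lam) - 2) \<le> 1" using hn h_props(1)[OF elim(1)] e by (intro powr_le1) auto
    have ln1: "1 \<le> (ln (1 / h n))^2" using h_props(2)[OF elim(1)] by (simp add: one_le_power)
    have "(?r n)^2 = h n powr (2 * \<gamma>0) * exp (2 * \<nu> * h n powr (- \<gamma>)) / (h n powr 2 * real (m n))"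
    proof -
      have "(h n powr \<gamma>0)^2 = h n powr (2 * \<gamma>0)" by (simp add: power2_eq_square flip: powr_add)
      moreover have "(exp (\<nu> * h n powr (- \<gamma>)))^2 = exp (2 * \<nu> * h n powr (- \<gamma>))"
        by (simp add: exp_double[symmetric] mult.assoc)
      moreover have "(h n)^2 = h n powr 2" using hn by simp
      ultimately show ?thesis by (simp only: power_divide power_mult_distrib real_sqrt_pow2 of_nat_0_le_iff)
    qed
    also have "h n powr (2 * \<gamma>0) = h n powr (4 * \<gamma> * (1 + lam) - 2) * h n powr 2 / h n powr (4 * \<gamma> * (1 + lam) - 2 * \<gamma>0)"
      unfolding powr_add[symmetric] powr_diff[symmetric] by simp
    also have "\<dots> * exp (2 * \<nu> * h n powr (- \<gamma>)) / (h n powr 2 * real (m n))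
        = h n powr (4 * \<gamma> * (1 + lam) - 2) * (exp (2 * \<nu> * h n powr (- \<gamma>)) / (real (m n) * h n powr (4 * \<gamma> * (1 + lam) - 2 * \<gamma>0)))"
    proof -
      have "u * v / D * E / (v * M) = u * (E / (M * D))" if "v \<noteq> 0" for u v D E M :: real using that by simp
      then show ?thesis using hn by simp
    qed
    also have "\<dots> \<le> (ln (1 / h n))^2 * (exp (2 * \<nu> * h n powr (- \<gamma>)) / (real (m n) * h n powr (4 * \<gamma> * (1 + lam) - 2 * \<gamma>0)))"
      using le1 ln1 by (intro mult_right_mono) auto
    finally show ?case by (simp add: mult_ac)
  qed
  then have "(\<lambda>n. (?r n)^2) \<longlonglongrightarrow> 0" using rate by (rule Lim_null_comparison)
  then have "(\<lambda>n. sqrt ((?r n)^2)) \<longlonglongrightarrow> sqrt 0" by (rule tendsto_real_sqrt)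
  moreover have "sqrt ((?r n)^2) = ?r n" for n using h_pos[of n] by (simp add: abs_of_nonneg)
  ultimately show ?thesis by (simp only: real_sqrt_zero)
qed

lemma char_vanishes: "(\<lambda>n. cmod (\<phi> (c / h n))) \<longlonglongrightarrow> 0" if c: "0 < c"
proof -
  have inf: "filterlim (\<lambda>n. c / h n) at_top sequentially" unfolding divide_inverse
    by (intro filterlim_tendsto_pos_mult_at_top[OF tendsto_const c] filterlim_inverse_at_top h_lim) (use h_pos in auto)
  obtain C where C: "0 < C" "\<And>u. 0 \<le> u \<Longrightarrow> (1 + u) powr \<bar>\<gamma>0\<bar> \<le> C * exp (\<nu> / 2 * u)"
    using powr_le_exp[of "\<bar>\<gamma>0\<bar>" "\<nu> / 2"] nu by auto
  let ?a = "\<lambda>t. C3 * \<bar>t\<bar> powr \<gamma>0 * exp (- \<nu> * \<bar>t\<bar> powr \<gamma>)"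
  have "((\<lambda>t. ?a t) \<longlongrightarrow> 0) at_top"
  proof (rule Lim_null_comparison)
    show "eventually (\<lambda>t. norm (?a t) \<le> C3 * C * exp (- (\<nu> / 2) * t)) at_top" using eventually_ge_at_top[of 1]
    proof eventually_elim
      case (elim t)
      have "\<bar>t\<bar> powr \<gamma>0 \<le> \<bar>t\<bar> powr \<bar>\<gamma>0\<bar>" using elim by (intro powr_mono) auto
      also have "\<dots> \<le> (1 + t) powr \<bar>\<gamma>0\<bar>" using elim by (intro powr_mono2) auto
      also have "\<dots> \<le> C * exp (\<nu> / 2 * t)" using C(2)[of t] elim by simp
      finally have 1: "\<bar>t\<bar> powr \<gamma>0 \<le> C * exp (\<nu> / 2 * t)" .
      have "t powr 1 \<le> t powr \<gamma>" using elim gam by (intro powr_mono) auto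
      then have 2: "exp (- \<nu> * \<bar>t\<bar> powr \<gamma>) \<le> exp (- \<nu> * t)" using elim nu by simp
      have "?a t \<le> C3 * (C * exp (\<nu> / 2 * t)) * exp (- \<nu> * t)" using 1 2 C3 C(1) by (intro mult_mono mult_left_mono) auto
      also have "\<dots> = C3 * C * exp (- (\<nu> / 2) * t)" unfolding mult.assoc mult_exp_exp by (simp add: field_simps)
      finally show ?case using C3 by simp
    qed
    have "((\<lambda>t. C3 * C * exp (- (\<nu> / 2) * t)) \<longlongrightarrow> C3 * C * 0) at_top"
    proof (intro tendsto_mult tendsto_const filterlim_compose[OF exp_at_bot])
      show "filterlim (\<lambda>t. - (\<nu> / 2) * t) at_bot at_top"
        using nu by (intro filterlim_tendsto_neg_mult_at_bot[OF tendsto_const _ filterlim_ident]) auto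
    qed
    then show "((\<lambda>t. C3 * C * exp (- (\<nu> / 2) * t)) \<longlongrightarrow> 0) at_top" by simp
  qed
  then have a0: "(\<lambda>n. complex_of_real (?a (c / h n))) \<longlonglongrightarrow> complex_of_real 0"
    by (intro tendsto_of_real filterlim_compose[OF _ inf])
  have r: "(\<lambda>n. \<phi> (c / h n) / complex_of_real (?a (c / h n))) \<longlonglongrightarrow> 1"
    using filterlim_compose[OF \<phi>_ratio filterlim_at_top_imp_at_infinity[OF inf]] .
  have "(\<lambda>n. \<phi> (c / h n) / complex_of_real (?a (c / h n)) * complex_of_real (?a (c / h n))) \<longlonglongrightarrow> 1 * complex_of_real 0"
    by (rule tendsto_mult[OF r a0])
  moreover have "\<phi> (c / h n) / complex_of_real (?a (c / h n)) * complex_of_real (?a (c / h n)) = \<phi> (c / h n)" for n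
    using c h_pos[of n] C3 by (simp add: less_imp_neq[symmetric])
  ultimately have "(\<lambda>n. \<phi> (c / h n)) \<longlonglongrightarrow> 0" by simp
  then show ?thesis by (rule tendsto_norm_zero)
qed

text \<open>The ratio \<open>h powr (1 + \<beta>) / edge_scale h\<close> is the power times the exponential in the undersmoothing condition.\<close>

lemma bias_rate: "(\<lambda>n. sqrt (real n) * h n powr (1 + \<beta>) / height (h n)) \<longlonglongrightarrow> 0"
proof -
  let ?u = "\<lambda>n. h n powr (\<beta> + 1 - \<gamma> * (1 + lam) - \<gamma>0) * exp (- \<nu> * h n powr (- \<gamma>)) * sqrt (real n * ln (1 / h n))"
  have "(\<lambda>n. ?u n / edge_const) \<longlonglongrightarrow> 0 / edge_const"
    using edge_const_pos by (intro tendsto_divide undersmooth tendsto_const) auto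
  then have lim: "(\<lambda>n. ?u n / edge_const) \<longlonglongrightarrow> 0" by simp
  have "eventually (\<lambda>n. norm (sqrt (real n) * h n powr (1 + \<beta>) / height (h n)) \<le> ?u n / edge_const) sequentially" using h_small
  proof eventually_elim
    case (elim n)
    have hn: "0 < h n" by (rule h_pos)
    have eq0: "h n powr (1 + \<beta>) / edge_scale (h n) = h n powr (\<beta> + 1 - \<gamma> * (1 + lam) - \<gamma>0) * exp (- \<nu> * h n powr (- \<gamma>))"
      using hn by (simp add: edge_scale_def powr_add powr_diff exp_minus field_simps)
    have eq: "sqrt (real n) * h n powr (1 + \<beta>) / height (h n) = h n powr (\<beta> + 1 - \<gamma> * (1 + lam) - \<gamma>0) * exp (- \<nu> * h n powr (- \<gamma>)) * sqrt (real n) / edge_const"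
    proof -
      have "sqrt (real n) * h n powr (1 + \<beta>) / height (h n) = h n powr (1 + \<beta>) / edge_scale (h n) * sqrt (real n) / edge_const"
        by (simp add: height_def mult_ac)
      then show ?thesis using eq0 by simp
    qed
    have "sqrt (real n) \<le> sqrt (real n * ln (1 / h n))" using h_props(2)[OF elim] by (intro real_sqrt_le_mono) (simp add: mult_le_cancel_left1)
    then have "sqrt (real n) * h n powr (1 + \<beta>) / height (h n) \<le> ?u n / edge_const"
      unfolding eq using edge_const_pos by (intro divide_right_mono mult_left_mono) auto
    moreover have "0 \<le> sqrt (real n) * h n powr (1 + \<beta>) / height (h n)" using height_pos[OF hn] by simp
    ultimately show ?case by simp
  qed
  then show ?thesis using lim by (rule Lim_null_comparison)
qed

end

section \<open>Mean errors of all approximations\<close>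
context deconvolution
begin

lemma inverse_char_exists:
  "\<exists>C>0. \<forall>h s. 0 < h \<longrightarrow> h \<le> 1 \<longrightarrow> \<bar>s\<bar> \<le> 1 / h \<longrightarrow> 1 / cmod (\<phi> s) \<le> C * inv_growth h"
proof -
  obtain C where C: "0 < C" "\<And>h t. 0 < h \<Longrightarrow> h \<le> 1 \<Longrightarrow> 0 \<le> t \<Longrightarrow> t \<le> 1 \<Longrightarrow>
     1 / cmod (\<phi> (t / h)) \<le> C * inv_growth h * exp (- (\<nu> / 2) * ((1 - t) / h powr \<gamma>))" using inverse_char_scaled_bound by blast
  have "1 / cmod (\<phi> s) \<le> C * inv_growth h" if h: "0 < h" "h \<le> 1" and s: "\<bar>s\<bar> \<le> 1 / h" for h s
  proof -
    let ?t = "\<bar>s\<bar> * h"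
    have t: "0 \<le> ?t" "?t \<le> 1" using h s by (auto simp: pos_le_divide_eq)
    have "cmod (\<phi> s) = cmod (\<phi> (?t / h))" using h char_cnj[of Q s] by (cases "0 \<le> s") (auto simp del: char_cnj)
    then have "1 / cmod (\<phi> s) \<le> C * inv_growth h * exp (- (\<nu> / 2) * ((1 - ?t) / h powr \<gamma>))" using C(2)[OF h t] by simp
    also have "\<dots> \<le> C * inv_growth h * 1" using C(1) nu t by (intro mult_left_mono) auto
    finally show ?thesis by simp
  qed
  then show ?thesis using C(1) by blast
qed

text \<open>A constant that exists by \<open>inverse_char_exists\<close>; it is fixed here because the good event below depends on it. The
  same applies to \<open>bias_const\<close>.\<close>

definition inv_const where
  "inv_const = (SOME C. 0 < C \<and> (\<forall>h s. 0 < h \<longrightarrow> h \<le> 1 \<longrightarrow> \<bar>s\<bar> \<le> 1 / h \<longrightarrow>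
     1 / cmod (\<phi> s) \<le> C * inv_growth h))"

definition inv_bound :: "nat \<Rightarrow> real" where
  "inv_bound n = inv_const * inv_growth (h n)"

lemma inv_bound:
  shows "0 < inv_bound n" and "h n \<le> 1 \<Longrightarrow> \<bar>s\<bar> \<le> 1 / h n \<Longrightarrow> 1 / cmod (\<phi> s) \<le> inv_bound n"
proof -
  note c = someI_ex[OF inverse_char_exists, folded inv_const_def]
  show "0 < inv_bound n" unfolding inv_bound_def using c h_pos[of n] by simp
  show "h n \<le> 1 \<Longrightarrow> \<bar>s\<bar> \<le> 1 / h n \<Longrightarrow> 1 / cmod (\<phi> s) \<le> inv_bound n"
    unfolding inv_bound_def using c h_pos[of n] by blast
qed

definition bias_const where
  "bias_const = (SOME C. 0 \<le> C \<and> (\<forall>h x. 0 < h \<longrightarrow>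
    \<bar>smoothed_value K \<psi> h x - h * fX x\<bar>
      \<le> C * h powr (1 + \<beta>)))"

lemma fX_int: "integrable lborel fX"
proof (rule integrableI_nonneg)
  show "fX \<in> borel_measurable lborel" using distributed_real_measurable[OF _ X_dens] fX0 by simp
  have "(\<integral>\<^sup>+x. ennreal (fX x) \<partial>lborel) = 1"
    using distributed_nn_integral[OF X_dens, of "\<lambda>_. 1"] emeasure_space_1 by simp
  then show "(\<integral>\<^sup>+x. ennreal (fX x) \<partial>lborel) < \<infinity>" by simp
qed (use fX0 in auto)

lemma bias_const:
  shows "0 \<le> bias_const"
    and "0 < h' \<Longrightarrow> \<bar>smoothed_value K \<psi> h' x - h' * fX x\<bar>
      \<le> bias_const * h' powr (1 + \<beta>)"
proof -
  have \<psi>: "\<psi> t = (\<integral>y. iexp (t * y) * fX y \<partial>lborel)" for t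
  proof -
    have [measurable]: "fX \<in> borel_measurable borel" using fX_int by simp
    have "distr M lborel X = distr M borel X" by (rule distr_cong) auto
    then have "distr M borel X = density lborel (\<lambda>x. ennreal (fX x))" using X_dens by (simp add: distributed_def)
    then have "\<psi> t = (\<integral>y. fX y *\<^sub>R iexp (t * y) \<partial>lborel)"
      unfolding char_def using fX0 by (subst integral_density[symmetric]) auto
    then show ?thesis by (simp add: scaleR_conv_of_real mult.commute)
  qed
  have "\<exists>C\<ge>0. \<forall>h x. 0 < h \<longrightarrow>
    \<bar>smoothed_value K \<psi> h x - h * fX x\<bar> \<le> C * h powr (1 + \<beta>)"
    by (rule smoothing_bias[OF fX0 fX_int hol k B_pos beta kernel fourier_supp K_mom K_orth \<psi> charX_int])
  note c = someI_ex[OF this, folded bias_const_def]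
  show "0 \<le> bias_const" using c by blast
  show "0 < h' \<Longrightarrow> \<bar>smoothed_value K \<psi> h' x - h' * fX x\<bar>
      \<le> bias_const * h' powr (1 + \<beta>)" using c by blast
qed

abbreviation y where "y n w \<equiv> (\<lambda>j. Y n j w)"
abbreviation e where "e n w \<equiv> (\<lambda>j. \<eta> n j w)"
abbreviation z where "z n w \<equiv> (\<lambda>j. \<xi> n j w)"

text \<open>The normalized empirical characteristic function of the observations, and its bootstrap counterpart \<open>Bt\<close>.\<close>

definition S :: "nat \<Rightarrow> 'a \<Rightarrow> real \<Rightarrow> complex" where
  "S n w s = sqrt (real n) * (emp_cf n (y n w) s - char P s)"

abbreviation Bt where "Bt n w \<equiv> multiplier_cf n (y n w) (z n w)"

text \<open>All random errors in one nonnegative quantity, so that a single application of Markov's inequality makes them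
  simultaneously small. The first term bounds the relative error of the empirical characteristic function of the
  noise on the whole window.\<close>

definition err :: "nat \<Rightarrow> 'a \<Rightarrow> real" where
  "err n w = inv_bound n * noise_sample.cf_error_bound (\<eta> n) (m n) Q (1 / h n) w
     + edge_gap (h n) (S n w) + edge_gap (h n) (Bt n w)
     + sqrt (real n) * noise_gap (h n) (m n) (e n w)
     + spread (h n) * ((\<Sum>j<n. (Y n j w)^2) / real n)
     + cmod (emp_cf n (y n w) (1 / h n)) + cmod (emp_cf n (y n w) (2 / h n))"

definition size :: "nat \<Rightarrow> 'a \<Rightarrow> real" where
  "size n w = cmod (S n w (1 / h n)) + cmod (Bt n w (1 / h n)) + cmod (Bt n w 0)"

text \<open>The deterministic errors. The last summand keeps the total positive, so that it can serve as a divisor.\<close>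

definition rem :: "nat \<Rightarrow> real" where
  "rem n = edge_dev (h n) + spread (h n) + sqrt (real n) * (pi * (bias_const * h n powr (1 + \<beta>)) / height (h n)) + 1 / real (Suc n)"

definition eps :: "nat \<Rightarrow> real" where
  "eps n = inv_bound n * (2 * (1 / h n) * (\<sigma> / sqrt (real (m n))))
     + spread (h n) * \<kappa> + spread (h n) * \<kappa>
     + sqrt (real n) * (mass_const / sqrt (real (m n)))
     + spread (h n) * \<kappa>^2
     + (cmod (\<phi> (1 / h n)) + 1 / sqrt (real n)) + (cmod (\<phi> (2 / h n)) + 1 / sqrt (real n)) + rem n"

lemma eps_lim: "eps \<longlonglongrightarrow> 0"
proof -
  have s: "(\<lambda>n. 1 / sqrt (real n)) \<longlonglongrightarrow> 0"
    by (intro real_tendsto_divide_at_top[OF tendsto_const] filterlim_compose[OF sqrt_at_top filterlim_real_sequentially])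
  have c: "(\<lambda>n. cmod (\<phi> (1 / h n))) \<longlonglongrightarrow> 0" "(\<lambda>n. cmod (\<phi> (2 / h n))) \<longlonglongrightarrow> 0"
    by (rule char_vanishes; simp)+
  have r1: "(\<lambda>n. sqrt (real n) * (mass_const / sqrt (real (m n)))) \<longlonglongrightarrow> 0"
    using tendsto_mult_right_zero[OF rate1, of mass_const] by (simp add: real_sqrt_divide mult_ac)
  have "(\<lambda>n. 2 * \<sigma> * inv_const * (h n powr \<gamma>0 * exp (\<nu> * h n powr (- \<gamma>)) / (h n * sqrt (real (m n))))) \<longlonglongrightarrow> 0"
    by (rule tendsto_mult_right_zero[OF rate2])
  then have r2: "(\<lambda>n. inv_bound n * (2 * (1 / h n) * (\<sigma> / sqrt (real (m n))))) \<longlonglongrightarrow> 0"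
    by (simp add: inv_bound_def mult_ac)
  have r3: "(\<lambda>n. sqrt (real n) * (pi * (bias_const * h n powr (1 + \<beta>)) / height (h n))) \<longlonglongrightarrow> 0"
    using tendsto_mult_right_zero[OF bias_rate, of "pi * bias_const"] by (simp add: mult_ac)
  have r4: "(\<lambda>n. 1 / real (Suc n)) \<longlonglongrightarrow> 0" using LIMSEQ_inverse_real_of_nat by (simp add: divide_inverse)
  have sp: "(\<lambda>n. spread (h n) * c) \<longlonglongrightarrow> 0" for c by (rule tendsto_mult_left_zero[OF spread_lim])
  have "eps \<longlonglongrightarrow> 0 + 0 + 0 + 0 + 0 + (0 + 0) + (0 + 0) + (0 + 0 + 0 + 0)"
    unfolding eps_def[abs_def] rem_def by (intro tendsto_add r1 r2 r3 r4 sp c s spread_lim edge_dev_lim)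
  then show ?thesis by simp
qed

lemma rem_pos: "0 \<le> edge_dev (h n)" "0 \<le> spread (h n)" "0 \<le> sqrt (real n) * (pi * (bias_const * h n powr (1 + \<beta>)) / height (h n))"
  "0 < rem n"
proof -
  note H = height_pos[OF h_pos[of n]]
  show 1: "0 \<le> edge_dev (h n)" unfolding edge_dev_def using H by (intro divide_nonneg_nonneg) auto
  show 2: "0 \<le> spread (h n)" by (rule spread_nonneg[OF h_pos])
  show 3: "0 \<le> sqrt (real n) * (pi * (bias_const * h n powr (1 + \<beta>)) / height (h n))" using H bias_const(1) by simp
  have "0 < 1 / real (Suc n)" by simp
  then show "0 < rem n" unfolding rem_def using 1 2 3 by linarith
qed

lemma rem_le_eps: "rem n \<le> eps n"
proof -
  have "0 \<le> inv_bound n * (2 * (1 / h n) * (\<sigma> / sqrt (real (m n))))" using inv_bound(1)[of n] h_pos[of n] \<sigma>0 by simp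
  moreover have "0 \<le> spread (h n) * \<kappa>" "0 \<le> spread (h n) * \<kappa>^2" "0 \<le> sqrt (real n) * (mass_const / sqrt (real (m n)))"
    using rem_pos(2)[of n] \<kappa>0(1) mass_const(1) by simp_all
  moreover have "0 \<le> 1 / sqrt (real n)" by simp
  ultimately show ?thesis unfolding eps_def using norm_ge_zero[of "\<phi> (1 / h n)"] norm_ge_zero[of "\<phi> (2 / h n)"] by linarith
qed

lemma eps_pos: "0 < eps n"
  using rem_le_eps rem_pos(4) less_le_trans by blast

lemma S_measurable: "(\<lambda>(w, s). S n w s) \<in> borel_measurable (M \<Otimes>\<^sub>M borel)"
proof -
  have [measurable]: "(\<lambda>x. emp_cf n (y n (fst x)) (snd x)) \<in> borel_measurable (M \<Otimes>\<^sub>M borel)"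
    using emp_cf_joint_measurable[where V="Y n" and n=n, OF Y_rv] by (simp add: split_beta')
  have [measurable]: "char P \<in> borel_measurable borel"
    using real_distribution.isCont_char[OF rd(2)] by (intro borel_measurable_continuous_onI) (simp add: continuous_at_imp_continuous_on)
  show ?thesis unfolding S_def split_beta' by measurable
qed

lemma Bt_measurable: "(\<lambda>(w, s). Bt n w s) \<in> borel_measurable (M \<Otimes>\<^sub>M borel)"
  unfolding multiplier_cf_def split_beta'
proof (intro borel_measurable_divide borel_measurable_const borel_measurable_sum)
  fix j assume "j \<in> {..<n}"
  then have [measurable]: "Y n j \<in> borel_measurable M" "\<xi> n j \<in> borel_measurable M" using Y_rv xi_rv by auto
  show "(\<lambda>x. complex_of_real (\<xi> n j (fst x)) * iexp (snd x * Y n j (fst x))) \<in> borel_measurable (M \<Otimes>\<^sub>M borel)" by measurable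
qed

lemma S_L1:
  assumes n: "0 < n"
  shows "integrable M (\<lambda>w. cmod (S n w s))" "expectation (\<lambda>w. cmod (S n w s)) \<le> 1"
    "integrable M (\<lambda>w. cmod (S n w s - S n w s'))" "expectation (\<lambda>w. cmod (S n w s - S n w s')) \<le> \<bar>s - s'\<bar> * \<kappa>"
  using multiplier_sample.sampling_cf_L1[OF sample[OF n], unfolded multiplier_sample.sampling_cf_def[OF sample[OF n]]]
  unfolding S_def \<kappa>_def by auto

lemma Bt_L1:
  assumes n: "0 < n"
  shows "integrable M (\<lambda>w. cmod (Bt n w s))" "expectation (\<lambda>w. cmod (Bt n w s)) \<le> 1"
    "integrable M (\<lambda>w. cmod (Bt n w s - Bt n w s'))" "expectation (\<lambda>w. cmod (Bt n w s - Bt n w s')) \<le> \<bar>s - s'\<bar> * \<kappa>"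
  using multiplier_sample.bootstrap_cf_L1[OF sample[OF n], unfolded multiplier_sample.bootstrap_cf_def[OF sample[OF n]]]
  unfolding \<kappa>_def by auto

lemma size_L1:
  assumes n: "0 < n"
  shows "integrable M (size n)" "expectation (size n) \<le> 3"
proof -
  show "integrable M (size n)" unfolding size_def[abs_def] by (intro L1_add S_L1(1)[OF n] Bt_L1(1)[OF n])
  have "expectation (size n) = expectation (\<lambda>w. cmod (S n w (1 / h n))) + expectation (\<lambda>w. cmod (Bt n w (1 / h n))) + expectation (\<lambda>w. cmod (Bt n w 0))"
    unfolding size_def[abs_def] using S_L1(1)[OF n] Bt_L1(1)[OF n] by simp
  then show "expectation (size n) \<le> 3" using S_L1(2)[OF n, of "1 / h n"] Bt_L1(2)[OF n, of "1 / h n"] Bt_L1(2)[OF n, of 0] by linarith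
qed

lemma Y_second_moment:
  assumes n: "0 < n"
  shows "integrable M (\<lambda>w. (\<Sum>j<n. (Y n j w)^2) / real n)" "expectation (\<lambda>w. (\<Sum>j<n. (Y n j w)^2) / real n) = \<kappa>^2"
proof -
  have i: "integrable M (\<lambda>w. (Y n j w)^2)" and e: "expectation (\<lambda>w. (Y n j w)^2) = \<kappa>^2" if j: "j < n" for j
  proof -
    have [measurable]: "Y n j \<in> borel_measurable M" by (rule Y_rv[OF j])
    have "integrable (distr M borel (Y n j)) (\<lambda>v. v^2)" using P_sq Y_distr[OF j] by simp
    then show "integrable M (\<lambda>w. (Y n j w)^2)" by (subst (asm) integrable_distr_eq) auto
    have "expectation (\<lambda>w. (Y n j w)^2) = (\<integral>v. v^2 \<partial>distr M borel (Y n j))" by (subst integral_distr) auto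
    then show "expectation (\<lambda>w. (Y n j w)^2) = \<kappa>^2" unfolding Y_distr[OF j] \<kappa>0(2) .
  qed
  show "integrable M (\<lambda>w. (\<Sum>j<n. (Y n j w)^2) / real n)" using i by (intro integrable_divide_zero impI L1_sum) auto
  show "expectation (\<lambda>w. (\<Sum>j<n. (Y n j w)^2) / real n) = \<kappa>^2" using i e n by (simp add: lebesgue_sum)
qed

lemma err_L1:
  assumes n: "0 < n" and m: "0 < m n" and h1: "h n \<le> 1"
  shows "integrable M (err n)" "expectation (err n) \<le> eps n"
proof -
  note h = h_pos[of n] h1
  have T: "0 < 1 / h n" using h by simp
  note N = noise[OF m]
  note c = noise_sample.cf_error_bound_L1[OF N T]
  note g1 = edge_gap_expectation[OF prob_space_axioms h S_measurable S_L1(3,4)[OF n] \<kappa>0(1)]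
  note g2 = edge_gap_expectation[OF prob_space_axioms h Bt_measurable Bt_L1(3,4)[OF n] \<kappa>0(1)]
  note g3 = noise_gap_expectation[OF N h refl]
  note y2 = Y_second_moment[OF n]
  note f = multiplier_sample.emp_cf_L1[OF sample[OF n]]
  let ?I1 = "\<lambda>w. inv_bound n * noise_sample.cf_error_bound (\<eta> n) (m n) Q (1 / h n) w"
  let ?I4 = "\<lambda>w. sqrt (real n) * noise_gap (h n) (m n) (e n w)"
  let ?I5 = "\<lambda>w. spread (h n) * ((\<Sum>j<n. (Y n j w)^2) / real n)"
  have i: "integrable M ?I1" "integrable M ?I4" "integrable M ?I5" using c(1) g3(1) y2(1) by (intro integrable_mult_right; simp)+
  note ints = i(1) g1(1) g2(1) i(2,3) f(1)[of "1 / h n"] f(1)[of "2 / h n"]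
  show "integrable M (err n)" unfolding err_def[abs_def] by (intro L1_add ints)
  have "expectation (err n) = expectation ?I1 + expectation (\<lambda>w. edge_gap (h n) (S n w)) + expectation (\<lambda>w. edge_gap (h n) (Bt n w))
    + expectation ?I4 + expectation ?I5 + expectation (\<lambda>w. cmod (emp_cf n (y n w) (1 / h n))) + expectation (\<lambda>w. cmod (emp_cf n (y n w) (2 / h n)))"
    unfolding err_def[abs_def] by (simp only: lebesgue_add L1_add ints)
  moreover have "expectation ?I1 \<le> inv_bound n * (2 * (1 / h n) * (\<sigma> / sqrt (real (m n))))"
    unfolding integral_mult_right_zero \<sigma>_def using c(2) inv_bound(1)[of n] by (intro mult_left_mono) auto
  moreover have "expectation ?I4 \<le> sqrt (real n) * (mass_const / sqrt (real (m n)))"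
  proof -
    have "mass (h n) / sqrt (real (m n)) \<le> mass_const / sqrt (real (m n))" using mass_const(2)[OF h] by (intro divide_right_mono) auto
    then show ?thesis unfolding integral_mult_right_zero using g3(2) by (intro mult_left_mono) auto
  qed
  moreover have "expectation ?I5 = spread (h n) * \<kappa>^2" unfolding integral_mult_right_zero y2(2) ..
  moreover have "cmod (char P s) \<le> cmod (\<phi> s)" for s
    unfolding char_P norm_mult using mult_right_mono[OF char_le_1(2) norm_ge_zero, of s "\<phi> s"] by simp
  then have "expectation (\<lambda>w. cmod (emp_cf n (y n w) s)) \<le> cmod (\<phi> s) + 1 / sqrt (real n)" for s
    using f(2)[of s] by (meson add_right_mono order_trans)
  from this[of "1 / h n"] this[of "2 / h n"]
  have "expectation (\<lambda>w. cmod (emp_cf n (y n w) (1 / h n))) \<le> cmod (\<phi> (1 / h n)) + 1 / sqrt (real n)"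
    "expectation (\<lambda>w. cmod (emp_cf n (y n w) (2 / h n))) \<le> cmod (\<phi> (2 / h n)) + 1 / sqrt (real n)" .
  ultimately show "expectation (err n) \<le> eps n" using g1(2) g2(2) rem_pos(4)[of n] unfolding eps_def by linarith
qed

end

section \<open>The good event\<close>
context deconvolution
begin

text \<open>The fourth root balances the requirements: \<open>err \<le> \<delta>\<^sup>2\<close> fails with probability at most \<open>eps / \<delta>\<^sup>2 = \<delta>\<^sup>2\<close>, while
  \<open>\<delta>\<close> still tends to \<open>0\<close>.\<close>

definition \<delta> :: "nat \<Rightarrow> real" where
  "\<delta> n = sqrt (sqrt (eps n))"

definition range_bound :: real where
  "range_bound = max \<bar>a\<bar> \<bar>b\<bar>"

definition admissible :: "nat \<Rightarrow> bool" where
  "admissible n \<longleftrightarrow> 0 < n \<and> 0 < m n \<and> h n \<le> exp (- 1) \<and> \<delta> n \<le> 1 / 2 \<and>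
     var_slack range_bound mass_const * (\<delta> n)^2 \<le> 1 / 2 \<and> (a < b \<longrightarrow> 2 * pi \<le> (b - a) / h n)"

definition good_event :: "nat \<Rightarrow> 'a set" where
  "good_event n = (if admissible n then {w\<in>space M. err n w \<le> (\<delta> n)^2 \<and> size n w \<le> 1 / \<delta> n} else {})"

lemma \<delta>_pos: "0 < \<delta> n"
  using eps_pos by (simp add: \<delta>_def)

lemma \<delta>_sq: "(\<delta> n)^2 = sqrt (eps n)" "(\<delta> n)^2 * (\<delta> n)^2 = eps n"
  using eps_pos[of n] by (simp_all add: \<delta>_def)

lemma \<delta>_lim: "\<delta> \<longlonglongrightarrow> 0"
proof -
  have "(\<lambda>n. sqrt (sqrt (eps n))) \<longlonglongrightarrow> sqrt (sqrt 0)" by (intro tendsto_real_sqrt eps_lim)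
  then show ?thesis by (simp add: \<delta>_def[abs_def])
qed

lemma admissible_ev: "eventually admissible sequentially"
proof -
  have d1: "eventually (\<lambda>n. \<delta> n < 1 / 2) sequentially" using order_tendstoD(2)[OF \<delta>_lim, of "1 / 2"] by simp
  have "(\<lambda>n. var_slack range_bound mass_const * (\<delta> n)^2) \<longlonglongrightarrow> var_slack range_bound mass_const * 0^2"
    by (intro tendsto_mult tendsto_power tendsto_const \<delta>_lim)
  then have d2: "eventually (\<lambda>n. var_slack range_bound mass_const * (\<delta> n)^2 < 1 / 2) sequentially" by (intro order_tendstoD(2)) auto
  have d3: "eventually (\<lambda>n. a < b \<longrightarrow> h n < (b - a) / (2 * pi)) sequentially"
  proof (cases "a < b")
    case True
    then have "0 < (b - a) / (2 * pi)" by simp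
    from order_tendstoD(2)[OF h_lim this] show ?thesis by (auto elim: eventually_mono)
  qed simp
  show ?thesis using h_small m_pos_ev eventually_gt_at_top[of "0::nat"] d1 d2 d3
  proof eventually_elim
    case (elim n)
    have "2 * pi \<le> (b - a) / h n" if "a < b"
    proof -
      have "h n \<le> (b - a) / (2 * pi)" using elim(6) that by simp
      then have "h n * (2 * pi) \<le> b - a" by (simp add: pos_le_divide_eq)
      then show ?thesis using h_pos[of n] by (simp add: pos_le_divide_eq mult.commute)
    qed
    then show ?case using elim by (simp add: admissible_def)
  qed
qed

lemma err_nonneg: "w \<in> space M \<Longrightarrow> 0 < m n \<Longrightarrow> 0 \<le> err n w"
  and err_parts: "w \<in> space M \<Longrightarrow> 0 < m n \<Longrightarrow> err n w \<le> d \<Longrightarrow>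
     inv_bound n * noise_sample.cf_error_bound (\<eta> n) (m n) Q (1 / h n) w \<le> d \<and> edge_gap (h n) (S n w) \<le> d \<and>
     edge_gap (h n) (Bt n w) \<le> d \<and> sqrt (real n) * noise_gap (h n) (m n) (e n w) \<le> d \<and>
     spread (h n) * ((\<Sum>j<n. (Y n j w)^2) / real n) \<le> d \<and>
     cmod (emp_cf n (y n w) (1 / h n)) \<le> d \<and> cmod (emp_cf n (y n w) (2 / h n)) \<le> d"
    (is "_ \<Longrightarrow> _ \<Longrightarrow> _ \<Longrightarrow> ?small")
proof -
  have H: "0 < height (h n)" by (rule height_pos[OF h_pos])
  have g: "0 \<le> edge_gap (h n) G" for G unfolding edge_gap_def using H by (intro divide_nonneg_nonneg lebesgue_nonneg) auto
  have ng: "0 \<le> sqrt (real n) * noise_gap (h n) (m n) (e n w)"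
    unfolding noise_gap_def using H by (intro mult_nonneg_nonneg divide_nonneg_nonneg lebesgue_nonneg) auto
  have yy: "0 \<le> spread (h n) * ((\<Sum>j<n. (Y n j w)^2) / real n)"
    using rem_pos(2)[of n] by (intro mult_nonneg_nonneg divide_nonneg_nonneg sum_nonneg) auto
  have c: "0 \<le> inv_bound n * noise_sample.cf_error_bound (\<eta> n) (m n) Q (1 / h n) w" if "w \<in> space M" "0 < m n"
  proof -
    have "0 \<le> cmod (emp_cf (m n) (e n w) 0 - char Q 0)" by simp
    also have "\<dots> \<le> noise_sample.cf_error_bound (\<eta> n) (m n) Q (1 / h n) w"
      by (rule noise_sample.emp_cf_uniform_error[OF noise[OF that(2)] that(1)]) (use h_pos[of n] in simp)
    finally show ?thesis using inv_bound(1)[of n] by simp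
  qed
  note nn = g[of "S n w"] g[of "Bt n w"] ng yy norm_ge_zero[of "emp_cf n (y n w) (1 / h n)"] norm_ge_zero[of "emp_cf n (y n w) (2 / h n)"]
  show "w \<in> space M \<Longrightarrow> 0 < m n \<Longrightarrow> 0 \<le> err n w" unfolding err_def using nn c by linarith
  assume "w \<in> space M" "0 < m n" "err n w \<le> d"
  then show ?small using nn c unfolding err_def by (intro conjI) linarith+
qed

lemma admissibleD:
  assumes "admissible n"
  shows "0 < n" "0 < m n" "h n \<le> 1" "\<delta> n \<le> 1 / 2" "var_slack range_bound mass_const * (\<delta> n)^2 \<le> 1 / 2"
    "a < b \<Longrightarrow> 2 * pi \<le> (b - a) / h n" using assms h_props(1)[of n] by (auto simp: admissible_def)

lemma good_event_sets: "good_event n \<in> events"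
proof (cases "admissible n")
  case True
  note a = admissibleD[OF True]
  have [measurable]: "err n \<in> borel_measurable M" "size n \<in> borel_measurable M" using err_L1(1)[OF a(1,2,3)] size_L1(1)[OF a(1)] by auto
  show ?thesis unfolding good_event_def using True by simp
qed (simp add: good_event_def)

lemma good_event_prob: "(\<lambda>n. prob (space M - good_event n)) \<longlonglongrightarrow> 0"
proof -
  have "eventually (\<lambda>n. norm (prob (space M - good_event n)) \<le> (\<delta> n)^2 + 3 * \<delta> n) sequentially" using admissible_ev
  proof eventually_elim
    case (elim n)
    note a = admissibleD[OF elim]
    note i = err_L1[OF a(1,2,3)] and j = size_L1[OF a(1)]
    have [measurable]: "err n \<in> borel_measurable M" "size n \<in> borel_measurable M" using i j by auto
    have d: "0 < \<delta> n" "0 < (\<delta> n)^2" using \<delta>_pos[of n] by auto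
    have "prob {w\<in>space M. (\<delta> n)^2 \<le> err n w} \<le> expectation (err n) / (\<delta> n)^2"
      by (rule integral_Markov_inequality_measure[where A="space M", OF i(1) sets.top])
        (use d err_nonneg[OF _ a(2)] in auto)
    also have "\<dots> \<le> eps n / (\<delta> n)^2" using i(2) by (intro divide_right_mono) auto
    also have "\<dots> = (\<delta> n)^2" using d(2) \<delta>_sq(2)[of n] by (simp add: divide_eq_eq)
    finally have p1: "prob {w\<in>space M. (\<delta> n)^2 \<le> err n w} \<le> (\<delta> n)^2" .
    have "prob {w\<in>space M. 1 / \<delta> n \<le> size n w} \<le> expectation (size n) / (1 / \<delta> n)"
      by (rule integral_Markov_inequality_measure[where A="space M", OF j(1) sets.top])
        (use d in \<open>auto simp: size_def\<close>)
    also have "\<dots> \<le> 3 / (1 / \<delta> n)" using j(2) d by (intro divide_right_mono) auto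
    finally have p2: "prob {w\<in>space M. 1 / \<delta> n \<le> size n w} \<le> 3 * \<delta> n" by simp
    have "space M - good_event n \<subseteq> {w\<in>space M. (\<delta> n)^2 \<le> err n w} \<union> {w\<in>space M. 1 / \<delta> n \<le> size n w}"
      using elim by (auto simp: good_event_def)
    then have "prob (space M - good_event n) \<le> prob ({w\<in>space M. (\<delta> n)^2 \<le> err n w} \<union> {w\<in>space M. 1 / \<delta> n \<le> size n w})"
      by (intro finite_measure_mono) auto
    also have "\<dots> \<le> prob {w\<in>space M. (\<delta> n)^2 \<le> err n w} + prob {w\<in>space M. 1 / \<delta> n \<le> size n w}"
      by (intro measure_Un_le) auto
    finally show ?case using p1 p2 by simp
  qed
  moreover have "(\<lambda>n. (\<delta> n)^2 + 3 * \<delta> n) \<longlonglongrightarrow> 0^2 + 3 * 0"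
    by (intro tendsto_add tendsto_mult tendsto_power tendsto_const \<delta>_lim)
  then have "(\<lambda>n. (\<delta> n)^2 + 3 * \<delta> n) \<longlonglongrightarrow> 0" by simp
  ultimately show ?thesis by (rule Lim_null_comparison)
qed

context
  fixes n w
  assumes w: "w \<in> good_event n"
begin

lemma adm: "admissible n"
  using w by (auto simp: good_event_def split: if_splits)

lemma wM: "w \<in> space M" and werr: "err n w \<le> (\<delta> n)^2" and wsize: "size n w \<le> 1 / \<delta> n"
  using w adm by (auto simp: good_event_def)

lemmas ad = admissibleD[OF adm]
lemmas parts = err_parts[OF wM ad(2) werr]

lemma d: "0 < \<delta> n" "\<delta> n \<le> 1/2" "eps n \<le> (\<delta> n)^2"
proof -
  show d: "0 < \<delta> n" "\<delta> n \<le> 1/2" using \<delta>_pos ad by auto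
  have "(\<delta> n)^2 \<le> 1" using d by (intro power_le_one) auto
  then have "(\<delta> n)^2 * (\<delta> n)^2 \<le> (\<delta> n)^2 * 1" by (intro mult_left_mono) auto
  then show "eps n \<le> (\<delta> n)^2" by (simp only: \<delta>_sq(2) mult_1_right)
qed

lemma det: "edge_dev (h n) \<le> (\<delta> n)^2" "spread (h n) \<le> (\<delta> n)^2"
  "sqrt (real n) * (pi * (bias_const * h n powr (1 + \<beta>)) / height (h n)) \<le> (\<delta> n)^2"
proof -
  have "0 < 1 / real (Suc n)" by simp
  then show "edge_dev (h n) \<le> (\<delta> n)^2" "spread (h n) \<le> (\<delta> n)^2"
    "sqrt (real n) * (pi * (bias_const * h n powr (1 + \<beta>)) / height (h n)) \<le> (\<delta> n)^2"
    using rem_le_eps[of n] d(3) rem_pos[of n] unfolding rem_def by linarith+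
qed

lemma rel: "rel_close ((\<delta> n)^2) (h n) (m n) (e n w)"
  unfolding rel_close_def
proof (intro allI impI)
  fix s assume s: "\<bar>s\<bar> \<le> 1 / h n"
  let ?c = "noise_sample.cf_error_bound (\<eta> n) (m n) Q (1 / h n) w"
  have 1: "cmod (emp_cf (m n) (e n w) s - \<phi> s) \<le> ?c" by (rule noise_sample.emp_cf_uniform_error[OF noise[OF ad(2)] wM s])
  have p: "0 < cmod (\<phi> s)" using char_nz by simp
  have "?c / cmod (\<phi> s) \<le> inv_bound n * ?c" using mult_right_mono[OF inv_bound(2)[OF ad(3) s] order_trans[OF norm_ge_zero 1]] by simp
  also have "\<dots> \<le> (\<delta> n)^2" using parts by simp
  finally have "?c \<le> (\<delta> n)^2 * cmod (\<phi> s)" using p by (simp add: pos_divide_le_eq)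
  then show "cmod (emp_cf (m n) (e n w) s - \<phi> s) \<le> (\<delta> n)^2 * cmod (\<phi> s)" using 1 by linarith
qed

lemma good: "good_sample (\<delta> n) mass_const (h n) n (m n) (y n w) (e n w)"
  unfolding good_sample_def using rel det parts mass_const(2)[OF h_pos ad(3)] by simp

lemma range_bound0: "0 \<le> range_bound" "x \<in> {a..b} \<Longrightarrow> \<bar>x\<bar> \<le> range_bound" "{a..b} \<noteq> {}"
  using ab by (auto simp: range_bound_def)

lemma sizes: "cmod (S n w (1 / h n)) \<le> 1 / \<delta> n" "cmod (Bt n w (1 / h n)) \<le> 1 / \<delta> n" "cmod (Bt n w 0) \<le> 1 / \<delta> n"
  using wsize norm_ge_zero[of "S n w (1 / h n)"] norm_ge_zero[of "Bt n w (1 / h n)"] norm_ge_zero[of "Bt n w 0"] unfolding size_def by linarith+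

lemmas gs = good d(1,2) h_pos ad(3,1) range_bound0(1) ad(5)

lemma wd: "well_defined K {a..b} (h n) n (m n) (y n w) (e n w)"
  by (rule good_sample_well_defined[OF gs range_bound0(3,2)])

lemma multiplier_close:
  assumes x: "x \<in> {a..b}"
  shows "\<bar>multiplier_process K {a..b} (h n) n (m n) (y n w) (e n w) (z n w) x
     - sqrt 2 * Re (iexp (- (x / h n)) * Bt n w (1 / h n))\<bar> \<le> band_slack range_bound mass_const * \<delta> n"
  by (rule multiplier_process_linearization[OF gs range_bound0(3,2) x _ sizes(2,3)]) (use parts in auto)

lemma density_close:
  assumes x: "x \<in> {a..b}"
  shows "\<bar>(dec_density K (h n) n (m n) (y n w) (e n w) x - fX x) * (sqrt (real n) * h n) / dec_sd K (h n) n (m n) (y n w) (e n w) x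
     - sqrt 2 * Re (iexp (- (x / h n)) * S n w (1 / h n))\<bar> \<le> band_slack range_bound mass_const * \<delta> n"
proof -
  have S: "S n w = (\<lambda>s. sqrt (real n) * (emp_cf n (y n w) s - \<psi> s * \<phi> s))" by (simp add: fun_eq_iff S_def char_P)
  have [measurable]: "\<psi> \<in> borel_measurable borel"
    using real_distribution.isCont_char[OF rd(3)] by (intro borel_measurable_continuous_onI) (simp add: continuous_at_imp_continuous_on)
  show ?thesis unfolding S
  proof (rule density_linearization[OF gs range_bound0(2)[OF x]])
    show "edge_gap (h n) (\<lambda>s. sqrt (real n) * (emp_cf n (y n w) s - \<psi> s * \<phi> s)) \<le> (\<delta> n)^2"
      using parts unfolding S by simp
    show "cmod (sqrt (real n) * (emp_cf n (y n w) (1 / h n) - \<psi> (1 / h n) * \<phi> (1 / h n))) \<le> 1 / \<delta> n"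
      using sizes(1) unfolding S by simp
    show "sqrt (real n) * noise_gap (h n) (m n) (e n w) \<le> (\<delta> n)^2" using parts by simp
    show "\<bar>smoothed_value K \<psi> (h n) x - h n * fX x\<bar> \<le> bias_const * h n powr (1 + \<beta>)" by (rule bias_const(2)[OF h_pos])
    show "sqrt (real n) * (pi * (bias_const * h n powr (1 + \<beta>)) / height (h n)) \<le> (\<delta> n)^2" by (rule det(3))
  qed (use char_le_1 in auto)
qed

end

text \<open>The limit functional: the supremum over a full period of the rotating projection, or a single projection if the
  interval is a point.\<close>

definition modulus :: "nat \<Rightarrow> complex \<Rightarrow> real" where
  "modulus n \<zeta> = (if a < b then cmod \<zeta> else \<bar>Re (iexp (- (a / h n)) * \<zeta>)\<bar>)"

definition T :: "nat \<Rightarrow> 'a \<Rightarrow> real" where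
  "T n w = sup_norm_on {a..b} (\<lambda>x. (dec_density K (h n) n (m n) (y n w) (e n w) x - fX x) * (sqrt (real n) * h n)
     / dec_sd K (h n) n (m n) (y n w) (e n w) x)"

definition W :: "nat \<Rightarrow> 'a \<Rightarrow> real" where
  "W n w = sup_norm_on {a..b} (multiplier_process K {a..b} (h n) n (m n) (y n w) (e n w) (z n w))"

lemma sup_modulus:
  fixes \<zeta> :: complex
  assumes "admissible n"
  shows "sup_norm_on {a..b} (\<lambda>x. sqrt 2 * Re (iexp (- (x / h n)) * \<zeta>)) = modulus n (sqrt 2 * \<zeta>)"
proof -
  have Re_scaled: "Re (complex_of_real r * v) = r * Re v" for r v by simp
  have eq: "(\<lambda>x. sqrt 2 * Re (iexp (- (x / h n)) * \<zeta>)) = (\<lambda>x. Re (iexp (- (x / h n)) * (sqrt 2 * \<zeta>)))"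
  proof
    fix x
    have "iexp (- (x / h n)) * (complex_of_real (sqrt 2) * \<zeta>) = complex_of_real (sqrt 2) * (iexp (- (x / h n)) * \<zeta>)"
      by (rule mult.left_commute)
    then show "sqrt 2 * Re (iexp (- (x / h n)) * \<zeta>) = Re (iexp (- (x / h n)) * (sqrt 2 * \<zeta>))" by (simp only: Re_scaled)
  qed
  show ?thesis
  proof (cases "a < b")
    case True
    show ?thesis unfolding eq sup_over_full_period[OF h_pos admissibleD(6)[OF assms True]] using True by (simp only: modulus_def if_True)
  next
    case False
    then have "{a..b} = {a}" using ab by auto
    then show ?thesis unfolding eq using False by (simp only: modulus_def if_False sup_norm_on_def image_insert image_empty cSup_singleton)
  qed
qed

lemma process_bounded: "\<bar>sqrt 2 * Re (iexp (- (x / h n)) * \<zeta>)\<bar> \<le> sqrt 2 * cmod \<zeta>"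
  unfolding abs_mult using Re_iexp_mult_le[of "- (x / h n)" \<zeta>] by (intro mult_mono) auto

lemma close_T:
  assumes w: "w \<in> good_event n"
  shows "\<bar>T n w - modulus n (sqrt 2 * S n w (1 / h n))\<bar> \<le> band_slack range_bound mass_const * \<delta> n"
proof -
  have eq: "modulus n (sqrt 2 * S n w (1 / h n)) = sup_norm_on {a..b} (\<lambda>x. sqrt 2 * Re (iexp (- (x / h n)) * S n w (1 / h n)))"
    by (rule sup_modulus[OF adm[OF w], symmetric])
  show ?thesis unfolding T_def eq by (rule sup_norm_on_close(1)[OF _ density_close[OF w] process_bounded]) (use ab in auto)
qed

lemma close_W:
  assumes w: "w \<in> good_event n"
  shows "\<bar>W n w - modulus n (sqrt 2 * Bt n w (1 / h n))\<bar> \<le> band_slack range_bound mass_const * \<delta> n"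
proof -
  have eq: "modulus n (sqrt 2 * Bt n w (1 / h n)) = sup_norm_on {a..b} (\<lambda>x. sqrt 2 * Re (iexp (- (x / h n)) * Bt n w (1 / h n)))"
    by (rule sup_modulus[OF adm[OF w], symmetric])
  show ?thesis unfolding W_def eq by (rule sup_norm_on_close(1)[OF _ multiplier_close[OF w] process_bounded]) (use ab in auto)
qed

text \<open>Since the estimated standard deviation is positive, membership in the band is a bound on the studentized
  deviation.\<close>

lemma coverage_iff:
  assumes w: "w \<in> good_event n"
  shows "(\<forall>x\<in>{a..b}. fX x \<in> confidence_band K {a..b} (h n) n (m n) (y n w) (e n w) t x) \<longleftrightarrow> T n w \<le> t"
proof -
  have pos: "0 < dec_sd K (h n) n (m n) (y n w) (e n w) x" if x: "x \<in> {a..b}" for x unfolding dec_sd_eq[OF gs[OF w]]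
    by (intro mult_pos_pos divide_pos_pos pi_gt_zero height_pos[OF h_pos]
        real_sqrt_gt_zero less_le_trans[OF _ V_lower[OF gs[OF w] range_bound0(2)[OF w x]]]) simp_all
  have "T n w \<le> t \<longleftrightarrow> (\<forall>x\<in>{a..b}. \<bar>(dec_density K (h n) n (m n) (y n w) (e n w) x - fX x) * (sqrt (real n) * h n)
     / dec_sd K (h n) n (m n) (y n w) (e n w) x\<bar> \<le> t)"
    unfolding T_def by (rule sup_norm_on_close(2)[OF _ density_close[OF w] process_bounded]) (use ab in auto)
  also have "\<dots> \<longleftrightarrow> (\<forall>x\<in>{a..b}. fX x \<in> confidence_band K {a..b} (h n) n (m n) (y n w) (e n w) t x)"
  proof (intro ball_cong refl)
    fix x assume x: "x \<in> {a..b}"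
    have q: "\<bar>(D - f) * r / s\<bar> \<le> t \<longleftrightarrow> f \<in> {D - s / r * t .. D + s / r * t}" if "0 < r" "0 < s" for D f r s :: real
    proof -
      have "\<bar>(D - f) * r / s\<bar> = \<bar>D - f\<bar> / (s / r)" using that by (simp add: abs_mult abs_divide)
      then have "\<bar>(D - f) * r / s\<bar> \<le> t \<longleftrightarrow> \<bar>D - f\<bar> \<le> s / r * t"
        using that by (simp add: pos_divide_le_eq pos_le_divide_eq mult.commute)
      then show ?thesis by (auto simp: abs_le_iff)
    qed
    have "0 < sqrt (real n) * h n" using ad(1)[OF w] h_pos[of n] by simp
    from q[OF this pos[OF x]]
    show "\<bar>(dec_density K (h n) n (m n) (y n w) (e n w) x - fX x) * (sqrt (real n) * h n) / dec_sd K (h n) n (m n) (y n w) (e n w) x\<bar> \<le> t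
      \<longleftrightarrow> fX x \<in> confidence_band K {a..b} (h n) n (m n) (y n w) (e n w) t x"
      unfolding confidence_band_def using wd[OF w] by simp
  qed
  finally show ?thesis by simp
qed

end

section \<open>Limits of the two statistics and coverage\<close>
lemma exp_neg_diff_le:
  fixes x y :: real
  assumes "0 \<le> x" "0 \<le> y"
  shows "\<bar>exp (- x) - exp (- y)\<bar> \<le> \<bar>x - y\<bar>"
proof -
  have *: "exp (- u) - exp (- v) \<le> v - u" if "0 \<le> u" "u \<le> v" for u v :: real
  proof -
    have "exp (- u) * (1 - exp (- (v - u))) \<le> 1 * (v - u)"
    proof (rule mult_mono)
      show "1 - exp (- (v - u)) \<le> v - u" using exp_ge_add_one_self[of "- (v - u)"] by linarith
    qed (use that in auto)
    moreover have "exp (- u) * exp (- (v - u)) = exp (- v)" by (simp add: mult_exp_exp)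
    ultimately show ?thesis by (simp add: right_diff_distrib)
  qed
  show ?thesis
  proof (cases "x \<le> y")
    case True
    then show ?thesis using *[of x y] assms by (simp add: abs_if)
  next
    case False
    then show ?thesis using *[of y x] assms by (simp add: abs_if)
  qed
qed

context deconvolution
begin

lemma char_P_vanishes: "0 < u \<Longrightarrow> (\<lambda>n. cmod (char P (u / h n))) \<longlonglongrightarrow> 0"
proof (rule Lim_null_comparison)
  show "0 < u \<Longrightarrow> (\<lambda>n. cmod (\<phi> (u / h n))) \<longlonglongrightarrow> 0" by (rule char_vanishes)
  show "eventually (\<lambda>n. norm (cmod (char P (u / h n))) \<le> cmod (\<phi> (u / h n))) sequentially"
    unfolding char_P norm_mult using mult_right_mono[OF char_le_1(2) norm_ge_zero] by (simp add: mult_left_le_one_le char_le_1)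
qed

text \<open>The projections of \<open>sqrt 2 * iexp (Y / h)\<close> onto \<open>c n\<close> are bounded, and their variances tend to \<open>r\<^sup>2\<close> for every
  choice of directions, because the characteristic function of the observations vanishes at the frequencies
  \<open>1 / h\<close> and \<open>2 / h\<close>.\<close>

lemma sampling_char_limit:
  fixes c :: "nat \<Rightarrow> complex"
  assumes c: "\<And>n. cmod (c n) = r"
  shows "(\<lambda>n. expectation (\<lambda>w. iexp (Re (cnj (c n) * (sqrt 2 * S n w (1 / h n)))))) \<longlonglongrightarrow> complex_of_real (exp (- r\<^sup>2 / 2))"
proof -
  interpret P: real_distribution P by (rule rd(2))
  have P1[simp]: "measure P UNIV = 1" using P.prob_space by simp
  define \<mu> where "\<mu> = (\<lambda>n. cnj (c n) * char P (1 / h n))"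
  define g where "g = (\<lambda>n v. sqrt 2 * (Re (cnj (c n) * iexp (1 / h n * v)) - Re (\<mu> n)))"
  have [measurable]: "g n \<in> borel_measurable borel" for n unfolding g_def by measurable
  have r0: "0 \<le> r" using c[of 0] norm_ge_zero[of "c 0"] by simp
  have u1: "\<bar>Re (cnj (c n) * iexp a)\<bar> \<le> r" for n a
    using abs_Re_le_cmod[of "cnj (c n) * iexp a"] by (simp only: norm_mult norm_exp_i_times complex_mod_cnj c mult_1_right)
  have ch1: "cmod (char P s) \<le> 1" for s by (rule P.cmod_char_le_1)
  have \<mu>1: "\<bar>Re (\<mu> n)\<bar> \<le> r * cmod (char P (1 / h n))" for n
    using abs_Re_le_cmod[of "\<mu> n"] unfolding \<mu>_def norm_mult complex_mod_cnj c .
  have \<mu>2: "\<bar>Re (\<mu> n)\<bar> \<le> r" for n using order_trans[OF \<mu>1 mult_left_mono[OF ch1 r0]] by simp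
  have iu: "integrable P (\<lambda>v. iexp (s * v))" for s by (rule P.integrable_const_bound[where B=1]) auto
  have iRe: "integrable P (\<lambda>v. Re (w * iexp (s * v)))" "(\<integral>v. Re (w * iexp (s * v)) \<partial>P) = Re (w * char P s)" for w s
  proof -
    have i: "integrable P (\<lambda>v. w * iexp (s * v))" using iu by (rule integrable_mult_right)
    show "integrable P (\<lambda>v. Re (w * iexp (s * v)))" using i by (rule integrable_Re)
    show "(\<integral>v. Re (w * iexp (s * v)) \<partial>P) = Re (w * char P s)" unfolding integral_Re[OF i] char_def by simp
  qed
  have mean: "(\<integral>v. g n v \<partial>P) = 0" for n unfolding g_def using iRe[of "cnj (c n)" "1 / h n"] P.prob_space by (simp add: \<mu>_def)
  have var: "(\<integral>v. (g n v)^2 \<partial>P) = r^2 + Re ((cnj (c n))^2 * char P (2 / h n)) - 2 * (Re (\<mu> n))^2" for n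
  proof -
    have "(g n v)^2 = r^2 + Re ((cnj (c n))^2 * iexp (2 / h n * v)) - 4 * Re (\<mu> n) * Re (cnj (c n) * iexp (1 / h n * v)) + 2 * (Re (\<mu> n))^2" for v
    proof -
      have "(g n v)^2 = 2 * (Re (cnj (c n) * iexp (1 / h n * v)))^2 - 4 * Re (\<mu> n) * Re (cnj (c n) * iexp (1 / h n * v)) + 2 * (Re (\<mu> n))^2"
        unfolding g_def power_mult_distrib power2_diff by (simp only: real_sqrt_pow2) (simp add: algebra_simps)
      moreover have "2 * (1 / h n * v) = 2 / h n * v" by simp
      ultimately show ?thesis unfolding Re_circle_square c by simp
    qed
    moreover have "(\<integral>v. r^2 + Re ((cnj (c n))^2 * iexp (2 / h n * v)) - 4 * Re (\<mu> n) * Re (cnj (c n) * iexp (1 / h n * v)) + 2 * (Re (\<mu> n))^2 \<partial>P)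
        = r^2 + Re ((cnj (c n))^2 * char P (2 / h n)) - 4 * Re (\<mu> n) * Re (\<mu> n) + 2 * (Re (\<mu> n))^2"
    proof -
      have 1: "integrable P (\<lambda>v. r^2)" "integrable P (\<lambda>v. 2 * (Re (\<mu> n))^2)" by simp_all
      have 2: "integrable P (\<lambda>v. 4 * Re (\<mu> n) * Re (cnj (c n) * iexp (1 / h n * v)))" using iRe(1) by (rule integrable_mult_right)
      note i = 1(1) iRe(1)[of "(cnj (c n))^2" "2 / h n"] 2 1(2)
      show ?thesis by (simp only: lebesgue_add lebesgue_diff L1_add
            L1_diff i integral_mult_right_zero iRe(2) lebesgue_integral_const)
          (simp add: \<mu>_def)
    qed
    ultimately show ?thesis by (simp add: power2_eq_square)
  qed
  have "(\<lambda>n. expectation (\<lambda>w. iexp ((\<Sum>j<n. g n (Y n j w)) / sqrt (real n)))) \<longlonglongrightarrow> exp (- r\<^sup>2 / 2)"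
  proof (rule clt_bounded_triangular_array[where V="\<lambda>n j w. g n (Y n j w)" and P="\<lambda>n. distr P borel (g n)" and C="sqrt 2 * (2 * r)"])
    show "indep_vars (\<lambda>_. borel) (\<lambda>j w. g n (Y n j w)) {..<n}" for n
      using indep_vars_compose2[OF Y_ind, where Y="\<lambda>_. g n" and N="\<lambda>_. borel"] by simp
    show "distr M borel (\<lambda>w. g n (Y n j w)) = distr P borel (g n)" if "j < n" for n j
      using Y_rv[OF that] unfolding Y_distr[OF that, symmetric] by (subst distr_distr) (auto simp: comp_def)
    show "prob_space (distr P borel (g n))" for n by (rule P.prob_space_distr) simp
    show "AE x in distr P borel (g n). \<bar>x\<bar> \<le> sqrt 2 * (2 * r)" for n
    proof -
      have "\<bar>g n v\<bar> \<le> sqrt 2 * (2 * r)" for v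
      proof -
        have "\<bar>Re (cnj (c n) * iexp (1 / h n * v)) - Re (\<mu> n)\<bar> \<le> 2 * r"
          using abs_triangle_ineq4[of "Re (cnj (c n) * iexp (1 / h n * v))" "Re (\<mu> n)"] u1[of n "1 / h n * v"] \<mu>2[of n] by linarith
        then show ?thesis unfolding g_def abs_mult by (simp only: abs_of_nonneg[OF real_sqrt_ge_zero] mult_left_mono real_sqrt_ge_zero zero_le_numeral)
      qed
      then show ?thesis by (subst AE_distr_iff) auto
    qed
    show "(\<integral>x. x \<partial>distr P borel (g n)) = 0" for n using mean[of n] by (subst integral_distr) auto
    have "(\<lambda>n. \<integral>v. (g n v)^2 \<partial>P) \<longlonglongrightarrow> r^2"
    proof -
      have q1: "(\<lambda>n. Re ((cnj (c n))^2 * char P (2 / h n))) \<longlonglongrightarrow> 0"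
      proof (rule Lim_null_comparison)
        show "eventually (\<lambda>n. norm (Re ((cnj (c n))^2 * char P (2 / h n))) \<le> r^2 * cmod (char P (2 / h n))) sequentially"
          using abs_Re_le_cmod[of "(cnj (c n))^2 * char P (2 / h n)" for n] by (simp add: norm_mult norm_power c)
        show "(\<lambda>n. r^2 * cmod (char P (2 / h n))) \<longlonglongrightarrow> 0" by (rule tendsto_mult_right_zero[OF char_P_vanishes]) simp
      qed
      have q2: "(\<lambda>n. Re (\<mu> n)) \<longlonglongrightarrow> 0"
      proof (rule Lim_null_comparison)
        show "eventually (\<lambda>n. norm (Re (\<mu> n)) \<le> r * cmod (char P (1 / h n))) sequentially" using \<mu>1 by simp
        show "(\<lambda>n. r * cmod (char P (1 / h n))) \<longlonglongrightarrow> 0" by (rule tendsto_mult_right_zero[OF char_P_vanishes]) simp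
      qed
      have "(\<lambda>n. r^2 + Re ((cnj (c n))^2 * char P (2 / h n)) - 2 * (Re (\<mu> n))^2) \<longlonglongrightarrow> r^2 + 0 - 2 * 0^2"
        by (intro tendsto_intros q1 q2)
      then show ?thesis unfolding var by simp
    qed
    then show "(\<lambda>n. \<integral>x. x^2 \<partial>distr P borel (g n)) \<longlonglongrightarrow> r^2" by (subst integral_distr) auto
  qed (use r0 in auto)
  moreover have "(\<Sum>j<n. g n (Y n j w)) / sqrt (real n) = Re (cnj (c n) * (sqrt 2 * S n w (1 / h n)))" for n w
  proof (cases "n = 0")
    case True
    then show ?thesis by (simp add: S_def)
  next
    case False
    let ?q = "complex_of_real (sqrt (real n))" and ?s = "1 / h n"
    have rr: "of_nat n = ?q * ?q" by (simp flip: of_real_mult)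
    have q0: "?q \<noteq> 0" using False by simp
    have "S n w ?s = (\<Sum>j<n. iexp (?s * Y n j w) - char P ?s) / ?q"
      unfolding S_def emp_cf_def sum_subtractf using q0 False by (simp add: rr field_simps)
    then have "cnj (c n) * (sqrt 2 * S n w ?s) = (\<Sum>j<n. sqrt 2 * (cnj (c n) * iexp (?s * Y n j w) - \<mu> n)) / ?q"
      by (simp add: \<mu>_def sum_distrib_left right_diff_distrib mult_ac)
    also have "Re \<dots> = (\<Sum>j<n. Re (complex_of_real (sqrt 2) * (cnj (c n) * iexp (?s * Y n j w) - \<mu> n))) / sqrt (real n)"
      by (simp only: Re_divide_of_real Re_sum)
    also have "\<dots> = (\<Sum>j<n. g n (Y n j w)) / sqrt (real n)"
    proof -
      have "Re (complex_of_real (sqrt 2) * (u - v)) = sqrt 2 * (Re u - Re v)" for u v by simp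
      then show ?thesis by (simp only: g_def)
    qed
    finally show ?thesis ..
  qed
  ultimately show ?thesis by (simp only:)
qed

lemma rv_at:
  assumes "(\<lambda>(w, s). G w s) \<in> borel_measurable (M \<Otimes>\<^sub>M borel)"
  shows "(\<lambda>w. G w (s::real)) \<in> borel_measurable M"
  using measurable_compose[OF _ assms, of "\<lambda>w. (w, s)" M] by simp

lemma modulus_limit:
  fixes Z :: "nat \<Rightarrow> 'a \<Rightarrow> complex"
  assumes Z[measurable]: "\<And>n. Z n \<in> borel_measurable M" and A[measurable]: "\<And>n. A n \<in> events"
    and lim: "\<And>r c. (\<And>n. cmod (c n) = r) \<Longrightarrow>
      (\<lambda>n. expectation (\<lambda>w. complex_of_real (indicator (A n) w) * iexp (Re (cnj (c n) * Z n w)))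
        - complex_of_real (prob (A n) * exp (- r\<^sup>2 / 2))) \<longlonglongrightarrow> 0"
    and x: "0 < x"
  shows "(\<lambda>n. prob (A n \<inter> {w\<in>space M. modulus n (Z n w) \<le> x})
     - prob (A n) * cdf (gauss_modulus_law (a < b)) x) \<longlonglongrightarrow> 0"
proof -
  have pA: "expectation (indicator (A n)) = prob (A n)" for n by (simp add: sets.Int_space_eq2)
  have "(\<lambda>n. expectation (\<lambda>w. indicator (A n) w * indicator {..x} (if a < b then cmod (Z n w) else \<bar>Re (iexp (- (a / h n)) * Z n w)\<bar>))
      - expectation (indicator (A n)) * cdf (gauss_modulus_law (a < b)) x) \<longlonglongrightarrow> 0"
    by (rule gauss_modulus_limit[OF prob_space_axioms _ _ _ _ _ x, where s="\<lambda>n. indicator (A n)" and \<theta>="\<lambda>n. a / h n"])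
      (use lim in \<open>auto simp: indicator_def pA[unfolded indicator_def]\<close>)
  moreover have "expectation (\<lambda>w. indicator (A n) w * indicator {..x} (if a < b then cmod (Z n w) else \<bar>Re (iexp (- (a / h n)) * Z n w)\<bar>))
     = prob (A n \<inter> {w\<in>space M. modulus n (Z n w) \<le> x})" for n
  proof -
    have [measurable]: "(\<lambda>w. modulus n (Z n w)) \<in> borel_measurable M" unfolding modulus_def by measurable
    have "expectation (\<lambda>w. indicator (A n) w * indicator {..x} (if a < b then cmod (Z n w) else \<bar>Re (iexp (- (a / h n)) * Z n w)\<bar>))
      = (\<integral>w. indicat_real (A n \<inter> {w\<in>space M. modulus n (Z n w) \<le> x}) w \<partial>M)"
      unfolding modulus_def by (rule lebesgue_cong) (auto simp: indicator_def)
    also have "\<dots> = prob (A n \<inter> {w\<in>space M. modulus n (Z n w) \<le> x})"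
      by (subst Bochner_Integration.integral_indicator) (auto intro!: arg_cong[where f=prob] dest: sets.sets_into_space)
    finally show ?thesis .
  qed
  ultimately show ?thesis by (simp only: pA)
qed

lemma sampling_limit:
  assumes x: "0 < x"
  shows "(\<lambda>n. prob {w\<in>space M. modulus n (sqrt 2 * S n w (1 / h n)) \<le> x}) \<longlonglongrightarrow> cdf (gauss_modulus_law (a < b)) x"
proof -
  have "(\<lambda>n. prob (space M \<inter> {w\<in>space M. modulus n (sqrt 2 * S n w (1 / h n)) \<le> x})
      - prob (space M) * cdf (gauss_modulus_law (a < b)) x) \<longlonglongrightarrow> 0"
  proof (rule modulus_limit[OF _ _ _ x])
    show "(\<lambda>w. sqrt 2 * S n w (1 / h n)) \<in> borel_measurable M" for n
      using rv_at[OF S_measurable] by (intro borel_measurable_times borel_measurable_const)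
    fix r and c :: "nat \<Rightarrow> complex" assume c: "\<And>n. cmod (c n) = r"
    have "expectation (\<lambda>w. complex_of_real (indicator (space M) w) * iexp (Re (cnj (c n) * (sqrt 2 * S n w (1 / h n)))))
      = expectation (\<lambda>w. iexp (Re (cnj (c n) * (sqrt 2 * S n w (1 / h n)))))" for n by (rule lebesgue_cong) auto
    moreover have "(\<lambda>n. expectation (\<lambda>w. iexp (Re (cnj (c n) * (sqrt 2 * S n w (1 / h n))))) - complex_of_real (exp (- r\<^sup>2 / 2))) \<longlonglongrightarrow> 0"
      by (rule LIM_zero[OF sampling_char_limit[where c=c and r=r, OF c]])
    ultimately show "(\<lambda>n. expectation (\<lambda>w. complex_of_real (indicator (space M) w) * iexp (Re (cnj (c n) * (sqrt 2 * S n w (1 / h n)))))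
        - complex_of_real (prob (space M) * exp (- r\<^sup>2 / 2))) \<longlonglongrightarrow> 0" by (simp only: prob_space mult_1_left)
  qed simp
  then have "(\<lambda>n. prob {w\<in>space M. modulus n (sqrt 2 * S n w (1 / h n)) \<le> x} - cdf (gauss_modulus_law (a < b)) x) \<longlonglongrightarrow> 0"
    by (simp add: prob_space Int_absorb1)
  then show ?thesis by (rule LIM_zero_cancel)
qed

abbreviation F where "F n \<equiv> data_algebra M n (m n) (Y n) (\<eta> n)"

lemma data_rv: "data n (m n) (Y n) (\<eta> n) \<in> M \<rightarrow>\<^sub>M row_space (n + m n)"
  using indep_var_rv2[OF xi_data] .

lemma F_subalgebra: "subalgebra M (F n)"
  unfolding subalgebra_def data_algebra_def using sets_image_in_sets[OF refl data_rv] by simp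

lemma F_sets:
  assumes "A \<in> sets (F n)"
  obtains U where "U \<in> sets (row_space (n + m n))" "A = data n (m n) (Y n) (\<eta> n) -` U \<inter> space M"
proof -
  have "data n (m n) (Y n) (\<eta> n) \<in> space M \<rightarrow> space (row_space (n + m n))" using data_rv by (auto simp: measurable_def)
  then show ?thesis using assms that unfolding data_algebra_def by (auto simp: sets_vimage_algebra2)
qed

text \<open>Given the data, the multiplier sum has the quadratic form \<open>r\<^sup>2 / 2 + q\<close> in its characteristic exponent, and \<open>q\<close> is
  a multiple of the empirical characteristic function at frequency \<open>2 / h\<close>.\<close>

lemma bootstrap_char_error:
  assumes n: "0 < n" and A: "A \<in> sets (F n)" and c: "cmod c = r"
  shows "cmod (expectation (\<lambda>w. complex_of_real (indicator A w) * iexp (Re (cnj c * (sqrt 2 * Bt n w (1 / h n)))))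
      - complex_of_real (prob A * exp (- r\<^sup>2 / 2))) \<le> r^2 / 2 * (cmod (char P (2 / h n)) + 1 / sqrt (real n))"
proof -
  note ms = sample[OF n]
  obtain U where U: "U \<in> sets (row_space (n + m n))" "A = data n (m n) (Y n) (\<eta> n) -` U \<inter> space M" by (rule F_sets[OF A])
  let ?D = "data n (m n) (Y n) (\<eta> n)"
  define q where "q = (\<lambda>w. Re ((cnj c)^2 * emp_cf n (y n w) (2 / h n)) / 2)"
  have AM[measurable]: "A \<in> events" using A F_subalgebra[of n] by (auto simp: subalgebra_def)
  have ind: "indicator A w = (indicator U (?D w) :: real)" if "w \<in> space M" for w using that U(2) by (auto simp: indicator_def)
  have quad: "(\<Sum>j<n. (Re (cnj c * iexp (1 / h n * Y n j w)))^2) / real n = r^2 / 2 + q w" for w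
    using multiplier_sample.circle_quadratic_form[OF ms, of c "1 / h n" w] unfolding c q_def by simp
  have pos: "0 \<le> r^2 / 2 + q w" for w unfolding quad[symmetric] by (intro divide_nonneg_nonneg sum_nonneg) auto
  have pos': "- (r^2 / 2) \<le> q w" for w using pos[of w] by linarith
  have [measurable]: "(\<lambda>w. emp_cf n (y n w) (2 / h n)) \<in> borel_measurable M" by (rule emp_cf_rv) (rule Y_rv)
  have [measurable]: "q \<in> borel_measurable M" unfolding q_def by measurable
  have qle: "\<bar>q w\<bar> \<le> r^2 / 2 * cmod (emp_cf n (y n w) (2 / h n))" for w
    using abs_Re_le_cmod[of "(cnj c)^2 * emp_cf n (y n w) (2 / h n)"] unfolding q_def norm_mult norm_power complex_mod_cnj c by simp
  have "expectation (\<lambda>w. complex_of_real (indicator A w) * iexp (Re (cnj c * (sqrt 2 * Bt n w (1 / h n)))))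
     = expectation (\<lambda>w. indicator U (?D w) * iexp (Re (cnj c * (sqrt 2 * Bt n w (1 / h n)))))"
    by (rule lebesgue_cong[OF refl]) (use ind in \<open>simp add: of_real_indicator\<close>)
  also have "\<dots> = complex_of_real (expectation (\<lambda>w. indicator U (?D w) * exp (- (\<Sum>j<n. (Re (cnj c * iexp (1 / h n * Y n j w)))^2) / real n)))"
    using multiplier_sample.bootstrap_conditional_char[OF ms U(1), of c "1 / h n"] unfolding multiplier_sample.bootstrap_cf_def[OF ms] .
  also have "expectation (\<lambda>w. indicator U (?D w) * exp (- (\<Sum>j<n. (Re (cnj c * iexp (1 / h n * Y n j w)))^2) / real n))
      = expectation (\<lambda>w. indicator A w * exp (- (r^2 / 2 + q w)))"
  proof (rule lebesgue_cong[OF refl])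
    fix w assume "w \<in> space M"
    then show "indicator U (?D w) * exp (- (\<Sum>j<n. (Re (cnj c * iexp (1 / h n * Y n j w)))^2) / real n) = indicator A w * exp (- (r^2 / 2 + q w))"
      unfolding quad[symmetric] using ind by simp
  qed
  finally have eq: "expectation (\<lambda>w. complex_of_real (indicator A w) * iexp (Re (cnj c * (sqrt 2 * Bt n w (1 / h n)))))
     = complex_of_real (expectation (\<lambda>w. indicator A w * exp (- (r^2 / 2 + q w))))" .
  have i1: "integrable M (\<lambda>w. indicator A w * exp (- (r^2 / 2 + q w)))"
    by (rule integrable_const_bound[where B=1]) (use pos' in \<open>auto simp: indicator_def\<close>)
  have i2: "integrable M (\<lambda>w. indicator A w * exp (- (r^2 / 2)))" by (rule integrable_const_bound[where B=1]) (auto simp: indicator_def)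
  have p: "prob A * exp (- r\<^sup>2 / 2) = expectation (\<lambda>w. indicator A w * exp (- (r^2 / 2)))" using AM by (simp add: sets.Int_space_eq2)
  note f = multiplier_sample.emp_cf_L1[OF ms, of "2 / h n"]
  have "\<bar>expectation (\<lambda>w. indicator A w * exp (- (r^2 / 2 + q w))) - prob A * exp (- r\<^sup>2 / 2)\<bar>
      = \<bar>expectation (\<lambda>w. indicator A w * exp (- (r^2 / 2 + q w)) - indicator A w * exp (- (r^2 / 2)))\<bar>"
    unfolding p lebesgue_diff[OF i1 i2] ..
  also have "\<dots> \<le> expectation (\<lambda>w. r^2 / 2 * cmod (emp_cf n (y n w) (2 / h n)))"
  proof (rule order_trans[OF integral_abs_bound integral_mono[OF integrable_abs[OF L1_diff[OF i1 i2]] integrable_mult_right[OF f(1)]]])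
    fix w
    have "\<bar>exp (- (r^2 / 2 + q w)) - exp (- (r^2 / 2))\<bar> \<le> \<bar>q w\<bar>" using exp_neg_diff_le[OF pos, of "r^2 / 2" w] by simp
    then show "\<bar>indicator A w * exp (- (r^2 / 2 + q w)) - indicator A w * exp (- (r^2 / 2))\<bar> \<le> r^2 / 2 * cmod (emp_cf n (y n w) (2 / h n))"
      using qle[of w] by (auto simp: indicator_def)
  qed
  also have "\<dots> \<le> r^2 / 2 * (cmod (char P (2 / h n)) + 1 / sqrt (real n))"
    unfolding integral_mult_right_zero using f(2) by (intro mult_left_mono) auto
  finally show ?thesis unfolding eq of_real_diff[symmetric] norm_of_real .
qed

lemma bootstrap_limit:
  assumes x: "0 < x" and A: "\<And>n. A n \<in> sets (F n)"
  shows "(\<lambda>n. prob (A n \<inter> {w\<in>space M. modulus n (sqrt 2 * Bt n w (1 / h n)) \<le> x})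
     - prob (A n) * cdf (gauss_modulus_law (a < b)) x) \<longlonglongrightarrow> 0"
proof (rule modulus_limit[OF _ _ _ x])
  show "(\<lambda>w. sqrt 2 * Bt n w (1 / h n)) \<in> borel_measurable M" for n
    using rv_at[OF Bt_measurable] by (intro borel_measurable_times borel_measurable_const)
  show "A n \<in> events" for n using A F_subalgebra[of n] by (auto simp: subalgebra_def)
  fix r and c :: "nat \<Rightarrow> complex" assume c: "\<And>n. cmod (c n) = r"
  show "(\<lambda>n. expectation (\<lambda>w. complex_of_real (indicator (A n) w) * iexp (Re (cnj (c n) * (sqrt 2 * Bt n w (1 / h n)))))
      - complex_of_real (prob (A n) * exp (- r\<^sup>2 / 2))) \<longlonglongrightarrow> 0"
  proof (rule Lim_null_comparison)
    show "eventually (\<lambda>n. cmod (expectation (\<lambda>w. complex_of_real (indicator (A n) w) * iexp (Re (cnj (c n) * (sqrt 2 * Bt n w (1 / h n)))))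
      - complex_of_real (prob (A n) * exp (- r\<^sup>2 / 2))) \<le> r^2 / 2 * (cmod (char P (2 / h n)) + 1 / sqrt (real n))) sequentially"
      using eventually_gt_at_top[of "0::nat"] by eventually_elim (rule bootstrap_char_error[OF _ A c])
    have "(\<lambda>n. r^2 / 2 * (cmod (char P (2 / h n)) + 1 / sqrt (real n))) \<longlonglongrightarrow> r^2 / 2 * (0 + 0)"
      by (intro tendsto_mult tendsto_add tendsto_const char_P_vanishes
          real_tendsto_divide_at_top[OF tendsto_const] filterlim_compose[OF sqrt_at_top filterlim_real_sequentially]) simp
    then show "(\<lambda>n. r^2 / 2 * (cmod (char P (2 / h n)) + 1 / sqrt (real n))) \<longlonglongrightarrow> 0" by simp
  qed
qed

text \<open>The Galois connection between quantile and distribution function turns the conditional quantile into a statement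
  about conditional probabilities, for which any version of the conditional expectation may be used.\<close>

lemma cond_quantile_characterization:
  fixes z :: real
  assumes cq: "cond_quantile M (F n) (W n) p c" and p: "0 < p" "p < 1"
  shows "c \<in> borel_measurable (F n)"
    and "AE w in M. c w \<le> z \<longleftrightarrow> p \<le> real_cond_exp M (F n) (\<lambda>w. indicator {..z} (W n w)) w"
proof -
  obtain \<mu> where \<mu>: "\<mu> \<in> F n \<rightarrow>\<^sub>M prob_algebra borel" and ce: "\<And>A. A \<in> sets borel \<Longrightarrow> AE w in M.
        measure (\<mu> w) A = real_cond_exp M (F n) (\<lambda>w'. indicator A (W n w')) w"
    and c: "\<And>w. w \<in> space M \<Longrightarrow> c w = quantile (\<mu> w) p"
    using cq unfolding cond_quantile_def regular_cond_distr_def by blast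
  have sp: "space (F n) = space M" using F_subalgebra[of n] by (simp add: subalgebra_def)
  have rd: "real_distribution (\<mu> w)" if "w \<in> space M" for w
  proof -
    have "\<mu> w \<in> space (prob_algebra borel)" using measurable_space[OF \<mu>] that sp by simp
    then have "prob_space (\<mu> w)" "sets (\<mu> w) = sets borel" by (auto simp: space_prob_algebra)
    then show ?thesis by (intro real_distribution.intro real_distribution_axioms.intro)
  qed
  have cz: "c w \<le> z \<longleftrightarrow> p \<le> measure (\<mu> w) {..z}" if "w \<in> space M" for w z
    unfolding c[OF that] quantile_le_iff[OF rd[OF that] p] cdf_def ..
  show "c \<in> borel_measurable (F n)" unfolding borel_measurable_iff_le
  proof
    fix z
    have [measurable]: "(\<lambda>w. measure (\<mu> w) {..z}) \<in> borel_measurable (F n)"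
      by (rule measurable_compose[OF measurable_prob_algebraD[OF \<mu>] measurable_measure_subprob_algebra]) simp
    have "{w\<in>space (F n). c w \<le> z} = {w\<in>space (F n). p \<le> measure (\<mu> w) {..z}}" using cz sp by auto
    also have "\<dots> \<in> sets (F n)" by measurable
    finally show "{w\<in>space (F n). c w \<le> z} \<in> sets (F n)" .
  qed
  have "AE w in M. measure (\<mu> w) {..z} = real_cond_exp M (F n) (\<lambda>w. indicator {..z} (W n w)) w" by (rule ce) simp
  then show "AE w in M. c w \<le> z \<longleftrightarrow> p \<le> real_cond_exp M (F n) (\<lambda>w. indicator {..z} (W n w)) w"
    using AE_space by eventually_elim (use cz in simp)
qed

lemma fX_isCont: "isCont fX x"
  by (rule holder_class_taylor(2)[OF hol]) (use k B_pos beta in auto)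

theorem coverage:
  assumes tau: "0 < \<tau>" "\<tau> < 1" and c: "\<And>n. cond_quantile M (F n) (W n) (1 - \<tau>) (c n)"
  shows "(\<lambda>n. prob {w\<in>space M. \<forall>x\<in>{a..b}. fX x \<in> confidence_band K {a..b} (h n) n (m n) (y n w) (e n w) (c n w) x}) \<longlonglongrightarrow> 1 - \<tau>"
proof (rule bootstrap_coverage_limit[where D="gauss_modulus_law (a < b)" and T=T and W=W and G=good_event and F=F and c=c
      and Sc="\<lambda>n w. modulus n (sqrt 2 * S n w (1 / h n))" and Sb="\<lambda>n w. modulus n (sqrt 2 * Bt n w (1 / h n))"
      and \<Delta>="\<lambda>n. band_slack range_bound mass_const * \<delta> n"])
  show "real_distribution (gauss_modulus_law (a < b))" by (rule gauss_modulus_law(1))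
  show "measure (gauss_modulus_law (a < b)) {x} = 0" for x by (rule gauss_modulus_law(2))
  show "measure (gauss_modulus_law (a < b)) {..0} = 0" by (rule gauss_modulus_law(3))
  show "0 \<le> u \<Longrightarrow> u < v \<Longrightarrow> 0 < measure (gauss_modulus_law (a < b)) {u<..<v}" for u v by (rule gauss_modulus_law(4))
  have [measurable]: "(\<lambda>w. S n w (1 / h n)) \<in> borel_measurable M" "(\<lambda>w. Bt n w (1 / h n)) \<in> borel_measurable M" for n
    by (rule rv_at[OF S_measurable], rule rv_at[OF Bt_measurable])
  show "(\<lambda>w. modulus n (sqrt 2 * S n w (1 / h n))) \<in> borel_measurable M" "(\<lambda>w. modulus n (sqrt 2 * Bt n w (1 / h n))) \<in> borel_measurable M" for n
    unfolding modulus_def by measurable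
  have I: "compact {a..b}" "{a..b} \<noteq> {}" using ab by auto
  show "W n \<in> borel_measurable M" for n unfolding W_def[abs_def] by (rule multiplier_sup_measurable[OF Y_rv eta_rv xi_rv h_pos I])
  show "good_event n \<in> events" for n by (rule good_event_sets)
  show "(\<lambda>n. prob (space M - good_event n)) \<longlonglongrightarrow> 0" by (rule good_event_prob)
  show "(\<lambda>n. band_slack range_bound mass_const * \<delta> n) \<longlonglongrightarrow> 0" by (rule tendsto_mult_right_zero[OF \<delta>_lim])
  show "subalgebra M (F n)" for n by (rule F_subalgebra)
  note q = cond_quantile_characterization[OF c, simplified, OF tau(2,1)]
  show "c n \<in> borel_measurable (F n)" for n by (rule q(1))
  then have cM: "c n \<in> borel_measurable M" for n by (rule measurable_from_subalg[OF F_subalgebra])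
  show "AE w in M. c n w \<le> z \<longleftrightarrow> 1 - \<tau> \<le> real_cond_exp M (F n) (\<lambda>w. indicator {..z} (W n w)) w" for n z by (rule q(2))
  show "{w\<in>space M. \<forall>x\<in>{a..b}. fX x \<in> confidence_band K {a..b} (h n) n (m n) (y n w) (e n w) (c n w) x} \<in> events" for n
    by (rule coverage_measurable[OF Y_rv eta_rv xi_rv h_pos I cM fX_isCont])
  show "w \<in> {w\<in>space M. \<forall>x\<in>{a..b}. fX x \<in> confidence_band K {a..b} (h n) n (m n) (y n w) (e n w) (c n w) x} \<longleftrightarrow> T n w \<le> c n w"
    if "w \<in> good_event n" for n w using coverage_iff[OF that] wM[OF that] by simp
qed (fact tau close_T close_W sampling_limit bootstrap_limit)+

end

theorem corollary4:
  fixes M :: "'a measure"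
    and X \<epsilon> :: "'a \<Rightarrow> real"
    and Y \<eta> \<xi> :: "nat \<Rightarrow> nat \<Rightarrow> 'a \<Rightarrow> real"
    and c :: "nat \<Rightarrow> 'a \<Rightarrow> real"
    and f\<^sub>X f\<^sub>\<epsilon> K :: "real \<Rightarrow> real"
    and h :: "nat \<Rightarrow> real" and m :: "nat \<Rightarrow> nat"
    and a b p C\<^sub>2 lam C\<^sub>3 \<gamma> \<gamma>\<^sub>0 \<nu> \<beta> B \<tau> :: real and k :: nat
  assumes "prob_space M"
    \<comment> \<open>the model\<close>
    and "prob_space.indep_var M borel X borel \<epsilon>"
    and "distributed M lborel X (\<lambda>x. ennreal (f\<^sub>X x))" and "\<And>x. 0 \<le> f\<^sub>X x"
    and "distributed M lborel \<epsilon> (\<lambda>x. ennreal (f\<^sub>\<epsilon> x))" and "\<And>x. 0 \<le> f\<^sub>\<epsilon> x"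
    \<comment> \<open>the samples\<close>
    and "filterlim m at_top sequentially"
    and "\<And>n. prob_space.indep_vars M (\<lambda>_. borel) (Y n) {..<n}"
    and "\<And>n j. j < n \<Longrightarrow> distr M borel (Y n j) = distr M borel (\<lambda>\<omega>. X \<omega> + \<epsilon> \<omega>)"
    and "\<And>n. prob_space.indep_vars M (\<lambda>_. borel) (\<eta> n) {..<m n}"
    and "\<And>n j. j < m n \<Longrightarrow> distributed M lborel (\<eta> n j) (\<lambda>x. ennreal (f\<^sub>\<epsilon> x))"
    \<comment> \<open>the multipliers\<close>
    and "\<And>n. prob_space.indep_vars M (\<lambda>_. borel) (\<xi> n) {..<n}"
    and "\<And>n j. j < n \<Longrightarrow> distributed M lborel (\<xi> n j) (\<lambda>x. ennreal (std_normal_density x))"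
    and "\<And>n. prob_space.indep_var M (row_space n) (sample_row n (\<xi> n))
                (row_space (n + m n)) (data n (m n) (Y n) (\<eta> n))"
    \<comment> \<open>the bandwidth\<close>
    and "\<And>n. 0 < h n" and "h \<longlonglongrightarrow> 0"
    \<comment> \<open>the target\<close>
    and "integrable lborel (\<lambda>t. cmod (char (distr M borel X) t))"
    \<comment> \<open>moments of the error\<close>
    and "0 < p" and "integrable M (\<lambda>\<omega>. \<bar>\<epsilon> \<omega>\<bar> powr p)"
    \<comment> \<open>the kernel\<close>
    and "kernel_function K"
    and "\<And>t. fourier K (- t) = fourier K t"
    and "closure {t. fourier K t \<noteq> 0} = {-1..1}"
    and "0 < C\<^sub>2" and "0 \<le> lam"
    and "(\<lambda>t. fourier K (1 - t) - complex_of_real (C\<^sub>2 * t powr lam))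
           \<in> o[at_right 0](\<lambda>t. complex_of_real (t powr lam))"
    \<comment> \<open>supersmoothness of the error\<close>
    and "\<And>t. char (distr M borel \<epsilon>) t \<noteq> 0"
    and "0 < C\<^sub>3" and "1 < \<gamma>" and "0 < \<nu>"
    and "char (distr M borel \<epsilon>) \<sim>[at_infinity]
           (\<lambda>t. complex_of_real (C\<^sub>3 * \<bar>t\<bar> powr \<gamma>\<^sub>0 * exp (- \<nu> * \<bar>t\<bar> powr \<gamma>)))"
    \<comment> \<open>rates of the bandwidth and the auxiliary sample size\<close>
    and "(\<lambda>n. (ln (1 / h n))\<^sup>2 / (real n * h n powr (4 * \<gamma> * (1 + lam)))) \<longlonglongrightarrow> 0"
    and "(\<lambda>n. max (real n * ln (1 / h n) / (real (m n) * h n powr (2 * \<gamma> * (1 + lam) - 2)))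
                  (exp (2 * \<nu> * h n powr (- \<gamma>)) * (ln (1 / h n))\<^sup>2
                     / (real (m n) * h n powr (4 * \<gamma> * (1 + lam) - 2 * \<gamma>\<^sub>0)))) \<longlonglongrightarrow> 0"
    \<comment> \<open>second moment; the interval\<close>
    and "integrable M (\<lambda>\<omega>. (X \<omega> + \<epsilon> \<omega>)\<^sup>2)" and "a \<le> b"
    \<comment> \<open>smoothness of the target and order of the kernel\<close>
    and "0 < \<beta>" and "0 < B" and "f\<^sub>X \<in> holder_class \<beta> B"
    and "real k < \<beta>" and "\<beta> \<le> real k + 1"
    and "integrable lborel (\<lambda>x. \<bar>x\<bar> ^ (k + 1) * \<bar>K x\<bar>)"
    and "\<And>l. l \<in> {1..k} \<Longrightarrow> (\<integral>x. x ^ l * K x \<partial>lborel) = 0"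
    \<comment> \<open>the critical value\<close>
    and "0 < \<tau>" and "\<tau> < 1"
    and "\<And>n. cond_quantile M (data_algebra M n (m n) (Y n) (\<eta> n))
           (\<lambda>\<omega>. sup_norm_on {a..b}
                  (multiplier_process K {a..b} (h n) n (m n)
                     (\<lambda>j. Y n j \<omega>) (\<lambda>j. \<eta> n j \<omega>) (\<lambda>j. \<xi> n j \<omega>)))
           (1 - \<tau>) (c n)"
    \<comment> \<open>undersmoothing\<close>
    and "(\<lambda>n. h n powr (\<beta> + 1 - \<gamma> * (1 + lam) - \<gamma>\<^sub>0) * exp (- \<nu> * h n powr (- \<gamma>))
               * sqrt (real n * ln (1 / h n))) \<longlonglongrightarrow> 0"
  shows "(\<lambda>n. \<P>(\<omega> in M. \<forall>x\<in>{a..b}. f\<^sub>X x \<in>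
              confidence_band K {a..b} (h n) n (m n) (\<lambda>j. Y n j \<omega>) (\<lambda>j. \<eta> n j \<omega>) (c n \<omega>) x))
           \<longlonglongrightarrow> 1 - \<tau>"
proof -
  interpret deconvolution M X \<epsilon> Y \<eta> \<xi> f\<^sub>X f\<^sub>\<epsilon> K h m a b C\<^sub>2 lam C\<^sub>3 \<gamma> \<gamma>\<^sub>0 \<nu> \<beta> B k
    by (intro deconvolution.intro deconvolution_axioms.intro) (fact assms)+
  show ?thesis
    by (rule coverage[unfolded W_def[abs_def]]) (fact assms)+
qed

end
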